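(* Let $\mathcal{E}'$ be an exact category with enough projectives, and let $\mathcal{P}'=\operatorname{Proj}(\mathcal{E}')$ be its subcategory of projective objects. Then there exists an exact equivalence $\mathcal{E}'\cong \operatorname{mod}_{\mathsf{adm}}(\mathcal{E})$ where $\mathcal{E}$ is an exact category with enough injectives if and only if the following hold: (1) $\operatorname{dom.dim}(\mathcal{E}')\geq 2\geq \operatorname{gl.dim}(\mathcal{E}')$. (2) Any morphism $X\to E$ in $\mathcal{E}'$ with $E\in{}^{\perp}\mathcal{P}'$ is admissible. (3) For any $E\in\mathcal{E}'$ there exists an admissible left $\mathcal{P}'$-approximation $E\to P$. Furthermore, in this case $\mathcal{E}'$ has enough injectives.
   Context: All categories are essentially small and additive; subcategories are full and closed under isomorphisms. Exact categories are in the sense of Quillen, with conflations, inflations (kernel parts) and deflations (cokernel parts); no idempotent completeness is assumed. An exact equivalence is an equivalence of categories which maps conflations to conflations and whose quasi-inverse does too. A morphism is admissible if it is a composite $m\circ p$ with $p$ a deflation and $m$ an inflation. A sequence is exact if all its morphisms are admissible and kernels coincide with images. $\operatorname{Mod}(\mathcal{E})$ is the abelian category of additive contravariant functors $\mathcal{E}\to \mathsf{Ab}$. $\operatorname{mod}_{\mathsf{adm}}(\mathcal{E})$ is the full subcategory of those $F$ admitting an exact sequence $\operatorname{Hom}_{\mathcal{E}}(-,X)\xrightarrow{\operatorname{Hom}_{\mathcal{E}}(-,f)}\operatorname{Hom}_{\mathcal{E}}(-,Y)\to F\to 0$ with $f\colon X\to Y$ admissible in $\mathcal{E}$. It is extension-closed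 in $\operatorname{Mod}(\mathcal{E})$ and carries the inherited exact structure. ${}^{\perp}\mathcal{P}'=\{E\in\mathcal{E}'\mid \operatorname{Hom}_{\mathcal{E}'}(E,P)=0\text{ for all }P\in\mathcal{P}'\}$. The dominant dimension $\operatorname{dom.dim}(\mathcal{E}')$ is the largest $n$ such that for every projective $P\in\mathcal{E}'$ there is an exact sequence $0\to P\to I_1\to\cdots\to I_n\to C\to 0$ with each $I_k$ ($1\le k\le n$) both projective and injective (so $\operatorname{dom.dim}(\mathcal{E}')\ge 2$ means that such a sequence with $n=2$ exists for every projective $P$). $\operatorname{gl.dim}$ denotes global dimension. A left $\mathcal{P}'$-approximation $f\colon E\to P$ is a morphism with $P\in\mathcal{P}'$ through which every morphism $E\to P''$ with $P''\in\mathcal{P}'$ factors; it is admissible if $f$ is an admissible morphism. *)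

theory Defs
  imports "HOL-Algebra.Group" "HOL-Library.Extended_Nat"
begin

section \<open>Additive categories\<close>

text \<open>
  A category with an addition on parallel arrows and a distinguished class of composable
  pairs of arrows (used for conflations).  The operations are only meaningful on arrows of
  the category, and composition only on composable ones.
\<close>

record ('o, 'm) excat =
  Obj :: "'o set"
  Arr :: "'m set"
  Dom :: "'m \<Rightarrow> 'o"
  Cod :: "'m \<Rightarrow> 'o"
  Ide :: "'o \<Rightarrow> 'm"
  Comp :: "'m \<Rightarrow> 'm \<Rightarrow> 'm"  (infixl \<open>\<cdot>\<index>\<close> 70)
  Add :: "'m \<Rightarrow> 'm \<Rightarrow> 'm"
  ZeroArr :: "'o \<Rightarrow> 'o \<Rightarrow> 'm"
  Confl :: "('m \<times> 'm) set"

definition Hom :: "('o, 'm) excat \<Rightarrow> 'o \<Rightarrow> 'o \<Rightarrow> 'm set" where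
  "Hom C X Y = {f \<in> Arr C. Dom C f = X \<and> Cod C f = Y}"

definition Hom_group :: "('o, 'm) excat \<Rightarrow> 'o \<Rightarrow> 'o \<Rightarrow> 'm monoid" where
  "Hom_group C X Y = \<lparr>carrier = Hom C X Y, monoid.mult = Add C, one = ZeroArr C X Y\<rparr>"

locale category =
  fixes C :: "('o, 'm) excat" (structure)
  assumes Dom_Obj: "f \<in> Arr C \<Longrightarrow> Dom C f \<in> Obj C"
    and Cod_Obj: "f \<in> Arr C \<Longrightarrow> Cod C f \<in> Obj C"
    and Ide_Hom: "X \<in> Obj C \<Longrightarrow> Ide C X \<in> Hom C X X"
    and Comp_Hom: "\<lbrakk>f \<in> Hom C X Y; g \<in> Hom C Y Z\<rbrakk> \<Longrightarrow> g \<cdot> f \<in> Hom C X Z"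
    and Comp_assoc: "\<lbrakk>f \<in> Hom C W X; g \<in> Hom C X Y; h \<in> Hom C Y Z\<rbrakk>
                       \<Longrightarrow> (h \<cdot> g) \<cdot> f = h \<cdot> (g \<cdot> f)"
    and Comp_Ide: "f \<in> Hom C X Y \<Longrightarrow> f \<cdot> Ide C X = f"
    and Ide_Comp: "f \<in> Hom C X Y \<Longrightarrow> Ide C Y \<cdot> f = f"

locale preadditive_category = category +
  assumes Hom_comm_group: "\<lbrakk>X \<in> Obj C; Y \<in> Obj C\<rbrakk> \<Longrightarrow> comm_group (Hom_group C X Y)"
    and Comp_Add: "\<lbrakk>f \<in> Hom C X Y; g \<in> Hom C X Y; h \<in> Hom C Y Z\<rbrakk>
                     \<Longrightarrow> h \<cdot> Add C f g = Add C (h \<cdot> f) (h \<cdot> g)"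
    and Add_Comp: "\<lbrakk>f \<in> Hom C X Y; g \<in> Hom C Y Z; h \<in> Hom C Y Z\<rbrakk>
                     \<Longrightarrow> Add C g h \<cdot> f = Add C (g \<cdot> f) (h \<cdot> f)"

definition zero_object :: "('o, 'm) excat \<Rightarrow> 'o \<Rightarrow> bool" where
  "zero_object C Z \<longleftrightarrow> Z \<in> Obj C \<and>
     (\<forall>X \<in> Obj C. (\<exists>!f. f \<in> Hom C Z X) \<and> (\<exists>!f. f \<in> Hom C X Z))"

definition is_biproduct ::
    "('o, 'm) excat \<Rightarrow> 'o \<Rightarrow> 'o \<Rightarrow> 'o \<Rightarrow> 'm \<Rightarrow> 'm \<Rightarrow> 'm \<Rightarrow> 'm \<Rightarrow> bool" where
  "is_biproduct C X Y S i\<^sub>X i\<^sub>Y p\<^sub>X p\<^sub>Y \<longleftrightarrow>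
     i\<^sub>X \<in> Hom C X S \<and> i\<^sub>Y \<in> Hom C Y S \<and> p\<^sub>X \<in> Hom C S X \<and> p\<^sub>Y \<in> Hom C S Y \<and>
     p\<^sub>X \<cdot>\<^bsub>C\<^esub> i\<^sub>X = Ide C X \<and> p\<^sub>Y \<cdot>\<^bsub>C\<^esub> i\<^sub>Y = Ide C Y \<and>
     p\<^sub>X \<cdot>\<^bsub>C\<^esub> i\<^sub>Y = ZeroArr C Y X \<and> p\<^sub>Y \<cdot>\<^bsub>C\<^esub> i\<^sub>X = ZeroArr C X Y \<and>
     Add C (i\<^sub>X \<cdot>\<^bsub>C\<^esub> p\<^sub>X) (i\<^sub>Y \<cdot>\<^bsub>C\<^esub> p\<^sub>Y) = Ide C S"

locale additive_category = preadditive_category +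
  assumes ex_zero_object: "\<exists>Z. zero_object C Z"
    and ex_biproduct: "\<lbrakk>X \<in> Obj C; Y \<in> Obj C\<rbrakk>
                         \<Longrightarrow> \<exists>S i\<^sub>X i\<^sub>Y p\<^sub>X p\<^sub>Y. is_biproduct C X Y S i\<^sub>X i\<^sub>Y p\<^sub>X p\<^sub>Y"

definition is_iso :: "('o, 'm) excat \<Rightarrow> 'm \<Rightarrow> bool" where
  "is_iso C f \<longleftrightarrow> f \<in> Arr C \<and>
     (\<exists>g \<in> Hom C (Cod C f) (Dom C f).
        g \<cdot>\<^bsub>C\<^esub> f = Ide C (Dom C f) \<and> f \<cdot>\<^bsub>C\<^esub> g = Ide C (Cod C f))"

definition is_kernel :: "('o, 'm) excat \<Rightarrow> 'm \<Rightarrow> 'm \<Rightarrow> bool" where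
  "is_kernel C i f \<longleftrightarrow> i \<in> Arr C \<and> f \<in> Arr C \<and> Cod C i = Dom C f \<and>
     f \<cdot>\<^bsub>C\<^esub> i = ZeroArr C (Dom C i) (Cod C f) \<and>
     (\<forall>W \<in> Obj C. \<forall>g \<in> Hom C W (Dom C f). f \<cdot>\<^bsub>C\<^esub> g = ZeroArr C W (Cod C f) \<longrightarrow>
        (\<exists>!h. h \<in> Hom C W (Dom C i) \<and> i \<cdot>\<^bsub>C\<^esub> h = g))"

definition is_cokernel :: "('o, 'm) excat \<Rightarrow> 'm \<Rightarrow> 'm \<Rightarrow> bool" where
  "is_cokernel C p f \<longleftrightarrow> p \<in> Arr C \<and> f \<in> Arr C \<and> Dom C p = Cod C f \<and>
     p \<cdot>\<^bsub>C\<^esub> f = ZeroArr C (Dom C f) (Cod C p) \<and>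
     (\<forall>W \<in> Obj C. \<forall>g \<in> Hom C (Cod C f) W. g \<cdot>\<^bsub>C\<^esub> f = ZeroArr C (Dom C f) W \<longrightarrow>
        (\<exists>!h. h \<in> Hom C (Cod C p) W \<and> h \<cdot>\<^bsub>C\<^esub> p = g))"

definition kernel_cokernel_pair :: "('o, 'm) excat \<Rightarrow> 'm \<Rightarrow> 'm \<Rightarrow> bool" where
  "kernel_cokernel_pair C i p \<longleftrightarrow> is_kernel C i p \<and> is_cokernel C p i"

text \<open>The commutative square \<open>f' \<cdot> i = i' \<cdot> f\<close> is a pushout of \<open>i\<close> and \<open>f\<close>,
  respectively the square \<open>p \<cdot> f' = f \<cdot> p'\<close> is a pullback of \<open>p\<close> and \<open>f\<close>.\<close>

definition is_pushout :: "('o, 'm) excat \<Rightarrow> 'm \<Rightarrow> 'm \<Rightarrow> 'm \<Rightarrow> 'm \<Rightarrow> bool" where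
  "is_pushout C i f i' f' \<longleftrightarrow>
     i \<in> Arr C \<and> f \<in> Arr C \<and> i' \<in> Arr C \<and> f' \<in> Arr C \<and>
     Dom C i = Dom C f \<and> Dom C f' = Cod C i \<and> Dom C i' = Cod C f \<and> Cod C f' = Cod C i' \<and>
     f' \<cdot>\<^bsub>C\<^esub> i = i' \<cdot>\<^bsub>C\<^esub> f \<and>
     (\<forall>W \<in> Obj C. \<forall>a \<in> Hom C (Cod C i) W. \<forall>b \<in> Hom C (Cod C f) W.
        a \<cdot>\<^bsub>C\<^esub> i = b \<cdot>\<^bsub>C\<^esub> f \<longrightarrow>
        (\<exists>!h. h \<in> Hom C (Cod C i') W \<and> h \<cdot>\<^bsub>C\<^esub> f' = a \<and> h \<cdot>\<^bsub>C\<^esub> i' = b))"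

definition is_pullback :: "('o, 'm) excat \<Rightarrow> 'm \<Rightarrow> 'm \<Rightarrow> 'm \<Rightarrow> 'm \<Rightarrow> bool" where
  "is_pullback C p f p' f' \<longleftrightarrow>
     p \<in> Arr C \<and> f \<in> Arr C \<and> p' \<in> Arr C \<and> f' \<in> Arr C \<and>
     Cod C p = Cod C f \<and> Cod C f' = Dom C p \<and> Cod C p' = Dom C f \<and> Dom C f' = Dom C p' \<and>
     p \<cdot>\<^bsub>C\<^esub> f' = f \<cdot>\<^bsub>C\<^esub> p' \<and>
     (\<forall>W \<in> Obj C. \<forall>a \<in> Hom C W (Dom C p). \<forall>b \<in> Hom C W (Dom C f).
        p \<cdot>\<^bsub>C\<^esub> a = f \<cdot>\<^bsub>C\<^esub> b \<longrightarrow>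
        (\<exists>!h. h \<in> Hom C W (Dom C p') \<and> f' \<cdot>\<^bsub>C\<^esub> h = a \<and> p' \<cdot>\<^bsub>C\<^esub> h = b))"


section \<open>Exact categories\<close>

definition inflation :: "('o, 'm) excat \<Rightarrow> 'm \<Rightarrow> bool" where
  "inflation C i \<longleftrightarrow> (\<exists>p. (i, p) \<in> Confl C)"

definition deflation :: "('o, 'm) excat \<Rightarrow> 'm \<Rightarrow> bool" where
  "deflation C p \<longleftrightarrow> (\<exists>i. (i, p) \<in> Confl C)"

text \<open>Quillen's axioms, in the formulation of Keller and Buehler; no idempotents are
  required to split.\<close>

locale exact_category = additive_category +
  assumes Confl_kernel_cokernel: "(i, p) \<in> Confl C \<Longrightarrow> kernel_cokernel_pair C i p"
    and Confl_iso_closed: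
      "\<lbrakk>(i, p) \<in> Confl C; i' \<in> Arr C; p' \<in> Arr C; Cod C i' = Dom C p';
        is_iso C a; is_iso C b; is_iso C c;
        a \<in> Hom C (Dom C i) (Dom C i'); b \<in> Hom C (Cod C i) (Cod C i');
        c \<in> Hom C (Cod C p) (Cod C p');
        b \<cdot> i = i' \<cdot> a; c \<cdot> p = p' \<cdot> b\<rbrakk> \<Longrightarrow> (i', p') \<in> Confl C"
    and Ide_inflation: "X \<in> Obj C \<Longrightarrow> inflation C (Ide C X)"
    and Ide_deflation: "X \<in> Obj C \<Longrightarrow> deflation C (Ide C X)"
    and Comp_inflation: "\<lbrakk>inflation C i; inflation C j; Cod C i = Dom C j\<rbrakk>
                           \<Longrightarrow> inflation C (j \<cdot> i)"
    and Comp_deflation: "\<lbrakk>deflation C p; deflation C q; Cod C p = Dom C q\<rbrakk>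
                           \<Longrightarrow> deflation C (q \<cdot> p)"
    and pushout_inflation: "\<lbrakk>inflation C i; f \<in> Arr C; Dom C f = Dom C i\<rbrakk>
                              \<Longrightarrow> \<exists>i' f'. is_pushout C i f i' f' \<and> inflation C i'"
    and pullback_deflation: "\<lbrakk>deflation C p; f \<in> Arr C; Cod C f = Cod C p\<rbrakk>
                               \<Longrightarrow> \<exists>p' f'. is_pullback C p f p' f' \<and> deflation C p'"

text \<open>\<open>m\<close> is the image of the admissible morphism \<open>f = m \<cdot> p\<close>.\<close>

definition is_image :: "('o, 'm) excat \<Rightarrow> 'm \<Rightarrow> 'm \<Rightarrow> bool" where
  "is_image C m f \<longleftrightarrow> inflation C m \<and>
     (\<exists>p. deflation C p \<and> Cod C p = Dom C m \<and> f = m \<cdot>\<^bsub>C\<^esub> p)"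

definition admissible_arr :: "('o, 'm) excat \<Rightarrow> 'm \<Rightarrow> bool" where
  "admissible_arr C f \<longleftrightarrow> (\<exists>m. is_image C m f)"

text \<open>A list \<open>[f\<^sub>0, \<dots>, f\<^sub>r]\<close> stands for the sequence
  \<open>X\<^sub>0 \<rightarrow> X\<^sub>1 \<rightarrow> \<dots>\<close> of its morphisms, from left to right.\<close>

definition exact_sequence :: "('o, 'm) excat \<Rightarrow> 'm list \<Rightarrow> bool" where
  "exact_sequence C fs \<longleftrightarrow> (\<forall>f \<in> set fs. admissible_arr C f) \<and>
     (\<forall>k. Suc k < length fs \<longrightarrow>
        Cod C (fs ! k) = Dom C (fs ! Suc k) \<and>
        (\<exists>m. is_image C m (fs ! k) \<and> is_kernel C m (fs ! Suc k)))"

text \<open>The sequence \<open>0 \<rightarrow> X\<^sub>0 \<rightarrow> \<dots> \<rightarrow> X\<^sub>r \<rightarrow> 0\<close> is exact.\<close>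

definition exact_sequence0 :: "('o, 'm) excat \<Rightarrow> 'm list \<Rightarrow> bool" where
  "exact_sequence0 C fs \<longleftrightarrow> fs \<noteq> [] \<and>
     (\<exists>Z. zero_object C Z \<and>
        exact_sequence C
          (ZeroArr C Z (Dom C (hd fs)) # fs @ [ZeroArr C (Cod C (last fs)) Z]))"

definition projective :: "('o, 'm) excat \<Rightarrow> 'o \<Rightarrow> bool" where
  "projective C P \<longleftrightarrow> P \<in> Obj C \<and>
     (\<forall>p. deflation C p \<longrightarrow>
        (\<forall>f \<in> Hom C P (Cod C p). \<exists>g \<in> Hom C P (Dom C p). p \<cdot>\<^bsub>C\<^esub> g = f))"

definition injective :: "('o, 'm) excat \<Rightarrow> 'o \<Rightarrow> bool" where
  "injective C I \<longleftrightarrow> I \<in> Obj C \<and>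
     (\<forall>i. inflation C i \<longrightarrow>
        (\<forall>f \<in> Hom C (Dom C i) I. \<exists>g \<in> Hom C (Cod C i) I. g \<cdot>\<^bsub>C\<^esub> i = f))"

definition Proj :: "('o, 'm) excat \<Rightarrow> 'o set" where
  "Proj C = {P. projective C P}"

definition enough_projectives :: "('o, 'm) excat \<Rightarrow> bool" where
  "enough_projectives C \<longleftrightarrow>
     (\<forall>X \<in> Obj C. \<exists>p. deflation C p \<and> projective C (Dom C p) \<and> Cod C p = X)"

definition enough_injectives :: "('o, 'm) excat \<Rightarrow> bool" where
  "enough_injectives C \<longleftrightarrow>
     (\<forall>X \<in> Obj C. \<exists>i. inflation C i \<and> Dom C i = X \<and> injective C (Cod C i))"


section \<open>Homological dimensions, orthogonals and approximations\<close>

text \<open>\<open>fs = [d\<^sub>n, \<dots>, d\<^sub>1, \<epsilon>]\<close> is a projective resolution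
  \<open>0 \<rightarrow> P\<^sub>n \<rightarrow> \<dots> \<rightarrow> P\<^sub>0 \<rightarrow> X \<rightarrow> 0\<close> of length \<open>n\<close>.\<close>

definition projective_resolution :: "('o, 'm) excat \<Rightarrow> nat \<Rightarrow> 'm list \<Rightarrow> 'o \<Rightarrow> bool" where
  "projective_resolution C n fs X \<longleftrightarrow>
     length fs = Suc n \<and> exact_sequence0 C fs \<and> Cod C (last fs) = X \<and>
     (\<forall>f \<in> set fs. projective C (Dom C f))"

text \<open>With the conventions \<open>Inf {} = \<infinity>\<close> and, for unbounded sets, \<open>Sup = \<infinity>\<close>.\<close>

definition proj_dim :: "('o, 'm) excat \<Rightarrow> 'o \<Rightarrow> enat" where
  "proj_dim C X = Inf {enat n | n. \<exists>fs. projective_resolution C n fs X}"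

definition gl_dim :: "('o, 'm) excat \<Rightarrow> enat" where
  "gl_dim C = (SUP X \<in> Obj C. proj_dim C X)"

text \<open>\<open>fs\<close> is an exact sequence
  \<open>0 \<rightarrow> P \<rightarrow> I\<^sub>1 \<rightarrow> \<dots> \<rightarrow> I\<^sub>n \<rightarrow> X \<rightarrow> 0\<close>, with \<open>X\<close> arbitrary.\<close>

definition proj_inj_copresentation :: "('o, 'm) excat \<Rightarrow> nat \<Rightarrow> 'm list \<Rightarrow> 'o \<Rightarrow> bool" where
  "proj_inj_copresentation C n fs P \<longleftrightarrow>
     length fs = Suc n \<and> exact_sequence0 C fs \<and> Dom C (hd fs) = P \<and>
     (\<forall>k < n. projective C (Cod C (fs ! k)) \<and> injective C (Cod C (fs ! k)))"

definition dom_dim :: "('o, 'm) excat \<Rightarrow> enat" where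
  "dom_dim C =
     Sup {enat n | n. \<forall>P. projective C P \<longrightarrow> (\<exists>fs. proj_inj_copresentation C n fs P)}"

definition left_perp :: "('o, 'm) excat \<Rightarrow> 'o set \<Rightarrow> 'o set" where
  "left_perp C S = {X \<in> Obj C. \<forall>P \<in> S. Hom C X P = {ZeroArr C X P}}"

definition left_approximation :: "('o, 'm) excat \<Rightarrow> 'o set \<Rightarrow> 'm \<Rightarrow> 'o \<Rightarrow> bool" where
  "left_approximation C S f X \<longleftrightarrow>
     f \<in> Arr C \<and> Dom C f = X \<and> Cod C f \<in> S \<and>
     (\<forall>P \<in> S. \<forall>g \<in> Hom C X P. \<exists>h \<in> Hom C (Cod C f) P. g = h \<cdot>\<^bsub>C\<^esub> f)"


section \<open>Exact equivalences\<close>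

definition is_functor ::
    "('o, 'm) excat \<Rightarrow> ('p, 'n) excat \<Rightarrow> ('o \<Rightarrow> 'p) \<Rightarrow> ('m \<Rightarrow> 'n) \<Rightarrow> bool" where
  "is_functor C D Fo Fa \<longleftrightarrow>
     (\<forall>X \<in> Obj C. Fo X \<in> Obj D) \<and>
     (\<forall>f \<in> Arr C. Fa f \<in> Hom D (Fo (Dom C f)) (Fo (Cod C f))) \<and>
     (\<forall>X \<in> Obj C. Fa (Ide C X) = Ide D (Fo X)) \<and>
     (\<forall>f \<in> Arr C. \<forall>g \<in> Arr C. Cod C f = Dom C g \<longrightarrow> Fa (g \<cdot>\<^bsub>C\<^esub> f) = Fa g \<cdot>\<^bsub>D\<^esub> Fa f)"

definition naturally_isomorphic ::
    "('o, 'm) excat \<Rightarrow> ('p, 'n) excat \<Rightarrow>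
     ('o \<Rightarrow> 'p) \<Rightarrow> ('m \<Rightarrow> 'n) \<Rightarrow> ('o \<Rightarrow> 'p) \<Rightarrow> ('m \<Rightarrow> 'n) \<Rightarrow> bool" where
  "naturally_isomorphic C D Fo Fa Go Ga \<longleftrightarrow>
     (\<exists>\<eta>. (\<forall>X \<in> Obj C. \<eta> X \<in> Hom D (Fo X) (Go X) \<and> is_iso D (\<eta> X)) \<and>
          (\<forall>f \<in> Arr C. Ga f \<cdot>\<^bsub>D\<^esub> \<eta> (Dom C f) = \<eta> (Cod C f) \<cdot>\<^bsub>D\<^esub> Fa f))"

definition preserves_conflations ::
    "('o, 'm) excat \<Rightarrow> ('p, 'n) excat \<Rightarrow> ('m \<Rightarrow> 'n) \<Rightarrow> bool" where
  "preserves_conflations C D Fa \<longleftrightarrow> (\<forall>(i, p) \<in> Confl C. (Fa i, Fa p) \<in> Confl D)"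

text \<open>Additivity of the functors need not be required: an equivalence between additive
  categories is automatically additive.\<close>

definition exactly_equivalent :: "('o, 'm) excat \<Rightarrow> ('p, 'n) excat \<Rightarrow> bool" where
  "exactly_equivalent C D \<longleftrightarrow>
     (\<exists>Fo Fa Go Ga.
        is_functor C D Fo Fa \<and> is_functor D C Go Ga \<and>
        naturally_isomorphic C C (Go \<circ> Fo) (Ga \<circ> Fa) id id \<and>
        naturally_isomorphic D D (Fo \<circ> Go) (Fa \<circ> Ga) id id \<and>
        preserves_conflations C D Fa \<and> preserves_conflations D C Ga)"


section \<open>Functor categories\<close>

text \<open>
  Contravariant functors to abelian groups, the latter being written as (multiplicative)
  monoid records with carrier inside \<open>'g\<close>.
  The values of \<open>FObj\<close> and \<open>FArr\<close> outside \<open>Obj C\<close>, \<open>Arr C\<close> and the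
  carriers are unspecified; this only adds isomorphic copies of functors.
\<close>

record ('o, 'm, 'g) cfunctor =
  FObj :: "'o \<Rightarrow> 'g monoid"
  FArr :: "'m \<Rightarrow> 'g \<Rightarrow> 'g"

definition additive_cfunctor :: "('o, 'm) excat \<Rightarrow> ('o, 'm, 'g) cfunctor \<Rightarrow> bool" where
  "additive_cfunctor C F \<longleftrightarrow>
     (\<forall>X \<in> Obj C. comm_group (FObj F X)) \<and>
     (\<forall>f \<in> Arr C. FArr F f \<in> hom (FObj F (Cod C f)) (FObj F (Dom C f))) \<and>
     (\<forall>X \<in> Obj C. \<forall>x \<in> carrier (FObj F X). FArr F (Ide C X) x = x) \<and>
     (\<forall>f \<in> Arr C. \<forall>g \<in> Arr C. Cod C f = Dom C g \<longrightarrow>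
        (\<forall>x \<in> carrier (FObj F (Cod C g)). FArr F (g \<cdot>\<^bsub>C\<^esub> f) x = FArr F f (FArr F g x))) \<and>
     (\<forall>f \<in> Arr C. \<forall>g \<in> Arr C. Dom C f = Dom C g \<longrightarrow> Cod C f = Cod C g \<longrightarrow>
        (\<forall>x \<in> carrier (FObj F (Cod C f)).
           FArr F (Add C f g) x = FArr F f x \<otimes>\<^bsub>FObj F (Dom C f)\<^esub> FArr F g x))"

text \<open>Natural transformations record their source and target, so that arrows of the functor
  category determine their domain and codomain.\<close>

record ('o, 'm, 'g) nattrans =
  NDom :: "('o, 'm, 'g) cfunctor"
  NCod :: "('o, 'm, 'g) cfunctor"
  NComp :: "'o \<Rightarrow> 'g \<Rightarrow> 'g"

text \<open>Components are normalised to \<open>undefined\<close> outside their domain, so that equality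
  of records is equality of natural transformations.\<close>

definition mk_nattrans ::
    "('o, 'm) excat \<Rightarrow> ('o, 'm, 'g) cfunctor \<Rightarrow> ('o, 'm, 'g) cfunctor \<Rightarrow>
     ('o \<Rightarrow> 'g \<Rightarrow> 'g) \<Rightarrow> ('o, 'm, 'g) nattrans" where
  "mk_nattrans C F G \<eta> =
     \<lparr>NDom = F, NCod = G,
      NComp = (\<lambda>X \<in> Obj C. \<lambda>x \<in> carrier (FObj F X). \<eta> X x)\<rparr>"

definition natural_transformation :: "('o, 'm) excat \<Rightarrow> ('o, 'm, 'g) nattrans \<Rightarrow> bool" where
  "natural_transformation C \<eta> \<longleftrightarrow>
     additive_cfunctor C (NDom \<eta>) \<and> additive_cfunctor C (NCod \<eta>) \<and>
     \<eta> = mk_nattrans C (NDom \<eta>) (NCod \<eta>) (NComp \<eta>) \<and>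
     (\<forall>X \<in> Obj C. NComp \<eta> X \<in> hom (FObj (NDom \<eta>) X) (FObj (NCod \<eta>) X)) \<and>
     (\<forall>f \<in> Arr C. \<forall>x \<in> carrier (FObj (NDom \<eta>) (Cod C f)).
        NComp \<eta> (Dom C f) (FArr (NDom \<eta>) f x) = FArr (NCod \<eta>) f (NComp \<eta> (Cod C f) x))"

text \<open>\<open>ModCat C\<close> carries the canonical exact structure of an abelian category: all
  kernel-cokernel pairs are conflations.\<close>

definition ModCat :: "('o, 'm) excat \<Rightarrow> (('o, 'm, 'g) cfunctor, ('o, 'm, 'g) nattrans) excat" where
  "ModCat C =
    (let A =
      \<lparr>Obj = {F. additive_cfunctor C F},
       Arr = {\<eta>. natural_transformation C \<eta>},
       Dom = NDom,
       Cod = NCod,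
       Ide = (\<lambda>F. mk_nattrans C F F (\<lambda>X x. x)),
       Comp = (\<lambda>\<theta> \<eta>. mk_nattrans C (NDom \<eta>) (NCod \<theta>) (\<lambda>X x. NComp \<theta> X (NComp \<eta> X x))),
       Add = (\<lambda>\<eta> \<theta>. mk_nattrans C (NDom \<eta>) (NCod \<eta>)
                 (\<lambda>X x. NComp \<eta> X x \<otimes>\<^bsub>FObj (NCod \<eta>) X\<^esub> NComp \<theta> X x)),
       ZeroArr = (\<lambda>F G. mk_nattrans C F G (\<lambda>X x. \<one>\<^bsub>FObj G X\<^esub>)),
       Confl = {}\<rparr>
     in A\<lparr>Confl := {(i, p). kernel_cokernel_pair A i p}\<rparr>)"

definition full_subcategory :: "('o, 'm) excat \<Rightarrow> 'o set \<Rightarrow> ('o, 'm) excat" where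
  "full_subcategory C S =
     C\<lparr>Obj := Obj C \<inter> S,
       Arr := {f \<in> Arr C. Dom C f \<in> S \<and> Cod C f \<in> S},
       Confl := {(i, p) \<in> Confl C. Dom C i \<in> S \<and> Cod C i \<in> S \<and> Cod C p \<in> S}\<rparr>"

text \<open>The representable functor \<open>Hom(-, X)\<close> and the transformation \<open>Hom(-, f)\<close>.\<close>

definition Yoneda_obj :: "('o, 'm) excat \<Rightarrow> 'o \<Rightarrow> ('o, 'm, 'm) cfunctor" where
  "Yoneda_obj C X = \<lparr>FObj = (\<lambda>W. Hom_group C W X), FArr = (\<lambda>f h. h \<cdot>\<^bsub>C\<^esub> f)\<rparr>"

definition Yoneda_arr :: "('o, 'm) excat \<Rightarrow> 'm \<Rightarrow> ('o, 'm, 'm) nattrans" where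
  "Yoneda_arr C f =
     mk_nattrans C (Yoneda_obj C (Dom C f)) (Yoneda_obj C (Cod C f)) (\<lambda>W h. f \<cdot>\<^bsub>C\<^esub> h)"

text \<open>
  Here the values of functors are abelian groups with carrier inside the type \<open>'m\<close> of
  arrows of \<open>C\<close>.  This is no restriction up to equivalence: a functor with a
  presentation by representables has values that are quotients of groups \<open>Hom(W, Y)\<close>,
  and hence is isomorphic to a functor with carriers inside \<open>'m\<close>.
\<close>

definition mod_adm ::
    "('o, 'm) excat \<Rightarrow> (('o, 'm, 'm) cfunctor, ('o, 'm, 'm) nattrans) excat" where
  "mod_adm C = full_subcategory (ModCat C)
     {F. \<exists>f \<pi> Z. f \<in> Arr C \<and> admissible_arr C f \<and>
           \<pi> \<in> Hom (ModCat C) (Yoneda_obj C (Cod C f)) F \<and> zero_object (ModCat C) Z \<and>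
           exact_sequence (ModCat C) [Yoneda_arr C f, \<pi>, ZeroArr (ModCat C) F Z]}"

end

theory Submission
  imports Defs "HOL-Algebra.Coset"
begin

text \<open>
  Call an object torsion if it admits no nonzero morphism to a projective.

  Given the three conditions, \<open>E\<close> is the category of projective objects of \<open>E'\<close>, where
  \<open>0 \<rightarrow> X \<rightarrow> Y \<rightarrow> Z\<close> is a conflation if it is the projective resolution of a torsion object.
  Approximations give every object \<open>A\<close> a torsion subobject such that the quotient is the
  kernel of a morphism from a projective onto a torsion object; this is exactly a factorization
  of a projective presentation of \<open>A\<close> into a deflation and an inflation of \<open>E\<close>. So \<open>A\<close>
  is determined by the functor \<open>Hom(-, A)\<close> on projectives, which is admissibly presented, and the
  objects that are both projective and injective are enough injectives for \<open>E\<close>.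

  Conversely, an admissible \<open>f = m \<cdot> p\<close> with \<open>k\<close> a kernel of \<open>p\<close> makes
  \<open>0 \<rightarrow> Hom(-, K) \<rightarrow> Hom(-, X) \<rightarrow> Hom(-, Y) \<rightarrow> F \<rightarrow> 0\<close> a projective resolution of the functor
  presented by \<open>f\<close>. Injectives of \<open>E\<close> represent injective functors, the torsion functors are those
  presented by deflations, and morphisms to them are factored by pulling back these deflations. If
  \<open>c\<close> is a cokernel of \<open>m\<close>, then \<open>Hom(-, c)\<close> induces a left approximation of \<open>F\<close>.
\<close>

section \<open>Arrows of preadditive categories\<close>

text \<open>In a Quillen exact category a kernel-cokernel pair need not be a conflation and a
  retraction need not have a kernel, so diagram lemmas of abelian categories cannot be quoted. The
  way out is \<open>G_ses\<close>: morphisms from a covering class of projectives serve as elements,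
  and a sequence that is exact on them is a conflation, by the obscure axiom. Most conflations below
  are found by such a chase. The conditions play different roles. For torsion T and projective P,
  dominant dimension 2 adds Ext^1(T, P) = 0 to Hom(T, P) = 0, so morphisms to projectives extend
  uniquely along inflations with torsion cokernel. Global dimension 2 makes second syzygies
  projective. Condition (3) embeds torsion-free objects into projectives with torsion cokernel,
  which turns inflations between projectives into inflations of \<open>E\<close>. Condition (2)
  provides the images and kernels behind the composition and pullback axioms for deflations. Enough
  injectives in \<open>E'\<close> rests on condition (1): the last term of a two-step copresentation
  of a projective is itself injective, and cosyzygy arguments spread embeddings from projectives to
  all objects.\<close>

lemma Hom_D:
  assumes "f \<in> Hom C X Y"
  shows "f \<in> Arr C" "Dom C f = X" "Cod C f = Y"
  using assms by (simp_all add: Hom_def)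

context category
begin

lemma Hom_Obj: "f \<in> Hom C X Y \<Longrightarrow> X \<in> Obj C \<and> Y \<in> Obj C"
  using Dom_Obj Cod_Obj by (auto simp: Hom_def)

text \<open>Stated over \<open>Arr\<close>, \<open>Dom\<close> and \<open>Cod\<close> rather than
  \<open>Hom\<close>: whether a long composite makes sense then reduces to equations between
  objects, which rewriting settles once \<open>Hom_def\<close> is unfolded.\<close>

lemma Comp_D:
  assumes "f \<in> Arr C" "g \<in> Arr C" "Cod C f = Dom C g"
  shows Comp_Arr [simp]: "g \<cdot> f \<in> Arr C"
    and Dom_Comp [simp]: "Dom C (g \<cdot> f) = Dom C f"
    and Cod_Comp [simp]: "Cod C (g \<cdot> f) = Cod C g"
  using Comp_Hom[of f "Dom C f" "Cod C f" g "Cod C g"] assms by (simp_all add: Hom_def)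

lemma Ide_D [simp]:
  assumes "X \<in> Obj C"
  shows "Ide C X \<in> Arr C" "Dom C (Ide C X) = X" "Cod C (Ide C X) = X"
  using Ide_Hom[OF assms] by (simp_all add: Hom_def)

lemma Dom_in_Obj [simp]: "f \<in> Arr C \<Longrightarrow> Dom C f \<in> Obj C"
  by (rule Dom_Obj)

lemma Cod_in_Obj [simp]: "f \<in> Arr C \<Longrightarrow> Cod C f \<in> Obj C"
  by (rule Cod_Obj)

lemma assoc [simp]:
  assumes "f \<in> Arr C" "g \<in> Arr C" "h \<in> Arr C" "Cod C f = Dom C g" "Cod C g = Dom C h"
  shows "(h \<cdot> g) \<cdot> f = h \<cdot> (g \<cdot> f)"
  using Comp_assoc[of f "Dom C f" "Cod C f" g "Cod C g" h "Cod C h"] assms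
  by (simp add: Hom_def)

lemma Comp_Ide_Arr [simp]: "\<lbrakk>f \<in> Arr C; Dom C f = X\<rbrakk> \<Longrightarrow> f \<cdot> Ide C X = f"
  using Comp_Ide[of f X "Cod C f"] by (simp add: Hom_def)

lemma Ide_Comp_Arr [simp]: "\<lbrakk>f \<in> Arr C; Cod C f = X\<rbrakk> \<Longrightarrow> Ide C X \<cdot> f = f"
  using Ide_Comp[of f "Dom C f" X] by (simp add: Hom_def)

text \<open>Rewriting with \<open>h \<cdot> g = k\<close> inside compositions associated to the right.\<close>

lemma cx:
  assumes "h \<cdot> g = k" "f \<in> Arr C" "g \<in> Arr C" "h \<in> Arr C" "Cod C f = Dom C g" "Cod C g = Dom C h"
  shows "h \<cdot> (g \<cdot> f) = k \<cdot> f"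
  using assoc[of f g h] assms by simp

lemma is_isoI:
  "\<lbrakk>f \<in> Hom C X Y; g \<in> Hom C Y X; g \<cdot> f = Ide C X; f \<cdot> g = Ide C Y\<rbrakk> \<Longrightarrow> is_iso C f"
  by (auto simp: is_iso_def Hom_def)

lemma is_isoE:
  assumes "is_iso C f" "f \<in> Hom C X Y"
  obtains g where "g \<in> Hom C Y X" "g \<cdot> f = Ide C X" "f \<cdot> g = Ide C Y" "is_iso C g"
  using assms by (auto simp: is_iso_def Hom_def)

lemma is_iso_Ide: "X \<in> Obj C \<Longrightarrow> is_iso C (Ide C X)"
  by (rule is_isoI[of _ X X "Ide C X"]) (simp_all add: Hom_def)

section \<open>Universal properties of pullbacks and pushouts\<close>

lemma is_pullback_Hom:
  assumes "is_pullback C p f p' f'" "p \<in> Hom C B D" "f \<in> Hom C D' D"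
  shows "p' \<in> Hom C (Dom C p') D'" "f' \<in> Hom C (Dom C p') B" "p \<cdot> f' = f \<cdot> p'"
proof -
  have "p' \<in> Arr C \<and> f' \<in> Arr C \<and> Cod C f' = Dom C p \<and> Cod C p' = Dom C f \<and> Dom C f' = Dom C p' \<and>
     p \<cdot> f' = f \<cdot> p'"
    using assms(1) unfolding is_pullback_def by blast
  then show "p' \<in> Hom C (Dom C p') D'" "f' \<in> Hom C (Dom C p') B" "p \<cdot> f' = f \<cdot> p'"
    using assms(2,3) by (simp_all add: Hom_def)
qed

lemma is_pullback_ex1:
  assumes "is_pullback C p f p' f'" "p \<in> Hom C B D" "f \<in> Hom C D' D"
    "x \<in> Hom C W B" "y \<in> Hom C W D'" "p \<cdot> x = f \<cdot> y"
  shows "\<exists>!h. h \<in> Hom C W (Dom C p') \<and> f' \<cdot> h = x \<and> p' \<cdot> h = y"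
proof -
  have "\<forall>W \<in> Obj C. \<forall>a \<in> Hom C W (Dom C p). \<forall>b \<in> Hom C W (Dom C f).
        p \<cdot> a = f \<cdot> b \<longrightarrow>
        (\<exists>!h. h \<in> Hom C W (Dom C p') \<and> f' \<cdot> h = a \<and> p' \<cdot> h = b)"
    using assms(1) unfolding is_pullback_def by (elim conjE)
  moreover have "W \<in> Obj C" "Dom C p = B" "Dom C f = D'"
    using Hom_Obj[OF assms(4)] assms(2,3) by (simp_all add: Hom_def)
  ultimately show ?thesis using assms(4-6) by simp
qed

lemma is_pullback_lift:
  assumes "is_pullback C p f p' f'" "p \<in> Hom C B D" "f \<in> Hom C D' D"
    "x \<in> Hom C W B" "y \<in> Hom C W D'" "p \<cdot> x = f \<cdot> y"
  obtains h where "h \<in> Hom C W (Dom C p')" "f' \<cdot> h = x" "p' \<cdot> h = y"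
  using ex1_implies_ex[OF is_pullback_ex1[OF assms]] by (elim exE conjE)

lemma is_pullback_eq:
  assumes "is_pullback C p f p' f'" "p \<in> Hom C B D" "f \<in> Hom C D' D"
    "h \<in> Hom C W (Dom C p')" "h' \<in> Hom C W (Dom C p')" "f' \<cdot> h = f' \<cdot> h'" "p' \<cdot> h = p' \<cdot> h'"
  shows "h = h'"
proof -
  note p' = is_pullback_Hom[OF assms(1-3)]
  have "f' \<cdot> h \<in> Hom C W B" "p' \<cdot> h \<in> Hom C W D'" "p \<cdot> (f' \<cdot> h) = f \<cdot> (p' \<cdot> h)"
    using p'(1,2) assms(2-4) by (simp_all add: Hom_def cx[OF p'(3)])
  from is_pullback_ex1[OF assms(1-3) this] show ?thesis using assms(4-7) by metis
qed

lemma is_pushout_Hom: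
  assumes "is_pushout C i f i' f'" "i \<in> Hom C A B" "f \<in> Hom C A A'"
  shows "i' \<in> Hom C A' (Cod C i')" "f' \<in> Hom C B (Cod C i')" "f' \<cdot> i = i' \<cdot> f"
proof -
  have "i' \<in> Arr C \<and> f' \<in> Arr C \<and> Dom C f' = Cod C i \<and> Dom C i' = Cod C f \<and> Cod C f' = Cod C i' \<and>
     f' \<cdot> i = i' \<cdot> f"
    using assms(1) unfolding is_pushout_def by blast
  then show "i' \<in> Hom C A' (Cod C i')" "f' \<in> Hom C B (Cod C i')" "f' \<cdot> i = i' \<cdot> f"
    using assms(2,3) by (simp_all add: Hom_def)
qed

lemma is_pushout_ex1:
  assumes "is_pushout C i f i' f'" "i \<in> Hom C A B" "f \<in> Hom C A A'"
    "x \<in> Hom C B W" "y \<in> Hom C A' W" "x \<cdot> i = y \<cdot> f"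
  shows "\<exists>!h. h \<in> Hom C (Cod C i') W \<and> h \<cdot> f' = x \<and> h \<cdot> i' = y"
proof -
  have "\<forall>W \<in> Obj C. \<forall>a \<in> Hom C (Cod C i) W. \<forall>b \<in> Hom C (Cod C f) W.
        a \<cdot> i = b \<cdot> f \<longrightarrow>
        (\<exists>!h. h \<in> Hom C (Cod C i') W \<and> h \<cdot> f' = a \<and> h \<cdot> i' = b)"
    using assms(1) unfolding is_pushout_def by (elim conjE)
  moreover have "W \<in> Obj C" "Cod C i = B" "Cod C f = A'"
    using Hom_Obj[OF assms(4)] assms(2,3) by (simp_all add: Hom_def)
  ultimately show ?thesis using assms(4-6) by simp
qed

lemma is_pushout_colift:
  assumes "is_pushout C i f i' f'" "i \<in> Hom C A B" "f \<in> Hom C A A'"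
    "x \<in> Hom C B W" "y \<in> Hom C A' W" "x \<cdot> i = y \<cdot> f"
  obtains h where "h \<in> Hom C (Cod C i') W" "h \<cdot> f' = x" "h \<cdot> i' = y"
  using ex1_implies_ex[OF is_pushout_ex1[OF assms]] by (elim exE conjE)

lemma is_pushout_eq:
  assumes "is_pushout C i f i' f'" "i \<in> Hom C A B" "f \<in> Hom C A A'"
    "h \<in> Hom C (Cod C i') W" "h' \<in> Hom C (Cod C i') W" "h \<cdot> f' = h' \<cdot> f'" "h \<cdot> i' = h' \<cdot> i'"
  shows "h = h'"
proof -
  note p' = is_pushout_Hom[OF assms(1-3)]
  have "h \<cdot> f' \<in> Hom C B W" "h \<cdot> i' \<in> Hom C A' W" "(h \<cdot> f') \<cdot> i = (h \<cdot> i') \<cdot> f"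
    using p'(1,2) assms(2-4) by (simp_all add: Hom_def p'(3))
  from is_pushout_ex1[OF assms(1-3) this] show ?thesis using assms(4-7) by metis
qed

end

section \<open>Negatives, differences and zero morphisms\<close>

definition neg :: "('o, 'm) excat \<Rightarrow> 'm \<Rightarrow> 'm" where
  "neg C f = inv\<^bsub>Hom_group C (Dom C f) (Cod C f)\<^esub> f"

context preadditive_category
begin

abbreviation add (infixl "\<oplus>" 65) where
  "f \<oplus> g \<equiv> Add C f g"

abbreviation sub (infixl "\<ominus>" 65) where
  "f \<ominus> g \<equiv> Add C f (neg C g)"

abbreviation zero ("\<zero>") where
  "\<zero> X Y \<equiv> ZeroArr C X Y"

lemma zero_D [simp]:
  assumes "X \<in> Obj C" "Y \<in> Obj C"
  shows "\<zero> X Y \<in> Arr C" "Dom C (\<zero> X Y) = X" "Cod C (\<zero> X Y) = Y"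
proof -
  interpret comm_group "Hom_group C X Y" by (rule Hom_comm_group[OF assms])
  have "\<zero> X Y \<in> Hom C X Y" using one_closed by (simp add: Hom_group_def)
  then show "\<zero> X Y \<in> Arr C" "Dom C (\<zero> X Y) = X" "Cod C (\<zero> X Y) = Y" by (auto dest: Hom_D)
qed

lemma zero_Hom: "\<lbrakk>X \<in> Obj C; Y \<in> Obj C\<rbrakk> \<Longrightarrow> \<zero> X Y \<in> Hom C X Y"
  by (simp add: Hom_def)

lemma add_D [simp]:
  assumes "f \<in> Arr C" "g \<in> Arr C" "Dom C f = Dom C g" "Cod C f = Cod C g"
  shows "f \<oplus> g \<in> Arr C" "Dom C (f \<oplus> g) = Dom C g" "Cod C (f \<oplus> g) = Cod C g"
proof -
  interpret comm_group "Hom_group C (Dom C g) (Cod C g)"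
    by (rule Hom_comm_group) (use assms in simp_all)
  have "f \<oplus> g \<in> Hom C (Dom C g) (Cod C g)"
    using m_closed[of f g] assms by (simp add: Hom_group_def Hom_def)
  then show "f \<oplus> g \<in> Arr C" "Dom C (f \<oplus> g) = Dom C g" "Cod C (f \<oplus> g) = Cod C g"
    by (auto dest: Hom_D)
qed

lemma neg_D [simp]:
  assumes "f \<in> Arr C"
  shows "neg C f \<in> Arr C" "Dom C (neg C f) = Dom C f" "Cod C (neg C f) = Cod C f"
proof -
  interpret comm_group "Hom_group C (Dom C f) (Cod C f)"
    by (rule Hom_comm_group) (use assms in simp_all)
  have "neg C f \<in> Hom C (Dom C f) (Cod C f)"
    using inv_closed[of f] assms by (simp add: Hom_group_def Hom_def neg_def)
  then show "neg C f \<in> Arr C" "Dom C (neg C f) = Dom C f" "Cod C (neg C f) = Cod C f"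
    by (auto dest: Hom_D)
qed

lemma add_assoc [simp]:
  assumes "f \<in> Arr C" "g \<in> Arr C" "h \<in> Arr C" "Dom C f = Dom C g" "Cod C f = Cod C g"
    "Dom C h = Dom C g" "Cod C h = Cod C g"
  shows "(f \<oplus> g) \<oplus> h = f \<oplus> (g \<oplus> h)"
proof -
  interpret comm_group "Hom_group C (Dom C g) (Cod C g)"
    by (rule Hom_comm_group) (use assms in simp_all)
  show ?thesis using m_assoc[of f g h] assms by (simp add: Hom_group_def Hom_def)
qed

lemma add_commute:
  assumes "f \<in> Arr C" "g \<in> Arr C" "Dom C f = Dom C g" "Cod C f = Cod C g"
  shows "f \<oplus> g = g \<oplus> f"
proof -
  interpret comm_group "Hom_group C (Dom C g) (Cod C g)"
    by (rule Hom_comm_group) (use assms in simp_all)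
  show ?thesis using m_comm[of f g] assms by (simp add: Hom_group_def Hom_def)
qed

lemma add_left_commute:
  assumes "f \<in> Arr C" "g \<in> Arr C" "h \<in> Arr C" "Dom C f = Dom C g" "Cod C f = Cod C g"
    "Dom C h = Dom C g" "Cod C h = Cod C g"
  shows "f \<oplus> (g \<oplus> h) = g \<oplus> (f \<oplus> h)"
  using assms add_assoc[of f g h] add_assoc[of g f h] add_commute[of f g] by simp

lemma add_zero [simp]:
  assumes "f \<in> Arr C" "Dom C f = X" "Cod C f = Y"
  shows "f \<oplus> \<zero> X Y = f" "\<zero> X Y \<oplus> f = f"
proof -
  interpret comm_group "Hom_group C X Y"
    by (rule Hom_comm_group) (use assms in auto)
  show "f \<oplus> \<zero> X Y = f" "\<zero> X Y \<oplus> f = f"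
    using r_one[of f] l_one[of f] assms by (simp_all add: Hom_group_def Hom_def)
qed

lemma add_neg [simp]:
  assumes "f \<in> Arr C"
  shows "f \<ominus> f = \<zero> (Dom C f) (Cod C f)" "neg C f \<oplus> f = \<zero> (Dom C f) (Cod C f)"
proof -
  interpret comm_group "Hom_group C (Dom C f) (Cod C f)"
    by (rule Hom_comm_group) (use assms in auto)
  show "f \<ominus> f = \<zero> (Dom C f) (Cod C f)" "neg C f \<oplus> f = \<zero> (Dom C f) (Cod C f)"
    using r_inv[of f] l_inv[of f] assms by (simp_all add: Hom_group_def Hom_def neg_def)
qed

lemma add_left_cancel:
  assumes "f \<in> Arr C" "g \<in> Arr C" "h \<in> Arr C" "Dom C f = Dom C g" "Cod C f = Cod C g"
    "Dom C h = Dom C g" "Cod C h = Cod C g"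
  shows "h \<oplus> f = h \<oplus> g \<longleftrightarrow> f = g"
proof -
  interpret comm_group "Hom_group C (Dom C g) (Cod C g)"
    by (rule Hom_comm_group) (use assms in auto)
  show ?thesis
    using right_cancel[of h f g] m_comm[of h f] m_comm[of h g] assms
    by (simp add: Hom_group_def Hom_def)
qed

lemma sub_eq_iff:
  assumes "x \<in> Arr C" "y \<in> Arr C" "z \<in> Arr C" "Dom C x = Dom C y" "Cod C x = Cod C y"
    "Dom C z = Dom C y" "Cod C z = Cod C y"
  shows "x \<ominus> y = z \<longleftrightarrow> x = y \<oplus> z"
proof
  assume "x \<ominus> y = z"
  then have "y \<oplus> z = y \<oplus> (neg C y \<oplus> x)" using assms add_commute[of x "neg C y"] by simp
  also have "\<dots> = x" using assms add_assoc[of y "neg C y" x] by (simp del: add_assoc)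
  finally show "x = y \<oplus> z" by simp
next
  assume "x = y \<oplus> z"
  then show "x \<ominus> y = z"
    using assms add_commute[of y z] by simp
qed

lemma sub_eq_zero_iff:
  assumes "x \<in> Arr C" "y \<in> Arr C" "X = Dom C y" "Y = Cod C y" "Dom C x = Dom C y"
    "Cod C x = Cod C y"
  shows "x \<ominus> y = \<zero> X Y \<longleftrightarrow> x = y"
  using sub_eq_iff[of x y "\<zero> X Y"] assms by simp

lemma comp_add [simp]:
  assumes "f \<in> Arr C" "g \<in> Arr C" "h \<in> Arr C" "Dom C f = Dom C g" "Cod C f = Cod C g"
    "Dom C h = Cod C g"
  shows "h \<cdot> (f \<oplus> g) = h \<cdot> f \<oplus> h \<cdot> g"
  using Comp_Add[of f "Dom C g" "Cod C g" g h "Cod C h"] assms by (simp add: Hom_def)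

lemma add_comp [simp]:
  assumes "f \<in> Arr C" "g \<in> Arr C" "h \<in> Arr C" "Dom C f = Dom C g" "Cod C f = Cod C g"
    "Dom C g = Cod C h"
  shows "(f \<oplus> g) \<cdot> h = f \<cdot> h \<oplus> g \<cdot> h"
  using Add_Comp[of h "Dom C h" "Cod C h" f "Cod C g" g] assms by (simp add: Hom_def)

text \<open>Distributivity makes the composite equal to its own double, and cancellation leaves
  zero.\<close>

lemma comp_zero [simp]:
  assumes "g \<in> Arr C" "X \<in> Obj C" "Dom C g = Y"
  shows "g \<cdot> \<zero> X Y = \<zero> X (Cod C g)"
proof -
  have Y: "Y \<in> Obj C" using assms by auto
  have "g \<cdot> \<zero> X Y \<oplus> g \<cdot> \<zero> X Y = g \<cdot> \<zero> X Y"
    using comp_add[of "\<zero> X Y" "\<zero> X Y" g] assms Y by simp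
  then show ?thesis
    using add_left_cancel[of "g \<cdot> \<zero> X Y" "\<zero> X (Cod C g)" "g \<cdot> \<zero> X Y"] assms Y by simp
qed

lemma zero_comp [simp]:
  assumes "f \<in> Arr C" "Y \<in> Obj C" "Cod C f = X"
  shows "\<zero> X Y \<cdot> f = \<zero> (Dom C f) Y"
proof -
  have X: "X \<in> Obj C" using assms by auto
  have "\<zero> X Y \<cdot> f \<oplus> \<zero> X Y \<cdot> f = \<zero> X Y \<cdot> f"
    using add_comp[of "\<zero> X Y" "\<zero> X Y" f] assms X by simp
  then show ?thesis
    using add_left_cancel[of "\<zero> X Y \<cdot> f" "\<zero> (Dom C f) Y" "\<zero> X Y \<cdot> f"] assms X by simp
qed

lemma neg_unique:
  assumes "f \<in> Arr C" "g \<in> Arr C" "Dom C f = Dom C g" "Cod C f = Cod C g"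
    "f \<oplus> g = \<zero> (Dom C g) (Cod C g)"
  shows "g = neg C f"
  using add_left_cancel[of g "neg C f" f] assms by simp

lemma comp_neg [simp]:
  assumes "f \<in> Arr C" "h \<in> Arr C" "Dom C h = Cod C f"
  shows "h \<cdot> neg C f = neg C (h \<cdot> f)"
  by (rule neg_unique) (use assms comp_add[of f "neg C f" h, symmetric] in simp_all)

lemma neg_comp [simp]:
  assumes "f \<in> Arr C" "h \<in> Arr C" "Dom C f = Cod C h"
  shows "neg C f \<cdot> h = neg C (f \<cdot> h)"
  by (rule neg_unique) (use assms add_comp[of f "neg C f" h, symmetric] in simp_all)

lemma neg_neg [simp]: "f \<in> Arr C \<Longrightarrow> neg C (neg C f) = f"
  using neg_unique[of "neg C f" f] by simp

lemma neg_zero [simp]: "\<lbrakk>X \<in> Obj C; Y \<in> Obj C\<rbrakk> \<Longrightarrow> neg C (\<zero> X Y) = \<zero> X Y"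
  using neg_unique[of "\<zero> X Y" "\<zero> X Y"] by simp

lemma is_kernel_D:
  assumes "is_kernel C i f"
  shows "i \<in> Hom C (Dom C i) (Dom C f)" "f \<in> Hom C (Dom C f) (Cod C f)"
    "f \<cdot> i = \<zero> (Dom C i) (Cod C f)"
  using assms by (simp_all add: is_kernel_def Hom_def)

lemma is_kernel_mono:
  assumes "is_kernel C i f" "x \<in> Hom C W (Dom C i)" "y \<in> Hom C W (Dom C i)" "i \<cdot> x = i \<cdot> y"
  shows "x = y"
proof -
  have "W \<in> Obj C" using Hom_Obj[OF assms(2)] by simp
  moreover have "i \<cdot> x \<in> Hom C W (Dom C f)" "f \<cdot> (i \<cdot> x) = \<zero> W (Cod C f)"
    using assms(1,2) by (auto simp: is_kernel_def Hom_def cx[of f i])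
  ultimately show ?thesis using assms unfolding is_kernel_def by metis
qed

lemma is_kernel_lift:
  assumes "is_kernel C i f" "g \<in> Hom C W (Dom C f)" "f \<cdot> g = \<zero> W (Cod C f)"
  shows "\<exists>h \<in> Hom C W (Dom C i). i \<cdot> h = g"
  using assms Hom_Obj[OF assms(2)] unfolding is_kernel_def by metis

lemma is_cokernel_D:
  assumes "is_cokernel C p f"
  shows "p \<in> Hom C (Cod C f) (Cod C p)" "f \<in> Hom C (Dom C f) (Cod C f)"
    "p \<cdot> f = \<zero> (Dom C f) (Cod C p)"
  using assms by (simp_all add: is_cokernel_def Hom_def)

lemma is_cokernel_epi:
  assumes "is_cokernel C p f" "x \<in> Hom C (Cod C p) W" "y \<in> Hom C (Cod C p) W" "x \<cdot> p = y \<cdot> p"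
  shows "x = y"
proof -
  have "W \<in> Obj C" using Hom_Obj[OF assms(2)] by simp
  moreover have "x \<cdot> p \<in> Hom C (Cod C f) W" "(x \<cdot> p) \<cdot> f = \<zero> (Dom C f) W"
    using assms(1,2) by (auto simp: is_cokernel_def Hom_def)
  ultimately show ?thesis using assms unfolding is_cokernel_def by metis
qed

lemma is_cokernel_colift:
  assumes "is_cokernel C p f" "g \<in> Hom C (Cod C f) W" "g \<cdot> f = \<zero> (Dom C f) W"
  shows "\<exists>h \<in> Hom C (Cod C p) W. h \<cdot> p = g"
  using assms Hom_Obj[OF assms(2)] unfolding is_cokernel_def by metis

lemma zero_object_Hom:
  assumes "zero_object C Z" "X \<in> Obj C"
  shows "f \<in> Hom C Z X \<longleftrightarrow> f = \<zero> Z X" "f \<in> Hom C X Z \<longleftrightarrow> f = \<zero> X Z"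
proof -
  have "\<zero> Z X \<in> Hom C Z X" "\<zero> X Z \<in> Hom C X Z"
    using assms by (simp_all add: zero_object_def Hom_def)
  then show "f \<in> Hom C Z X \<longleftrightarrow> f = \<zero> Z X" "f \<in> Hom C X Z \<longleftrightarrow> f = \<zero> X Z"
    using assms unfolding zero_object_def by metis+
qed

lemma zero_objectI:
  assumes "Z \<in> Obj C" "Ide C Z = \<zero> Z Z"
  shows "zero_object C Z"
  unfolding zero_object_def
proof (intro conjI ballI ex1I)
  fix X assume X: "X \<in> Obj C"
  show "\<zero> Z X \<in> Hom C Z X" "\<zero> X Z \<in> Hom C X Z" using X assms by (simp_all add: Hom_def)
  show "f = \<zero> Z X" if "f \<in> Hom C Z X" for f
    using that X assms(1) Comp_Ide[OF that] by (simp add: assms(2) Hom_def)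
  show "f = \<zero> X Z" if "f \<in> Hom C X Z" for f
    using that X assms(1) Ide_Comp[OF that] by (simp add: assms(2) Hom_def)
qed (rule assms(1))

end

section \<open>Conflations\<close>

text \<open>A conflation is a bare pair of arrows; carrying the three objects along lets consecutive
  conflations be matched by their common object.\<close>

definition ses :: "('o, 'm) excat \<Rightarrow> 'o \<Rightarrow> 'm \<Rightarrow> 'o \<Rightarrow> 'm \<Rightarrow> 'o \<Rightarrow> bool" where
  "ses C A i B p D \<longleftrightarrow> (i, p) \<in> Confl C \<and> i \<in> Hom C A B \<and> p \<in> Hom C B D"

context exact_category
begin

lemma Confl_ses: "(i, p) \<in> Confl C \<Longrightarrow> ses C (Dom C i) i (Cod C i) p (Cod C p)"
  using Confl_kernel_cokernel[of i p] is_kernel_D[of i p] is_cokernel_D[of p i]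
  by (simp add: ses_def kernel_cokernel_pair_def Hom_def)

lemma ses_kc:
  assumes "ses C A i B p D"
  shows "is_kernel C i p" "is_cokernel C p i"
  using assms Confl_kernel_cokernel[of i p] by (simp_all add: ses_def kernel_cokernel_pair_def)

lemma ses_Hom:
  assumes "ses C A i B p D"
  shows "i \<in> Hom C A B" "p \<in> Hom C B D"
  using assms by (simp_all add: ses_def)

lemma ses_Obj:
  assumes "ses C A i B p D"
  shows "A \<in> Obj C" "B \<in> Obj C" "D \<in> Obj C"
  using ses_Hom[OF assms] Hom_Obj by blast+

lemma ses_comp: "ses C A i B p D \<Longrightarrow> p \<cdot> i = \<zero> A D"
  using is_kernel_D(3)[OF ses_kc(1)] ses_Hom by (metis Hom_D(2,3))

lemma ses_mono:
  assumes "ses C A i B p D" "x \<in> Hom C W A" "y \<in> Hom C W A" "i \<cdot> x = i \<cdot> y"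
  shows "x = y"
  using is_kernel_mono[OF ses_kc(1)[OF assms(1)]] assms Hom_D(2)[OF ses_Hom(1)[OF assms(1)]] by metis

lemma ses_mono0:
  assumes "ses C A i B p D" "x \<in> Hom C W A" "i \<cdot> x = \<zero> W B"
  shows "x = \<zero> W A"
proof -
  have "W \<in> Obj C" "A \<in> Obj C" using Hom_Obj[OF assms(2)] by simp_all
  then show ?thesis
    using ses_Hom[OF assms(1)] by (intro ses_mono[OF assms(1,2)]) (simp_all add: Hom_def assms(3))
qed

lemma ses_lift:
  assumes "ses C A i B p D" "g \<in> Hom C W B" "p \<cdot> g = \<zero> W D"
  shows "\<exists>h \<in> Hom C W A. i \<cdot> h = g"
  using is_kernel_lift[OF ses_kc(1)[OF assms(1)], of g W] assms ses_Hom[OF assms(1)]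
  by (metis Hom_D(2,3))

lemma ses_epi:
  assumes "ses C A i B p D" "x \<in> Hom C D W" "y \<in> Hom C D W" "x \<cdot> p = y \<cdot> p"
  shows "x = y"
  using is_cokernel_epi[OF ses_kc(2)[OF assms(1)]] assms Hom_D(3)[OF ses_Hom(2)[OF assms(1)]] by metis

lemma ses_epi0:
  assumes "ses C A i B p D" "x \<in> Hom C D W" "x \<cdot> p = \<zero> B W"
  shows "x = \<zero> D W"
proof -
  have "W \<in> Obj C" "D \<in> Obj C" using Hom_Obj[OF assms(2)] by simp_all
  then show ?thesis
    using ses_Hom[OF assms(1)] by (intro ses_epi[OF assms(1,2)]) (simp_all add: Hom_def assms(3))
qed

lemma ses_colift:
  assumes "ses C A i B p D" "g \<in> Hom C B W" "g \<cdot> i = \<zero> A W"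
  shows "\<exists>h \<in> Hom C D W. h \<cdot> p = g"
  using is_cokernel_colift[OF ses_kc(2)[OF assms(1)], of g W] assms ses_Hom[OF assms(1)]
  by (metis Hom_D(2,3))

text \<open>The subtraction step of element chases: the difference of two arrows that agree after
  \<open>p\<close> comes from the kernel.\<close>

lemma ses_lift_sub:
  assumes "ses C A i B p D" "x \<in> Hom C W B" "y \<in> Hom C W B" "p \<cdot> x = p \<cdot> y"
  shows "\<exists>h \<in> Hom C W A. x = y \<oplus> i \<cdot> h"
proof -
  note i = ses_Hom[OF assms(1)] and O = ses_Obj[OF assms(1)] Hom_Obj[OF assms(2)]
  have "x \<ominus> y \<in> Hom C W B" "p \<cdot> (x \<ominus> y) = \<zero> W D"
    using assms i O by (simp_all add: Hom_def)
  then obtain h where "h \<in> Hom C W A" "i \<cdot> h = x \<ominus> y"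
    using ses_lift[OF assms(1)] by blast
  then show ?thesis
    using sub_eq_iff[of x y "i \<cdot> h"] assms(2,3) i by (auto simp: Hom_def)
qed

lemma ses_iso:
  assumes "ses C A i B p D" "i' \<in> Hom C A' B'" "p' \<in> Hom C B' D'"
    "is_iso C a" "is_iso C b" "is_iso C c"
    "a \<in> Hom C A A'" "b \<in> Hom C B B'" "c \<in> Hom C D D'" "b \<cdot> i = i' \<cdot> a" "c \<cdot> p = p' \<cdot> b"
  shows "ses C A' i' B' p' D'"
  using Confl_iso_closed[of i p i' p' a b c] assms ses_Hom[OF assms(1)]
  by (auto simp: ses_def Hom_def)

lemma inflation_ses: "inflation C i \<Longrightarrow> i \<in> Hom C A B \<Longrightarrow> \<exists>D p. ses C A i B p D"
  unfolding inflation_def using Confl_ses[of i] by (auto simp: Hom_def)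

lemma deflation_ses: "deflation C p \<Longrightarrow> p \<in> Hom C B D \<Longrightarrow> \<exists>A i. ses C A i B p D"
  unfolding deflation_def
proof -
  assume "\<exists>i. (i, p) \<in> Confl C" "p \<in> Hom C B D"
  then obtain i where "ses C (Dom C i) i (Cod C i) p (Cod C p)" using Confl_ses by blast
  then have "ses C (Dom C i) i B p D"
    using \<open>p \<in> Hom C B D\<close> ses_Hom[of "Dom C i" i "Cod C i" p "Cod C p"] by (auto simp: Hom_def)
  then show ?thesis by blast
qed

lemma ses_inflation: "ses C A i B p D \<Longrightarrow> inflation C i"
  and ses_deflation: "ses C A i B p D \<Longrightarrow> deflation C p"
  by (auto simp: ses_def inflation_def deflation_def)

lemma inflation_Arr: "inflation C i \<Longrightarrow> i \<in> Arr C"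
  and deflation_Arr: "deflation C p \<Longrightarrow> p \<in> Arr C"
  using Confl_ses by (auto simp: inflation_def deflation_def ses_def Hom_def)

text \<open>The axiom yields a deflation \<open>b'\<close> with an unspecified kernel \<alpha>. The
  universal property supplies the candidate \<open>a'\<close>, lying over \<open>a\<close> and over
  zero; comparing \<open>a'\<close> with \<alpha> in both directions gives mutually inverse
  morphisms, along which the conflation is transported to \<open>a'\<close>.\<close>

lemma ses_pullback:
  assumes "ses C A a B b D" "f \<in> Hom C D' D"
  shows "\<exists>B' a' b' f'. ses C A a' B' b' D' \<and> f' \<in> Hom C B' B \<and> f' \<cdot> a' = a \<and> b \<cdot> f' = f \<cdot> b'
    \<and> is_pullback C b f b' f'"
proof -
  note ab = ses_Hom[OF assms(1)]
  have D': "D' \<in> Obj C" using Hom_Obj[OF assms(2)] by simp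
  obtain b' f' where pb: "is_pullback C b f b' f'" and "deflation C b'"
    using pullback_deflation[OF ses_deflation[OF assms(1)], of f] assms(2) ab
    by (auto simp: Hom_def)
  define B' where "B' = Dom C b'"
  note pbH = is_pullback_Hom[OF pb ab(2) assms(2), folded B'_def]
  note b' = pbH(1) and f' = pbH(2) and sq = pbH(3)
  note lift = is_pullback_lift[OF pb ab(2) assms(2), folded B'_def]
    and eq = is_pullback_eq[OF pb ab(2) assms(2), folded B'_def]
  obtain A0 \<alpha> where \<alpha>: "ses C A0 \<alpha> B' b' D'"
    using deflation_ses[OF \<open>deflation C b'\<close> b'] by blast
  note \<alpha>b = ses_Hom[OF \<alpha>] and O = ses_Obj[OF \<alpha>] ses_Obj[OF assms(1)]
  have e: "b \<cdot> a = f \<cdot> \<zero> A D'" using ses_comp[OF assms(1)] assms(2) O by (simp add: Hom_def)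
  obtain a' where a': "a' \<in> Hom C A B'" "f' \<cdot> a' = a" "b' \<cdot> a' = \<zero> A D'"
    by (rule lift[OF ab(1) zero_Hom[OF O(4) D'] e])
  obtain \<delta> where \<delta>: "\<delta> \<in> Hom C A A0" "\<alpha> \<cdot> \<delta> = a'" using ses_lift[OF \<alpha> a'(1,3)] by blast
  have "b \<cdot> (f' \<cdot> \<alpha>) = \<zero> A0 D"
    using ab assms(2) f' \<alpha>b b' O by (simp add: Hom_def cx[OF sq] ses_comp[OF \<alpha>])
  then obtain \<gamma> where \<gamma>: "\<gamma> \<in> Hom C A0 A" "a \<cdot> \<gamma> = f' \<cdot> \<alpha>"
    using ses_lift[OF assms(1), of "f' \<cdot> \<alpha>" A0] f' \<alpha>b by (auto simp: Hom_def)
  have e: "a \<cdot> (\<gamma> \<cdot> \<delta>) = a \<cdot> Ide C A"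
    using ab \<gamma> \<delta> f' \<alpha>b a'(2) O by (simp add: Hom_def cx[OF \<gamma>(2)])
  have \<gamma>\<delta>: "\<gamma> \<cdot> \<delta> = Ide C A"
    by (rule ses_mono[OF assms(1) _ _ e]) (use \<gamma> \<delta> O in \<open>simp_all add: Hom_def\<close>)
  have "a' \<cdot> \<gamma> \<in> Hom C A0 B' \<and> f' \<cdot> (a' \<cdot> \<gamma>) = f' \<cdot> \<alpha> \<and> b' \<cdot> (a' \<cdot> \<gamma>) = b' \<cdot> \<alpha>"
    using a' \<gamma> \<alpha>b f' b' ab O D'
    by (simp add: Hom_def cx[OF a'(2)] cx[OF a'(3)] ses_comp[OF \<alpha>])
  then have "a' \<cdot> \<gamma> = \<alpha>" using eq \<alpha>b(1) by blast
  then have e: "\<alpha> \<cdot> (\<delta> \<cdot> \<gamma>) = \<alpha> \<cdot> Ide C A0"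
    using a' \<alpha>b \<gamma> \<delta>(1) O by (simp add: Hom_def cx[OF \<delta>(2)])
  have \<delta>\<gamma>: "\<delta> \<cdot> \<gamma> = Ide C A0"
    by (rule ses_mono[OF \<alpha> _ _ e]) (use \<gamma> \<delta> O in \<open>simp_all add: Hom_def\<close>)
  have "ses C A a' B' b' D'"
    by (rule ses_iso[OF \<alpha> a'(1) b' is_isoI[OF \<gamma>(1) \<delta>(1) \<delta>\<gamma> \<gamma>\<delta>]
        is_iso_Ide[OF O(2)] is_iso_Ide[OF O(3)] \<gamma>(1)])
      (use O \<alpha>b b' \<open>a' \<cdot> \<gamma> = \<alpha>\<close> in \<open>simp_all add: Hom_def\<close>)
  then show ?thesis using f' a'(2) sq pb by blast
qed

text \<open>Dual to \<open>ses_pullback\<close>: the unspecified cokernel \<beta> of the pushed-out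
  inflation is compared with the candidate \<open>b'\<close> that the universal property
  supplies.\<close>

lemma ses_pushout:
  assumes "ses C A a B b D" "f \<in> Hom C A A'"
  shows "\<exists>B' a' b' f'. ses C A' a' B' b' D \<and> f' \<in> Hom C B B' \<and> f' \<cdot> a = a' \<cdot> f \<and> b' \<cdot> f' = b
    \<and> is_pushout C a f a' f'"
proof -
  note ab = ses_Hom[OF assms(1)]
  have A': "A' \<in> Obj C" using Hom_Obj[OF assms(2)] by simp
  obtain a' f' where po: "is_pushout C a f a' f'" and "inflation C a'"
    using pushout_inflation[OF ses_inflation[OF assms(1)], of f] assms(2) ab
    by (auto simp: Hom_def)
  define B' where "B' = Cod C a'"
  note poH = is_pushout_Hom[OF po ab(1) assms(2), folded B'_def]
  note a' = poH(1) and f' = poH(2) and sq = poH(3)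
  note colift = is_pushout_colift[OF po ab(1) assms(2), folded B'_def]
    and eq = is_pushout_eq[OF po ab(1) assms(2), folded B'_def]
  obtain D0 \<beta> where \<beta>: "ses C A' a' B' \<beta> D0"
    using inflation_ses[OF \<open>inflation C a'\<close> a'] by blast
  note \<beta>a = ses_Hom[OF \<beta>] and O = ses_Obj[OF \<beta>] ses_Obj[OF assms(1)]
  have e: "b \<cdot> a = \<zero> A' D \<cdot> f" using ses_comp[OF assms(1)] assms(2) O by (simp add: Hom_def)
  obtain b' where b': "b' \<in> Hom C B' D" "b' \<cdot> f' = b" "b' \<cdot> a' = \<zero> A' D"
    by (rule colift[OF ab(2) zero_Hom[OF A' O(6)] e])
  obtain \<delta> where \<delta>: "\<delta> \<in> Hom C D0 D" "\<delta> \<cdot> \<beta> = b'" using ses_colift[OF \<beta> b'(1,3)] by blast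
  have "(\<beta> \<cdot> f') \<cdot> a = \<zero> A D0"
    using ab assms(2) f' \<beta>a a' O by (simp add: Hom_def sq cx[OF ses_comp[OF \<beta>]])
  then obtain \<gamma> where \<gamma>: "\<gamma> \<in> Hom C D D0" "\<gamma> \<cdot> b = \<beta> \<cdot> f'"
    using ses_colift[OF assms(1), of "\<beta> \<cdot> f'" D0] f' \<beta>a by (auto simp: Hom_def)
  have e: "(\<delta> \<cdot> \<gamma>) \<cdot> b = Ide C D \<cdot> b"
    using ab \<gamma> \<delta> f' \<beta>a b'(2) O by (simp add: Hom_def cx[OF \<delta>(2)])
  have \<delta>\<gamma>: "\<delta> \<cdot> \<gamma> = Ide C D"
    by (rule ses_epi[OF assms(1) _ _ e]) (use \<gamma> \<delta> O in \<open>simp_all add: Hom_def\<close>)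
  have "\<gamma> \<cdot> b' \<in> Hom C B' D0 \<and> (\<gamma> \<cdot> b') \<cdot> f' = \<beta> \<cdot> f' \<and> (\<gamma> \<cdot> b') \<cdot> a' = \<beta> \<cdot> a'"
    using b' \<gamma> \<beta>a f' a' O by (simp add: Hom_def ses_comp[OF \<beta>])
  then have "\<gamma> \<cdot> b' = \<beta>" using eq \<beta>a(2) by blast
  then have e: "(\<gamma> \<cdot> \<delta>) \<cdot> \<beta> = Ide C D0 \<cdot> \<beta>"
    using \<beta>a \<gamma> \<delta> O by (simp add: Hom_def)
  have \<gamma>\<delta>: "\<gamma> \<cdot> \<delta> = Ide C D0"
    by (rule ses_epi[OF \<beta> _ _ e]) (use \<gamma> \<delta> O in \<open>simp_all add: Hom_def\<close>)
  have "ses C A' a' B' b' D"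
    by (rule ses_iso[OF \<beta> a' b'(1) is_iso_Ide[OF O(1)] is_iso_Ide[OF O(2)]
        is_isoI[OF \<delta>(1) \<gamma>(1) \<gamma>\<delta> \<delta>\<gamma>] _ _ \<delta>(1)])
      (use O \<beta>a a' \<delta> b'(1) in \<open>simp_all add: Hom_def\<close>)
  then show ?thesis using f' b'(2) sq po by blast
qed

end

section \<open>The obscure axiom, zero objects and trivial conflations\<close>

context exact_category
begin

lemma zero_object_exists: obtains Z where "zero_object C Z" "Z \<in> Obj C"
  using ex_zero_object by (auto simp: zero_object_def)

text \<open>Buehler's obscure axiom: the comparison \<open>u\<close> from the pushout of
  \<open>ker (p \<cdot> q)\<close> to \<open>B\<close> is inverted by a morphism that is constructed on the
  pullback of \<open>p \<cdot> q\<close> along \<open>p\<close>.\<close>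

lemma ses_if_composite_deflation:
  assumes ker: "is_kernel C i p" and i: "i \<in> Hom C K B" and p: "p \<in> Hom C B D"
    and q: "q \<in> Hom C W B" and defl: "deflation C (p \<cdot> q)"
  shows "ses C K i B p D"
proof -
  define d where "d = p \<cdot> q"
  have d: "d \<in> Hom C W D" using p q by (simp add: d_def Hom_def)
  have pi: "p \<cdot> i = \<zero> K D" using is_kernel_D(3)[OF ker] i p by (simp add: Hom_def)
  have O: "K \<in> Obj C" "B \<in> Obj C" "D \<in> Obj C" "W \<in> Obj C"
    using Hom_Obj[OF i] Hom_Obj[OF p] Hom_Obj[OF q] by simp_all
  have i_mono: "x = y" if "x \<in> Hom C V K" "y \<in> Hom C V K" "i \<cdot> x = i \<cdot> y" for x y V
    using is_kernel_mono[OF ker, of x V y] that i by (simp add: Hom_def)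
  have i_lift: "\<exists>h \<in> Hom C V K. i \<cdot> h = g" if "g \<in> Hom C V B" "p \<cdot> g = \<zero> V D" for g V
    using is_kernel_lift[OF ker, of g V] that i p by (simp add: Hom_def)
  obtain N n where n: "ses C N n W d D"
    using deflation_ses[OF defl[folded d_def] d] by blast
  note nH = ses_Hom[OF n] and ON = ses_Obj(1)[OF n]
  have qn: "q \<cdot> n \<in> Hom C N B" "p \<cdot> (q \<cdot> n) = \<zero> N D"
    using q p nH ses_comp[OF n] by (simp_all add: d_def Hom_def)
  then obtain \<kappa> where \<kappa>: "\<kappa> \<in> Hom C N K" "i \<cdot> \<kappa> = q \<cdot> n" using i_lift by blast
  obtain B' i' p' q' where B': "ses C K i' B' p' D" and q': "q' \<in> Hom C W B'"
    and sq: "q' \<cdot> n = i' \<cdot> \<kappa>" and pq: "p' \<cdot> q' = d" and po: "is_pushout C n \<kappa> i' q'"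
    using ses_pushout[OF n \<kappa>(1)] by blast
  note i'H = ses_Hom[OF B'] and OB' = ses_Obj(2)[OF B']
  have Cod_i': "Cod C i' = B'" using i'H by (simp add: Hom_def)
  note po_eq = is_pushout_eq[OF po nH(1) \<kappa>(1), unfolded Cod_i']
  obtain u where u: "u \<in> Hom C B' B" "u \<cdot> q' = q" "u \<cdot> i' = i"
    by (rule is_pushout_colift[OF po nH(1) \<kappa>(1) q i \<kappa>(2)[symmetric], unfolded Cod_i'])
  have pu: "p \<cdot> u = p'"
    by (rule po_eq[of _ D])
      (use u p i'H q' O in \<open>simp_all add: Hom_def pi ses_comp[OF B'] pq d_def\<close>)
  obtain T n2 \<pi>2 \<pi>1 where T: "ses C N n2 T \<pi>2 B" and \<pi>1: "\<pi>1 \<in> Hom C T W"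
    and \<pi>n: "\<pi>1 \<cdot> n2 = n" and \<pi>sq: "d \<cdot> \<pi>1 = p \<cdot> \<pi>2" and pb: "is_pullback C d p \<pi>2 \<pi>1"
    using ses_pullback[OF n p] by blast
  note TH = ses_Hom[OF T] and OT = ses_Obj(2)[OF T]
  have DT: "Dom C \<pi>2 = T" using TH by (simp add: Hom_def)
  note pb_lift = is_pullback_lift[OF pb d p, unfolded DT]
  have "\<pi>2 \<ominus> q \<cdot> \<pi>1 \<in> Hom C T B" "p \<cdot> (\<pi>2 \<ominus> q \<cdot> \<pi>1) = \<zero> T D"
    using TH \<pi>1 q p O OT \<pi>sq by (simp_all add: Hom_def d_def)
  then obtain \<tau> where \<tau>: "\<tau> \<in> Hom C T K" "i \<cdot> \<tau> = \<pi>2 \<ominus> q \<cdot> \<pi>1" using i_lift by blast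
  \<comment> \<open>On the pullback \<open>T\<close> of pairs of \<open>w\<close> in
    \<open>W\<close> and \<open>b\<close> in \<open>B\<close> with the same image,
    \<open>b = q w + i \<tau>\<close>. An inverse of \<open>u\<close> must carry \<open>q\<close> to
    \<open>q'\<close> and \<open>i\<close> to \<open>i'\<close>, which dictates this formula. It
    descends along \<open>\<pi>2\<close> because it vanishes on the kernel
    \<open>n2\<close>.\<close>
  define v0 where "v0 = q' \<cdot> \<pi>1 \<oplus> i' \<cdot> \<tau>"
  have v0: "v0 \<in> Hom C T B'" using q' \<pi>1 i'H \<tau> by (simp add: v0_def Hom_def)
  have e: "i \<cdot> (\<tau> \<cdot> n2) = i \<cdot> neg C \<kappa>"
    using i \<tau> TH q \<pi>1 \<kappa> nH O ON by (simp add: Hom_def cx[OF \<tau>(2)] ses_comp[OF T] \<pi>n)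
  have \<tau>n: "\<tau> \<cdot> n2 = neg C \<kappa>"
    by (rule i_mono[OF _ _ e]) (use \<tau> TH \<kappa> in \<open>simp_all add: Hom_def\<close>)
  have "v0 \<cdot> n2 = \<zero> N B'"
    using q' \<pi>1 i'H \<tau> TH \<kappa> nH ON by (simp add: Hom_def v0_def \<pi>n \<tau>n sq)
  then obtain v where v: "v \<in> Hom C B B'" "v \<cdot> \<pi>2 = v0" using ses_colift[OF T v0] by blast
  have e: "(u \<cdot> v) \<cdot> \<pi>2 = Ide C B \<cdot> \<pi>2"
    using u v TH q' \<pi>1 i'H \<tau>(1) i q O OT sub_eq_iff[of \<pi>2 "q \<cdot> \<pi>1" "i \<cdot> \<tau>"] \<tau>(2)
    by (simp add: Hom_def v0_def cx[OF u(2)] cx[OF u(3)])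
  have uv: "u \<cdot> v = Ide C B"
    by (rule ses_epi[OF T _ _ e]) (use u v O in \<open>simp_all add: Hom_def\<close>)
  \<comment> \<open>The elements \<open>(1, q)\<close> and \<open>(0, i)\<close> of the pullback, on
    which \<tau> is \<open>0\<close> and \<open>1\<close> respectively, serve to evaluate
    \<open>v\<close> at \<open>q\<close> and at \<open>i\<close>.\<close>
  have e: "d \<cdot> Ide C W = p \<cdot> q" using d O by (simp add: d_def Hom_def)
  obtain s where s: "s \<in> Hom C W T" "\<pi>1 \<cdot> s = Ide C W" "\<pi>2 \<cdot> s = q"
    by (rule pb_lift[OF Ide_Hom[OF O(4)] q e])
  have e: "i \<cdot> (\<tau> \<cdot> s) = i \<cdot> \<zero> W K"
    using i \<tau> TH q \<pi>1 s O by (simp add: Hom_def cx[OF \<tau>(2)])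
  have \<tau>s: "\<tau> \<cdot> s = \<zero> W K"
    by (rule i_mono[OF _ _ e]) (use \<tau> s O in \<open>simp_all add: Hom_def\<close>)
  have "v \<cdot> (\<pi>2 \<cdot> s) = q'"
    using v TH s(1,2) q' \<pi>1 i'H \<tau> O by (simp add: Hom_def cx[OF v(2)] v0_def \<tau>s)
  then have vq: "v \<cdot> q = q'" using s by simp
  have e: "d \<cdot> \<zero> K W = p \<cdot> i" using d O by (simp add: pi Hom_def)
  obtain s2 where s2: "s2 \<in> Hom C K T" "\<pi>1 \<cdot> s2 = \<zero> K W" "\<pi>2 \<cdot> s2 = i"
    by (rule pb_lift[OF zero_Hom[OF O(1) O(4)] i e])
  have e: "i \<cdot> (\<tau> \<cdot> s2) = i \<cdot> Ide C K"
    using i \<tau> TH q \<pi>1 s2 O by (simp add: Hom_def cx[OF \<tau>(2)])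
  have \<tau>s2: "\<tau> \<cdot> s2 = Ide C K"
    by (rule i_mono[OF _ _ e]) (use \<tau> s2 O in \<open>simp_all add: Hom_def\<close>)
  have "v \<cdot> (\<pi>2 \<cdot> s2) = i'"
    using v TH s2(1,2) q' \<pi>1 i'H \<tau> O OB' by (simp add: Hom_def cx[OF v(2)] v0_def \<tau>s2)
  then have vi: "v \<cdot> i = i'" using s2 by simp
  have vu: "v \<cdot> u = Ide C B'"
    by (rule po_eq[of _ B']) (use u v q' i'H OB' vi vq in \<open>simp_all add: Hom_def\<close>)
  show ?thesis
    by (rule ses_iso[OF B' i p is_iso_Ide[OF O(1)] is_isoI[OF u(1) v(1) vu uv] is_iso_Ide[OF O(3)]])
      (use O u i p pu i'H in \<open>simp_all add: Hom_def\<close>)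
qed

lemma zero_object_iso:
  assumes "zero_object C Z" "zero_object C Z'"
  shows "is_iso C (\<zero> Z Z')"
proof -
  have O: "Z \<in> Obj C" "Z' \<in> Obj C" using assms by (simp_all add: zero_object_def)
  have "Ide C Z = \<zero> Z Z" "Ide C Z' = \<zero> Z' Z'"
    using zero_object_Hom(1)[OF assms(1) O(1)] zero_object_Hom(1)[OF assms(2) O(2)] Ide_Hom O by blast+
  then show ?thesis using O by (intro is_isoI[of _ Z Z' "\<zero> Z' Z"]) (simp_all add: Hom_def)
qed

text \<open>The axioms make the identity a deflation with an unspecified kernel; that kernel is a
  zero object, and zero objects are isomorphic.\<close>

lemma ses_zero_Ide:
  assumes Z: "zero_object C Z" and X: "X \<in> Obj C"
  shows "ses C Z (\<zero> Z X) X (Ide C X) X"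
proof -
  obtain A i where i: "ses C A i X (Ide C X) X"
    using deflation_ses[OF Ide_deflation[OF X] Ide_Hom[OF X]] by blast
  note iH = ses_Hom[OF i] and O = ses_Obj[OF i]
  have OZ: "Z \<in> Obj C" using Z by (simp add: zero_object_def)
  have i0: "i = \<zero> A X" using ses_comp[OF i] iH by (simp add: Hom_def)
  have "Ide C A = \<zero> A A"
    by (rule ses_mono0[OF i Ide_Hom]) (use O iH i0 in \<open>simp_all add: Hom_def\<close>)
  then have Z': "zero_object C A" using O by (intro zero_objectI)
  show ?thesis
    by (rule ses_iso[OF i _ _ zero_object_iso[OF Z' Z] is_iso_Ide[OF X] is_iso_Ide[OF X]])
      (use O OZ i0 in \<open>simp_all add: Hom_def\<close>)
qed

lemma ses_Ide_zero:
  assumes Z: "zero_object C Z" and X: "X \<in> Obj C"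
  shows "ses C X (Ide C X) X (\<zero> X Z) Z"
proof -
  obtain D p where p: "ses C X (Ide C X) X p D"
    using inflation_ses[OF Ide_inflation[OF X] Ide_Hom[OF X]] by blast
  note pH = ses_Hom[OF p] and O = ses_Obj[OF p]
  have OZ: "Z \<in> Obj C" using Z by (simp add: zero_object_def)
  have p0: "p = \<zero> X D" using ses_comp[OF p] pH by (simp add: Hom_def)
  have "Ide C D = \<zero> D D"
    by (rule ses_epi0[OF p Ide_Hom]) (use O pH p0 in \<open>simp_all add: Hom_def\<close>)
  then have Z': "zero_object C D" using O by (intro zero_objectI)
  show ?thesis
    by (rule ses_iso[OF p _ _ is_iso_Ide[OF X] is_iso_Ide[OF X] zero_object_iso[OF Z' Z]])
      (use O OZ p0 in \<open>simp_all add: Hom_def\<close>)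
qed

lemma ses_zero_left:
  assumes "ses C A i B p D" "i = \<zero> A B"
  shows "is_iso C p"
proof -
  note H = ses_Hom[OF assms(1)] and O = ses_Obj[OF assms(1)]
  have "Ide C B \<cdot> i = \<zero> A B" using assms O by (simp add: Hom_def)
  then obtain h where h: "h \<in> Hom C D B" "h \<cdot> p = Ide C B"
    using ses_colift[OF assms(1) Ide_Hom[OF O(2)]] by blast
  have e: "(p \<cdot> h) \<cdot> p = Ide C D \<cdot> p" using H h O by (simp add: Hom_def)
  have "p \<cdot> h = Ide C D"
    by (rule ses_epi[OF assms(1) _ _ e]) (use H h O in \<open>simp_all add: Hom_def\<close>)
  then show ?thesis using is_isoI[OF H(2) h(1) h(2)] by simp
qed

lemma ses_zero_right:
  assumes "ses C A i B p D" "p = \<zero> B D"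
  shows "is_iso C i"
proof -
  note H = ses_Hom[OF assms(1)] and O = ses_Obj[OF assms(1)]
  have "p \<cdot> Ide C B = \<zero> B D" using assms O by (simp add: Hom_def)
  then obtain h where h: "h \<in> Hom C B A" "i \<cdot> h = Ide C B"
    using ses_lift[OF assms(1) Ide_Hom[OF O(2)]] by blast
  have e: "i \<cdot> (h \<cdot> i) = i \<cdot> Ide C A" using H h O by (simp add: Hom_def cx[OF h(2)])
  have "h \<cdot> i = Ide C A"
    by (rule ses_mono[OF assms(1) _ _ e]) (use H h O in \<open>simp_all add: Hom_def\<close>)
  then show ?thesis using is_isoI[OF H(1) h(1)] h(2) by simp
qed

section \<open>Admissible morphisms as pairs of conflations\<close>

lemma is_image_ses:
  assumes "is_image C m f" "f \<in> Hom C X Y"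
  shows "\<exists>K k p c F. ses C K k X p (Dom C m) \<and> ses C (Dom C m) m Y c F \<and> f = m \<cdot> p"
proof -
  obtain p where mp: "inflation C m" "deflation C p" "Cod C p = Dom C m" "f = m \<cdot> p"
    using assms by (auto simp: is_image_def)
  have "p \<in> Hom C X (Dom C m)" "m \<in> Hom C (Dom C m) Y"
    using inflation_Arr[OF mp(1)] deflation_Arr[OF mp(2)] mp assms(2) by (simp_all add: Hom_def)
  then show ?thesis
    using inflation_ses[OF mp(1)] deflation_ses[OF mp(2)] mp(4) by blast
qed

lemma admissible_ses:
  assumes "admissible_arr C f" "f \<in> Hom C X Y"
  shows "\<exists>K k I p m c F. ses C K k X p I \<and> ses C I m Y c F \<and> f = m \<cdot> p"
  using is_image_ses[OF _ assms(2)] assms(1) unfolding admissible_arr_def by blast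

lemma ses_is_image:
  assumes "ses C K k X p I" "ses C I m Y c F"
  shows "is_image C m (m \<cdot> p)"
  using assms ses_inflation[OF assms(2)] ses_deflation[OF assms(1)]
  unfolding is_image_def by (auto simp: ses_def Hom_def)

lemma ses_admissible:
  assumes "ses C K k X p I" "ses C I m Y c F"
  shows "admissible_arr C (m \<cdot> p)"
  using ses_is_image[OF assms] unfolding admissible_arr_def by blast

section \<open>Projective and injective objects\<close>

lemma projective_lift:
  assumes "projective C P" "ses C A i B p D" "z \<in> Hom C P D"
  shows "\<exists>y \<in> Hom C P B. p \<cdot> y = z"
  using assms ses_deflation[OF assms(2)] ses_Hom[OF assms(2)]
  unfolding projective_def by (auto simp: Hom_D)

lemma injective_extend:
  assumes "injective C I" "ses C A i B p D" "z \<in> Hom C A I"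
  shows "\<exists>y \<in> Hom C B I. y \<cdot> i = z"
  using assms ses_inflation[OF assms(2)] ses_Hom[OF assms(2)]
  unfolding injective_def by (auto simp: Hom_D)

lemma projectiveI:
  assumes "P \<in> Obj C"
    "\<And>A i B p D z. \<lbrakk>ses C A i B p D; z \<in> Hom C P D\<rbrakk> \<Longrightarrow> \<exists>y \<in> Hom C P B. p \<cdot> y = z"
  shows "projective C P"
  unfolding projective_def
proof (intro conjI allI impI ballI)
  fix p f assume p: "deflation C p" "f \<in> Hom C P (Cod C p)"
  then have "p \<in> Hom C (Dom C p) (Cod C p)" using deflation_Arr by (simp add: Hom_def)
  then show "\<exists>g \<in> Hom C P (Dom C p). p \<cdot> g = f"
    using deflation_ses[OF p(1)] assms(2)[OF _ p(2)] by blast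
qed (rule assms(1))

lemma injectiveI:
  assumes "I \<in> Obj C"
    "\<And>A i B p D z. \<lbrakk>ses C A i B p D; z \<in> Hom C A I\<rbrakk> \<Longrightarrow> \<exists>y \<in> Hom C B I. y \<cdot> i = z"
  shows "injective C I"
  unfolding injective_def
proof (intro conjI allI impI ballI)
  fix i f assume i: "inflation C i" "f \<in> Hom C (Dom C i) I"
  then have "i \<in> Hom C (Dom C i) (Cod C i)" using inflation_Arr by (simp add: Hom_def)
  then show "\<exists>g \<in> Hom C (Cod C i) I. g \<cdot> i = f"
    using inflation_ses[OF i(1)] assms(2)[OF _ i(2)] by blast
qed (rule assms(1))

text \<open>Extending \<open>z\<close> along \<open>i\<close> amounts to splitting the pushout of
  \<open>i\<close> along \<open>z\<close>, which is an inflation out of \<open>I\<close>.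
  Injectivity is thereby reduced to the vanishing of extensions by \<open>I\<close>.\<close>

lemma injective_if_retracts:
  assumes "I \<in> Obj C"
    "\<And>a B b D. ses C I a B b D \<Longrightarrow> \<exists>\<rho> \<in> Hom C B I. \<rho> \<cdot> a = Ide C I"
  shows "injective C I"
proof (rule injectiveI[OF assms(1)])
  fix A i B p D z assume i: "ses C A i B p D" and z: "z \<in> Hom C A I"
  obtain B' a' b' f' where a': "ses C I a' B' b' D" and f': "f' \<in> Hom C B B'" "f' \<cdot> i = a' \<cdot> z"
    using ses_pushout[OF i z] by blast
  obtain \<rho> where \<rho>: "\<rho> \<in> Hom C B' I" "\<rho> \<cdot> a' = Ide C I" using assms(2)[OF a'] by blast
  have "\<rho> \<cdot> f' \<in> Hom C B I" "(\<rho> \<cdot> f') \<cdot> i = z"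
    using \<rho> f' ses_Hom[OF i] ses_Hom[OF a'] z by (simp_all add: Hom_def cx[OF \<rho>(2)])
  then show "\<exists>y \<in> Hom C B I. y \<cdot> i = z" by blast
qed

lemma zero_object_projective: "zero_object C Z \<Longrightarrow> projective C Z"
proof (rule projectiveI)
  assume Z: "zero_object C Z"
  then show OZ: "Z \<in> Obj C" by (simp add: zero_object_def)
  fix A i B p D z assume p: "ses C A i B p D" "z \<in> Hom C Z D"
  have "z = \<zero> Z D" using zero_object_Hom(1)[OF Z ses_Obj(3)[OF p(1)]] p(2) by blast
  then show "\<exists>y \<in> Hom C Z B. p \<cdot> y = z"
    using zero_Hom[OF OZ ses_Obj(2)[OF p(1)]] OZ ses_Hom[OF p(1)]
    by (intro bexI[of _ "\<zero> Z B"]) (simp_all add: Hom_def)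
qed

lemma biproductE:
  assumes "X \<in> Obj C" "Y \<in> Obj C"
  obtains S i1 i2 p1 p2 where "is_biproduct C X Y S i1 i2 p1 p2"
    "i1 \<in> Hom C X S" "i2 \<in> Hom C Y S" "p1 \<in> Hom C S X" "p2 \<in> Hom C S Y"
    "p1 \<cdot> i1 = Ide C X" "p2 \<cdot> i2 = Ide C Y" "p1 \<cdot> i2 = \<zero> Y X" "p2 \<cdot> i1 = \<zero> X Y"
    "i1 \<cdot> p1 \<oplus> i2 \<cdot> p2 = Ide C S"
  using ex_biproduct[OF assms] unfolding is_biproduct_def by blast

lemma biproduct_projective:
  assumes "projective C X" "projective C Y" "is_biproduct C X Y S i1 i2 p1 p2"
  shows "projective C S"
proof -
  have H: "i1 \<in> Hom C X S" "i2 \<in> Hom C Y S" "p1 \<in> Hom C S X" "p2 \<in> Hom C S Y"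
    and 1: "i1 \<cdot> p1 \<oplus> i2 \<cdot> p2 = Ide C S"
    using assms(3) by (auto simp: is_biproduct_def)
  show ?thesis
  proof (rule projectiveI)
    show "S \<in> Obj C" using Hom_Obj[OF H(1)] by simp
    fix A i B p D z assume p: "ses C A i B p D" and z: "z \<in> Hom C S D"
    have zi: "z \<cdot> i1 \<in> Hom C X D" "z \<cdot> i2 \<in> Hom C Y D" using z H by (simp_all add: Hom_def)
    obtain y1 y2 where y: "y1 \<in> Hom C X B" "p \<cdot> y1 = z \<cdot> i1" "y2 \<in> Hom C Y B" "p \<cdot> y2 = z \<cdot> i2"
      using projective_lift[OF assms(1) p zi(1)] projective_lift[OF assms(2) p zi(2)] by blast
    have "p \<cdot> (y1 \<cdot> p1 \<oplus> y2 \<cdot> p2) = z \<cdot> (i1 \<cdot> p1 \<oplus> i2 \<cdot> p2)"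
      using y ses_Hom[OF p] H z by (simp add: Hom_def cx[OF y(2)] cx[OF y(4)])
    also have "\<dots> = z" using z by (simp add: 1 Hom_def)
    finally show "\<exists>y \<in> Hom C S B. p \<cdot> y = z"
      using y H by (intro bexI[of _ "y1 \<cdot> p1 \<oplus> y2 \<cdot> p2"]) (simp_all add: Hom_def)
  qed
qed

lemma biproduct_injective:
  assumes "injective C X" "injective C Y" "is_biproduct C X Y S i1 i2 p1 p2"
  shows "injective C S"
proof -
  have H: "i1 \<in> Hom C X S" "i2 \<in> Hom C Y S" "p1 \<in> Hom C S X" "p2 \<in> Hom C S Y"
    and 1: "i1 \<cdot> p1 \<oplus> i2 \<cdot> p2 = Ide C S"
    using assms(3) by (auto simp: is_biproduct_def)
  show ?thesis
  proof (rule injectiveI)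
    show "S \<in> Obj C" using Hom_Obj[OF H(1)] by simp
    fix A i B p D z assume p: "ses C A i B p D" and z: "z \<in> Hom C A S"
    have zi: "p1 \<cdot> z \<in> Hom C A X" "p2 \<cdot> z \<in> Hom C A Y" using z H by (simp_all add: Hom_def)
    obtain y1 y2 where y: "y1 \<in> Hom C B X" "y1 \<cdot> i = p1 \<cdot> z" "y2 \<in> Hom C B Y" "y2 \<cdot> i = p2 \<cdot> z"
      using injective_extend[OF assms(1) p zi(1)] injective_extend[OF assms(2) p zi(2)] by blast
    have "(i1 \<cdot> y1 \<oplus> i2 \<cdot> y2) \<cdot> i = (i1 \<cdot> p1 \<oplus> i2 \<cdot> p2) \<cdot> z"
      using y ses_Hom[OF p] H z by (simp add: Hom_def)
    also have "\<dots> = z" using z by (simp add: 1 Hom_def)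
    finally show "\<exists>y \<in> Hom C B S. y \<cdot> i = z"
      using y H by (intro bexI[of _ "i1 \<cdot> y1 \<oplus> i2 \<cdot> y2"]) (simp_all add: Hom_def)
  qed
qed

end

section \<open>Testing conflations on projective objects\<close>

text \<open>Since \<open>1 - a \<rho>\<close> kills \<open>a\<close>, it factors through the
  cokernel \<open>b\<close>; the factor is the section.\<close>

lemma (in exact_category) ses_retraction_section:
  assumes a: "ses C A a B b D" and \<rho>: "\<rho> \<in> Hom C B A" "\<rho> \<cdot> a = Ide C A"
  shows "\<exists>\<sigma> \<in> Hom C D B. b \<cdot> \<sigma> = Ide C D \<and> a \<cdot> \<rho> \<oplus> \<sigma> \<cdot> b = Ide C B"
proof -
  note aH = ses_Hom[OF a] and O = ses_Obj[OF a]
  have "Ide C B \<ominus> a \<cdot> \<rho> \<in> Hom C B B" "(Ide C B \<ominus> a \<cdot> \<rho>) \<cdot> a = \<zero> A B"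
    using aH \<rho> O by (simp_all add: Hom_def)
  then obtain \<sigma> where \<sigma>: "\<sigma> \<in> Hom C D B" "\<sigma> \<cdot> b = Ide C B \<ominus> a \<cdot> \<rho>"
    using ses_colift[OF a] by blast
  have 1: "a \<cdot> \<rho> \<oplus> \<sigma> \<cdot> b = Ide C B"
    using sub_eq_iff[of "Ide C B" "a \<cdot> \<rho>" "\<sigma> \<cdot> b"] \<sigma> aH \<rho>(1) O by (simp add: Hom_def)
  have e: "(b \<cdot> \<sigma>) \<cdot> b = Ide C D \<cdot> b"
    using aH \<sigma> \<rho>(1) O by (simp add: Hom_def cx[OF ses_comp[OF a]])
  have "b \<cdot> \<sigma> = Ide C D"
    by (rule ses_epi[OF a _ _ e]) (use aH \<sigma> O in \<open>simp_all add: Hom_def\<close>)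
  then show ?thesis using \<sigma>(1) 1 by blast
qed

text \<open>Morphisms from objects of \<open>G\<close> play the role of elements. The two instances
  are \<open>Proj C\<close> and the objects that correspond to representable functors under an
  equivalence.\<close>

locale exact_category_gen = exact_category +
  fixes G :: "'a set"
  assumes G_projective: "P \<in> G \<Longrightarrow> projective C P"
    and G_cover: "X \<in> Obj C \<Longrightarrow> \<exists>P \<in> G. \<exists>N n r. ses C N n P r X"
begin

lemma G_lift: "\<lbrakk>P \<in> G; ses C A i B p D; z \<in> Hom C P D\<rbrakk> \<Longrightarrow> \<exists>y \<in> Hom C P B. p \<cdot> y = z"
  using projective_lift[OF G_projective] .

lemma G_zero:
  assumes f: "f \<in> Hom C X Y" and 0: "\<And>P x. \<lbrakk>P \<in> G; x \<in> Hom C P X\<rbrakk> \<Longrightarrow> f \<cdot> x = \<zero> P Y"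
  shows "f = \<zero> X Y"
proof -
  obtain P N n r where P: "P \<in> G" "ses C N n P r X" using G_cover Hom_Obj[OF f] by blast
  show ?thesis using ses_epi0[OF P(2) f] 0[OF P(1)] ses_Hom[OF P(2)] by blast
qed

text \<open>A morphism \<open>g\<close> killed by \<open>b\<close> is lifted on a cover of its
  source; by \<open>mono\<close> the lift kills the kernel of the cover and so descends, which makes
  \<open>a\<close> a kernel of \<open>b\<close>. The cover \<open>r\<close> of \<open>D\<close>
  lifts through \<open>b\<close>, so \<open>b\<close> is the left factor of a deflation, and a
  morphism with a kernel and this property is a deflation by
  \<open>ses_if_composite_deflation\<close>.\<close>

lemma G_ses:
  assumes a: "a \<in> Hom C A B" and b: "b \<in> Hom C B D" and ba: "b \<cdot> a = \<zero> A D"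
    and mono: "\<And>P x. \<lbrakk>P \<in> G; x \<in> Hom C P A; a \<cdot> x = \<zero> P B\<rbrakk> \<Longrightarrow> x = \<zero> P A"
    and exact: "\<And>P y. \<lbrakk>P \<in> G; y \<in> Hom C P B; b \<cdot> y = \<zero> P D\<rbrakk> \<Longrightarrow> \<exists>x \<in> Hom C P A. a \<cdot> x = y"
    and surj: "\<And>P z. \<lbrakk>P \<in> G; z \<in> Hom C P D\<rbrakk> \<Longrightarrow> \<exists>y \<in> Hom C P B. b \<cdot> y = z"
  shows "ses C A a B b D"
proof -
  have O: "A \<in> Obj C" "B \<in> Obj C" "D \<in> Obj C" using Hom_Obj[OF a] Hom_Obj[OF b] by simp_all
  have zero: "h = \<zero> W A" if h: "h \<in> Hom C W A" "a \<cdot> h = \<zero> W B" for h W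
  proof (rule G_zero[OF h(1)])
    fix P x assume P: "P \<in> G" and x: "x \<in> Hom C P W"
    show "h \<cdot> x = \<zero> P A"
      by (rule mono[OF P]) (use h x a O in \<open>simp_all add: Hom_def cx[OF h(2)]\<close>)
  qed
  have ex: "\<exists>h. h \<in> Hom C W A \<and> a \<cdot> h = g" if g: "g \<in> Hom C W B" "b \<cdot> g = \<zero> W D" for g W
  proof -
    have OW: "W \<in> Obj C" using Hom_Obj[OF g(1)] by simp
    obtain Q N n r where Q: "Q \<in> G" "ses C N n Q r W" using G_cover[OF OW] by blast
    note rH = ses_Hom[OF Q(2)] and OQ = ses_Obj[OF Q(2)]
    have "g \<cdot> r \<in> Hom C Q B" "b \<cdot> (g \<cdot> r) = \<zero> Q D"
      using g b rH O by (simp_all add: Hom_def cx[OF g(2)])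
    then obtain x where x: "x \<in> Hom C Q A" "a \<cdot> x = g \<cdot> r" using exact[OF Q(1)] by blast
    have "x \<cdot> n \<in> Hom C N A" "a \<cdot> (x \<cdot> n) = \<zero> N B"
      using a x rH g OQ by (simp_all add: Hom_def cx[OF x(2)] ses_comp[OF Q(2)])
    then have "x \<cdot> n = \<zero> N A" using zero by blast
    then obtain h where h: "h \<in> Hom C W A" "h \<cdot> r = x" using ses_colift[OF Q(2) x(1)] by blast
    have e: "(a \<cdot> h) \<cdot> r = g \<cdot> r" using a h rH x(2) by (simp add: Hom_def)
    have "a \<cdot> h = g" by (rule ses_epi[OF Q(2) _ _ e]) (use a h g in \<open>simp_all add: Hom_def\<close>)
    with h show ?thesis by blast
  qed
  have un: "h = h'" if "h \<in> Hom C W A" "h' \<in> Hom C W A" "a \<cdot> h = a \<cdot> h'" for h h' W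
  proof -
    have "h \<ominus> h' = \<zero> W A"
      by (rule zero) (use that a O in \<open>auto simp: Hom_def\<close>)
    then show ?thesis using that sub_eq_zero_iff[of h h' W A] by (simp add: Hom_def)
  qed
  have "is_kernel C a b"
    unfolding is_kernel_def
  proof (intro conjI ballI impI)
    fix W g assume "W \<in> Obj C" "g \<in> Hom C W (Dom C b)" "b \<cdot> g = \<zero> W (Cod C b)"
    then have g: "g \<in> Hom C W B" "b \<cdot> g = \<zero> W D" using b by (simp_all add: Hom_def)
    have "Dom C a = A" using a by (simp add: Hom_def)
    then show "\<exists>!h. h \<in> Hom C W (Dom C a) \<and> a \<cdot> h = g" using ex[OF g] un by metis
  qed (use a b ba in \<open>simp_all add: Hom_def\<close>)
  moreover obtain Q N n r where Q: "Q \<in> G" "ses C N n Q r D" using G_cover[OF O(3)] by blast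
  moreover obtain q where q: "q \<in> Hom C Q B" "b \<cdot> q = r"
    using surj[OF Q(1) ses_Hom(2)[OF Q(2)]] by blast
  ultimately show ?thesis
    using ses_if_composite_deflation[OF _ a b q(1)] ses_deflation[OF Q(2)] by blast
qed

text \<open>The third isomorphism theorem: with \<open>D = B/A\<close>, \<open>X = E/A\<close> and
  \<open>F = E/B\<close>, the subobject \<open>B/A\<close> of \<open>E/A\<close> has quotient
  \<open>E/B\<close>.\<close>

lemma ses_composite_inflations:
  assumes i: "ses C A i B p D" and j: "ses C B j E q F"
  shows "\<exists>X r u v. ses C A (j \<cdot> i) E r X \<and> ses C D u X v F \<and> u \<cdot> p = r \<cdot> j \<and> v \<cdot> r = q"
proof -
  note iH = ses_Hom[OF i] and jH = ses_Hom[OF j] and O = ses_Obj[OF i] ses_Obj[OF j]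
  have "inflation C (j \<cdot> i)" "j \<cdot> i \<in> Hom C A E"
    using Comp_inflation[OF ses_inflation[OF i] ses_inflation[OF j]] iH jH by (simp_all add: Hom_def)
  then obtain X r where r: "ses C A (j \<cdot> i) E r X" using inflation_ses by blast
  note rH = ses_Hom[OF r] and OX = ses_Obj(3)[OF r]
  have "r \<cdot> j \<in> Hom C B X" "(r \<cdot> j) \<cdot> i = \<zero> A X"
    using ses_comp[OF r] rH jH iH by (simp_all add: Hom_def)
  then obtain u where u: "u \<in> Hom C D X" "u \<cdot> p = r \<cdot> j" using ses_colift[OF i] by blast
  have "q \<cdot> (j \<cdot> i) = \<zero> A F" using jH iH O by (simp add: Hom_def cx[OF ses_comp[OF j]])
  then obtain v where v: "v \<in> Hom C X F" "v \<cdot> r = q" using ses_colift[OF r jH(2)] by blast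
  have "ses C D u X v F"
  proof (rule G_ses[OF u(1) v(1)])
    show "v \<cdot> u = \<zero> D F"
      by (rule ses_epi0[OF i]) (use u v iH jH rH in \<open>simp_all add: Hom_def cx[OF v(2)] ses_comp[OF j]\<close>)
  next
    fix P x assume P: "P \<in> G" and x: "x \<in> Hom C P D" "u \<cdot> x = \<zero> P X"
    have OP: "P \<in> Obj C" using Hom_Obj[OF x(1)] by simp
    obtain y where y: "y \<in> Hom C P B" "p \<cdot> y = x" using G_lift[OF P i x(1)] by blast
    have "j \<cdot> y \<in> Hom C P E" "r \<cdot> (j \<cdot> y) = \<zero> P X"
      using rH jH y x(2) u(1) iH by (simp_all add: Hom_def cx[OF u(2)[symmetric]])
    then obtain w where w: "w \<in> Hom C P A" "(j \<cdot> i) \<cdot> w = j \<cdot> y" using ses_lift[OF r] by blast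
    have "y = i \<cdot> w"
      by (rule ses_mono[OF j]) (use y w iH jH in \<open>simp_all add: Hom_def\<close>)
    then show "x = \<zero> P D" using y w iH O by (auto simp: Hom_def cx[OF ses_comp[OF i]])
  next
    fix P z assume P: "P \<in> G" and z: "z \<in> Hom C P X" "v \<cdot> z = \<zero> P F"
    obtain e where e: "e \<in> Hom C P E" "r \<cdot> e = z" using G_lift[OF P r z(1)] by blast
    have "q \<cdot> e = \<zero> P F" using e z(2) v rH by (simp add: Hom_def cx[OF v(2), symmetric])
    then obtain b where b: "b \<in> Hom C P B" "j \<cdot> b = e" using ses_lift[OF j e(1)] by blast
    have "u \<cdot> (p \<cdot> b) = z" using b e u iH rH jH by (simp add: Hom_def cx[OF u(2)])
    then show "\<exists>x \<in> Hom C P D. u \<cdot> x = z"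
      using b iH by (intro bexI[of _ "p \<cdot> b"]) (simp_all add: Hom_def)
  next
    fix P z assume P: "P \<in> G" and z: "z \<in> Hom C P F"
    obtain e where e: "e \<in> Hom C P E" "q \<cdot> e = z" using G_lift[OF P j z] by blast
    then show "\<exists>y \<in> Hom C P X. v \<cdot> y = z"
      using rH v by (intro bexI[of _ "r \<cdot> e"]) (simp_all add: Hom_def cx[OF v(2)])
  qed
  then show ?thesis using r u(2) v(2) by blast
qed

text \<open>The pushout is symmetric: its universal property also produces \<open>c'\<close> on the
  other leg, and a chase on \<open>G\<close> shows that \<open>f'\<close> is again an inflation with
  the cokernel of \<open>f\<close>.\<close>

lemma ses_pushout_inflations:
  assumes a: "ses C A a B b D" and f: "ses C A f A' c F"
  shows "\<exists>B' a' b' f' c'. ses C A' a' B' b' D \<and> ses C B f' B' c' F \<and> f' \<cdot> a = a' \<cdot> f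
    \<and> b' \<cdot> f' = b \<and> c' \<cdot> a' = c"
proof -
  note aH = ses_Hom[OF a] and fH = ses_Hom[OF f] and O = ses_Obj[OF a] ses_Obj[OF f]
  obtain B' a' b' f' where a': "ses C A' a' B' b' D" and f': "f' \<in> Hom C B B'"
    and sq: "f' \<cdot> a = a' \<cdot> f" and b'f': "b' \<cdot> f' = b" and po: "is_pushout C a f a' f'"
    using ses_pushout[OF a fH(1)] by blast
  note a'H = ses_Hom[OF a'] and OB' = ses_Obj(2)[OF a']
  have Cod_a': "Cod C a' = B'" using a'H by (simp add: Hom_def)
  have e: "\<zero> B F \<cdot> a = c \<cdot> f" using aH O ses_comp[OF f] by (simp add: Hom_def)
  obtain c' where c': "c' \<in> Hom C B' F" "c' \<cdot> f' = \<zero> B F" "c' \<cdot> a' = c"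
    by (rule is_pushout_colift[OF po aH(1) fH(1) zero_Hom[OF O(2) O(6)] fH(2) e, unfolded Cod_a'])
  have "ses C B f' B' c' F"
  proof (rule G_ses[OF f' c'(1,2)])
    fix P x assume P: "P \<in> G" and x: "x \<in> Hom C P B" "f' \<cdot> x = \<zero> P B'"
    have OP: "P \<in> Obj C" using Hom_Obj[OF x(1)] by simp
    have "b' \<cdot> (f' \<cdot> x) = \<zero> P D" using x(2) a'H OP by (simp add: Hom_def)
    then have "b \<cdot> x = \<zero> P D" using a'H f' x(1) by (simp add: Hom_def cx[OF b'f'])
    then obtain w where w: "w \<in> Hom C P A" "a \<cdot> w = x" using ses_lift[OF a x(1)] by blast
    have "a' \<cdot> (f \<cdot> w) = \<zero> P B'"
      using x(2) w aH fH a'H f' cx[OF sq, of w] by (auto simp: Hom_def)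
    then have "f \<cdot> w = \<zero> P A'" using ses_mono0[OF a', of "f \<cdot> w" P] w fH by (simp add: Hom_def)
    then have "w = \<zero> P A" using ses_mono0[OF f w(1)] by simp
    then show "x = \<zero> P B" using w aH OP by (auto simp: Hom_def)
  next
    fix P z assume P: "P \<in> G" and z: "z \<in> Hom C P B'" "c' \<cdot> z = \<zero> P F"
    have OP: "P \<in> Obj C" using Hom_Obj[OF z(1)] by simp
    have b'z: "b' \<cdot> z \<in> Hom C P D" using z a'H by (simp add: Hom_def)
    obtain y where y: "y \<in> Hom C P B" "b \<cdot> y = b' \<cdot> z" using G_lift[OF P a b'z] by blast
    have f'y: "f' \<cdot> y \<in> Hom C P B'" "b' \<cdot> z = b' \<cdot> (f' \<cdot> y)"
      using y f' a'H by (simp_all add: Hom_def cx[OF b'f'])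
    obtain w where w: "w \<in> Hom C P A'" "z = f' \<cdot> y \<oplus> a' \<cdot> w"
      using ses_lift_sub[OF a' z(1) f'y] by blast
    have "c \<cdot> w = \<zero> P F"
      using z(2) w y f' a'H c' OP fH O by (simp add: Hom_def cx[OF c'(2)] cx[OF c'(3)])
    then obtain v where v: "v \<in> Hom C P A" "f \<cdot> v = w" using ses_lift[OF f w(1)] by blast
    have "f' \<cdot> (y \<oplus> a \<cdot> v) = z"
      using y v w f' aH a'H fH by (simp add: Hom_def cx[OF sq])
    then show "\<exists>x \<in> Hom C P B. f' \<cdot> x = z"
      using y v aH by (intro bexI[of _ "y \<oplus> a \<cdot> v"]) (simp_all add: Hom_def)
  next
    fix P z assume P: "P \<in> G" and z: "z \<in> Hom C P F"
    obtain e where e: "e \<in> Hom C P A'" "c \<cdot> e = z" using G_lift[OF P f z] by blast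
    then show "\<exists>y \<in> Hom C P B'. c' \<cdot> y = z"
      using a'H c' by (intro bexI[of _ "a' \<cdot> e"]) (simp_all add: Hom_def cx[OF c'(3)])
  qed
  then show ?thesis using a' sq b'f' c'(3) by blast
qed

text \<open>A retraction need not have a kernel in general; this one does, namely the section of
  \<open>b\<close> that belongs to \<open>\<rho>\<close>, and the decomposition of the identity of
  \<open>B\<close> makes exactness on elements immediate.\<close>

lemma ses_split:
  assumes a: "ses C A a B b D" and \<rho>: "\<rho> \<in> Hom C B A" "\<rho> \<cdot> a = Ide C A"
  shows "\<exists>\<sigma>. ses C D \<sigma> B \<rho> A \<and> b \<cdot> \<sigma> = Ide C D \<and> a \<cdot> \<rho> \<oplus> \<sigma> \<cdot> b = Ide C B"
proof -
  note aH = ses_Hom[OF a] and O = ses_Obj[OF a]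
  obtain \<sigma> where \<sigma>: "\<sigma> \<in> Hom C D B" and b\<sigma>: "b \<cdot> \<sigma> = Ide C D"
    and 1: "a \<cdot> \<rho> \<oplus> \<sigma> \<cdot> b = Ide C B"
    using ses_retraction_section[OF a \<rho>] by blast
  have \<sigma>b: "\<sigma> \<cdot> b = Ide C B \<ominus> a \<cdot> \<rho>"
    using sub_eq_iff[of "Ide C B" "a \<cdot> \<rho>" "\<sigma> \<cdot> b"] 1 \<sigma> aH \<rho>(1) O by (simp add: Hom_def)
  have \<rho>\<sigma>: "\<rho> \<cdot> \<sigma> = \<zero> D A"
    by (rule ses_epi0[OF a]) (use aH \<sigma> \<sigma>b \<rho> O in \<open>simp_all add: Hom_def cx[OF \<rho>(2)]\<close>)
  have "ses C D \<sigma> B \<rho> A"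
  proof (rule G_ses[OF \<sigma>(1) \<rho>(1) \<rho>\<sigma>])
    fix P x assume x: "x \<in> Hom C P D" "\<sigma> \<cdot> x = \<zero> P B"
    have "P \<in> Obj C" using Hom_Obj[OF x(1)] by simp
    then show "x = \<zero> P D" using cx[OF b\<sigma>, of x] x \<sigma>(1) aH by (simp add: Hom_def)
  next
    fix P y assume y: "y \<in> Hom C P B" "\<rho> \<cdot> y = \<zero> P A"
    have "P \<in> Obj C" using Hom_Obj[OF y(1)] by simp
    moreover have "y = (a \<cdot> \<rho> \<oplus> \<sigma> \<cdot> b) \<cdot> y" using y by (simp add: 1 Hom_def)
    ultimately have "\<sigma> \<cdot> (b \<cdot> y) = y" using y \<sigma>(1) aH \<rho>(1) O by (simp add: Hom_def)
    then show "\<exists>x \<in> Hom C P D. \<sigma> \<cdot> x = y"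
      using y aH by (intro bexI[of _ "b \<cdot> y"]) (simp_all add: Hom_def)
  next
    fix P z assume z: "z \<in> Hom C P A"
    then show "\<exists>y \<in> Hom C P B. \<rho> \<cdot> y = z"
      using aH \<rho> by (intro bexI[of _ "a \<cdot> z"]) (simp_all add: Hom_def cx[OF \<rho>(2)])
  qed
  then show ?thesis using b\<sigma> 1 by blast
qed

end

section \<open>Global and dominant dimension in terms of conflations\<close>

lemma exact_sequence_single: "exact_sequence C [f] \<longleftrightarrow> admissible_arr C f"
  by (simp add: exact_sequence_def)

lemma exact_sequence_Cons:
  "exact_sequence C (f # g # fs) \<longleftrightarrow> admissible_arr C f \<and> Cod C f = Dom C g \<and>
     (\<exists>m. is_image C m f \<and> is_kernel C m g) \<and> exact_sequence C (g # fs)" (is "?L \<longleftrightarrow> ?R")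
proof
  assume L: ?L
  then have *: "Cod C ((f # g # fs) ! k) = Dom C ((f # g # fs) ! Suc k) \<and>
      (\<exists>m. is_image C m ((f # g # fs) ! k) \<and> is_kernel C m ((f # g # fs) ! Suc k))"
    if "Suc k < length (f # g # fs)" for k
    using that unfolding exact_sequence_def by blast
  show ?R
    using L *[of 0] *[of "Suc k" for k] by (auto simp: exact_sequence_def)
next
  assume R: ?R
  show ?L
    unfolding exact_sequence_def
  proof (intro conjI allI impI)
    show "\<forall>f \<in> set (f # g # fs). admissible_arr C f" using R by (auto simp: exact_sequence_def)
    fix k assume k: "Suc k < length (f # g # fs)"
    show "Cod C ((f # g # fs) ! k) = Dom C ((f # g # fs) ! Suc k)"
      "\<exists>m. is_image C m ((f # g # fs) ! k) \<and> is_kernel C m ((f # g # fs) ! Suc k)"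
      using R k by (cases k; auto simp: exact_sequence_def)+
  qed
qed

section \<open>Cutting exact sequences into conflations and splicing conflations\<close>

context exact_category
begin

lemma ses_kernel_comp_mono:
  assumes "ses C A i B p D" "ses C D m E c F"
  shows "is_kernel C i (m \<cdot> p)"
proof -
  note H = ses_Hom[OF assms(1)] ses_Hom[OF assms(2)] and k = ses_kc(1)[OF assms(1)]
    and O = ses_Obj[OF assms(1)] ses_Obj[OF assms(2)]
  show ?thesis
    unfolding is_kernel_def
  proof (intro conjI ballI impI)
    fix W g assume W: "W \<in> Obj C" and "g \<in> Hom C W (Dom C (m \<cdot> p))"
      and "m \<cdot> p \<cdot> g = \<zero> W (Cod C (m \<cdot> p))"
    then have g: "g \<in> Hom C W B" "m \<cdot> (p \<cdot> g) = \<zero> W E" using H by (simp_all add: Hom_def)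
    then have "p \<cdot> g = \<zero> W D" using H by (intro ses_mono0[OF assms(2)]) (simp_all add: Hom_def)
    then show "\<exists>!h. h \<in> Hom C W (Dom C i) \<and> i \<cdot> h = g"
      using k W g(1) H unfolding is_kernel_def by (simp add: Hom_def)
  qed (use H O ses_comp[OF assms(1)] in \<open>simp_all add: Hom_def\<close>)
qed

text \<open>As \<open>m\<close> is monic, a kernel of \<open>m \<cdot> p\<close> is a kernel of
  \<open>p\<close>, hence isomorphic to the kernel \<open>k\<close> that is already part of a
  conflation. Exact sequences give kernels only abstractly; this recovers conflations from
  them.\<close>

lemma kernel_ses:
  assumes "is_kernel C i (m \<cdot> p)" "i \<in> Hom C A B" "ses C K k B p D" "ses C D m E c F"
  shows "ses C A i B p D"
proof -
  note kH = ses_Hom[OF assms(3)] and mH = ses_Hom[OF assms(4)]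
    and O = ses_Obj[OF assms(3)] ses_Obj[OF assms(4)]
  have OA: "A \<in> Obj C" using Hom_Obj[OF assms(2)] by simp
  have mp: "m \<cdot> p \<in> Hom C B E" using kH mH by (simp add: Hom_def)
  have D: "Dom C i = A" "Dom C (m \<cdot> p) = B" "Cod C (m \<cdot> p) = E"
    using assms(2) mp by (simp_all add: Hom_def)
  have "k \<in> Hom C K B" "(m \<cdot> p) \<cdot> k = \<zero> K E"
    using kH mH O ses_comp[OF assms(3)] by (simp_all add: Hom_def)
  then obtain x where x: "x \<in> Hom C K A" "i \<cdot> x = k"
    using is_kernel_lift[OF assms(1), of k K, unfolded D] by blast
  have "m \<cdot> (p \<cdot> i) = \<zero> A E" using is_kernel_D(3)[OF assms(1)] assms(2) kH mH by (simp add: Hom_def)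
  then have "p \<cdot> i = \<zero> A D"
    using kH assms(2) by (intro ses_mono0[OF assms(4)]) (simp_all add: Hom_def)
  then obtain y where y: "y \<in> Hom C A K" "k \<cdot> y = i" using ses_lift[OF assms(3,2)] by blast
  have e: "k \<cdot> (y \<cdot> x) = k \<cdot> Ide C K" using kH x y(1) O by (simp add: Hom_def cx[OF y(2)])
  have yx: "y \<cdot> x = Ide C K"
    by (rule ses_mono[OF assms(3) _ _ e]) (use x y O in \<open>simp_all add: Hom_def\<close>)
  have e: "i \<cdot> (x \<cdot> y) = i \<cdot> Ide C A" using assms(2) kH x(1) y OA by (simp add: Hom_def cx[OF x(2)])
  have xy: "x \<cdot> y = Ide C A"
    by (rule is_kernel_mono[OF assms(1) _ _ e]) (use x y OA assms(2) in \<open>simp_all add: Hom_def\<close>)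
  show ?thesis
    by (rule ses_iso[OF assms(3,2) kH(2) is_isoI[OF x(1) y(1) yx xy] is_iso_Ide[OF O(2)] is_iso_Ide[OF O(3)]])
      (use x kH O in \<open>simp_all add: Hom_def\<close>)
qed

lemma is_image_zero:
  assumes "is_image C m (\<zero> X Y)" "X \<in> Obj C" "Y \<in> Obj C"
  shows "m \<in> Hom C (Dom C m) Y" "m = \<zero> (Dom C m) Y"
proof -
  obtain K k p c F where 1: "ses C K k X p (Dom C m)" and 2: "ses C (Dom C m) m Y c F"
    and 3: "\<zero> X Y = m \<cdot> p"
    using is_image_ses[OF assms(1) zero_Hom[OF assms(2,3)]] by blast
  show m: "m \<in> Hom C (Dom C m) Y" using ses_Hom(1)[OF 2] .
  show "m = \<zero> (Dom C m) Y" by (rule ses_epi0[OF 1 m]) (use 3 in simp)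
qed

lemma ses_zero_mono:
  assumes "ses C A (\<zero> A B) B p D"
  shows "zero_object C A"
proof (rule zero_objectI)
  note O = ses_Obj[OF assms]
  show "A \<in> Obj C" using O by simp
  show "Ide C A = \<zero> A A"
    by (rule ses_mono0[OF assms Ide_Hom]) (use O in simp_all)
qed

lemma exact_sequence0_ses:
  assumes 1: "ses C A a B q Q" and 2: "ses C Q b D c E"
  shows "exact_sequence0 C [a, b \<cdot> q, c]"
proof -
  obtain Z where Z: "zero_object C Z" "Z \<in> Obj C" by (rule zero_object_exists)
  note O = ses_Obj[OF 1] ses_Obj[OF 2] and H = ses_Hom[OF 1] ses_Hom[OF 2]
  note ZA = ses_zero_Ide[OF Z(1)] and AZ = ses_Ide_zero[OF Z(1)]
  have zz: "\<zero> Z A \<cdot> Ide C Z = \<zero> Z A" "Ide C Z \<cdot> \<zero> E Z = \<zero> E Z" "a \<cdot> Ide C A = a" "Ide C E \<cdot> c = c"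
    using O Z H by (simp_all add: Hom_def)
  have a1: "is_image C (\<zero> Z A) (\<zero> Z A)" using ses_is_image[OF ZA[OF Z(2)] ZA[OF O(1)]] zz by simp
  have a2: "is_image C a a" using ses_is_image[OF ZA[OF O(1)] 1] zz by simp
  have a3: "is_image C b (b \<cdot> q)" using ses_is_image[OF 1 2] .
  have a4: "is_image C (Ide C E) c" using ses_is_image[OF 2 AZ[OF O(6)]] zz by simp
  have a5: "is_image C (Ide C Z) (\<zero> E Z)"
    using ses_is_image[OF AZ[OF O(6)] ZA[OF Z(2)], of ] ses_is_image[OF AZ[OF O(6)] AZ[OF Z(2)]] zz
    by simp
  have k1: "is_kernel C (\<zero> Z A) a" using ses_kernel_comp_mono[OF ZA[OF O(1)] 1] zz by simp
  have k2: "is_kernel C a (b \<cdot> q)" using ses_kernel_comp_mono[OF 1 2] .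
  have k3: "is_kernel C b c" using ses_kc(1)[OF 2] .
  have k4: "is_kernel C (Ide C E) (\<zero> E Z)" using ses_kc(1)[OF AZ[OF O(6)]] .
  have "exact_sequence C [\<zero> Z A, a, b \<cdot> q, c, \<zero> E Z]"
    unfolding exact_sequence_Cons exact_sequence_single admissible_arr_def
    using a1 a2 a3 a4 a5 k1 k2 k3 k4 O Z H by (intro conjI) (auto simp: Hom_def)
  then show ?thesis
    unfolding exact_sequence0_def using Z H by (auto simp: Hom_def)
qed

lemma gl_dim_le_2I:
  assumes "\<And>X. X \<in> Obj C \<Longrightarrow> \<exists>P2 d P1 p K l P0 r. ses C P2 d P1 p K \<and> ses C K l P0 r X \<and>
    projective C P2 \<and> projective C P1 \<and> projective C P0"
  shows "gl_dim C \<le> 2"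
  unfolding gl_dim_def
proof (rule SUP_least)
  fix X assume "X \<in> Obj C"
  then obtain P2 d P1 p K l P0 r where 1: "ses C P2 d P1 p K" and 2: "ses C K l P0 r X" and
    P: "projective C P2" "projective C P1" "projective C P0"
    using assms by blast
  have "projective_resolution C 2 [d, l \<cdot> p, r] X"
    using exact_sequence0_ses[OF 1 2] ses_Hom[OF 1] ses_Hom[OF 2] P
    by (auto simp: projective_resolution_def Hom_def)
  then have "proj_dim C X \<le> enat 2" unfolding proj_dim_def by (intro Inf_lower) blast
  then show "proj_dim C X \<le> 2" by (simp add: numeral_eq_enat)
qed

lemma dom_dim_ge_2I:
  assumes "\<And>P. projective C P \<Longrightarrow> \<exists>a I1 q Q b I2 c E. ses C P a I1 q Q \<and> ses C Q b I2 c E \<and>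
    projective C I1 \<and> injective C I1 \<and> projective C I2 \<and> injective C I2"
  shows "dom_dim C \<ge> 2"
proof -
  have "\<exists>fs. proj_inj_copresentation C 2 fs P" if P: "projective C P" for P
  proof -
    obtain a I1 q Q b I2 c E where 1: "ses C P a I1 q Q" and 2: "ses C Q b I2 c E" and
      I: "projective C I1" "injective C I1" "projective C I2" "injective C I2"
      using assms[OF P] by blast
    have "proj_inj_copresentation C 2 [a, b \<cdot> q, c] P"
      using exact_sequence0_ses[OF 1 2] ses_Hom[OF 1] ses_Hom[OF 2] I
      by (auto simp: proj_inj_copresentation_def Hom_def less_2_cases_iff)
    then show ?thesis by blast
  qed
  then have "enat 2 \<le> dom_dim C" unfolding dom_dim_def by (intro Sup_upper) blast
  then show ?thesis by (simp add: numeral_eq_enat)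
qed

text \<open>The cutting step for exact sequences: the image of \<open>f\<close> is the kernel of
  \<open>g\<close>, hence of the deflation part \<gamma> of \<open>g\<close>, so the inflation part
  of \<open>f\<close> and \<gamma> form a conflation.\<close>

lemma image_kernel_ses:
  assumes f: "f \<in> Hom C X Y" and m: "is_image C m f" "is_kernel C m g"
    and g: "g = \<mu> \<cdot> \<gamma>" "ses C K k Y \<gamma> J" "ses C J \<mu> W c F"
  shows "\<exists>N n p. ses C N n X p (Dom C m) \<and> ses C (Dom C m) m Y \<gamma> J \<and> f = m \<cdot> p"
proof -
  obtain N n p c' F' where 1: "ses C N n X p (Dom C m)" "ses C (Dom C m) m Y c' F'" "f = m \<cdot> p"
    using is_image_ses[OF m(1) f] by blast
  then show ?thesis using kernel_ses[OF m(2)[unfolded g(1)] ses_Hom(1)[OF 1(2)] g(2,3)] by blast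
qed

text \<open>Exactness where the incoming morphism is zero: the image is both monic and zero, so the
  deflation part of the outgoing morphism has zero kernel.\<close>

lemma image_zero_kernel_ses:
  assumes "X \<in> Obj C" "Y \<in> Obj C" "is_image C m (\<zero> X Y)" "is_kernel C m (\<mu> \<cdot> \<gamma>)"
    "ses C K k Y \<gamma> J" "ses C J \<mu> W c F"
  shows "ses C (Dom C m) (\<zero> (Dom C m) Y) Y \<gamma> J" "zero_object C (Dom C m)" "is_iso C \<gamma>"
proof -
  note m = is_image_zero[OF assms(3,1,2)]
  show 1: "ses C (Dom C m) (\<zero> (Dom C m) Y) Y \<gamma> J" using kernel_ses[OF assms(4) m(1) assms(5,6)] m(2) by simp
  show "zero_object C (Dom C m)" using ses_zero_mono[OF 1] .
  show "is_iso C \<gamma>" using ses_zero_left[OF 1] by simp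
qed

lemma ses_iso_precomp:
  assumes "ses C I m B q Q" "is_iso C p" "p \<in> Hom C A I"
  shows "ses C A (m \<cdot> p) B q Q"
proof -
  note H = ses_Hom[OF assms(1)] and O = ses_Obj[OF assms(1)]
  obtain p' where p': "p' \<in> Hom C I A" "p' \<cdot> p = Ide C A" "p \<cdot> p' = Ide C I" "is_iso C p'"
    using is_isoE[OF assms(2,3)] by metis
  show ?thesis
    by (rule ses_iso[OF assms(1) _ H(2) p'(4) is_iso_Ide[OF O(2)] is_iso_Ide[OF O(3)] p'(1)])
      (use O H p' assms(3) in \<open>simp_all add: Hom_def\<close>)
qed

text \<open>Exactness at the last term: the image of \<open>e\<close> is the kernel of the morphism
  to zero, so the inflation part of \<open>e\<close> is an isomorphism.\<close>

lemma exact_last_deflation: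
  assumes "zero_object C Z" "e \<in> Hom C P X" "is_image C m e" "is_kernel C m (\<zero> X Z)"
  shows "\<exists>N n. ses C N n P e X"
proof -
  have O: "Z \<in> Obj C" "X \<in> Obj C" "P \<in> Obj C"
    using assms(1) Hom_Obj[OF assms(2)] by (simp_all add: zero_object_def)
  have e: "\<zero> X Z = Ide C Z \<cdot> \<zero> X Z" using O by simp
  obtain N n p where n: "ses C N n P p (Dom C m)" "ses C (Dom C m) m X (\<zero> X Z) Z" "e = m \<cdot> p"
    using image_kernel_ses[OF assms(2-4) e ses_Ide_zero[OF assms(1) O(2)] ses_Ide_zero[OF assms(1) O(1)]]
    by blast
  note H = ses_Hom[OF n(1)] ses_Hom[OF n(2)] and O' = ses_Obj[OF n(1)] ses_Obj[OF n(2)]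
  have iso: "is_iso C m" using ses_zero_right[OF n(2)] by simp
  have "ses C N n P e X"
    by (rule ses_iso[OF n(1) H(1) assms(2) is_iso_Ide[OF O'(1)] is_iso_Ide[OF O'(2)] iso])
      (use O' H n(3) in \<open>simp_all add: Hom_def\<close>)
  then show ?thesis by blast
qed

lemma projective_resolution_2:
  assumes "gl_dim C \<le> 2" "X \<in> Obj C"
  shows "\<exists>P2 d P1 p K l P0 r. ses C P2 d P1 p K \<and> ses C K l P0 r X \<and>
    projective C P2 \<and> projective C P1 \<and> projective C P0"
proof -
  let ?S = "{enat n | n. \<exists>fs. projective_resolution C n fs X}"
  have *: "proj_dim C X \<le> 2" using assms unfolding gl_dim_def by (meson SUP_upper order_trans)
  \<comment> \<open>The infimum of a nonempty set of extended naturals is attained, so a finite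
    \<open>proj_dim\<close> comes from an actual resolution; an empty set would give
    infinity.\<close>
  have "?S \<noteq> {}"
  proof
    assume "?S = {}"
    then have "proj_dim C X = \<infinity>" unfolding proj_dim_def by (simp add: Inf_enat_def)
    then show False using * by simp
  qed
  then obtain x where "x \<in> ?S" by blast
  then have "(LEAST x. x \<in> ?S) \<in> ?S" by (rule LeastI)
  then have "proj_dim C X \<in> ?S" unfolding proj_dim_def Inf_enat_def using \<open>?S \<noteq> {}\<close> by simp
  then obtain n fs where n: "proj_dim C X = enat n" and fs: "projective_resolution C n fs X" by blast
  have n2: "n \<le> 2" using * n by (simp add: numeral_eq_enat)
  obtain Z where Z: "zero_object C Z" and
    ex: "exact_sequence C (\<zero> Z (Dom C (hd fs)) # fs @ [\<zero> (Cod C (last fs)) Z])"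
    using fs by (auto simp: projective_resolution_def exact_sequence0_def)
  have OZ: "Z \<in> Obj C" using Z by (simp add: zero_object_def)
  have len: "length fs = Suc n" and last: "Cod C (last fs) = X"
    and proj: "\<And>f. f \<in> set fs \<Longrightarrow> projective C (Dom C f)"
    using fs by (auto simp: projective_resolution_def)
  note exs = exact_sequence_Cons exact_sequence_single
  have arr: "f \<in> Hom C (Dom C f) (Cod C f)" if "admissible_arr C f" for f
  proof -
    obtain m where "is_image C m f" using \<open>admissible_arr C f\<close> by (auto simp: admissible_arr_def)
    then obtain p where "inflation C m" "deflation C p" "Cod C p = Dom C m" "f = m \<cdot> p"
      by (auto simp: is_image_def)
    then show ?thesis using inflation_Arr deflation_Arr by (simp add: Hom_def)
  qed
  \<comment> \<open>Resolutions of length less than two are padded on the left with zero objects,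
    which are projective.\<close>
  consider "n = 0" | "n = 1" | "n = 2" using n2 by linarith
  then show ?thesis
  proof cases
    assume "n = 0"
    then obtain e where e: "fs = [e]" using len by (auto simp: length_Suc_conv)
    obtain m m' where ex': "admissible_arr C e" "is_image C m (\<zero> Z (Dom C e))" "is_kernel C m e"
      "is_image C m' e" "is_kernel C m' (\<zero> X Z)"
      using ex last by (auto simp: e exs)
    have eH: "e \<in> Hom C (Dom C e) X" using arr[OF ex'(1)] last by (simp add: e)
    obtain N n where n: "ses C N n (Dom C e) e X" using exact_last_deflation[OF Z eH ex'(4,5)] by blast
    have "is_kernel C m (Ide C X \<cdot> e)" using ex'(3) eH by (simp add: Hom_def)
    from image_zero_kernel_ses[OF OZ ses_Obj(2)[OF n] ex'(2) this n ses_Ide_zero[OF Z ses_Obj(3)[OF n]]]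
    have m: "ses C (Dom C m) (\<zero> (Dom C m) (Dom C e)) (Dom C e) e X" "zero_object C (Dom C m)" by simp_all
    then show ?thesis
      using ses_zero_Ide[OF m(2) ses_Obj(1)[OF m(1)]] zero_object_projective[OF m(2)] proj[of e] e
      by (metis list.set_intros(1))
  next
    assume "n = 1"
    then obtain d e where e: "fs = [d, e]" using len by (auto simp: length_Suc_conv)
    obtain m m' m'' where ex': "admissible_arr C e" "admissible_arr C d" "is_image C m (\<zero> Z (Dom C d))"
      "is_kernel C m d" "Cod C d = Dom C e" "is_image C m' d" "is_kernel C m' e"
      "is_image C m'' e" "is_kernel C m'' (\<zero> X Z)"
      using ex last by (auto simp: e exs)
    have H: "e \<in> Hom C (Dom C e) X" "d \<in> Hom C (Dom C d) (Dom C e)"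
      using arr[OF ex'(1)] arr[OF ex'(2)] last ex'(5) by (simp_all add: e)
    obtain N n where n: "ses C N n (Dom C e) e X" using exact_last_deflation[OF Z H(1) ex'(8,9)] by blast
    have e1: "e = Ide C X \<cdot> e" using H by (simp add: Hom_def)
    obtain N n p where p: "ses C N n (Dom C d) p (Dom C m')" "ses C (Dom C m') m' (Dom C e) e X" "d = m' \<cdot> p"
      using image_kernel_ses[OF H(2) ex'(6,7) e1 n ses_Ide_zero[OF Z ses_Obj(3)[OF n]]] by blast
    from image_zero_kernel_ses[OF OZ ses_Obj(2)[OF p(1)] ex'(3) ex'(4)[unfolded p(3)] p(1,2)]
    show ?thesis using p(2) zero_object_projective proj[of e] proj[of d] e
      by (metis list.set_intros)
  next
    assume "n = 2"
    then obtain d2 d e where e: "fs = [d2, d, e]" using len by (auto simp: length_Suc_conv numeral_2_eq_2)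
    obtain m m' m'' m3 where ex': "admissible_arr C e" "admissible_arr C d" "admissible_arr C d2"
      "is_image C m (\<zero> Z (Dom C d2))" "is_kernel C m d2" "Cod C d2 = Dom C d" "is_image C m' d2"
      "is_kernel C m' d" "Cod C d = Dom C e" "is_image C m'' d" "is_kernel C m'' e"
      "is_image C m3 e" "is_kernel C m3 (\<zero> X Z)"
      using ex last by (auto simp: e exs)
    have H: "e \<in> Hom C (Dom C e) X" "d \<in> Hom C (Dom C d) (Dom C e)" "d2 \<in> Hom C (Dom C d2) (Dom C d)"
      using arr[OF ex'(1)] arr[OF ex'(2)] arr[OF ex'(3)] last ex'(6,9) by (simp_all add: e)
    obtain N n where n: "ses C N n (Dom C e) e X" using exact_last_deflation[OF Z H(1) ex'(12,13)] by blast
    have e1: "e = Ide C X \<cdot> e" using H by (simp add: Hom_def)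
    obtain N n p where p: "ses C N n (Dom C d) p (Dom C m'')" "ses C (Dom C m'') m'' (Dom C e) e X"
      "d = m'' \<cdot> p"
      using image_kernel_ses[OF H(2) ex'(10,11) e1 n ses_Ide_zero[OF Z ses_Obj(3)[OF n]]] by blast
    obtain N n q where q: "ses C N n (Dom C d2) q (Dom C m')" "ses C (Dom C m') m' (Dom C d) p (Dom C m'')"
      "d2 = m' \<cdot> q"
      using image_kernel_ses[OF H(3) ex'(7,8) p(3,1,2)] by blast
    from image_zero_kernel_ses[OF OZ ses_Obj(2)[OF q(1)] ex'(4) ex'(5)[unfolded q(3)] q(1,2)]
    have "is_iso C q" by simp
    then have "ses C (Dom C d2) d2 (Dom C d) p (Dom C m'')"
      using ses_iso_precomp[OF q(2) _ ses_Hom(2)[OF q(1)]] q(3) by simp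
    then show ?thesis using p(2) proj[of e] proj[of d] proj[of d2] e
      by (metis list.set_intros)
  qed
qed

lemma proj_inj_copresentation_2:
  assumes "dom_dim C \<ge> 2" "projective C P"
  shows "\<exists>a I1 q Q b I2 c E. ses C P a I1 q Q \<and> ses C Q b I2 c E \<and>
    projective C I1 \<and> injective C I1 \<and> projective C I2 \<and> injective C I2"
proof -
  let ?S = "{enat n | n. \<forall>P. projective C P \<longrightarrow> (\<exists>fs. proj_inj_copresentation C n fs P)}"
  \<comment> \<open>A supremum of at least 2, possibly infinite, only guarantees some member above
    1, that is, a uniform length \<open>n \<ge> 2\<close>. A longer copresentation is truncated:
    admissibility of its second morphism already provides the cokernel of \<open>Q\<close> in
    \<open>I2\<close>.\<close>
  have "\<exists>x \<in> ?S. 1 < x"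
    using assms(1) less_Sup_iff[of 1 ?S] unfolding dom_dim_def
    by (metis (lifting) one_less_numeral_iff order_less_le_trans semiring_norm(76) numeral_eq_enat
        one_enat_def enat_ord_simps(2))
  then obtain n where n: "1 < enat n" "\<forall>P. projective C P \<longrightarrow> (\<exists>fs. proj_inj_copresentation C n fs P)"
    by blast
  then obtain fs where fs: "proj_inj_copresentation C n fs P" using assms(2) by blast
  have n2: "n \<ge> 2" using n(1) by (simp add: one_enat_def)
  have len: "length fs = Suc n" and dom: "Dom C (hd fs) = P"
    and I: "\<And>k. k < n \<Longrightarrow> projective C (Cod C (fs ! k)) \<and> injective C (Cod C (fs ! k))"
    using fs by (auto simp: proj_inj_copresentation_def)
  obtain a f gs where fs': "fs = a # f # gs" using len n2
    by (cases fs; cases "tl fs") auto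
  obtain Z where Z: "zero_object C Z" and
    ex: "exact_sequence C (\<zero> Z P # a # f # gs @ [\<zero> (Cod C (last fs)) Z])"
    using fs dom by (auto simp: proj_inj_copresentation_def exact_sequence0_def fs')
  have OZ: "Z \<in> Obj C" using Z by (simp add: zero_object_def)
  obtain h hs where hs: "gs @ [\<zero> (Cod C (last fs)) Z] = h # hs" by (cases gs) auto
  obtain m m' where ex': "admissible_arr C a" "admissible_arr C f" "is_image C m (\<zero> Z P)"
    "is_kernel C m a" "Cod C a = Dom C f" "is_image C m' a" "is_kernel C m' f"
    using ex by (auto simp: hs exact_sequence_Cons)
  have D: "Dom C a = P" using dom fs' by simp
  have inArr: "g \<in> Arr C" if g: "admissible_arr C g" for g
  proof -
    obtain m p where "inflation C m" "deflation C p" "Cod C p = Dom C m" "g = m \<cdot> p"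
      using g by (auto simp: is_image_def admissible_arr_def)
    then show ?thesis using inflation_Arr deflation_Arr by simp
  qed
  have H: "a \<in> Hom C P (Cod C a)" "f \<in> Hom C (Cod C a) (Cod C f)"
    using inArr[OF ex'(1)] inArr[OF ex'(2)] D ex'(5) by (simp_all add: Hom_def)
  obtain K k Q q b c E where q: "ses C K k (Cod C a) q Q" "ses C Q b (Cod C f) c E" "f = b \<cdot> q"
    using admissible_ses[OF ex'(2) H(2)] by blast
  obtain N n p where p: "ses C N n P p (Dom C m')" "ses C (Dom C m') m' (Cod C a) q Q" "a = m' \<cdot> p"
    using image_kernel_ses[OF H(1) ex'(6,7) q(3,1,2)] by blast
  from image_zero_kernel_ses[OF OZ ses_Obj(2)[OF p(1)] ex'(3) ex'(4)[unfolded p(3)] p(1,2)]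
  have "is_iso C p" by simp
  then have "ses C P a (Cod C a) q Q" using ses_iso_precomp[OF p(2) _ ses_Hom(2)[OF p(1)]] p(3) by simp
  then show ?thesis using q(2) I[of 0] I[of 1] n2 fs' by fastforce
qed

end

section \<open>Enough injectives\<close>

lemma (in exact_category) ses_section_retraction:
  assumes a: "ses C A a B b D" and \<sigma>: "\<sigma> \<in> Hom C D B" "b \<cdot> \<sigma> = Ide C D"
  shows "\<exists>\<rho> \<in> Hom C B A. \<rho> \<cdot> a = Ide C A \<and> a \<cdot> \<rho> \<oplus> \<sigma> \<cdot> b = Ide C B"
proof -
  note H = ses_Hom[OF a] and O = ses_Obj[OF a]
  have "Ide C B \<ominus> \<sigma> \<cdot> b \<in> Hom C B B" "b \<cdot> (Ide C B \<ominus> \<sigma> \<cdot> b) = \<zero> B D"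
    using H \<sigma> O by (simp_all add: Hom_def cx[OF \<sigma>(2)])
  then obtain \<rho> where \<rho>: "\<rho> \<in> Hom C B A" "a \<cdot> \<rho> = Ide C B \<ominus> \<sigma> \<cdot> b" using ses_lift[OF a] by blast
  have e: "a \<cdot> (\<rho> \<cdot> a) = a \<cdot> Ide C A"
    using H \<sigma>(1) \<rho>(1) O by (simp add: Hom_def cx[OF \<rho>(2)] ses_comp[OF a])
  have "\<rho> \<cdot> a = Ide C A"
    by (rule ses_mono[OF a _ _ e]) (use H \<rho> O in \<open>simp_all add: Hom_def\<close>)
  moreover have "a \<cdot> \<rho> \<oplus> \<sigma> \<cdot> b = Ide C B"
    using sub_eq_iff[of "Ide C B" "\<sigma> \<cdot> b" "a \<cdot> \<rho>"] add_commute[of "a \<cdot> \<rho>" "\<sigma> \<cdot> b"] \<rho> H \<sigma>(1) O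
    by (simp add: Hom_def)
  ultimately show ?thesis using \<rho>(1) by blast
qed

text \<open>Enough projectives and condition (1), the latter in terms of conflations. This is the
  setting for enough injectives and for the first properties of torsion objects.\<close>

locale auslander_dim_category = exact_category_gen C "Proj C"
  for C :: "('o, 'm) excat" (structure) +
  assumes copresentation: "projective C P \<Longrightarrow> \<exists>a I1 q Q b I2 c E. ses C P a I1 q Q \<and>
      ses C Q b I2 c E \<and> projective C I1 \<and> injective C I1 \<and> projective C I2 \<and> injective C I2"
    and resolution: "X \<in> Obj C \<Longrightarrow> \<exists>P2 d P1 p K l P0 r. ses C P2 d P1 p K \<and> ses C K l P0 r X \<and>
      projective C P2 \<and> projective C P1 \<and> projective C P0"
begin

text \<open>Dimension shifting along the two injectives identifies Ext^1(H, E) with Ext^3(H, P), and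
  the latter vanishes because \<open>H\<close> has a projective resolution of length two. The proof
  carries out the shift by hand on an extension of \<open>H\<close> by \<open>E\<close> and ends
  with a section of it.\<close>

lemma cosyzygy_injective:
  assumes a: "ses C P a I1 q Q" and b: "ses C Q b I2 c E" and I: "injective C I1" "injective C I2"
  shows "injective C E"
proof (rule injective_if_retracts)
  show OE: "E \<in> Obj C" using ses_Obj[OF b] by simp
  fix a' B b' H assume a': "ses C E a' B b' H"
  note Ha = ses_Hom[OF a] and Hb = ses_Hom[OF b] and Ha' = ses_Hom[OF a']
    and O = ses_Obj[OF a] ses_Obj[OF b] ses_Obj[OF a']
  obtain R2 d R1 p K l R0 r where d: "ses C R2 d R1 p K" and l: "ses C K l R0 r H"
    and R: "projective C R2" "projective C R1" "projective C R0"
    using resolution O by blast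
  note Hd = ses_Hom[OF d] and Hl = ses_Hom[OF l] and OR = ses_Obj[OF d] ses_Obj[OF l]
  obtain s where s: "s \<in> Hom C R0 B" "b' \<cdot> s = r" using projective_lift[OF R(3) a' Hl(2)] by blast
  \<comment> \<open>The restriction \<open>t\<close> of \<open>s\<close> to the syzygy
    \<open>K\<close> represents the class of the extension; a section exists as soon as
    \<open>t\<close> extends to \<open>R0\<close>.\<close>
  have "s \<cdot> l \<in> Hom C K B" "b' \<cdot> (s \<cdot> l) = \<zero> K H"
    using s Hl Ha' by (simp_all add: Hom_def cx[OF s(2)] ses_comp[OF l])
  then obtain t where t: "t \<in> Hom C K E" "a' \<cdot> t = s \<cdot> l" using ses_lift[OF a'] by blast
  have tp: "t \<cdot> p \<in> Hom C R1 E" using t Hd by (simp add: Hom_def)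
  obtain u where u: "u \<in> Hom C R1 I2" "c \<cdot> u = t \<cdot> p" using projective_lift[OF R(2) b tp] by blast
  have "u \<cdot> d \<in> Hom C R2 I2" "c \<cdot> (u \<cdot> d) = \<zero> R2 E"
    using u t Hd Hb OE OR by (simp_all add: Hom_def cx[OF u(2)] ses_comp[OF d])
  then obtain n where n: "n \<in> Hom C R2 Q" "b \<cdot> n = u \<cdot> d" using ses_lift[OF b] by blast
  obtain n1 where n1: "n1 \<in> Hom C R2 I1" "q \<cdot> n1 = n" using projective_lift[OF R(1) a n(1)] by blast
  obtain n2 where n2: "n2 \<in> Hom C R1 I1" "n2 \<cdot> d = n1" using injective_extend[OF I(1) d n1(1)] by blast
  \<comment> \<open>\<open>u\<close> lifts \<open>t \<cdot> p\<close>, and its restriction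
    \<open>n\<close> to \<open>R2\<close> obstructs a lift of \<open>t\<close> itself. Lifting
    \<open>n\<close> to \<open>I1\<close> and extending over \<open>R1\<close> by injectivity gives
    the correction that makes \<open>u\<close> vanish on \<open>R2\<close>.\<close>
  have "u \<ominus> b \<cdot> (q \<cdot> n2) \<in> Hom C R1 I2" "(u \<ominus> b \<cdot> (q \<cdot> n2)) \<cdot> d = \<zero> R2 I2"
    using u(1) n n1 n2 Ha Hb Hd OR O by (simp_all add: Hom_def)
  then obtain t1 where t1: "t1 \<in> Hom C K I2" "t1 \<cdot> p = u \<ominus> b \<cdot> (q \<cdot> n2)"
    using ses_colift[OF d] by blast
  have e: "(c \<cdot> t1) \<cdot> p = t \<cdot> p"
    using t1 Hb Ha u n2(1) Hd O OR t by (simp add: Hom_def cx[OF ses_comp[OF b]])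
  have ct: "c \<cdot> t1 = t"
    by (rule ses_epi[OF d _ _ e]) (use t1 Hb t in \<open>simp_all add: Hom_def\<close>)
  obtain t2 where t2: "t2 \<in> Hom C R0 I2" "t2 \<cdot> l = t1" using injective_extend[OF I(2) l t1(1)] by blast
  have "s \<ominus> a' \<cdot> (c \<cdot> t2) \<in> Hom C R0 B" "(s \<ominus> a' \<cdot> (c \<cdot> t2)) \<cdot> l = \<zero> K B"
    using s t t2 Ha' Hb Hl O OR by (simp_all add: Hom_def ct)
  then obtain \<sigma> where \<sigma>: "\<sigma> \<in> Hom C H B" "\<sigma> \<cdot> r = s \<ominus> a' \<cdot> (c \<cdot> t2)"
    using ses_colift[OF l] by blast
  have e: "(b' \<cdot> \<sigma>) \<cdot> r = Ide C H \<cdot> r"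
    using \<sigma> Ha' s Hb t2(1) Hl O OR by (simp add: Hom_def cx[OF ses_comp[OF a']])
  have "b' \<cdot> \<sigma> = Ide C H"
    by (rule ses_epi[OF l _ _ e]) (use \<sigma> Ha' O in \<open>simp_all add: Hom_def\<close>)
  then show "\<exists>\<rho> \<in> Hom C B E. \<rho> \<cdot> a' = Ide C E" using ses_section_retraction[OF a' \<sigma>(1)] by blast
qed

section \<open>Objects that admit an inflation into an injective\<close>

definition embeds :: "'o \<Rightarrow> bool" where
  "embeds X \<longleftrightarrow> (\<exists>i I q D. ses C X i I q D \<and> injective C I)"

text \<open>The second step is what is asked of a subobject so that the quotient by it embeds again,
  see \<open>embeds_quotient\<close>.\<close>

definition embeds2 :: "'o \<Rightarrow> bool" where
  "embeds2 X \<longleftrightarrow> (\<exists>i I q D. ses C X i I q D \<and> injective C I \<and> embeds D)"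

lemma embeds_injective: "injective C I \<Longrightarrow> embeds I"
  using ses_Ide_zero[of _ I] zero_object_exists unfolding embeds_def injective_def by metis

lemma embeds_sub: "\<lbrakk>ses C X i Y p D; embeds Y\<rbrakk> \<Longrightarrow> embeds X"
  unfolding embeds_def using ses_composite_inflations by metis

text \<open>The extension \<open>U\<close> of \<open>D\<close> by the injective \<open>I\<close>
  splits by a retraction \<rho>, so \<rho> and \<open>j \<cdot> b\<close> together embed
  \<open>U\<close> into the biproduct of \<open>I\<close> and \<open>J\<close>, with the same
  cokernel as \<open>j\<close>.\<close>

lemma split_embedding:
  assumes a: "ses C I a U b D" and I: "injective C I" and j: "ses C D j J c E" and J: "injective C J"
  shows "\<exists>S e c'. ses C U e S c' E \<and> injective C S"
proof -
  note Ha = ses_Hom[OF a] and Hj = ses_Hom[OF j] and O = ses_Obj[OF a] ses_Obj[OF j]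
  obtain \<rho> where \<rho>: "\<rho> \<in> Hom C U I" "\<rho> \<cdot> a = Ide C I" using injective_extend[OF I a Ide_Hom] O by blast
  obtain S i1 i2 p1 p2 where S: "is_biproduct C I J S i1 i2 p1 p2"
    "i1 \<in> Hom C I S" "i2 \<in> Hom C J S" "p1 \<in> Hom C S I" "p2 \<in> Hom C S J"
    "p1 \<cdot> i1 = Ide C I" "p2 \<cdot> i2 = Ide C J" "p1 \<cdot> i2 = \<zero> J I" "p2 \<cdot> i1 = \<zero> I J"
    "i1 \<cdot> p1 \<oplus> i2 \<cdot> p2 = Ide C S"
    using biproductE[OF O(1) O(5)] by blast
  note cxS = cx[OF S(6)] cx[OF S(7)] cx[OF S(8)] cx[OF S(9)]
  have OS: "S \<in> Obj C" using Hom_Obj[OF S(2)] by simp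
  define e where "e = i1 \<cdot> \<rho> \<oplus> i2 \<cdot> (j \<cdot> b)"
  have e: "e \<in> Hom C U S" "p1 \<cdot> e = \<rho>" "p2 \<cdot> e = j \<cdot> b"
    using S \<rho> Ha Hj O by (simp_all add: e_def Hom_def cxS)
  have "ses C U e S (c \<cdot> p2) E"
  proof (rule G_ses[OF e(1)])
    show cp: "c \<cdot> p2 \<in> Hom C S E" using Hj S by (simp add: Hom_def)
    show "(c \<cdot> p2) \<cdot> e = \<zero> U E"
      using e Hj S Ha O by (simp add: Hom_def cx[OF ses_comp[OF j]])
  next
    fix P x assume x: "x \<in> Hom C P U" "e \<cdot> x = \<zero> P S"
    have OP: "P \<in> Obj C" using Hom_Obj[OF x(1)] by simp
    have 1: "\<rho> \<cdot> x = \<zero> P I" using cx[OF e(2), of x] x S e(1) OP by (simp add: Hom_def)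
    have "j \<cdot> (b \<cdot> x) = \<zero> P J" using cx[OF e(3), of x] x S e(1) OP Ha Hj by (simp add: Hom_def)
    then have "b \<cdot> x = \<zero> P D" using Ha x(1) by (intro ses_mono0[OF j]) (simp_all add: Hom_def)
    then obtain w where w: "w \<in> Hom C P I" "a \<cdot> w = x" using ses_lift[OF a x(1)] by blast
    have "w = \<zero> P I" using 1 w Ha \<rho>(1) cx[OF \<rho>(2), of w] O by (simp add: Hom_def)
    then show "x = \<zero> P U" using w Ha OP by (auto simp: Hom_def)
  next
    fix P s assume P: "P \<in> Proj C" and s: "s \<in> Hom C P S" "(c \<cdot> p2) \<cdot> s = \<zero> P E"
    have "p2 \<cdot> s \<in> Hom C P J" "c \<cdot> (p2 \<cdot> s) = \<zero> P E" using s S Hj by (simp_all add: Hom_def)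
    then obtain w where w: "w \<in> Hom C P D" "j \<cdot> w = p2 \<cdot> s" using ses_lift[OF j] by blast
    obtain u where u: "u \<in> Hom C P U" "b \<cdot> u = w" using G_lift[OF P a w(1)] by blast
    \<comment> \<open>A lift \<open>u\<close> of the \<open>J\<close>-component already has the
      right image in \<open>D\<close>; adding an element of \<open>I\<close> adjusts its value under
      \<rho> to the first component of \<open>s\<close>.\<close>
    define x where "x = u \<oplus> a \<cdot> (p1 \<cdot> s \<ominus> \<rho> \<cdot> u)"
    have x: "x \<in> Hom C P U" using u Ha S s \<rho> by (simp add: x_def Hom_def)
    have "P \<in> Obj C" using Hom_Obj[OF s(1)] by simp
    then have bx: "b \<cdot> x = w"
      using u Ha S s \<rho>(1) w(1) O by (simp add: x_def Hom_def cx[OF ses_comp[OF a]])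
    have "\<rho> \<cdot> x = \<rho> \<cdot> u \<oplus> (p1 \<cdot> s \<ominus> \<rho> \<cdot> u)"
      using u Ha S s \<rho> O by (simp add: x_def Hom_def cx[OF \<rho>(2)])
    also have "\<dots> = p1 \<cdot> s"
      using u S s \<rho>(1) add_left_commute[of "\<rho> \<cdot> u" "p1 \<cdot> s" "neg C (\<rho> \<cdot> u)"] by (simp add: Hom_def)
    finally have rx: "\<rho> \<cdot> x = p1 \<cdot> s" .
    have "e \<cdot> x = (i1 \<cdot> p1 \<oplus> i2 \<cdot> p2) \<cdot> s"
      using x S(2-5) s \<rho>(1) Ha Hj w(2) by (simp add: e_def Hom_def rx bx)
    also have "\<dots> = s" using s by (simp add: S(10) Hom_def)
    finally show "\<exists>x \<in> Hom C P U. e \<cdot> x = s" using x by blast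
  next
    fix P z assume P: "P \<in> Proj C" and z: "z \<in> Hom C P E"
    obtain y where y: "y \<in> Hom C P J" "c \<cdot> y = z" using G_lift[OF P j z] by blast
    then show "\<exists>s \<in> Hom C P S. (c \<cdot> p2) \<cdot> s = z"
      using S Hj by (intro bexI[of _ "i2 \<cdot> y"]) (simp_all add: Hom_def cxS)
  qed
  then show ?thesis using biproduct_injective[OF I J S(1)] by blast
qed

text \<open>Pushing out along an embedding of \<open>A\<close> into an injective replaces
  \<open>A\<close> by an injective, which is the case of \<open>split_embedding\<close>, and
  \<open>B\<close> is a subobject of the pushout.\<close>

lemma embeds_extension:
  assumes a: "ses C A a B b D" and "embeds A" "embeds D"
  shows "embeds B"
proof -
  obtain f I g A' where f: "ses C A f I g A'" "injective C I" using assms(2) by (auto simp: embeds_def)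
  obtain j J c E where j: "ses C D j J c E" "injective C J" using assms(3) by (auto simp: embeds_def)
  obtain U a' b' f' c' where "ses C I a' U b' D" "ses C B f' U c' A'"
    using ses_pushout_inflations[OF a f(1)] by blast
  moreover then have "embeds U" using split_embedding[OF _ f(2) j] unfolding embeds_def by metis
  ultimately show ?thesis using embeds_sub by blast
qed

text \<open>The dual of Schanuel's lemma: the pushout \<open>U\<close> of two embeddings of
  \<open>A\<close> into injectives is an extension of \<open>A0\<close> by \<open>I\<close> and of
  \<open>D\<close> by \<open>I0\<close>. The first shows that \<open>U\<close> embeds, the second
  splits and makes \<open>D\<close> a subobject of \<open>U\<close>.\<close>

lemma embeds_cosyzygy:
  assumes "embeds2 A" and f: "ses C A f I g D" and I: "injective C I"
  shows "embeds D"
proof -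
  obtain f0 I0 g0 A0 where f0: "ses C A f0 I0 g0 A0" "injective C I0" "embeds A0"
    using assms(1) by (auto simp: embeds2_def)
  obtain U a' b' f' c' where a': "ses C I a' U b' A0" "ses C I0 f' U c' D"
    using ses_pushout_inflations[OF f0(1) f] by blast
  have U: "embeds U" using embeds_extension[OF a'(1) embeds_injective[OF I] f0(3)] .
  obtain \<rho> where "\<rho> \<in> Hom C U I0" "\<rho> \<cdot> f' = Ide C I0"
    using injective_extend[OF f0(2) a'(2) Ide_Hom] ses_Obj[OF a'(2)] by blast
  then obtain \<sigma> where "ses C D \<sigma> U \<rho> I0" using ses_split[OF a'(2)] by blast
  then show ?thesis using U embeds_sub by blast
qed

text \<open>If \<open>B\<close> embeds into \<open>J\<close>, then \<open>B/A\<close> is a subobject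
  of \<open>J/A\<close>, which is a cosyzygy of \<open>A\<close>.\<close>

lemma embeds_quotient:
  assumes a: "ses C A a B b D" and A: "embeds2 A" and "embeds B"
  shows "embeds D"
proof -
  obtain j J q F where j: "ses C B j J q F" "injective C J" using assms(3) by (auto simp: embeds_def)
  obtain X r u v where r: "ses C A (j \<cdot> a) J r X" "ses C D u X v F"
    using ses_composite_inflations[OF a j(1)] by blast
  then show ?thesis using embeds_sub[OF r(2)] embeds_cosyzygy[OF A r(1) j(2)] by blast
qed

text \<open>An embedding of \<open>P1\<close> into \<open>J\<close> and a copresentation of
  \<open>P2\<close> are combined as in a mapping cone. The quotient \<open>D = J/P2\<close> is a
  summand of the pushout \<open>U\<close> and so embeds into an injective \<open>S\<close>, with
  cokernel \<open>D'\<close> an extension of \<open>E\<close> by \<open>I\<close>; here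
  \<open>E\<close> is injective by \<open>cosyzygy_injective\<close>. As \<open>K\<close> is a
  subobject of \<open>D\<close> with quotient \<open>R\<close>, its cokernel in \<open>S\<close> is
  an extension of \<open>D'\<close> by \<open>R\<close>, and both embed.\<close>

lemma embeds2_quotient:
  assumes d: "ses C P2 d P1 p K" and "projective C P2" "projective C P1"
  shows "embeds2 K"
proof -
  obtain a1 J q1 R b1 J1 where a1: "ses C P1 a1 J q1 R" "injective C J" "embeds R"
    using copresentation[OF assms(3)] unfolding embeds_def by blast
  obtain a2 I q2 Q b2 I2 c2 E where a2: "ses C P2 a2 I q2 Q" "ses C Q b2 I2 c2 E"
    "injective C I" "injective C I2"
    using copresentation[OF assms(2)] by blast
  have E: "embeds E" using cosyzygy_injective[OF a2] embeds_injective by blast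
  obtain D r u v where D: "ses C P2 (a1 \<cdot> d) J r D" "ses C K u D v R"
    using ses_composite_inflations[OF d a1(1)] by blast
  obtain U a' b' f' c' where U: "ses C I a' U b' D" "ses C J f' U c' Q"
    using ses_pushout_inflations[OF D(1) a2(1)] by blast
  obtain \<rho> where "\<rho> \<in> Hom C U I" "\<rho> \<cdot> a' = Ide C I"
    using injective_extend[OF a2(3) U(1) Ide_Hom] ses_Obj[OF U(1)] by blast
  then obtain \<sigma> where \<sigma>: "ses C D \<sigma> U \<rho> I" using ses_split[OF U(1)] by blast
  obtain S e c'' where S: "ses C U e S c'' E" "injective C S"
    using split_embedding[OF U(2) a1(2) a2(2,4)] by blast
  obtain D' r2 u2 v2 where D': "ses C D (e \<cdot> \<sigma>) S r2 D'" "ses C I u2 D' v2 E"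
    using ses_composite_inflations[OF \<sigma> S(1)] by blast
  have "embeds D'" using embeds_extension[OF D'(2) embeds_injective[OF a2(3)] E] .
  moreover obtain K' r3 u3 v3 where K': "ses C K (e \<cdot> \<sigma> \<cdot> u) S r3 K'" "ses C R u3 K' v3 D'"
    using ses_composite_inflations[OF D(2) D'(1)] by blast
  ultimately have "embeds K'" using embeds_extension[OF K'(2) a1(3)] by blast
  then show ?thesis using K'(1) S(2) by (auto simp: embeds2_def)
qed

text \<open>Every object is a quotient of a projective by a first syzygy, and the syzygy is itself a
  quotient of projectives.\<close>

lemma enough_injectives: "enough_injectives C"
  unfolding enough_injectives_def
proof
  fix X assume "X \<in> Obj C"
  then obtain P2 d P1 p K l P0 r where d: "ses C P2 d P1 p K" and l: "ses C K l P0 r X"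
    and P: "projective C P2" "projective C P1" "projective C P0"
    using resolution by blast
  have "embeds P0" using copresentation[OF P(3)] unfolding embeds_def by blast
  then have "embeds X" using embeds_quotient[OF l embeds2_quotient[OF d P(1,2)]] by blast
  then obtain i I q D where i: "ses C X i I q D" "injective C I" by (auto simp: embeds_def)
  then show "\<exists>i. inflation C i \<and> Dom C i = X \<and> injective C (Cod C i)"
    using ses_inflation[OF i(1)] ses_Hom[OF i(1)] by (auto simp: Hom_def)
qed

section \<open>Torsion objects and second syzygies\<close>

lemma perp_zero: "\<lbrakk>T \<in> left_perp C (Proj C); projective C P; f \<in> Hom C T P\<rbrakk> \<Longrightarrow> f = \<zero> T P"
  by (auto simp: left_perp_def Proj_def)

lemma perp_Obj: "T \<in> left_perp C (Proj C) \<Longrightarrow> T \<in> Obj C"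
  by (simp add: left_perp_def)

text \<open>Projectives embed into projective-injectives, so these suffice for testing.\<close>

lemma perpI:
  assumes "T \<in> Obj C"
    "\<And>I f. \<lbrakk>projective C I; injective C I; f \<in> Hom C T I\<rbrakk> \<Longrightarrow> f = \<zero> T I"
  shows "T \<in> left_perp C (Proj C)"
  unfolding left_perp_def Proj_def
proof (intro CollectI conjI ballI equalityI subsetI)
  fix P f assume "P \<in> Collect (projective C)" and f: "f \<in> Hom C T P"
  then obtain a I1 q Q where a: "ses C P a I1 q Q" "projective C I1" "injective C I1"
    using copresentation by blast
  have "a \<cdot> f = \<zero> T I1"
    by (rule assms(2)) (use a f ses_Hom[OF a(1)] in \<open>simp_all add: Hom_def\<close>)
  then show "f \<in> {\<zero> T P}" using ses_mono0[OF a(1) f] by simp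
next
  fix P f assume "P \<in> Collect (projective C)" "f \<in> {\<zero> T P}"
  then show "f \<in> Hom C T P" using zero_Hom assms(1) by (auto simp: projective_def)
qed (rule assms(1))

text \<open>Against projective-injectives, which suffice by \<open>perpI\<close>, a morphism from a
  subobject extends to \<open>B\<close> and vanishes there.\<close>

lemma perp_sub:
  assumes "ses C A i B p D" "B \<in> left_perp C (Proj C)"
  shows "A \<in> left_perp C (Proj C)"
proof (rule perpI)
  note H = ses_Hom[OF assms(1)]
  show "A \<in> Obj C" using ses_Obj[OF assms(1)] by simp
  fix I f assume I: "projective C I" "injective C I" "f \<in> Hom C A I"
  obtain g where g: "g \<in> Hom C B I" "g \<cdot> i = f" using injective_extend[OF I(2) assms(1) I(3)] by blast
  then have "g = \<zero> B I" using perp_zero[OF assms(2) I(1)] by blast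
  then show "f = \<zero> A I" using g H Hom_Obj[OF I(3)] by (auto simp: Hom_def)
qed

lemma perp_quotient:
  assumes "ses C A i B p D" "B \<in> left_perp C (Proj C)"
  shows "D \<in> left_perp C (Proj C)"
proof (rule perpI)
  show "D \<in> Obj C" using ses_Obj[OF assms(1)] by simp
  fix I f assume I: "projective C I" "injective C I" "f \<in> Hom C D I"
  have "f \<cdot> p = \<zero> B I"
    by (rule perp_zero[OF assms(2) I(1)]) (use I ses_Hom[OF assms(1)] in \<open>simp add: Hom_def\<close>)
  then show "f = \<zero> D I" using ses_epi0[OF assms(1) I(3)] by simp
qed

text \<open>The vanishing of Ext^1(T, P). A morphism to \<open>P\<close> extends as a morphism to
  \<open>I1\<close>; the obstruction to staying in \<open>P\<close> is a morphism from
  \<open>T\<close> to \<open>Q\<close>, which vanishes because \<open>Q\<close> embeds into the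
  projective \<open>I2\<close>.\<close>

lemma perp_extend:
  assumes T: "T \<in> left_perp C (Proj C)" and j: "ses C J j Z c T" and h: "h \<in> Hom C J P"
    and P: "projective C P"
  shows "\<exists>g \<in> Hom C Z P. g \<cdot> j = h"
proof -
  obtain a I1 q Q b I2 c' E where a: "ses C P a I1 q Q" and b: "ses C Q b I2 c' E"
    and I: "injective C I1" "projective C I2"
    using copresentation[OF P] by blast
  note Hj = ses_Hom[OF j] and Ha = ses_Hom[OF a] and Hb = ses_Hom[OF b]
    and O = ses_Obj[OF j] ses_Obj[OF a] ses_Obj[OF b]
  have "a \<cdot> h \<in> Hom C J I1" using Ha h by (simp add: Hom_def)
  then obtain u where u: "u \<in> Hom C Z I1" "u \<cdot> j = a \<cdot> h" using injective_extend[OF I(1) j] by blast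
  have "q \<cdot> u \<in> Hom C Z Q" "(q \<cdot> u) \<cdot> j = \<zero> J Q"
    using u Hj Ha h O by (simp_all add: Hom_def cx[OF ses_comp[OF a]])
  then obtain w where w: "w \<in> Hom C T Q" "w \<cdot> c = q \<cdot> u" using ses_colift[OF j] by blast
  have "b \<cdot> w = \<zero> T I2" by (rule perp_zero[OF T I(2)]) (use w Hb in \<open>simp add: Hom_def\<close>)
  then have "w = \<zero> T Q" using ses_mono0[OF b w(1)] by simp
  then have "q \<cdot> u = \<zero> Z Q" using w Hj O by (auto simp: Hom_def)
  then obtain v where v: "v \<in> Hom C Z P" "a \<cdot> v = u" using ses_lift[OF a u(1)] by blast
  have "v \<cdot> j = h"
    by (rule ses_mono[OF a, of _ J]) (use v u Ha Hj h in \<open>simp_all add: Hom_def cx[OF v(2)]\<close>)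
  then show ?thesis using v by blast
qed

text \<open>Two extensions differ by a morphism that factors through \<open>T\<close>, and Hom(T, P)
  = 0.\<close>

lemma perp_extend_unique:
  assumes T: "T \<in> left_perp C (Proj C)" and j: "ses C J j Z c T" and P: "projective C P"
    and g: "g \<in> Hom C Z P" "g' \<in> Hom C Z P" "g \<cdot> j = g' \<cdot> j"
  shows "g = g'"
proof -
  note Hj = ses_Hom[OF j] and O = ses_Obj[OF j] Hom_Obj[OF g(1)]
  have "g \<ominus> g' \<in> Hom C Z P" "(g \<ominus> g') \<cdot> j = \<zero> J P"
    using g Hj by (simp_all add: Hom_def)
  then obtain w where w: "w \<in> Hom C T P" "w \<cdot> c = g \<ominus> g'" using ses_colift[OF j] by blast
  then have "w = \<zero> T P" using perp_zero[OF T P] by blast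
  then have "g \<ominus> g' = \<zero> Z P" using w Hj O by (auto simp: Hom_def)
  then show ?thesis using sub_eq_zero_iff[of g g' Z P] g by (simp add: Hom_def)
qed

text \<open>Pulling the conflation back along \<open>u\<close> gives an extension of
  \<open>T\<close> by a projective, which splits by \<open>perp_extend\<close> applied to the
  identity.\<close>

lemma perp_lift:
  assumes T: "T \<in> left_perp C (Proj C)" and f: "ses C X f Y q J" and X: "projective C X"
    and u: "u \<in> Hom C T J"
  shows "\<exists>v \<in> Hom C T Y. q \<cdot> v = u"
proof -
  note Hf = ses_Hom[OF f]
  obtain Y' a' b' f' where a': "ses C X a' Y' b' T" and f': "f' \<in> Hom C Y' Y" "q \<cdot> f' = u \<cdot> b'"
    using ses_pullback[OF f u] by blast
  note Ha = ses_Hom[OF a'] and O = ses_Obj[OF a']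
  obtain \<rho> where "\<rho> \<in> Hom C Y' X" "\<rho> \<cdot> a' = Ide C X"
    using perp_extend[OF T a' Ide_Hom[OF O(1)] X] by blast
  then obtain \<sigma> where \<sigma>: "ses C T \<sigma> Y' \<rho> X" "b' \<cdot> \<sigma> = Ide C T" using ses_split[OF a'] by blast
  have "f' \<cdot> \<sigma> \<in> Hom C T Y" "q \<cdot> (f' \<cdot> \<sigma>) = u"
    using f' ses_Hom[OF \<sigma>(1)] \<sigma>(2) Ha Hf u by (simp_all add: Hom_def cx[OF f'(2)])
  then show ?thesis by blast
qed

text \<open>A quotient of a projective by a projective subobject is torsion-free, because a morphism
  from a torsion object would lift to \<open>Y\<close>. This covers the cokernels of inflations
  between projectives.\<close>

lemma perp_zero_quotient:
  assumes T: "T \<in> left_perp C (Proj C)" and f: "ses C X f Y q J"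
    and "projective C X" "projective C Y" and u: "u \<in> Hom C T J"
  shows "u = \<zero> T J"
proof -
  obtain v where v: "v \<in> Hom C T Y" "q \<cdot> v = u" using perp_lift[OF T f assms(3) u] by blast
  then have "v = \<zero> T Y" using perp_zero[OF T assms(4)] by blast
  then show ?thesis using v ses_Hom[OF f] perp_Obj[OF T] by (auto simp: Hom_def)
qed

text \<open>The comparison theorem in the lowest three degrees, the third being the second syzygies
  \<open>N\<close> and \<open>N'\<close>.\<close>

lemma resolution_map:
  assumes i: "ses C N i Q1 q J" and j: "ses C J j Q0 r T" and Q: "projective C Q1" "projective C Q0"
    and d: "ses C N' d P1 p K" and l: "ses C K l P0 r' T"
  shows "\<exists>\<phi>0 \<phi>1 \<phi>2. \<phi>0 \<in> Hom C Q0 P0 \<and> \<phi>1 \<in> Hom C Q1 P1 \<and> \<phi>2 \<in> Hom C N N' \<and>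
    r' \<cdot> \<phi>0 = r \<and> \<phi>0 \<cdot> (j \<cdot> q) = l \<cdot> (p \<cdot> \<phi>1) \<and> \<phi>1 \<cdot> i = d \<cdot> \<phi>2"
proof -
  note Hi = ses_Hom[OF i] and Hj = ses_Hom[OF j] and Hd = ses_Hom[OF d] and Hl = ses_Hom[OF l]
    and O = ses_Obj[OF i] ses_Obj[OF d] ses_Obj[OF l] ses_Obj[OF j]
  obtain \<phi>0 where \<phi>0: "\<phi>0 \<in> Hom C Q0 P0" "r' \<cdot> \<phi>0 = r" using projective_lift[OF Q(2) l Hj(2)] by blast
  have "\<phi>0 \<cdot> j \<in> Hom C J P0" "r' \<cdot> (\<phi>0 \<cdot> j) = \<zero> J T"
    using \<phi>0 Hj Hl by (simp_all add: Hom_def cx[OF \<phi>0(2)] ses_comp[OF j])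
  then obtain \<kappa> where \<kappa>: "\<kappa> \<in> Hom C J K" "l \<cdot> \<kappa> = \<phi>0 \<cdot> j" using ses_lift[OF l] by blast
  have "\<kappa> \<cdot> q \<in> Hom C Q1 K" using \<kappa> Hi by (simp add: Hom_def)
  then obtain \<phi>1 where \<phi>1: "\<phi>1 \<in> Hom C Q1 P1" "p \<cdot> \<phi>1 = \<kappa> \<cdot> q"
    using projective_lift[OF Q(1) d] by blast
  have "\<phi>1 \<cdot> i \<in> Hom C N P1" "p \<cdot> (\<phi>1 \<cdot> i) = \<zero> N K"
    using \<phi>1 Hi \<kappa>(1) Hd O by (simp_all add: Hom_def cx[OF \<phi>1(2)] ses_comp[OF i])
  then obtain \<phi>2 where \<phi>2: "\<phi>2 \<in> Hom C N N'" "d \<cdot> \<phi>2 = \<phi>1 \<cdot> i" using ses_lift[OF d] by blast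
  have "\<phi>0 \<cdot> (j \<cdot> q) = l \<cdot> (p \<cdot> \<phi>1)"
    using cx[OF \<kappa>(2), of q] \<phi>1(2) \<phi>0(1) \<kappa>(1) Hj Hl Hi by (simp add: Hom_def)
  then show ?thesis using \<phi>0 \<phi>1(1) \<phi>2 by metis
qed

text \<open>The homotopy \<open>\<psi> \<phi> \<sim> 1\<close> of a comparison with a resolution of length two exhibits the
  identity of a second syzygy as a sum of two maps that factor through projectives.\<close>

lemma second_syzygy_projective:
  assumes i: "ses C N i Q1 q J" and j: "ses C J j Q0 r T" and Q: "projective C Q1" "projective C Q0"
  shows "projective C N"
proof -
  note Hi = ses_Hom[OF i] and Hj = ses_Hom[OF j] and O = ses_Obj[OF i] ses_Obj[OF j]
  obtain P2 d P1 p K l P0 r' where d: "ses C P2 d P1 p K" and l: "ses C K l P0 r' T"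
    and P: "projective C P2" "projective C P1" "projective C P0"
    using resolution[OF O(6)] by blast
  note Hd = ses_Hom[OF d] and Hl = ses_Hom[OF l]
  obtain \<phi>0 \<phi>1 \<phi>2 where \<phi>: "\<phi>0 \<in> Hom C Q0 P0" "\<phi>1 \<in> Hom C Q1 P1" "\<phi>2 \<in> Hom C N P2"
    "r' \<cdot> \<phi>0 = r" "\<phi>0 \<cdot> (j \<cdot> q) = l \<cdot> (p \<cdot> \<phi>1)" "\<phi>1 \<cdot> i = d \<cdot> \<phi>2"
    using resolution_map[OF i j Q d l] by blast
  obtain \<psi>0 \<psi>1 \<psi>2 where \<psi>: "\<psi>0 \<in> Hom C P0 Q0" "\<psi>1 \<in> Hom C P1 Q1" "\<psi>2 \<in> Hom C P2 N"
    "r \<cdot> \<psi>0 = r'" "\<psi>0 \<cdot> (l \<cdot> p) = j \<cdot> (q \<cdot> \<psi>1)" "\<psi>1 \<cdot> d = i \<cdot> \<psi>2"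
    using resolution_map[OF d l P(2,3) i j] by blast
  \<comment> \<open>The homotopy consists of \<open>h0\<close> and \<open>h\<close> with
    \<open>\<psi>0 \<phi>0 = 1 + j q h0\<close> and
    \<open>\<psi>1 \<phi>1 = 1 + h0 j q + i h\<close>. Restricted to \<open>N\<close>, where
    \<open>q\<close> vanishes, the second equation leaves
    \<open>\<psi>2 \<phi>2 = 1 + h i\<close>.\<close>
  have "\<psi>0 \<cdot> \<phi>0 \<in> Hom C Q0 Q0" "r \<cdot> (\<psi>0 \<cdot> \<phi>0) = r \<cdot> Ide C Q0"
    using \<phi>(1) \<psi>(1) Hj by (simp_all add: Hom_def cx[OF \<psi>(4)] \<phi>(4))
  then obtain h' where h': "h' \<in> Hom C Q0 J" "\<psi>0 \<cdot> \<phi>0 = Ide C Q0 \<oplus> j \<cdot> h'"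
    using ses_lift_sub[OF j _ Ide_Hom[OF O(5)]] by blast
  obtain h0 where h0: "h0 \<in> Hom C Q0 Q1" "q \<cdot> h0 = h'" using projective_lift[OF Q(2) i h'(1)] by blast
  have j\<psi>: "j \<cdot> (q \<cdot> (\<psi>1 \<cdot> \<phi>1)) = (\<psi>0 \<cdot> \<phi>0) \<cdot> (j \<cdot> q)"
  proof -
    have "(j \<cdot> (q \<cdot> \<psi>1)) \<cdot> \<phi>1 = \<psi>0 \<cdot> (l \<cdot> (p \<cdot> \<phi>1))"
      unfolding \<psi>(5)[symmetric] using \<psi>(1,2) \<phi>(2) Hl Hd by (simp add: Hom_def)
    also have "\<dots> = (\<psi>0 \<cdot> \<phi>0) \<cdot> (j \<cdot> q)"
      unfolding \<phi>(5)[symmetric] using \<psi>(1) \<phi>(1) Hi Hj by (simp add: Hom_def)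
    finally show ?thesis using \<psi>(2) \<phi>(2) Hi Hj by (simp add: Hom_def)
  qed
  have e: "j \<cdot> (q \<cdot> (\<psi>1 \<cdot> \<phi>1)) = j \<cdot> (q \<cdot> (Ide C Q1 \<oplus> h0 \<cdot> (j \<cdot> q)))"
    unfolding j\<psi> h'(2) using h0 h'(1) Hi Hj O by (simp add: Hom_def cx[OF h0(2)])
  have e2: "q \<cdot> (\<psi>1 \<cdot> \<phi>1) = q \<cdot> (Ide C Q1 \<oplus> h0 \<cdot> (j \<cdot> q))"
    by (rule ses_mono[OF j _ _ e]) (use \<psi>(2) \<phi>(2) h0(1) Hi Hj O in \<open>simp_all add: Hom_def\<close>)
  have "\<psi>1 \<cdot> \<phi>1 \<in> Hom C Q1 Q1" "Ide C Q1 \<oplus> h0 \<cdot> (j \<cdot> q) \<in> Hom C Q1 Q1"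
    using \<psi>(2) \<phi>(2) h0(1) Hi Hj O by (simp_all add: Hom_def)
  then obtain h where h: "h \<in> Hom C Q1 N" "\<psi>1 \<cdot> \<phi>1 = (Ide C Q1 \<oplus> h0 \<cdot> (j \<cdot> q)) \<oplus> i \<cdot> h"
    using ses_lift_sub[OF i _ _ e2] by blast
  have "i \<cdot> (\<psi>2 \<cdot> \<phi>2) = (i \<cdot> \<psi>2) \<cdot> \<phi>2" using \<psi>(3) \<phi>(3) Hi by (simp add: Hom_def)
  also have "\<dots> = \<psi>1 \<cdot> (d \<cdot> \<phi>2)" unfolding \<psi>(6)[symmetric] using \<psi>(2) \<phi>(3) Hd by (simp add: Hom_def)
  also have "\<dots> = (\<psi>1 \<cdot> \<phi>1) \<cdot> i" unfolding \<phi>(6)[symmetric] using \<psi>(2) \<phi>(2) Hi by (simp add: Hom_def)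
  also have "\<dots> = i \<cdot> (Ide C N \<oplus> h \<cdot> i)"
    unfolding h(2) using h(1) h0(1) Hi Hj O by (simp add: Hom_def ses_comp[OF i])
  finally have e3: "i \<cdot> (\<psi>2 \<cdot> \<phi>2) = i \<cdot> (Ide C N \<oplus> h \<cdot> i)" .
  have 1: "\<psi>2 \<cdot> \<phi>2 = Ide C N \<oplus> h \<cdot> i"
    by (rule ses_mono[OF i _ _ e3]) (use \<psi>(3) \<phi>(3) h(1) Hi O in \<open>simp_all add: Hom_def\<close>)
  show ?thesis
  proof (rule projectiveI[OF O(1)])
    fix A a B b D z assume b: "ses C A a B b D" and z: "z \<in> Hom C N D"
    note Hb = ses_Hom[OF b] and OD = ses_Obj(3)[OF b]
    have "z \<cdot> \<psi>2 \<in> Hom C P2 D" "z \<cdot> h \<in> Hom C Q1 D" using z \<psi>(3) h(1) by (simp_all add: Hom_def)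
    then obtain y1 y2 where y: "y1 \<in> Hom C P2 B" "b \<cdot> y1 = z \<cdot> \<psi>2" "y2 \<in> Hom C Q1 B" "b \<cdot> y2 = z \<cdot> h"
      using projective_lift[OF P(1) b] projective_lift[OF Q(1) b] by meson
    have "b \<cdot> (y1 \<cdot> \<phi>2 \<ominus> y2 \<cdot> i) = z \<cdot> (\<psi>2 \<cdot> \<phi>2 \<ominus> h \<cdot> i)"
      using y Hb \<phi>(3) \<psi>(3) h(1) Hi z by (simp add: Hom_def cx[OF y(2)] cx[OF y(4)])
    also have "\<psi>2 \<cdot> \<phi>2 \<ominus> h \<cdot> i = Ide C N"
      unfolding 1 using h(1) Hi O by (simp add: Hom_def)
    finally have "b \<cdot> (y1 \<cdot> \<phi>2 \<ominus> y2 \<cdot> i) = z" using z by (simp add: Hom_def)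
    then show "\<exists>y \<in> Hom C N B. b \<cdot> y = z"
      using y \<phi>(3) Hi by (intro bexI[of _ "y1 \<cdot> \<phi>2 \<ominus> y2 \<cdot> i"]) (simp_all add: Hom_def)
  qed
qed

end

section \<open>The exact structure on the projective objects\<close>

text \<open>The inflation part of \<open>f\<close> is monic, so \<open>f\<close> has the kernel of
  its deflation part, and \<open>G_ses\<close> applies. With condition (2) this recognizes
  deflations onto torsion objects.\<close>

lemma (in exact_category_gen) G_deflation:
  assumes f: "f \<in> Hom C X Y" and "admissible_arr C f"
    and surj: "\<And>P z. \<lbrakk>P \<in> G; z \<in> Hom C P Y\<rbrakk> \<Longrightarrow> \<exists>y \<in> Hom C P X. f \<cdot> y = z"
  shows "\<exists>K k. ses C K k X f Y"
proof -
  obtain K k I p m c F where p: "ses C K k X p I" and m: "ses C I m Y c F" and fmp: "f = m \<cdot> p"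
    using admissible_ses[OF assms(2) f] by blast
  note Hp = ses_Hom[OF p] and Hm = ses_Hom[OF m] and O = ses_Obj[OF p] ses_Obj[OF m]
  have "ses C K k X f Y"
  proof (rule G_ses[OF Hp(1) f])
    show "f \<cdot> k = \<zero> K Y" using Hp Hm O ses_comp[OF p] by (simp add: fmp Hom_def)
    show "x = \<zero> P K" if "x \<in> Hom C P K" "k \<cdot> x = \<zero> P X" for P x using ses_mono0[OF p that] .
    show "\<exists>x \<in> Hom C P K. k \<cdot> x = y" if y: "y \<in> Hom C P X" "f \<cdot> y = \<zero> P Y" for P y
    proof -
      have "p \<cdot> y \<in> Hom C P I" "m \<cdot> (p \<cdot> y) = \<zero> P Y" using y Hp Hm by (simp_all add: fmp Hom_def)
      then have "p \<cdot> y = \<zero> P I" by (rule ses_mono0[OF m])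
      then show ?thesis using ses_lift[OF p y(1)] by blast
    qed
  qed (rule surj)
  then show ?thesis by blast
qed

locale auslander_category = auslander_dim_category +
  assumes admissible_to_perp:
      "\<lbrakk>f \<in> Hom C X T; T \<in> left_perp C (Proj C)\<rbrakk> \<Longrightarrow> admissible_arr C f"
    and approximation:
      "X \<in> Obj C \<Longrightarrow> \<exists>f. left_approximation C (Proj C) f X \<and> admissible_arr C f"
begin

text \<open>The kernel \<open>T\<close> of an admissible approximation is torsion: a morphism from
  \<open>T\<close> to a projective-injective extends to \<open>X\<close> by injectivity, then
  factors through the approximation by projectivity, and so vanishes on \<open>T\<close>.\<close>

lemma approximation_ses:
  assumes "X \<in> Obj C"
  shows "\<exists>T t L l Z m c H. ses C T t X l L \<and> ses C L m Z c H \<and> projective C Z \<and>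
    T \<in> left_perp C (Proj C) \<and>
    (\<forall>P g. projective C P \<longrightarrow> g \<in> Hom C X P \<longrightarrow> (\<exists>h \<in> Hom C Z P. h \<cdot> (m \<cdot> l) = g))"
proof -
  obtain \<theta> where \<theta>: "left_approximation C (Proj C) \<theta> X" "admissible_arr C \<theta>"
    using approximation[OF assms] by blast
  define Z where "Z = Cod C \<theta>"
  have \<theta>H: "\<theta> \<in> Hom C X Z" and Z: "projective C Z"
    and ext: "\<And>P g. projective C P \<Longrightarrow> g \<in> Hom C X P \<Longrightarrow> \<exists>h \<in> Hom C Z P. g = h \<cdot> \<theta>"
    using \<theta>(1) by (auto simp: left_approximation_def Z_def Hom_def Proj_def)
  obtain T t L l m c H where t: "ses C T t X l L" and m: "ses C L m Z c H" and \<theta>ml: "\<theta> = m \<cdot> l"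
    using admissible_ses[OF \<theta>(2) \<theta>H] by blast
  note Ht = ses_Hom[OF t] and Hm = ses_Hom[OF m]
  have "T \<in> left_perp C (Proj C)"
  proof (rule perpI)
    show "T \<in> Obj C" using ses_Obj[OF t] by simp
    fix I f assume I: "projective C I" "injective C I" "f \<in> Hom C T I"
    obtain g where g: "g \<in> Hom C X I" "g \<cdot> t = f" using injective_extend[OF I(2) t I(3)] by blast
    obtain h where h: "h \<in> Hom C Z I" "g = h \<cdot> \<theta>" using ext[OF I(1) g(1)] by blast
    show "f = \<zero> T I"
      using g(2) h Ht Hm ses_Obj[OF m] ses_Obj[OF t] ses_comp[OF t] unfolding \<theta>ml
      by (auto simp: Hom_def)
  qed
  moreover have "\<exists>h \<in> Hom C Z P. h \<cdot> (m \<cdot> l) = g" if "projective C P" "g \<in> Hom C X P" for P g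
    using ext[OF that] \<theta>ml by blast
  ultimately show ?thesis using t m Z by blast
qed

text \<open>A minimal approximation is obtained by shrinking the target \<open>Z\<close> of an arbitrary one to the
  kernel of the composite of the cokernel \<open>Z \<rightarrow> H\<close> with the torsion-free quotient of \<open>H\<close>;
  this kernel is a second syzygy.\<close>

lemma torsion_approximation:
  assumes "X \<in> Obj C"
  shows "\<exists>T t L l Z m c T'. ses C T t X l L \<and> ses C L m Z c T' \<and> projective C Z \<and>
    T \<in> left_perp C (Proj C) \<and> T' \<in> left_perp C (Proj C)"
proof -
  obtain T t L l Z0 m0 c0 H where t: "ses C T t X l L" and m0: "ses C L m0 Z0 c0 H"
    and Z0: "projective C Z0" and T: "T \<in> left_perp C (Proj C)"
    using approximation_ses[OF assms] by metis
  obtain T1 t1 H1 l1 Z1 m1 c1 H2 where t1: "ses C T1 t1 H l1 H1" and m1: "ses C H1 m1 Z1 c1 H2"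
    and Z1: "projective C Z1" and T1: "T1 \<in> left_perp C (Proj C)"
    using approximation_ses[OF ses_Obj(3)[OF m0]] by metis
  note Hm0 = ses_Hom[OF m0] and Ht1 = ses_Hom[OF t1] and O = ses_Obj[OF m0] ses_Obj[OF t1]
  have "deflation C (l1 \<cdot> c0)" "l1 \<cdot> c0 \<in> Hom C Z0 H1"
    using Comp_deflation[OF ses_deflation[OF m0] ses_deflation[OF t1]] Hm0 Ht1
    by (simp_all add: Hom_def)
  then obtain Z z where z: "ses C Z z Z0 (l1 \<cdot> c0) H1" using deflation_ses by blast
  note Hz = ses_Hom[OF z] and OZ = ses_Obj(1)[OF z]
  have Z: "projective C Z" using second_syzygy_projective[OF z m1 Z0 Z1] .
  have "(l1 \<cdot> c0) \<cdot> m0 = \<zero> L H1" using Hm0 Ht1 O by (simp add: Hom_def ses_comp[OF m0])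
  then obtain m where m: "m \<in> Hom C L Z" "z \<cdot> m = m0" using ses_lift[OF z Hm0(1)] by blast
  have "c0 \<cdot> z \<in> Hom C Z H" "l1 \<cdot> (c0 \<cdot> z) = \<zero> Z H1"
    using ses_comp[OF z] Hm0 Ht1 Hz by (simp_all add: Hom_def)
  then obtain c where c: "c \<in> Hom C Z T1" "t1 \<cdot> c = c0 \<cdot> z" using ses_lift[OF t1] by blast
  \<comment> \<open>\<open>Z\<close> is the preimage in \<open>Z0\<close> of the torsion part
    \<open>T1\<close> of \<open>H = Z0/L\<close>, so the quotient of \<open>Z\<close> by
    \<open>L\<close> is \<open>T1\<close>.\<close>
  have "ses C L m Z c T1"
  proof (rule G_ses[OF m(1) c(1)])
    show "c \<cdot> m = \<zero> L T1"
      by (rule ses_mono0[OF t1])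
        (use m c Ht1 Hm0 Hz in \<open>simp_all add: Hom_def cx[OF c(2)] ses_comp[OF m0]\<close>)
  next
    fix P x assume x: "x \<in> Hom C P L" "m \<cdot> x = \<zero> P Z"
    have "P \<in> Obj C" using Hom_Obj[OF x(1)] by simp
    then have "m0 \<cdot> x = \<zero> P Z0" using cx[OF m(2), of x] x m(1) Hz by (simp add: Hom_def)
    then show "x = \<zero> P L" by (rule ses_mono0[OF m0 x(1)])
  next
    fix P y assume y: "y \<in> Hom C P Z" "c \<cdot> y = \<zero> P T1"
    have OP: "P \<in> Obj C" using Hom_Obj[OF y(1)] by simp
    have "z \<cdot> y \<in> Hom C P Z0" "c0 \<cdot> (z \<cdot> y) = \<zero> P H"
      using cx[OF c(2), of y] y c(1) Hz Ht1 Hm0 OP by (simp_all add: Hom_def)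
    then obtain x where x: "x \<in> Hom C P L" "m0 \<cdot> x = z \<cdot> y" using ses_lift[OF m0] by blast
    have "m \<cdot> x = y"
      by (rule ses_mono[OF z, of _ P]) (use x y m Hz in \<open>simp_all add: Hom_def cx[OF m(2)]\<close>)
    then show "\<exists>x \<in> Hom C P L. m \<cdot> x = y" using x by blast
  next
    fix P y assume P: "P \<in> Proj C" and y: "y \<in> Hom C P T1"
    have "t1 \<cdot> y \<in> Hom C P H" using y Ht1 by (simp add: Hom_def)
    then obtain u where u: "u \<in> Hom C P Z0" "c0 \<cdot> u = t1 \<cdot> y" using G_lift[OF P m0] by blast
    have "(l1 \<cdot> c0) \<cdot> u = \<zero> P H1"
      using u y Hm0 Ht1 O by (simp add: Hom_def cx[OF ses_comp[OF t1]])
    then obtain w where w: "w \<in> Hom C P Z" "z \<cdot> w = u" using ses_lift[OF z u(1)] by blast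
    have "c \<cdot> w = y"
      by (rule ses_mono[OF t1, of _ P])
        (use w u c y Ht1 Hm0 Hz in \<open>simp_all add: Hom_def cx[OF c(2)]\<close>)
    then show "\<exists>w \<in> Hom C P Z. c \<cdot> w = y" using w by blast
  qed
  then show ?thesis using t Z T T1 by blast
qed

lemma torsion_free_embedding:
  assumes "X \<in> Obj C"
    and "\<And>T u. \<lbrakk>T \<in> left_perp C (Proj C); u \<in> Hom C T X\<rbrakk> \<Longrightarrow> u = \<zero> T X"
  shows "\<exists>Z m c T. ses C X m Z c T \<and> projective C Z \<and> T \<in> left_perp C (Proj C)"
proof -
  obtain T t L l Z m c T' where t: "ses C T t X l L" and m: "ses C L m Z c T'"
    and Z: "projective C Z" and T: "T \<in> left_perp C (Proj C)" "T' \<in> left_perp C (Proj C)"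
    using torsion_approximation[OF assms(1)] by metis
  have "is_iso C l"
    by (rule ses_zero_left[OF t assms(2)[OF T(1) ses_Hom(1)[OF t]]])
  then show ?thesis using ses_iso_precomp[OF m _ ses_Hom(2)[OF t]] Z T by blast
qed

end

text \<open>The conflations \<open>X \<rightarrow> Y \<rightarrow> Z\<close> are the projective resolutions of the objects \<open>T\<close> that are left
  orthogonal to the projectives.\<close>

definition proj_excat :: "('o, 'm) excat \<Rightarrow> ('o, 'm) excat" where
  "proj_excat C = (full_subcategory C (Proj C))\<lparr>Confl :=
     {(f, g). \<exists>X Y q J j Z c T. ses C X f Y q J \<and> ses C J j Z c T \<and> g = j \<cdot>\<^bsub>C\<^esub> q \<and>
        projective C X \<and> projective C Y \<and> projective C Z \<and> T \<in> left_perp C (Proj C)}\<rparr>"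

lemma proj_excat_simps [simp]:
  "Obj (proj_excat C) = {P. projective C P}"
  "f \<in> Arr (proj_excat C) \<longleftrightarrow> f \<in> Arr C \<and> projective C (Dom C f) \<and> projective C (Cod C f)"
  "Dom (proj_excat C) = Dom C" "Cod (proj_excat C) = Cod C" "Ide (proj_excat C) = Ide C"
  "Comp (proj_excat C) = Comp C" "Add (proj_excat C) = Add C" "ZeroArr (proj_excat C) = ZeroArr C"
  by (auto simp: proj_excat_def full_subcategory_def Proj_def projective_def)

lemma proj_excat_Hom:
  "f \<in> Hom (proj_excat C) X Y \<longleftrightarrow> f \<in> Hom C X Y \<and> projective C X \<and> projective C Y"
  by (auto simp: Hom_def)

lemma proj_excat_Hom_eq:
  "\<lbrakk>projective C X; projective C Y\<rbrakk> \<Longrightarrow> Hom (proj_excat C) X Y = Hom C X Y"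
  by (auto simp: Hom_def)

lemma proj_excat_Confl:
  "(f, g) \<in> Confl (proj_excat C) \<longleftrightarrow> (\<exists>X Y q J j Z c T. ses C X f Y q J \<and> ses C J j Z c T \<and>
     g = j \<cdot>\<^bsub>C\<^esub> q \<and> projective C X \<and> projective C Y \<and> projective C Z \<and> T \<in> left_perp C (Proj C))"
  by (simp add: proj_excat_def)

section \<open>The axioms of an exact category for the projective objects\<close>

context auslander_category
begin

abbreviation E where "E \<equiv> proj_excat C"

lemma proj_Obj: "projective C P \<Longrightarrow> P \<in> Obj C"
  by (simp add: projective_def)

lemma proj_excat_category: "category E"
proof (rule category.intro)
  fix X assume "X \<in> Obj E"
  then show "Ide E X \<in> Hom E X X" using Ide_Hom proj_Obj by (simp add: proj_excat_Hom)
qed (use Comp_Hom Comp_assoc Comp_Ide Ide_Comp in \<open>auto simp: proj_excat_Hom Proj_def\<close>)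

lemma proj_excat_preadditive: "preadditive_category E"
proof (intro preadditive_category.intro preadditive_category_axioms.intro proj_excat_category)
  fix X Y assume "X \<in> Obj E" "Y \<in> Obj E"
  then show "comm_group (Hom_group E X Y)"
    using Hom_comm_group[of X Y] proj_Obj by (simp add: Hom_group_def proj_excat_Hom_eq)
qed (use Comp_Add Add_Comp in \<open>auto simp: proj_excat_Hom\<close>)

lemma proj_excat_additive: "additive_category E"
proof (intro additive_category.intro additive_category_axioms.intro proj_excat_preadditive)
  obtain Z where Z: "zero_object C Z" by (rule zero_object_exists)
  have "zero_object E Z"
    using Z zero_object_projective[OF Z] proj_Obj
    unfolding zero_object_def by (simp add: proj_excat_Hom_eq)
  then show "\<exists>Z. zero_object E Z" by blast
next
  fix X Y assume XY: "X \<in> Obj E" "Y \<in> Obj E"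
  then obtain S i1 i2 p1 p2 where S: "is_biproduct C X Y S i1 i2 p1 p2"
    using ex_biproduct[of X Y] proj_Obj by auto
  have "projective C S" using biproduct_projective[OF _ _ S] XY by simp
  then have "is_biproduct E X Y S i1 i2 p1 p2"
    using S XY by (simp add: is_biproduct_def proj_excat_Hom)
  then show "\<exists>S i1 i2 p1 p2. is_biproduct E X Y S i1 i2 p1 p2" by blast
qed

text \<open>The cokernel of an inflation between projectives is torsion-free by
  \<open>perp_zero_quotient\<close>, so it embeds into a projective with torsion cokernel, which
  completes a conflation of \<open>E\<close>. The axioms for composing inflations can then be read
  off from \<open>C\<close>.\<close>

lemma proj_excat_inflation:
  "inflation E f \<longleftrightarrow> inflation C f \<and> projective C (Dom C f) \<and> projective C (Cod C f)"
proof
  assume "inflation E f"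
  then show "inflation C f \<and> projective C (Dom C f) \<and> projective C (Cod C f)"
    using ses_inflation unfolding inflation_def proj_excat_Confl by (auto simp: ses_def Hom_def)
next
  assume f: "inflation C f \<and> projective C (Dom C f) \<and> projective C (Cod C f)"
  then have "f \<in> Hom C (Dom C f) (Cod C f)" using inflation_Arr by (simp add: Hom_def)
  then obtain J q where q: "ses C (Dom C f) f (Cod C f) q J" using inflation_ses f by blast
  obtain Z m c T where "ses C J m Z c T" "projective C Z" "T \<in> left_perp C (Proj C)"
    using torsion_free_embedding[OF ses_Obj(3)[OF q]] perp_zero_quotient[OF _ q] f by blast
  then show "inflation E f" using q f unfolding inflation_def proj_excat_Confl by blast
qed

text \<open>The kernel \<open>N\<close> is a second syzygy of \<open>T\<close>, hence
  projective.\<close>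

lemma proj_excat_deflationI:
  assumes "ses C N n Y q J" "ses C J j Z c T" "projective C Y" "projective C Z"
    "T \<in> left_perp C (Proj C)"
  shows "deflation E (j \<cdot> q)"
  using assms second_syzygy_projective[OF assms(1-4)]
  unfolding deflation_def proj_excat_Confl by blast

lemma proj_excat_deflationE:
  assumes "deflation E g" "g \<in> Hom C Y Z"
  obtains N n q J j c T where "ses C N n Y q J" "ses C J j Z c T" "g = j \<cdot> q"
    "projective C N" "projective C Y" "projective C Z" "T \<in> left_perp C (Proj C)"
proof -
  obtain X f Y' q J j Z' c T where q: "ses C X f Y' q J" and j: "ses C J j Z' c T" and g: "g = j \<cdot> q"
    and P: "projective C X" "projective C Y'" "projective C Z'" "T \<in> left_perp C (Proj C)"
    using assms(1) unfolding deflation_def proj_excat_Confl by blast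
  have "Y' = Y" "Z' = Z" using assms(2) ses_Hom[OF q] ses_Hom[OF j] g by (simp_all add: Hom_def)
  then show ?thesis using that q j g P by blast
qed

text \<open>Cancel \<open>q\<close> as an epimorphism, then \<open>j\<close> by uniqueness of
  extensions along inflations with torsion cokernel.\<close>

lemma perp_epi:
  assumes q: "ses C N n Y q J" and j: "ses C J j Z c T" and T: "T \<in> left_perp C (Proj C)"
    and P: "projective C P" and w: "w \<in> Hom C Z P" "w \<cdot> (j \<cdot> q) = \<zero> Y P"
  shows "w = \<zero> Z P"
proof -
  note Hq = ses_Hom[OF q] and Hj = ses_Hom[OF j] and O = ses_Obj[OF j] proj_Obj[OF P]
  have "w \<cdot> j = \<zero> J P"
    by (rule ses_epi0[OF q]) (use w Hq Hj in \<open>simp_all add: Hom_def\<close>)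
  then have e: "w \<cdot> j = \<zero> Z P \<cdot> j" using Hj O by (simp add: Hom_def)
  show ?thesis
    by (rule perp_extend_unique[OF T j P w(1) zero_Hom e]) (use O in simp_all)
qed

text \<open>Kernel: \<open>j\<close> is monic and \<open>f\<close> is a kernel of \<open>q\<close>.
  Cokernel: a morphism to a projective that kills \<open>f\<close> descends to \<open>J\<close>, and
  from there it extends uniquely to \<open>Z\<close> because \<open>T\<close> is torsion.\<close>

lemma proj_excat_kernel_cokernel:
  assumes "(f, g) \<in> Confl E"
  shows "kernel_cokernel_pair E f g"
proof -
  obtain X Y q J j Z c T where q: "ses C X f Y q J" and j: "ses C J j Z c T" and g: "g = j \<cdot> q"
    and P: "projective C X" "projective C Y" "projective C Z" and T: "T \<in> left_perp C (Proj C)"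
    using assms unfolding proj_excat_Confl by blast
  note Hq = ses_Hom[OF q] and Hj = ses_Hom[OF j] and O = ses_Obj[OF q] ses_Obj[OF j]
  have gH: "g \<in> Hom C Y Z" and gf: "g \<cdot> f = \<zero> X Z"
    using Hq Hj O ses_comp[OF q] by (simp_all add: g Hom_def)
  have D: "Dom C f = X" "Cod C f = Y" "Dom C g = Y" "Cod C g = Z" "f \<in> Arr C" "g \<in> Arr C"
    using Hq gH by (simp_all add: Hom_def)
  have "is_kernel E f g"
    unfolding is_kernel_def
  proof (intro conjI ballI impI)
    fix W h assume "W \<in> Obj E" "h \<in> Hom E W (Dom E g)" "Comp E g h = ZeroArr E W (Cod E g)"
    then have h: "h \<in> Hom C W Y" "j \<cdot> (q \<cdot> h) = \<zero> W Z" and W: "projective C W"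
      using Hq Hj by (simp_all add: proj_excat_Hom D g Hom_def)
    have "q \<cdot> h = \<zero> W J" by (rule ses_mono0[OF j _ h(2)]) (use Hq h in \<open>simp add: Hom_def\<close>)
    then obtain x where x: "x \<in> Hom C W X" "f \<cdot> x = h" using ses_lift[OF q h(1)] by blast
    show "\<exists>!x. x \<in> Hom E W (Dom E f) \<and> Comp E f x = h"
    proof (rule ex1I[of _ x])
      show "x \<in> Hom E W (Dom E f) \<and> Comp E f x = h" using x W P(1) by (simp add: proj_excat_Hom D)
      fix y assume "y \<in> Hom E W (Dom E f) \<and> Comp E f y = h"
      then have "y \<in> Hom C W X" "f \<cdot> y = f \<cdot> x" using x by (simp_all add: proj_excat_Hom D)
      then show "y = x" using ses_mono[OF q _ x(1)] by blast
    qed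
  qed (use P D gf in simp_all)
  moreover have "is_cokernel E g f"
    unfolding is_cokernel_def
  proof (intro conjI ballI impI)
    fix W h assume "W \<in> Obj E" "h \<in> Hom E (Cod E f) W" "Comp E h f = ZeroArr E (Dom E f) W"
    then have h: "h \<in> Hom C Y W" "h \<cdot> f = \<zero> X W" and W: "projective C W"
      by (simp_all add: proj_excat_Hom D)
    obtain h1 where h1: "h1 \<in> Hom C J W" "h1 \<cdot> q = h" using ses_colift[OF q h] by blast
    obtain h2 where h2: "h2 \<in> Hom C Z W" "h2 \<cdot> j = h1" using perp_extend[OF T j h1(1) W] by blast
    have h2g: "h2 \<cdot> g = h" using h2 h1(2) Hq Hj cx[of h2 j h1 q] by (simp add: g Hom_def)
    have un: "y = y'" if "y \<in> Hom C Z W" "y' \<in> Hom C Z W" "y \<cdot> g = y' \<cdot> g" for y y'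
    proof -
      have e: "(y \<cdot> j) \<cdot> q = (y' \<cdot> j) \<cdot> q" using that Hq Hj by (simp add: g Hom_def)
      have "y \<cdot> j = y' \<cdot> j"
        by (rule ses_epi[OF q _ _ e]) (use that Hj in \<open>simp_all add: Hom_def\<close>)
      then show ?thesis using perp_extend_unique[OF T j W that(1,2)] by simp
    qed
    show "\<exists>!y. y \<in> Hom E (Cod E g) W \<and> Comp E y g = h"
    proof (rule ex1I[of _ h2])
      show h2E: "h2 \<in> Hom E (Cod E g) W \<and> Comp E h2 g = h"
        using h2(1) h2g W P(3) by (simp add: proj_excat_Hom D)
      fix y assume "y \<in> Hom E (Cod E g) W \<and> Comp E y g = h"
      then have "y \<in> Hom C Z W" "y \<cdot> g = h2 \<cdot> g" using h2g by (simp_all add: proj_excat_Hom D)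
      then show "y = h2" using un[OF _ h2(1)] by blast
    qed
  qed (use P D gf in simp_all)
  ultimately show ?thesis by (simp add: kernel_cokernel_pair_def)
qed

lemma proj_excat_is_iso: "is_iso E a \<longleftrightarrow> is_iso C a \<and> projective C (Dom C a) \<and> projective C (Cod C a)"
  by (auto simp: is_iso_def proj_excat_Hom)

text \<open>The objects \<open>J\<close> and \<open>T\<close> are kept; only the morphisms
  connecting them to the middle and right terms are conjugated.\<close>

lemma proj_excat_iso_closed:
  assumes "(i, p) \<in> Confl E" "i' \<in> Arr E" "p' \<in> Arr E" "Cod C i' = Dom C p'"
    "is_iso E a" "is_iso E b" "is_iso E d"
    "a \<in> Hom E (Dom C i) (Dom C i')" "b \<in> Hom E (Cod C i) (Cod C i')"
    "d \<in> Hom E (Cod C p) (Cod C p')" "b \<cdot> i = i' \<cdot> a" "d \<cdot> p = p' \<cdot> b"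
  shows "(i', p') \<in> Confl E"
proof -
  obtain X Y q J j Z c T where q: "ses C X i Y q J" and j: "ses C J j Z c T" and p: "p = j \<cdot> q"
    and T: "T \<in> left_perp C (Proj C)"
    using assms(1) unfolding proj_excat_Confl by blast
  note Hq = ses_Hom[OF q] and Hj = ses_Hom[OF j] and O = ses_Obj[OF q] ses_Obj[OF j]
  define X' Y' Z' where D: "X' = Dom C i'" "Y' = Cod C i'" "Z' = Cod C p'"
  have H: "i' \<in> Hom C X' Y'" "p' \<in> Hom C Y' Z'" "a \<in> Hom C X X'" "b \<in> Hom C Y Y'" "d \<in> Hom C Z Z'"
    and iso: "is_iso C a" "is_iso C b" "is_iso C d"
    and P: "projective C X'" "projective C Y'" "projective C Z'"
    using assms Hq Hj by (auto simp: proj_excat_Hom proj_excat_is_iso p D Hom_def)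
  obtain b' where b': "b' \<in> Hom C Y' Y" "b' \<cdot> b = Ide C Y" "b \<cdot> b' = Ide C Y'"
    using is_isoE[OF iso(2) H(4)] by metis
  obtain d' where d': "d' \<in> Hom C Z' Z" "d' \<cdot> d = Ide C Z" "d \<cdot> d' = Ide C Z'"
    using is_isoE[OF iso(3) H(5)] by metis
  have "ses C X' i' Y' (q \<cdot> b') J"
    by (rule ses_iso[OF q H(1) _ iso(1,2) is_iso_Ide[OF O(3)] H(3,4)])
      (use O Hq b' H assms(11) in \<open>simp_all add: Hom_def\<close>)
  moreover have "ses C J (d \<cdot> j) Z' (c \<cdot> d') T"
    by (rule ses_iso[OF j _ _ is_iso_Ide[OF O(3)] iso(3) is_iso_Ide[OF O(6)] _ H(5)])
      (use O Hj d' H in \<open>simp_all add: Hom_def\<close>)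
  moreover have "p' = (d \<cdot> j) \<cdot> (q \<cdot> b')"
  proof -
    have "p' = (p' \<cdot> b) \<cdot> b'" using H b' by (simp add: Hom_def)
    also have "\<dots> = (d \<cdot> p) \<cdot> b'" by (simp add: assms(12))
    also have "\<dots> = (d \<cdot> j) \<cdot> (q \<cdot> b')" using H Hq Hj b' by (simp add: Hom_def p)
    finally show ?thesis .
  qed
  ultimately show ?thesis using P T unfolding proj_excat_Confl by blast
qed

text \<open>Think of \<open>J\<close> and \<open>K\<close> as subobjects of \<open>Z\<close>, with
  \<open>T = Z/J\<close> and \<open>V = Z/K\<close>. The image of \<open>J\<close> in
  \<open>V\<close> should be \<open>V0 = (J + K)/K\<close>, and \<open>h \<cdot> g\<close> should be
  \<open>Y --> V0\<close> followed by \<open>V0 --> W\<close>. Condition (2) for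
  \<open>K --> T\<close> gives the intersection \<open>L\<close> of \<open>J\<close> and
  \<open>K\<close> and the quotient \<open>T3 = Z/(J + K)\<close>; condition (2) for
  \<open>V --> T3\<close> gives \<open>V0\<close> as a kernel. The chase then identifies
  \<open>V0\<close> with \<open>J/L\<close>.\<close>

lemma proj_excat_Comp_deflation:
  assumes "deflation E g" "deflation E h" "Cod C g = Dom C h"
  shows "deflation E (h \<cdot> g)"
proof -
  have dArr: "u \<in> Hom C (Dom C u) (Cod C u)" if "deflation E u" for u
    using that unfolding deflation_def proj_excat_Confl by (auto simp: ses_def Hom_def)
  define Y Z W where YZW: "Y = Dom C g" "Z = Dom C h" "W = Cod C h"
  have gH: "g \<in> Hom C Y Z" and hH: "h \<in> Hom C Z W"
    using dArr[OF assms(1)] dArr[OF assms(2)] assms(3) by (simp_all add: YZW)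
  obtain N n q J j c T where q: "ses C N n Y q J" and j: "ses C J j Z c T" and g: "g = j \<cdot> q"
    and Y: "projective C Y" and T: "T \<in> left_perp C (Proj C)"
    using proj_excat_deflationE[OF assms(1) gH] by metis
  obtain K k q2 V j2 c2 T2 where k: "ses C K k Z q2 V" and j2: "ses C V j2 W c2 T2"
    and h: "h = j2 \<cdot> q2" and W: "projective C W" and T2: "T2 \<in> left_perp C (Proj C)"
    using proj_excat_deflationE[OF assms(2) hH] by metis
  note Hq = ses_Hom[OF q] and Hj = ses_Hom[OF j] and Hk = ses_Hom[OF k] and Hj2 = ses_Hom[OF j2]
  have ck: "c \<cdot> k \<in> Hom C K T" using Hj Hk by (simp add: Hom_def)
  obtain L k0 l1 T1 m1 d1 T3 where k0: "ses C L k0 K l1 T1" and m1: "ses C T1 m1 T d1 T3"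
    and ckml: "c \<cdot> k = m1 \<cdot> l1"
    using admissible_ses[OF admissible_to_perp[OF ck T] ck] by blast
  note Hk0 = ses_Hom[OF k0] and Hm1 = ses_Hom[OF m1]
  note O = ses_Obj[OF q] ses_Obj[OF j] ses_Obj[OF k] ses_Obj[OF j2] ses_Obj[OF k0] ses_Obj[OF m1]
  have T3: "T3 \<in> left_perp C (Proj C)" using perp_quotient[OF m1 T] .
  \<comment> \<open>\<open>T1\<close> is \<open>(J + K)/J\<close>, so \<open>T3 = T/T1\<close> is
    \<open>Z/(J + K)\<close>, and the projection from \<open>Z\<close> descends to
    \<open>V = Z/K\<close>.\<close>
  have "d1 \<cdot> c \<in> Hom C Z T3" "(d1 \<cdot> c) \<cdot> k = \<zero> K T3"
    using Hj Hm1 Hk Hk0 O by (simp_all add: Hom_def ckml cx[OF ses_comp[OF m1]])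
  then obtain s where s: "s \<in> Hom C V T3" "s \<cdot> q2 = d1 \<cdot> c" using ses_colift[OF k] by blast
  have "\<exists>y \<in> Hom C P V. s \<cdot> y = z" if P: "P \<in> Proj C" and z: "z \<in> Hom C P T3" for P z
  proof -
    obtain t where t: "t \<in> Hom C P T" "d1 \<cdot> t = z" using G_lift[OF P m1 z] by blast
    obtain y where y: "y \<in> Hom C P Z" "c \<cdot> y = t" using G_lift[OF P j t(1)] by blast
    show ?thesis
      using y t s Hk Hj Hm1 by (intro bexI[of _ "q2 \<cdot> y"]) (simp_all add: Hom_def cx[OF s(2)])
  qed
  then obtain V0 v0 where v0: "ses C V0 v0 V s T3"
    using G_deflation[OF s(1) admissible_to_perp[OF s(1) T3]] by blast
  note Hv0 = ses_Hom[OF v0] and OV0 = ses_Obj(1)[OF v0]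
  have "q2 \<cdot> j \<in> Hom C J V" "s \<cdot> (q2 \<cdot> j) = \<zero> J T3"
    using Hk Hj s Hm1 O by (simp_all add: Hom_def cx[OF s(2)] ses_comp[OF j])
  then obtain e where e: "e \<in> Hom C J V0" "v0 \<cdot> e = q2 \<cdot> j" using ses_lift[OF v0] by blast
  have "k \<cdot> k0 \<in> Hom C L Z" "c \<cdot> (k \<cdot> k0) = \<zero> L T"
    using Hk Hk0 Hj Hm1 O by (simp_all add: Hom_def cx[OF ckml] ses_comp[OF k0])
  then obtain u where u: "u \<in> Hom C L J" "j \<cdot> u = k \<cdot> k0" using ses_lift[OF j] by blast
  have "ses C L u J e V0"
  proof (rule G_ses[OF u(1) e(1)])
    show "e \<cdot> u = \<zero> L V0"
      by (rule ses_mono0[OF v0])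
        (use e u Hv0 Hk Hj Hk0 O in \<open>simp_all add: Hom_def cx[OF e(2)] cx[OF ses_comp[OF k]]\<close>)
  next
    fix P x assume x: "x \<in> Hom C P L" "u \<cdot> x = \<zero> P J"
    have OP: "P \<in> Obj C" using Hom_Obj[OF x(1)] by simp
    have "k0 \<cdot> x \<in> Hom C P K" "k \<cdot> (k0 \<cdot> x) = \<zero> P Z"
      using cx[OF u(2), of x] u(1) x Hk Hk0 Hj OP by (simp_all add: Hom_def)
    then have "k0 \<cdot> x = \<zero> P K" by (rule ses_mono0[OF k])
    then show "x = \<zero> P L" by (rule ses_mono0[OF k0 x(1)])
  next
    fix P x assume x: "x \<in> Hom C P J" "e \<cdot> x = \<zero> P V0"
    have OP: "P \<in> Obj C" using Hom_Obj[OF x(1)] by simp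
    have "j \<cdot> x \<in> Hom C P Z" "q2 \<cdot> (j \<cdot> x) = \<zero> P V"
      using cx[OF e(2), of x] e(1) x Hv0 Hk Hj OP by (simp_all add: Hom_def)
    then obtain y where y: "y \<in> Hom C P K" "k \<cdot> y = j \<cdot> x" using ses_lift[OF k] by blast
    have "l1 \<cdot> y \<in> Hom C P T1" "m1 \<cdot> (l1 \<cdot> y) = \<zero> P T"
      using cx[OF ckml, of y] y x Hj Hk Hk0 Hm1 O by (simp_all add: Hom_def cx[OF ses_comp[OF j]])
    then have "l1 \<cdot> y = \<zero> P T1" by (rule ses_mono0[OF m1])
    then obtain w where w: "w \<in> Hom C P L" "k0 \<cdot> w = y" using ses_lift[OF k0 y(1)] by blast
    have "u \<cdot> w = x"
      by (rule ses_mono[OF j, of _ P]) (use u w x y Hj Hk Hk0 in \<open>simp_all add: Hom_def cx[OF u(2)]\<close>)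
    then show "\<exists>w \<in> Hom C P L. u \<cdot> w = x" using w by blast
  next
    fix P v assume P: "P \<in> Proj C" and v: "v \<in> Hom C P V0"
    have v0v: "v0 \<cdot> v \<in> Hom C P V" using v Hv0 by (simp add: Hom_def)
    obtain z where z: "z \<in> Hom C P Z" "q2 \<cdot> z = v0 \<cdot> v" using G_lift[OF P k v0v] by blast
    have "c \<cdot> z \<in> Hom C P T" "d1 \<cdot> (c \<cdot> z) = \<zero> P T3"
      using cx[OF s(2), of z] z v s(1) Hk Hj Hm1 Hv0 O
      by (simp_all add: Hom_def cx[OF ses_comp[OF v0]])
    then obtain t where t: "t \<in> Hom C P T1" "m1 \<cdot> t = c \<cdot> z" using ses_lift[OF m1] by blast
    obtain \<kappa> where \<kappa>: "\<kappa> \<in> Hom C P K" "l1 \<cdot> \<kappa> = t" using G_lift[OF P k0 t(1)] by blast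
    have "k \<cdot> \<kappa> \<in> Hom C P Z" "c \<cdot> z = c \<cdot> (k \<cdot> \<kappa>)"
      using cx[OF ckml, of \<kappa>] \<kappa> t Hk Hj Hk0 Hm1 by (simp_all add: Hom_def)
    then obtain x where x: "x \<in> Hom C P J" "z = k \<cdot> \<kappa> \<oplus> j \<cdot> x" using ses_lift_sub[OF j z(1)] by blast
    have OP: "P \<in> Obj C" using Hom_Obj[OF v] by simp
    have e': "v0 \<cdot> (e \<cdot> x) = v0 \<cdot> v"
      using z(2) x \<kappa>(1) e(1) Hv0 Hk Hj OP O
      by (simp add: Hom_def cx[OF e(2)] cx[OF ses_comp[OF k]])
    have "e \<cdot> x = v"
      by (rule ses_mono[OF v0 _ _ e']) (use e x v in \<open>simp_all add: Hom_def\<close>)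
    then show "\<exists>x \<in> Hom C P J. e \<cdot> x = v" using x by blast
  qed
  note eD = this
  have "deflation C (e \<cdot> q)" "e \<cdot> q \<in> Hom C Y V0"
    using Comp_deflation[OF ses_deflation[OF q] ses_deflation[OF eD]] Hq e by (simp_all add: Hom_def)
  then obtain N' n' where eq: "ses C N' n' Y (e \<cdot> q) V0" using deflation_ses by blast
  have "inflation C (j2 \<cdot> v0)" "j2 \<cdot> v0 \<in> Hom C V0 W"
    using Comp_inflation[OF ses_inflation[OF v0] ses_inflation[OF j2]] Hv0 Hj2 by (simp_all add: Hom_def)
  then obtain T' c3 where jv: "ses C V0 (j2 \<cdot> v0) W c3 T'" using inflation_ses by blast
  note Hjv = ses_Hom[OF jv] and OT' = ses_Obj(3)[OF jv]
  have hg: "h \<cdot> g = (j2 \<cdot> v0) \<cdot> (e \<cdot> q)"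
    using Hq Hj Hk Hj2 Hv0 e(1) cx[OF e(2), of q] by (simp add: g h Hom_def)
  \<comment> \<open>A morphism from \<open>T'\<close> to a projective becomes zero after composing
    down to \<open>Y\<close>; deflations of \<open>E\<close> are cancelled against projectives by
    \<open>perp_epi\<close>, first \<open>g\<close> and then \<open>h\<close>.\<close>
  have "T' \<in> left_perp C (Proj C)"
  proof (rule perpI[OF OT'])
    fix I f assume I: "projective C I" "injective C I" "f \<in> Hom C T' I"
    have OI: "I \<in> Obj C" using proj_Obj[OF I(1)] .
    have fc: "f \<cdot> c3 \<in> Hom C W I" using I Hjv by (simp add: Hom_def)
    have "(f \<cdot> (c3 \<cdot> (j2 \<cdot> v0))) \<cdot> (e \<cdot> q) = \<zero> Y I"
      using I(3) Hq e(1) OI O OV0 unfolding ses_comp[OF jv] by (simp add: Hom_def)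
    then have "(f \<cdot> c3) \<cdot> (h \<cdot> g) = \<zero> Y I"
      using I(3) Hjv Hv0 Hj2 Hq e(1) unfolding hg by (simp add: Hom_def)
    then have "(f \<cdot> c3 \<cdot> h) \<cdot> (j \<cdot> q) = \<zero> Y I" "f \<cdot> c3 \<cdot> h \<in> Hom C Z I"
      using fc hH Hq Hj I(3) Hjv by (simp_all add: g Hom_def)
    then have "f \<cdot> c3 \<cdot> h = \<zero> Z I" using perp_epi[OF q j T I(1)] by blast
    then have "f \<cdot> c3 = \<zero> W I" using perp_epi[OF k j2 T2 I(1) fc] by (simp add: h)
    then show "f = \<zero> T' I" by (rule ses_epi0[OF jv I(3)])
  qed
  then show ?thesis using proj_excat_deflationI[OF eq jv Y W] hg by simp
qed

text \<open>The pushout \<open>U\<close> formed in \<open>C\<close> is torsion-free, as an extension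
  of the torsion-free \<open>J\<close> by the projective \<open>X'\<close>, but it may fail to be
  projective. It is replaced by a projective \<open>Z\<close> into which it embeds with torsion
  cokernel: morphisms from \<open>U\<close> to projectives extend uniquely to \<open>Z\<close>, so
  \<open>Z\<close> has the universal property in \<open>E\<close>.\<close>

lemma proj_excat_pushout:
  assumes "inflation E i" "f \<in> Arr E" "Dom C f = Dom C i"
  shows "\<exists>i' f'. is_pushout E i f i' f' \<and> inflation E i'"
proof -
  define X Y X' where XY: "X = Dom C i" "Y = Cod C i" "X' = Cod C f"
  have infl: "inflation C i" and P: "projective C X" "projective C Y" "projective C X'"
    using assms unfolding proj_excat_inflation by (simp_all add: XY)
  have iH: "i \<in> Hom C X Y" and fH: "f \<in> Hom C X X'"
    using inflation_Arr[OF infl] assms by (simp_all add: XY Hom_def)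
  obtain J q where q: "ses C X i Y q J" using inflation_ses[OF infl iH] by blast
  obtain U a b f1 where a: "ses C X' a U b J" and f1: "f1 \<in> Hom C Y U" "f1 \<cdot> i = a \<cdot> f"
    and po: "is_pushout C i f a f1"
    using ses_pushout[OF q fH] by blast
  note Ha = ses_Hom[OF a] and O = ses_Obj[OF a]
  have CodU: "Cod C a = U" using Ha by (simp add: Hom_def)
  have "u = \<zero> T U" if T: "T \<in> left_perp C (Proj C)" and u: "u \<in> Hom C T U" for T u
  proof -
    have "b \<cdot> u \<in> Hom C T J" using u Ha by (simp add: Hom_def)
    then have "b \<cdot> u = \<zero> T J" by (rule perp_zero_quotient[OF T q P(1,2)])
    then obtain u0 where u0: "u0 \<in> Hom C T X'" "a \<cdot> u0 = u" using ses_lift[OF a u] by blast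
    then have "u0 = \<zero> T X'" using perp_zero[OF T P(3)] by blast
    then show ?thesis using u0 Ha perp_Obj[OF T] by (auto simp: Hom_def)
  qed
  then obtain Z m c T where m: "ses C U m Z c T" and Z: "projective C Z"
    and T: "T \<in> left_perp C (Proj C)"
    using torsion_free_embedding[OF O(2)] by metis
  note Hm = ses_Hom[OF m]
  have maH: "m \<cdot> a \<in> Hom C X' Z" and mfH: "m \<cdot> f1 \<in> Hom C Y Z" using Ha Hm f1 by (simp_all add: Hom_def)
  have D: "Cod C (m \<cdot> a) = Z" "Dom C (m \<cdot> a) = X'" "Dom C (m \<cdot> f1) = Y" "Cod C (m \<cdot> f1) = Z"
    "m \<cdot> a \<in> Arr C" "m \<cdot> f1 \<in> Arr C" "i \<in> Arr C" "f \<in> Arr C"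
    "Dom C i = X" "Cod C i = Y" "Dom C f = X" "Cod C f = X'"
    using maH mfH iH fH by (simp_all add: Hom_def)
  have infl': "inflation E (m \<cdot> a)"
    using Comp_inflation[OF ses_inflation[OF a] ses_inflation[OF m]] Ha Hm P Z
    unfolding proj_excat_inflation by (simp add: D) (simp add: Hom_def)
  have sq: "(m \<cdot> f1) \<cdot> i = (m \<cdot> a) \<cdot> f"
    using f1 Ha Hm iH fH by (simp add: Hom_def)
  have "is_pushout E i f (m \<cdot> a) (m \<cdot> f1)"
    unfolding is_pushout_def
  proof (intro conjI ballI impI)
    fix W x y assume "W \<in> Obj E" "x \<in> Hom E (Cod E i) W" "y \<in> Hom E (Cod E f) W"
      "Comp E x i = Comp E y f"
    then have W: "projective C W" and x: "x \<in> Hom C Y W" and y: "y \<in> Hom C X' W" "x \<cdot> i = y \<cdot> f"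
      by (simp_all add: proj_excat_Hom D)
    obtain h where h: "h \<in> Hom C U W" "h \<cdot> f1 = x" "h \<cdot> a = y"
      by (rule is_pushout_colift[OF po iH fH x y, unfolded CodU])
    obtain k where k: "k \<in> Hom C Z W" "k \<cdot> m = h" using perp_extend[OF T m h(1) W] by blast
    have kx: "k \<cdot> (m \<cdot> f1) = x" "k \<cdot> (m \<cdot> a) = y"
      using k(1) h f1 Ha Hm by (simp_all add: Hom_def cx[OF k(2)])
    show "\<exists>!h. h \<in> Hom E (Cod E (m \<cdot> a)) W \<and> Comp E h (m \<cdot> f1) = x \<and> Comp E h (m \<cdot> a) = y"
    proof (rule ex1I[of _ k])
      show "k \<in> Hom E (Cod E (m \<cdot> a)) W \<and> Comp E k (m \<cdot> f1) = x \<and> Comp E k (m \<cdot> a) = y"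
        using k(1) kx W Z by (simp add: proj_excat_Hom D)
      fix k' assume "k' \<in> Hom E (Cod E (m \<cdot> a)) W \<and> Comp E k' (m \<cdot> f1) = x \<and> Comp E k' (m \<cdot> a) = y"
      then have k': "k' \<in> Hom C Z W" "k' \<cdot> (m \<cdot> f1) = x" "k' \<cdot> (m \<cdot> a) = y"
        by (simp_all add: proj_excat_Hom D)
      have "k' \<cdot> m = h"
        by (rule is_pushout_eq[OF po iH fH, unfolded CodU])
          (use k' h f1 Ha Hm in \<open>simp_all add: Hom_def\<close>)
      then show "k' = k" using perp_extend_unique[OF T m W k'(1) k(1)] k(2) by simp
    qed
  qed (use D P Z sq in simp_all)
  then show ?thesis using infl' by blast
qed

text \<open>A morphism to \<open>Z\<close> factors through \<open>J\<close> exactly if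
  \<open>c\<close> kills it. So the pullback is formed in two stages: \<open>L\<close> is the kernel
  of \<open>c \<cdot> t\<close>, available by condition (2), and \<open>R\<close> is the pullback of
  \<open>q\<close> along \<open>L --> J\<close>. The quotient \<open>T1\<close> of \<open>T0\<close>
  by \<open>L\<close> is torsion as a subobject of \<open>T\<close>.\<close>

lemma proj_excat_pullback:
  assumes "deflation E g" "t \<in> Arr E" "Cod C t = Cod C g"
  shows "\<exists>g' t'. is_pullback E g t g' t' \<and> deflation E g'"
proof -
  have gArr: "g \<in> Hom C (Dom C g) (Cod C g)"
    using assms(1) unfolding deflation_def proj_excat_Confl by (auto simp: ses_def Hom_def)
  define Y Z T0 where YZ: "Y = Dom C g" "Z = Cod C g" "T0 = Dom C t"
  have gH: "g \<in> Hom C Y Z" and tH: "t \<in> Hom C T0 Z" and PT0: "projective C T0"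
    using gArr assms by (simp_all add: YZ Hom_def)
  obtain N n q J j c T where q: "ses C N n Y q J" and j: "ses C J j Z c T" and g: "g = j \<cdot> q"
    and PY: "projective C Y" and PZ: "projective C Z" and T: "T \<in> left_perp C (Proj C)"
    using proj_excat_deflationE[OF assms(1) gH] by metis
  note Hq = ses_Hom[OF q] and Hj = ses_Hom[OF j]
  have ct: "c \<cdot> t \<in> Hom C T0 T" using Hj tH by (simp add: Hom_def)
  obtain L l l1 T1 m1 d1 T2 where l: "ses C L l T0 l1 T1" and m1: "ses C T1 m1 T d1 T2"
    and ctml: "c \<cdot> t = m1 \<cdot> l1"
    using admissible_ses[OF admissible_to_perp[OF ct T] ct] by blast
  note Hl = ses_Hom[OF l] and Hm1 = ses_Hom[OF m1]
  note O = ses_Obj[OF q] ses_Obj[OF j] ses_Obj[OF l] ses_Obj[OF m1]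
  have T1: "T1 \<in> left_perp C (Proj C)" using perp_sub[OF m1 T] .
  have "t \<cdot> l \<in> Hom C L Z" "c \<cdot> (t \<cdot> l) = \<zero> L T"
    using tH Hl Hj Hm1 O by (simp_all add: Hom_def cx[OF ctml] ses_comp[OF l])
  then obtain u where u: "u \<in> Hom C L J" "j \<cdot> u = t \<cdot> l" using ses_lift[OF j] by blast
  obtain R n1 r n2 where r: "ses C N n1 R r L" and n2: "n2 \<in> Hom C R Y" "q \<cdot> n2 = u \<cdot> r"
    and pb: "is_pullback C q u r n2"
    using ses_pullback[OF q u(1)] by blast
  note Hr = ses_Hom[OF r] and OR = ses_Obj(2)[OF r]
  have DR: "Dom C r = R" using Hr by (simp add: Hom_def)
  note pb_lift = is_pullback_lift[OF pb Hq(2) u(1), unfolded DR]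
    and pb_eq = is_pullback_eq[OF pb Hq(2) u(1), unfolded DR]
  have lr: "l \<cdot> r \<in> Hom C R T0" using Hl Hr by (simp add: Hom_def)
  have sq: "g \<cdot> n2 = t \<cdot> (l \<cdot> r)"
    using Hq Hj n2 u Hl Hr tH cx[OF u(2), of r] by (simp add: g Hom_def)
  have un: "h = h'" if "h \<in> Hom C W R" "h' \<in> Hom C W R" "n2 \<cdot> h = n2 \<cdot> h'"
      "(l \<cdot> r) \<cdot> h = (l \<cdot> r) \<cdot> h'" for W h h'
  proof (rule pb_eq[OF that(1-3)])
    have e: "l \<cdot> (r \<cdot> h) = l \<cdot> (r \<cdot> h')" using that Hl Hr by (simp add: Hom_def)
    show "r \<cdot> h = r \<cdot> h'"
      by (rule ses_mono[OF l _ _ e]) (use that Hr in \<open>simp_all add: Hom_def\<close>)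
  qed
  have ex: "\<exists>h \<in> Hom C W R. n2 \<cdot> h = x \<and> (l \<cdot> r) \<cdot> h = y"
    if x: "x \<in> Hom C W Y" and y: "y \<in> Hom C W T0" and xy: "g \<cdot> x = t \<cdot> y" for W x y
  proof -
    have OW: "W \<in> Obj C" using Hom_Obj[OF x] by simp
    have "m1 \<cdot> (l1 \<cdot> y) = c \<cdot> (t \<cdot> y)" using y tH Hl Hm1 Hj by (simp add: Hom_def cx[OF ctml])
    also have "\<dots> = c \<cdot> (g \<cdot> x)" by (simp only: xy)
    also have "\<dots> = \<zero> W T" using x Hq Hj O by (simp add: g Hom_def cx[OF ses_comp[OF j]])
    finally have "l1 \<cdot> y = \<zero> W T1" using y Hl by (intro ses_mono0[OF m1]) (simp_all add: Hom_def)
    then obtain z where z: "z \<in> Hom C W L" "l \<cdot> z = y" using ses_lift[OF l y] by blast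
    have e: "j \<cdot> (q \<cdot> x) = j \<cdot> (u \<cdot> z)"
      using xy x z u tH Hq Hj Hl by (simp add: g Hom_def cx[OF u(2)])
    have "q \<cdot> x = u \<cdot> z"
      by (rule ses_mono[OF j _ _ e]) (use x z u Hq in \<open>simp_all add: Hom_def\<close>)
    then obtain h where h: "h \<in> Hom C W R" "n2 \<cdot> h = x" "r \<cdot> h = z" by (rule pb_lift[OF x z(1)])
    then have "(l \<cdot> r) \<cdot> h = y" using z(2) Hl Hr by (simp add: Hom_def)
    then show ?thesis using h by blast
  qed
  \<comment> \<open>\<open>R\<close> is the kernel of \<open>(g, -t)\<close> on the biproduct of
    \<open>Y\<close> and \<open>T0\<close>, and the image of that morphism is the kernel
    \<open>J2\<close> of \<open>d1 \<cdot> c\<close>. So \<open>R\<close> is a second syzygy of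
    \<open>T2\<close>.\<close>
  have "projective C R"
  proof -
    have "deflation C (d1 \<cdot> c)" "d1 \<cdot> c \<in> Hom C Z T2"
      using Comp_deflation[OF ses_deflation[OF j] ses_deflation[OF m1]] Hj Hm1 by (simp_all add: Hom_def)
    then obtain J2 j2 where j2: "ses C J2 j2 Z (d1 \<cdot> c) T2" using deflation_ses by blast
    note Hj2 = ses_Hom[OF j2] and OJ2 = ses_Obj(1)[OF j2]
    obtain S i1 i2 p1 p2 where S: "is_biproduct C Y T0 S i1 i2 p1 p2"
      "i1 \<in> Hom C Y S" "i2 \<in> Hom C T0 S" "p1 \<in> Hom C S Y" "p2 \<in> Hom C S T0"
      "p1 \<cdot> i1 = Ide C Y" "p2 \<cdot> i2 = Ide C T0" "p1 \<cdot> i2 = \<zero> T0 Y" "p2 \<cdot> i1 = \<zero> Y T0"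
      "i1 \<cdot> p1 \<oplus> i2 \<cdot> p2 = Ide C S"
      using biproductE[OF O(2) O(8)] by blast
    note cxS = cx[OF S(6)] cx[OF S(7)] cx[OF S(8)] cx[OF S(9)]
    have PS: "projective C S" using biproduct_projective[OF PY PT0 S(1)] .
    have OS: "S \<in> Obj C" using Hom_Obj[OF S(2)] by simp
    define d where "d = i1 \<cdot> n2 \<oplus> i2 \<cdot> (l \<cdot> r)"
    define e0 where "e0 = g \<cdot> p1 \<ominus> t \<cdot> p2"
    have d: "d \<in> Hom C R S" "p1 \<cdot> d = n2" "p2 \<cdot> d = l \<cdot> r"
      using S n2(1) lr Hl Hr O OR by (simp_all add: d_def Hom_def cxS)
    have e0: "e0 \<in> Hom C S Z" using gH tH S by (simp add: e0_def Hom_def)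
    have e0x: "e0 \<cdot> x = g \<cdot> (p1 \<cdot> x) \<ominus> t \<cdot> (p2 \<cdot> x)" if "x \<in> Hom C W S" for x W
      using that gH tH S by (simp add: e0_def Hom_def)
    have "c \<cdot> g = \<zero> Y T" using Hq Hj O by (simp add: g Hom_def cx[OF ses_comp[OF j]])
    then have "(d1 \<cdot> c) \<cdot> e0 = \<zero> S T2"
      using gH tH S(4,5) Hj Hm1 Hl O OS
      by (simp add: e0_def Hom_def cx[of c g] cx[OF ctml] cx[OF ses_comp[OF m1]])
    then obtain e where e: "e \<in> Hom C S J2" "j2 \<cdot> e = e0" using ses_lift[OF j2 e0] by blast
    have "ses C R d S e J2"
    proof (rule G_ses[OF d(1) e(1)])
      have "e0 \<cdot> d = \<zero> R Z"
        using e0x[OF d(1)] d sq gH n2(1) tH lr by (simp add: Hom_def)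
      then show "e \<cdot> d = \<zero> R J2"
        using e d Hj2 by (intro ses_mono0[OF j2]) (simp_all add: Hom_def cx[OF e(2)])
    next
      fix P x assume x: "x \<in> Hom C P R" "d \<cdot> x = \<zero> P S"
      have OP: "P \<in> Obj C" using Hom_Obj[OF x(1)] by simp
      have "n2 \<cdot> x = n2 \<cdot> \<zero> P R" "(l \<cdot> r) \<cdot> x = (l \<cdot> r) \<cdot> \<zero> P R"
        using cx[OF d(2), of x] cx[OF d(3), of x] x d(1) S(4,5) n2(1) lr OP OR Hl Hr
        by (simp_all add: Hom_def)
      then show "x = \<zero> P R" using un[OF x(1) zero_Hom[OF OP OR]] by blast
    next
      fix P x assume x: "x \<in> Hom C P S" "e \<cdot> x = \<zero> P J2"
      have OP: "P \<in> Obj C" using Hom_Obj[OF x(1)] by simp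
      have "e0 \<cdot> x = \<zero> P Z" using cx[OF e(2), of x] x e(1) Hj2 OP by (simp add: Hom_def)
      then have e1: "g \<cdot> (p1 \<cdot> x) = t \<cdot> (p2 \<cdot> x)"
        using e0x[OF x(1)] sub_eq_zero_iff[of "g \<cdot> (p1 \<cdot> x)" "t \<cdot> (p2 \<cdot> x)" P Z] x(1) gH tH S(4,5)
        by (simp add: Hom_def)
      have px: "p1 \<cdot> x \<in> Hom C P Y" "p2 \<cdot> x \<in> Hom C P T0" using x S(4,5) by (simp_all add: Hom_def)
      obtain h where h: "h \<in> Hom C P R" "n2 \<cdot> h = p1 \<cdot> x" "(l \<cdot> r) \<cdot> h = p2 \<cdot> x"
        using ex[OF px e1] by blast
      have "d \<cdot> h = i1 \<cdot> (n2 \<cdot> h) \<oplus> i2 \<cdot> ((l \<cdot> r) \<cdot> h)"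
        using h(1) S(2,3) n2(1) Hl Hr by (simp add: d_def Hom_def)
      also have "\<dots> = (i1 \<cdot> p1 \<oplus> i2 \<cdot> p2) \<cdot> x"
        unfolding h(2,3) using x(1) S(2-5) by (simp add: Hom_def)
      also have "\<dots> = x" using x(1) by (simp add: S(10) Hom_def)
      finally show "\<exists>h \<in> Hom C P R. d \<cdot> h = x" using h(1) by blast
    next
      fix P z assume P: "P \<in> Proj C" and z: "z \<in> Hom C P J2"
      have OP: "P \<in> Obj C" using Hom_Obj[OF z] by simp
      have "c \<cdot> (j2 \<cdot> z) \<in> Hom C P T" "d1 \<cdot> (c \<cdot> (j2 \<cdot> z)) = \<zero> P T2"
        using cx[OF ses_comp[OF j2], of z] z Hj Hm1 Hj2 O by (simp_all add: Hom_def)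
      then obtain \<tau> where \<tau>: "\<tau> \<in> Hom C P T1" "m1 \<cdot> \<tau> = c \<cdot> (j2 \<cdot> z)" using ses_lift[OF m1] by blast
      obtain w where w: "w \<in> Hom C P T0" "l1 \<cdot> w = \<tau>" using G_lift[OF P l \<tau>(1)] by blast
      have "j2 \<cdot> z \<in> Hom C P Z" "t \<cdot> w \<in> Hom C P Z" "c \<cdot> (j2 \<cdot> z) = c \<cdot> (t \<cdot> w)"
        using cx[OF ctml, of w] w \<tau> z tH Hj Hl Hm1 Hj2 by (simp_all add: Hom_def)
      then obtain v where v: "v \<in> Hom C P J" "j2 \<cdot> z = t \<cdot> w \<oplus> j \<cdot> v"
        using ses_lift_sub[OF j] by blast
      obtain y where y: "y \<in> Hom C P Y" "q \<cdot> y = v" using G_lift[OF P q v(1)] by blast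
      \<comment> \<open>The chase has written \<open>j2 \<cdot> z\<close> as
        \<open>t w + g y\<close>; the minus sign matches that of \<open>t\<close> in
        \<open>e0\<close>.\<close>
      define x where "x = i1 \<cdot> y \<ominus> i2 \<cdot> w"
      have x: "x \<in> Hom C P S" "p1 \<cdot> x = y" "p2 \<cdot> x = neg C w"
        using y(1) w(1) S O OP by (simp_all add: x_def Hom_def cxS)
      have gy: "g \<cdot> y = j \<cdot> v" using y Hq Hj by (simp add: g Hom_def)
      have "e0 \<cdot> x = j2 \<cdot> z"
        unfolding e0x[OF x(1)] x(2,3) v(2) gy
        using w(1) v(1) tH Hj add_commute[of "j \<cdot> v" "t \<cdot> w"] by (simp add: Hom_def)
      then have e1: "j2 \<cdot> (e \<cdot> x) = j2 \<cdot> z" using x(1) e Hj2 by (simp add: Hom_def cx[OF e(2)])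
      have "e \<cdot> x = z"
        by (rule ses_mono[OF j2 _ _ e1]) (use x e z in \<open>simp_all add: Hom_def\<close>)
      then show "\<exists>x \<in> Hom C P S. e \<cdot> x = z" using x(1) by blast
    qed
    then show ?thesis using second_syzygy_projective[OF _ j2 PS PZ] by blast
  qed
  note PR = this
  have D: "Dom C (l \<cdot> r) = R" "Cod C (l \<cdot> r) = T0" "l \<cdot> r \<in> Arr C" "n2 \<in> Arr C" "Dom C n2 = R"
    "Cod C n2 = Y" "Dom C g = Y" "Cod C g = Z" "g \<in> Arr C" "Dom C t = T0" "Cod C t = Z" "t \<in> Arr C"
    using lr n2(1) gH tH by (simp_all add: Hom_def)
  have "is_pullback E g t (l \<cdot> r) n2"
    unfolding is_pullback_def
  proof (intro conjI ballI impI)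
    fix W x y assume "W \<in> Obj E" "x \<in> Hom E W (Dom E g)" "y \<in> Hom E W (Dom E t)"
      "Comp E g x = Comp E t y"
    then have W: "projective C W" and x: "x \<in> Hom C W Y" and y: "y \<in> Hom C W T0" "g \<cdot> x = t \<cdot> y"
      by (simp_all add: proj_excat_Hom D)
    obtain h where h: "h \<in> Hom C W R" "n2 \<cdot> h = x" "(l \<cdot> r) \<cdot> h = y" using ex[OF x y] by blast
    show "\<exists>!h. h \<in> Hom E W (Dom E (l \<cdot> r)) \<and> Comp E n2 h = x \<and> Comp E (l \<cdot> r) h = y"
    proof (rule ex1I[of _ h])
      show "h \<in> Hom E W (Dom E (l \<cdot> r)) \<and> Comp E n2 h = x \<and> Comp E (l \<cdot> r) h = y"
        using h W PR by (simp only: proj_excat_Hom D proj_excat_simps)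
      fix h' assume "h' \<in> Hom E W (Dom E (l \<cdot> r)) \<and> Comp E n2 h' = x \<and> Comp E (l \<cdot> r) h' = y"
      then show "h' = h" using un[of h' W h] h by (simp only: proj_excat_Hom D proj_excat_simps)
    qed
  qed (use D PY PZ PT0 PR sq in simp_all)
  moreover have "deflation E (l \<cdot> r)" using proj_excat_deflationI[OF r l PR PT0 T1] .
  ultimately show ?thesis by blast
qed

lemma proj_excat_Ide:
  assumes "projective C X"
  shows "inflation E (Ide C X)" "deflation E (Ide C X)"
proof -
  note OX = proj_Obj[OF assms]
  show "inflation E (Ide C X)"
    unfolding proj_excat_inflation using Ide_inflation[OF OX] OX assms by simp
  obtain Z where Z: "zero_object C Z" "Z \<in> Obj C" by (rule zero_object_exists)
  have "Z \<in> left_perp C (Proj C)"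
    by (rule perpI[OF Z(2)]) (use zero_object_Hom(1)[OF Z(1)] proj_Obj in blast)
  then show "deflation E (Ide C X)"
    using proj_excat_deflationI[OF ses_zero_Ide[OF Z(1) OX] ses_Ide_zero[OF Z(1) OX] assms assms] OX
    by simp
qed

theorem proj_excat_exact: "exact_category E"
proof (intro exact_category.intro exact_category_axioms.intro proj_excat_additive)
  show "inflation E (Comp E j i)" if "inflation E i" "inflation E j" "Cod E i = Dom E j" for i j
    using that Comp_inflation[of i j] inflation_Arr by (simp add: proj_excat_inflation)
  show "\<exists>i' f'. is_pushout E i f i' f' \<and> inflation E i'"
    if "inflation E i" "f \<in> Arr E" "Dom E f = Dom E i" for i f
    using proj_excat_pushout[of i f] that by simp
  show "\<exists>p' f'. is_pullback E p f p' f' \<and> deflation E p'"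
    if "deflation E p" "f \<in> Arr E" "Cod E f = Cod E p" for p f
    using proj_excat_pullback[of p f] that by simp
  show "deflation E (Comp E q p)" if "deflation E p" "deflation E q" "Cod E p = Dom E q" for p q
    using proj_excat_Comp_deflation[of p q] that by simp
  show "inflation E (Ide E X)" "deflation E (Ide E X)" if "X \<in> Obj E" for X
    using proj_excat_Ide[of X] that by simp_all
  show "(i', p') \<in> Confl E"
    if "(i, p) \<in> Confl E" "i' \<in> Arr E" "p' \<in> Arr E" "Cod E i' = Dom E p'"
      "is_iso E a" "is_iso E b" "is_iso E c" "a \<in> Hom E (Dom E i) (Dom E i')"
      "b \<in> Hom E (Cod E i) (Cod E i')" "c \<in> Hom E (Cod E p) (Cod E p')"
      "Comp E b i = Comp E i' a" "Comp E c p = Comp E p' b" for i p i' p' a b c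
    using proj_excat_iso_closed[of i p i' p' a b c] that by (simp only: proj_excat_simps)
qed (rule proj_excat_kernel_cokernel)

text \<open>Inflations of \<open>E\<close> are inflations of \<open>C\<close>, so an object that is
  projective and injective in \<open>C\<close> stays injective in \<open>E\<close>.\<close>

theorem proj_excat_enough_injectives: "enough_injectives E"
  unfolding enough_injectives_def
proof
  fix X assume "X \<in> Obj E"
  then have X: "projective C X" by simp
  then obtain a I1 q Q where a: "ses C X a I1 q Q" "projective C I1" "injective C I1"
    using copresentation by blast
  have "injective E I1"
    unfolding injective_def
  proof (intro conjI allI impI ballI)
    show "I1 \<in> Obj E" using a by simp
    fix i f assume "inflation E i" "f \<in> Hom E (Dom E i) I1"
    then have "inflation C i" "f \<in> Hom C (Dom C i) I1" "projective C (Cod C i)"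
      by (simp_all add: proj_excat_inflation proj_excat_Hom)
    then show "\<exists>g \<in> Hom E (Cod E i) I1. Comp E g i = f"
      using a(2,3) unfolding injective_def by (simp add: proj_excat_Hom_eq)
  qed
  moreover have "inflation E a" "Dom E a = X" "Cod E a = I1"
    using ses_Hom[OF a(1)] ses_inflation[OF a(1)] X a(2) by (simp_all add: proj_excat_inflation Hom_def)
  ultimately show "\<exists>i. inflation E i \<and> Dom E i = X \<and> injective E (Cod E i)" by blast
qed

end

section \<open>Conflations in the functor category\<close>

lemma is_kernel_Confl_update: "is_kernel (A\<lparr>Confl := S\<rparr>) i p = is_kernel A i p"
  and is_cokernel_Confl_update: "is_cokernel (A\<lparr>Confl := S\<rparr>) p i = is_cokernel A p i"
  by (simp_all add: is_kernel_def is_cokernel_def Hom_def)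

lemma ModCat_simps [simp]:
  "Obj (ModCat C) = {F. additive_cfunctor C F}"
  "Arr (ModCat C) = {\<eta>. natural_transformation C \<eta>}"
  "Dom (ModCat C) = NDom" "Cod (ModCat C) = NCod"
  "Ide (ModCat C) = (\<lambda>F. mk_nattrans C F F (\<lambda>X x. x))"
  "Comp (ModCat C) = (\<lambda>\<theta> \<eta>. mk_nattrans C (NDom \<eta>) (NCod \<theta>) (\<lambda>X x. NComp \<theta> X (NComp \<eta> X x)))"
  "ZeroArr (ModCat C) = (\<lambda>F G. mk_nattrans C F G (\<lambda>X x. \<one>\<^bsub>FObj G X\<^esub>))"
  by (simp_all add: ModCat_def Let_def)

text \<open>The conflations of \<open>ModCat\<close> are defined as kernel-cokernel pairs of the
  record before its field \<open>Confl\<close> is set; kernels and cokernels do not see that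
  field.\<close>

lemma ModCat_Confl:
  fixes C :: "('o, 'm) excat" and i p :: "('o, 'm, 'g) nattrans"
  shows "(i, p) \<in> Confl (ModCat C) \<longleftrightarrow> kernel_cokernel_pair (ModCat C) i p"
proof -
  let ?M = "ModCat C :: (('o, 'm, 'g) cfunctor, ('o, 'm, 'g) nattrans) excat"
  have "\<exists>A. ?M = A\<lparr>Confl := {(i, p). kernel_cokernel_pair A i p}\<rparr>"
    unfolding ModCat_def Let_def by (rule exI) (rule refl)
  then obtain A where A: "?M = A\<lparr>Confl := {(i, p). kernel_cokernel_pair A i p}\<rparr>" by blast
  show ?thesis
    unfolding A kernel_cokernel_pair_def
    by (simp add: is_kernel_Confl_update is_cokernel_Confl_update)
qed

lemma mk_nattrans_simps [simp]:
  "NDom (mk_nattrans C F G \<eta>) = F" "NCod (mk_nattrans C F G \<eta>) = G"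
  "\<lbrakk>X \<in> Obj C; x \<in> carrier (FObj F X)\<rbrakk> \<Longrightarrow> NComp (mk_nattrans C F G \<eta>) X x = \<eta> X x"
  by (simp_all add: mk_nattrans_def)

lemma cfunctor_D:
  assumes "additive_cfunctor C F"
  shows cfunctor_group: "X \<in> Obj C \<Longrightarrow> comm_group (FObj F X)"
    and cfunctor_hom: "f \<in> Arr C \<Longrightarrow> FArr F f \<in> hom (FObj F (Cod C f)) (FObj F (Dom C f))"
    and cfunctor_Ide: "\<lbrakk>X \<in> Obj C; x \<in> carrier (FObj F X)\<rbrakk> \<Longrightarrow> FArr F (Ide C X) x = x"
    and cfunctor_Comp: "\<lbrakk>f \<in> Arr C; g \<in> Arr C; Cod C f = Dom C g; x \<in> carrier (FObj F (Cod C g))\<rbrakk>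
      \<Longrightarrow> FArr F (g \<cdot>\<^bsub>C\<^esub> f) x = FArr F f (FArr F g x)"
    and cfunctor_Add: "\<lbrakk>f \<in> Arr C; g \<in> Arr C; Dom C f = Dom C g; Cod C f = Cod C g;
      x \<in> carrier (FObj F (Cod C f))\<rbrakk>
      \<Longrightarrow> FArr F (Add C f g) x = FArr F f x \<otimes>\<^bsub>FObj F (Dom C f)\<^esub> FArr F g x"
  using assms unfolding additive_cfunctor_def by simp_all

lemma ModCat_Hom:
  "\<eta> \<in> Hom (ModCat C) F G \<longleftrightarrow> natural_transformation C \<eta> \<and> NDom \<eta> = F \<and> NCod \<eta> = G"
  by (simp add: Hom_def)

lemma ModCat_HomI:
  assumes "additive_cfunctor C F" "additive_cfunctor C G"
    "\<And>X x. \<lbrakk>X \<in> Obj C; x \<in> carrier (FObj F X)\<rbrakk> \<Longrightarrow> \<eta> X x \<in> carrier (FObj G X)"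
    "\<And>X x y. \<lbrakk>X \<in> Obj C; x \<in> carrier (FObj F X); y \<in> carrier (FObj F X)\<rbrakk>
      \<Longrightarrow> \<eta> X (x \<otimes>\<^bsub>FObj F X\<^esub> y) = \<eta> X x \<otimes>\<^bsub>FObj G X\<^esub> \<eta> X y"
    "\<And>f x. \<lbrakk>f \<in> Arr C; x \<in> carrier (FObj F (Cod C f)); Dom C f \<in> Obj C; Cod C f \<in> Obj C\<rbrakk>
      \<Longrightarrow> \<eta> (Dom C f) (FArr F f x) = FArr G f (\<eta> (Cod C f) x)"
    "category C"
  shows "mk_nattrans C F G \<eta> \<in> Hom (ModCat C) F G"
proof -
  have *: "NComp (mk_nattrans C F G \<eta>) X \<in> hom (FObj F X) (FObj G X)" if X: "X \<in> Obj C" for X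
  proof -
    interpret comm_group "FObj F X" using cfunctor_group[OF assms(1) X] .
    show ?thesis using assms(3,4) X by (auto simp: hom_def)
  qed
  have "NComp (mk_nattrans C F G \<eta>) (Dom C f) (FArr F f x)
      = FArr G f (NComp (mk_nattrans C F G \<eta>) (Cod C f) x)"
    if "f \<in> Arr C" "x \<in> carrier (FObj F (Cod C f))" for f x
    using that assms(5) category.Dom_Obj[OF assms(6)] category.Cod_Obj[OF assms(6)]
      hom_in_carrier[OF cfunctor_hom[OF assms(1)]] by simp
  moreover have "mk_nattrans C F G \<eta> = mk_nattrans C F G (NComp (mk_nattrans C F G \<eta>))"
    by (auto simp: mk_nattrans_def restrict_def fun_eq_iff)
  ultimately show ?thesis
    using assms(1,2) * unfolding ModCat_Hom natural_transformation_def by simp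
qed

lemma nattrans_D:
  assumes "\<eta> \<in> Hom (ModCat C) F G"
  shows nattrans_cfunctor: "additive_cfunctor C F" "additive_cfunctor C G"
    and nattrans_hom: "X \<in> Obj C \<Longrightarrow> NComp \<eta> X \<in> hom (FObj F X) (FObj G X)"
    and nattrans_natural: "\<lbrakk>f \<in> Arr C; x \<in> carrier (FObj F (Cod C f))\<rbrakk>
      \<Longrightarrow> NComp \<eta> (Dom C f) (FArr F f x) = FArr G f (NComp \<eta> (Cod C f) x)"
    and nattrans_mk: "\<eta> = mk_nattrans C F G (NComp \<eta>)"
    and nattrans_Dom_Cod: "NDom \<eta> = F" "NCod \<eta> = G"
  using assms unfolding ModCat_Hom natural_transformation_def by auto

lemma nattrans_closed:
  "\<lbrakk>\<eta> \<in> Hom (ModCat C) F G; X \<in> Obj C; x \<in> carrier (FObj F X)\<rbrakk> \<Longrightarrow> NComp \<eta> X x \<in> carrier (FObj G X)"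
  using nattrans_hom hom_in_carrier by fastforce

lemma nattrans_mult:
  "\<lbrakk>\<eta> \<in> Hom (ModCat C) F G; X \<in> Obj C; x \<in> carrier (FObj F X); y \<in> carrier (FObj F X)\<rbrakk>
    \<Longrightarrow> NComp \<eta> X (x \<otimes>\<^bsub>FObj F X\<^esub> y) = NComp \<eta> X x \<otimes>\<^bsub>FObj G X\<^esub> NComp \<eta> X y"
  using nattrans_hom hom_mult by fastforce

lemma nattrans_group_hom:
  assumes "\<eta> \<in> Hom (ModCat C) F G" "X \<in> Obj C"
  shows "group_hom (FObj F X) (FObj G X) (NComp \<eta> X)"
  using assms nattrans_hom[OF assms] cfunctor_group[OF nattrans_cfunctor(1)[OF assms(1)]]
    cfunctor_group[OF nattrans_cfunctor(2)[OF assms(1)]]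
  by (simp add: group_hom_def group_hom_axioms_def comm_group_def)

lemma cfunctor_group_hom:
  assumes "category C" "additive_cfunctor C F" "f \<in> Arr C"
  shows "group_hom (FObj F (Cod C f)) (FObj F (Dom C f)) (FArr F f)"
  using cfunctor_hom[OF assms(2,3)] cfunctor_group[OF assms(2)]
    category.Dom_Obj[OF assms(1,3)] category.Cod_Obj[OF assms(1,3)]
  by (simp add: group_hom_def group_hom_axioms_def comm_group_def)

lemma nattrans_one:
  "\<lbrakk>\<eta> \<in> Hom (ModCat C) F G; X \<in> Obj C\<rbrakk> \<Longrightarrow> NComp \<eta> X \<one>\<^bsub>FObj F X\<^esub> = \<one>\<^bsub>FObj G X\<^esub>"
  using nattrans_group_hom group_hom.hom_one by fast

lemma cfunctor_one:
  "\<lbrakk>category C; additive_cfunctor C F; f \<in> Arr C\<rbrakk>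
    \<Longrightarrow> FArr F f \<one>\<^bsub>FObj F (Cod C f)\<^esub> = \<one>\<^bsub>FObj F (Dom C f)\<^esub>"
  using cfunctor_group_hom group_hom.hom_one by fast

lemma cfunctor_closed:
  "\<lbrakk>additive_cfunctor C F; f \<in> Arr C; x \<in> carrier (FObj F (Cod C f))\<rbrakk>
    \<Longrightarrow> FArr F f x \<in> carrier (FObj F (Dom C f))"
  using cfunctor_hom hom_in_carrier by fastforce

lemma cfunctor_one_closed:
  "\<lbrakk>additive_cfunctor C F; X \<in> Obj C\<rbrakk> \<Longrightarrow> \<one>\<^bsub>FObj F X\<^esub> \<in> carrier (FObj F X)"
  by (meson cfunctor_group comm_group_def group.is_monoid monoid.one_closed)

lemma nattrans_inj:
  assumes "\<eta> \<in> Hom (ModCat C) F G" "X \<in> Obj C"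
    "\<And>x. \<lbrakk>x \<in> carrier (FObj F X); NComp \<eta> X x = \<one>\<^bsub>FObj G X\<^esub>\<rbrakk> \<Longrightarrow> x = \<one>\<^bsub>FObj F X\<^esub>"
    "x \<in> carrier (FObj F X)" "y \<in> carrier (FObj F X)" "NComp \<eta> X x = NComp \<eta> X y"
  shows "x = y"
  using group_hom.inj_on_one_iff[OF nattrans_group_hom[OF assms(1,2)]] assms(3-6)
  unfolding inj_on_def by blast

lemma nattrans_eqI:
  assumes "\<eta> \<in> Hom (ModCat C) F G" "\<theta> \<in> Hom (ModCat C) F G"
    "\<And>X x. \<lbrakk>X \<in> Obj C; x \<in> carrier (FObj F X)\<rbrakk> \<Longrightarrow> NComp \<eta> X x = NComp \<theta> X x"
  shows "\<eta> = \<theta>"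
proof -
  have "mk_nattrans C F G (NComp \<eta>) = mk_nattrans C F G (NComp \<theta>)"
    using assms(3) by (auto simp: mk_nattrans_def restrict_def fun_eq_iff)
  then show ?thesis using nattrans_mk[OF assms(1)] nattrans_mk[OF assms(2)] by simp
qed

lemma ModCat_Comp_NComp:
  assumes "\<eta> \<in> Hom (ModCat C) F G" "X \<in> Obj C" "x \<in> carrier (FObj F X)"
  shows "NComp (\<theta> \<cdot>\<^bsub>ModCat C\<^esub> \<eta>) X x = NComp \<theta> X (NComp \<eta> X x)"
  using assms nattrans_Dom_Cod[OF assms(1)] by simp

lemma ModCat_category:
  assumes "category C"
  shows "category (ModCat C :: (('o, 'm, 'g) cfunctor, ('o, 'm, 'g) nattrans) excat)" (is "category ?M")
proof (rule category.intro)
  fix f assume "f \<in> Arr ?M"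
  then show "Dom ?M f \<in> Obj ?M" "Cod ?M f \<in> Obj ?M" by (auto simp: natural_transformation_def)
next
  fix F assume "F \<in> Obj ?M"
  then show "Ide ?M F \<in> Hom ?M F F" using ModCat_HomI[of C F F "\<lambda>X x. x"] assms by simp
next
  fix \<eta> \<theta> F G H assume h: "\<eta> \<in> Hom ?M F G" "\<theta> \<in> Hom ?M G H"
  note D = nattrans_Dom_Cod[OF h(1)] nattrans_Dom_Cod[OF h(2)]
  have "mk_nattrans C F H (\<lambda>X x. NComp \<theta> X (NComp \<eta> X x)) \<in> Hom ?M F H"
    using nattrans_cfunctor[OF h(1)] nattrans_cfunctor[OF h(2)] assms nattrans_closed[OF h(1)]
      nattrans_closed[OF h(2)] nattrans_mult[OF h(1)] nattrans_mult[OF h(2)]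
      nattrans_natural[OF h(1)] nattrans_natural[OF h(2)]
    by (intro ModCat_HomI) simp_all
  then show "\<theta> \<cdot>\<^bsub>?M\<^esub> \<eta> \<in> Hom ?M F H" by (simp add: D)
  note C = this
next
  fix \<eta> \<theta> \<zeta> F G H K
  assume h: "\<eta> \<in> Hom ?M F G" "\<theta> \<in> Hom ?M G H" "\<zeta> \<in> Hom ?M H K"
  show "(\<zeta> \<cdot>\<^bsub>?M\<^esub> \<theta>) \<cdot>\<^bsub>?M\<^esub> \<eta> = \<zeta> \<cdot>\<^bsub>?M\<^esub> (\<theta> \<cdot>\<^bsub>?M\<^esub> \<eta>)"
    using nattrans_Dom_Cod[OF h(1)] nattrans_Dom_Cod[OF h(2)] nattrans_Dom_Cod[OF h(3)]
      nattrans_closed[OF h(1)]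
    by (auto simp: mk_nattrans_def restrict_def fun_eq_iff)
next
  fix \<eta> F G assume h: "\<eta> \<in> Hom ?M F G"
  have "\<eta> \<cdot>\<^bsub>?M\<^esub> Ide ?M F = mk_nattrans C F G (NComp \<eta>)"
    "Ide ?M G \<cdot>\<^bsub>?M\<^esub> \<eta> = mk_nattrans C F G (NComp \<eta>)"
    using nattrans_Dom_Cod[OF h] nattrans_closed[OF h]
    by (auto simp: mk_nattrans_def restrict_def fun_eq_iff)
  then show "\<eta> \<cdot>\<^bsub>?M\<^esub> Ide ?M F = \<eta>" "Ide ?M G \<cdot>\<^bsub>?M\<^esub> \<eta> = \<eta>"
    using nattrans_mk[OF h] by simp_all
qed

lemma ModCat_zero_Hom:
  assumes "category C" "additive_cfunctor C F" "additive_cfunctor C G"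
  shows "ZeroArr (ModCat C) F G \<in> Hom (ModCat C) F G"
proof -
  have "\<one>\<^bsub>FObj G X\<^esub> = \<one>\<^bsub>FObj G X\<^esub> \<otimes>\<^bsub>FObj G X\<^esub> \<one>\<^bsub>FObj G X\<^esub>" if "X \<in> Obj C" for X
  proof -
    interpret comm_group "FObj G X" using cfunctor_group[OF assms(3) that] .
    show ?thesis by simp
  qed
  then have "mk_nattrans C F G (\<lambda>X x. \<one>\<^bsub>FObj G X\<^esub>) \<in> Hom (ModCat C) F G"
    using assms cfunctor_one_closed[OF assms(3)] cfunctor_one[OF assms(1,3)]
    by (intro ModCat_HomI) simp_all
  then show ?thesis by simp
qed

definition pointwise_exact ::
    "('o, 'm) excat \<Rightarrow> ('o, 'm, 'g) nattrans \<Rightarrow> ('o, 'm, 'g) nattrans \<Rightarrow> bool" where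
  "pointwise_exact C i p \<longleftrightarrow> (\<forall>X \<in> Obj C.
     (\<forall>x \<in> carrier (FObj (NDom i) X). NComp i X x = \<one>\<^bsub>FObj (NCod i) X\<^esub> \<longrightarrow> x = \<one>\<^bsub>FObj (NDom i) X\<^esub>) \<and>
     (\<forall>y \<in> carrier (FObj (NCod i) X). NComp p X y = \<one>\<^bsub>FObj (NCod p) X\<^esub> \<longleftrightarrow>
        (\<exists>x \<in> carrier (FObj (NDom i) X). NComp i X x = y)) \<and>
     (\<forall>z \<in> carrier (FObj (NCod p) X). \<exists>y \<in> carrier (FObj (NCod i) X). NComp p X y = z))"

section \<open>The Yoneda lemma and kernels of natural transformations\<close>

context preadditive_category
begin

lemma Yoneda_cfunctor: "X \<in> Obj C \<Longrightarrow> additive_cfunctor C (Yoneda_obj C X)"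
  unfolding additive_cfunctor_def Yoneda_obj_def
  using Hom_comm_group Add_Comp Comp_Add
  by (auto simp: Hom_group_def hom_def Hom_def)

lemma Yoneda_obj_simps [simp]:
  "carrier (FObj (Yoneda_obj C X) W) = Hom C W X"
  "FArr (Yoneda_obj C X) f h = h \<cdot> f"
  "monoid.mult (FObj (Yoneda_obj C X) W) = Add C"
  "\<one>\<^bsub>FObj (Yoneda_obj C X) W\<^esub> = \<zero> W X"
  by (simp_all add: Yoneda_obj_def Hom_group_def)

text \<open>The transformation that the Yoneda lemma attaches to an element \<open>x\<close> of
  \<open>F W\<close>; it makes elements of functors accessible to universal properties.\<close>

definition yoneda_map :: "('a, 'b, 'b) cfunctor \<Rightarrow> 'a \<Rightarrow> 'b \<Rightarrow> ('a, 'b, 'b) nattrans" where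
  "yoneda_map F W x = mk_nattrans C (Yoneda_obj C W) F (\<lambda>V h. FArr F h x)"

lemma yoneda_map_Hom:
  assumes "additive_cfunctor C F" "W \<in> Obj C" "x \<in> carrier (FObj F W)"
  shows "yoneda_map F W x \<in> Hom (ModCat C) (Yoneda_obj C W) F"
  unfolding yoneda_map_def
  by (rule ModCat_HomI[OF Yoneda_cfunctor[OF assms(2)] assms(1)])
    (use assms cfunctor_closed[OF assms(1)] cfunctor_Add[OF assms(1)] cfunctor_Comp[OF assms(1)]
      category_axioms in \<open>auto simp: Hom_def\<close>)

lemma yoneda_map_NComp:
  "h \<in> Hom C V W \<Longrightarrow> NComp (yoneda_map F W x) V h = FArr F h x"
  using Hom_Obj[of h V W] by (simp add: yoneda_map_def)

lemma yoneda_map_Ide: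
  assumes "additive_cfunctor C F" "W \<in> Obj C" "x \<in> carrier (FObj F W)"
  shows "NComp (yoneda_map F W x) W (Ide C W) = x"
  using yoneda_map_NComp[OF Ide_Hom[OF assms(2)]] cfunctor_Ide[OF assms] by simp

lemma yoneda_eval:
  assumes "\<eta> \<in> Hom (ModCat C) (Yoneda_obj C W) F" "h \<in> Hom C V W"
  shows "NComp \<eta> V h = FArr F h (NComp \<eta> W (Ide C W))"
  using nattrans_natural[OF assms(1), of h "Ide C W"] assms(2) Hom_Obj[OF assms(2)]
  by (simp add: Hom_def)

lemma yoneda_eval_closed:
  assumes "\<eta> \<in> Hom (ModCat C) (Yoneda_obj C W) F" "W \<in> Obj C"
  shows "NComp \<eta> W (Ide C W) \<in> carrier (FObj F W)"
  using nattrans_closed[OF assms] Ide_Hom[OF assms(2)] by simp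

lemma Yoneda_arr_Hom:
  assumes "f \<in> Hom C X Y"
  shows "Yoneda_arr C f \<in> Hom (ModCat C) (Yoneda_obj C X) (Yoneda_obj C Y)"
proof -
  have D: "Dom C f = X" "Cod C f = Y" "X \<in> Obj C" "Y \<in> Obj C" using assms Hom_Obj by (auto simp: Hom_def)
  show ?thesis
    unfolding Yoneda_arr_def D
    by (rule ModCat_HomI[OF Yoneda_cfunctor[OF D(3)] Yoneda_cfunctor[OF D(4)]])
      (use assms category_axioms in \<open>auto simp: Hom_def\<close>)
qed

lemma Yoneda_arr_NComp:
  "\<lbrakk>f \<in> Hom C X Y; h \<in> Hom C W X\<rbrakk> \<Longrightarrow> NComp (Yoneda_arr C f) W h = f \<cdot> h"
  using Hom_Obj[of h W X] by (simp add: Yoneda_arr_def Hom_D)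

text \<open>Elements of \<open>F X\<close> are transformations from the functor represented by
  \<open>X\<close>, so the universal property tested on this one functor gives exactness at
  \<open>X\<close>. Representable functors have carriers of arrows, whence the types.\<close>

lemma ModCat_kernel_pointwise:
  assumes k: "is_kernel (ModCat C) i p" and i: "i \<in> Hom (ModCat C) F G"
    and p: "p \<in> Hom (ModCat C) G (H :: ('a, 'b, 'b) cfunctor)" and X: "X \<in> Obj C"
  shows "\<And>x. \<lbrakk>x \<in> carrier (FObj F X); NComp i X x = \<one>\<^bsub>FObj G X\<^esub>\<rbrakk> \<Longrightarrow> x = \<one>\<^bsub>FObj F X\<^esub>"
    and "\<And>y. y \<in> carrier (FObj G X) \<Longrightarrow> NComp p X y = \<one>\<^bsub>FObj H X\<^esub> \<longleftrightarrow>
      (\<exists>x \<in> carrier (FObj F X). NComp i X x = y)"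
proof -
  let ?M = "ModCat C :: (('a, 'b, 'b) cfunctor, ('a, 'b, 'b) nattrans) excat"
  let ?Y = "Yoneda_obj C X"
  interpret M: category ?M by (rule ModCat_category[OF category_axioms])
  note F = nattrans_cfunctor[OF i] nattrans_cfunctor[OF p]
  note D = nattrans_Dom_Cod[OF i] nattrans_Dom_Cod[OF p]
  have Y: "additive_cfunctor C ?Y" using Yoneda_cfunctor[OF X] .
  have pi: "p \<cdot>\<^bsub>?M\<^esub> i = ZeroArr ?M F H" using k D by (simp add: is_kernel_def del: ModCat_simps(5-))
  have ex1: "\<exists>!h. h \<in> Hom ?M ?Y F \<and> i \<cdot>\<^bsub>?M\<^esub> h = g"
    if "g \<in> Hom ?M ?Y G" "p \<cdot>\<^bsub>?M\<^esub> g = ZeroArr ?M ?Y H" for g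
    using k that Y D unfolding is_kernel_def by (simp del: ModCat_simps(5-))
  {
    fix x assume x: "x \<in> carrier (FObj F X)" "NComp i X x = \<one>\<^bsub>FObj G X\<^esub>"
    note yx = yoneda_map_Hom[OF F(1) X x(1)]
    note Z = ModCat_zero_Hom[OF category_axioms Y F(1)] ModCat_zero_Hom[OF category_axioms Y F(2)]
      ModCat_zero_Hom[OF category_axioms Y F(4)]
    have "i \<cdot>\<^bsub>?M\<^esub> yoneda_map F X x = ZeroArr ?M ?Y G"
    proof (rule nattrans_eqI[OF M.Comp_Hom[OF yx i] Z(2)])
      fix V h assume V: "V \<in> Obj C" "h \<in> carrier (FObj ?Y V)"
      have h: "h \<in> Hom C V X" using V by simp
      have "NComp i V (FArr F h x) = FArr G h (NComp i X x)"
        using nattrans_natural[OF i, of h x] h x(1) by (simp add: Hom_def)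
      also have "\<dots> = \<one>\<^bsub>FObj G V\<^esub>"
        using cfunctor_one[OF category_axioms F(2), of h] h x(2) by (simp add: Hom_def)
      finally show "NComp (i \<cdot>\<^bsub>?M\<^esub> yoneda_map F X x) V h = NComp (ZeroArr ?M ?Y G) V h"
        using ModCat_Comp_NComp[OF yx V] yoneda_map_NComp[OF h] V by simp
    qed
    moreover have "i \<cdot>\<^bsub>?M\<^esub> ZeroArr ?M ?Y F = ZeroArr ?M ?Y G"
      by (rule nattrans_eqI[OF M.Comp_Hom[OF Z(1) i] Z(2)])
        (use nattrans_one[OF i] in \<open>simp add: ModCat_Comp_NComp[OF Z(1)]\<close>)
    moreover have "p \<cdot>\<^bsub>?M\<^esub> ZeroArr ?M ?Y G = ZeroArr ?M ?Y H"
      by (rule nattrans_eqI[OF M.Comp_Hom[OF Z(2) p] Z(3)])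
        (use nattrans_one[OF p] in \<open>simp add: ModCat_Comp_NComp[OF Z(2)]\<close>)
    ultimately have "yoneda_map F X x = ZeroArr ?M ?Y F"
      using ex1[OF Z(2)] yx Z(1) by blast
    then show "x = \<one>\<^bsub>FObj F X\<^esub>"
      using yoneda_map_Ide[OF F(1) X x(1)] X by (simp add: Hom_def)
  }
  fix y assume y: "y \<in> carrier (FObj G X)"
  show "NComp p X y = \<one>\<^bsub>FObj H X\<^esub> \<longleftrightarrow> (\<exists>x \<in> carrier (FObj F X). NComp i X x = y)"
  proof
    assume py: "NComp p X y = \<one>\<^bsub>FObj H X\<^esub>"
    note yy = yoneda_map_Hom[OF F(2) X y]
    have "p \<cdot>\<^bsub>?M\<^esub> yoneda_map G X y = ZeroArr ?M ?Y H"
    proof (rule nattrans_eqI[OF M.Comp_Hom[OF yy p] ModCat_zero_Hom[OF category_axioms Y F(4)]])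
      fix V h assume V: "V \<in> Obj C" "h \<in> carrier (FObj ?Y V)"
      have h: "h \<in> Hom C V X" using V by simp
      have "NComp p V (FArr G h y) = FArr H h (NComp p X y)"
        using nattrans_natural[OF p, of h y] h y by (simp add: Hom_def)
      also have "\<dots> = \<one>\<^bsub>FObj H V\<^esub>"
        using cfunctor_one[OF category_axioms F(4), of h] h py by (simp add: Hom_def)
      finally show "NComp (p \<cdot>\<^bsub>?M\<^esub> yoneda_map G X y) V h = NComp (ZeroArr ?M ?Y H) V h"
        using ModCat_Comp_NComp[OF yy V] yoneda_map_NComp[OF h] V by simp
    qed
    then obtain h where h: "h \<in> Hom ?M ?Y F" "i \<cdot>\<^bsub>?M\<^esub> h = yoneda_map G X y" using ex1[OF yy] by blast
    have "NComp i X (NComp h X (Ide C X)) = y"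
      using ModCat_Comp_NComp[OF h(1) X, of "Ide C X" i] Ide_Hom[OF X] yoneda_map_Ide[OF F(2) X y]
      unfolding h(2) by simp
    then show "\<exists>x \<in> carrier (FObj F X). NComp i X x = y" using yoneda_eval_closed[OF h(1) X] by blast
  next
    assume "\<exists>x \<in> carrier (FObj F X). NComp i X x = y"
    then obtain x where x: "x \<in> carrier (FObj F X)" "NComp i X x = y" by blast
    have "NComp (p \<cdot>\<^bsub>?M\<^esub> i) X x = NComp (ZeroArr ?M F H) X x" by (simp only: pi)
    then show "NComp p X y = \<one>\<^bsub>FObj H X\<^esub>"
      using ModCat_Comp_NComp[OF i X x(1)] x X by simp
  qed
qed

end

section \<open>Subfunctors, images and pointwise criteria for kernels and cokernels\<close>

context category
begin

definition subfunctor :: "('o, 'm, 'g) cfunctor \<Rightarrow> ('o \<Rightarrow> 'g set) \<Rightarrow> ('o, 'm, 'g) cfunctor" where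
  "subfunctor F S = \<lparr>FObj = (\<lambda>X. (FObj F X)\<lparr>carrier := S X\<rparr>), FArr = FArr F\<rparr>"

lemma subfunctor_simps [simp]:
  "carrier (FObj (subfunctor F S) X) = S X" "FArr (subfunctor F S) = FArr F"
  "monoid.mult (FObj (subfunctor F S) X) = monoid.mult (FObj F X)"
  "\<one>\<^bsub>FObj (subfunctor F S) X\<^esub> = \<one>\<^bsub>FObj F X\<^esub>"
  by (simp_all add: subfunctor_def)

lemma subfunctor_cfunctor:
  assumes F: "additive_cfunctor C F"
    and sub: "\<And>X. X \<in> Obj C \<Longrightarrow> subgroup (S X) (FObj F X)"
    and closed: "\<And>f x. \<lbrakk>f \<in> Arr C; x \<in> S (Cod C f)\<rbrakk> \<Longrightarrow> FArr F f x \<in> S (Dom C f)"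
  shows "additive_cfunctor C (subfunctor F S)"
proof -
  have S: "x \<in> carrier (FObj F X)" if "X \<in> Obj C" "x \<in> S X" for X x
    using subgroup.mem_carrier[OF sub[OF that(1)] that(2)] .
  have grp: "comm_group (FObj (subfunctor F S) X)" if X: "X \<in> Obj C" for X
  proof -
    interpret comm_group "FObj F X" using cfunctor_group[OF F X] .
    interpret subgroup "S X" "FObj F X" using sub[OF X] .
    have "group ((FObj F X)\<lparr>carrier := S X\<rparr>)" by (rule subgroup_is_group) (rule is_group)
    then show ?thesis
      by (intro group.group_comm_groupI) (use m_comm in \<open>auto simp: subfunctor_def\<close>)
  qed
  show ?thesis
    unfolding additive_cfunctor_def
  proof (intro conjI ballI impI)
    fix f assume f: "f \<in> Arr C"
    show "FArr (subfunctor F S) f \<in> hom (FObj (subfunctor F S) (Cod C f)) (FObj (subfunctor F S) (Dom C f))"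
      using f closed hom_mult[OF cfunctor_hom[OF F f]] S[of "Cod C f"] by (auto simp: hom_def)
  qed (use grp F S closed in \<open>auto simp: cfunctor_Ide cfunctor_Comp cfunctor_Add\<close>)
qed

lemma subfunctor_inclusion:
  assumes "additive_cfunctor C F" "additive_cfunctor C (subfunctor F S)"
    "\<And>X. X \<in> Obj C \<Longrightarrow> S X \<subseteq> carrier (FObj F X)"
  shows "mk_nattrans C (subfunctor F S) F (\<lambda>X x. x) \<in> Hom (ModCat C) (subfunctor F S) F"
  by (rule ModCat_HomI[OF assms(2,1)]) (use assms(3) category_axioms in auto)

lemma image_functor:
  assumes \<eta>: "\<eta> \<in> Hom (ModCat C) F G"
  defines "S \<equiv> \<lambda>X. NComp \<eta> X ` carrier (FObj F X)"
  shows "additive_cfunctor C (subfunctor G S)"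
    and "mk_nattrans C F (subfunctor G S) (NComp \<eta>) \<in> Hom (ModCat C) F (subfunctor G S)"
    and "mk_nattrans C (subfunctor G S) G (\<lambda>X x. x) \<in> Hom (ModCat C) (subfunctor G S) G"
proof -
  note F = nattrans_cfunctor[OF \<eta>]
  have sub: "subgroup (S X) (FObj G X)" if "X \<in> Obj C" for X
    unfolding S_def using group_hom.img_is_subgroup[OF nattrans_group_hom[OF \<eta> that]] .
  show c: "additive_cfunctor C (subfunctor G S)"
  proof (rule subfunctor_cfunctor[OF F(2) sub])
    fix f x assume f: "f \<in> Arr C" "x \<in> S (Cod C f)"
    then obtain z where z: "z \<in> carrier (FObj F (Cod C f))" "x = NComp \<eta> (Cod C f) z" by (auto simp: S_def)
    then have "FArr G f x = NComp \<eta> (Dom C f) (FArr F f z)" using nattrans_natural[OF \<eta> f(1)] by simp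
    then show "FArr G f x \<in> S (Dom C f)"
      using cfunctor_closed[OF F(1) f(1) z(1)] by (simp add: S_def)
  qed
  show "mk_nattrans C F (subfunctor G S) (NComp \<eta>) \<in> Hom (ModCat C) F (subfunctor G S)"
    by (rule ModCat_HomI[OF F(1) c])
      (use nattrans_mult[OF \<eta>] nattrans_natural[OF \<eta>] category_axioms in \<open>auto simp: S_def\<close>)
  show "mk_nattrans C (subfunctor G S) G (\<lambda>X x. x) \<in> Hom (ModCat C) (subfunctor G S) G"
    by (rule subfunctor_inclusion[OF F(2) c]) (use subgroup.subset[OF sub] in blast)
qed

text \<open>The corestriction \<open>p0\<close> of \<open>p\<close> to its image also kills
  \<open>i\<close>, so it factors as \<open>h \<cdot> p\<close>. Including the image back into
  \<open>H\<close> gives \<open>p\<close> again, so the inclusion after \<open>h\<close> is the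
  identity by uniqueness, and every element of \<open>H\<close> lies in the image.\<close>

lemma ModCat_cokernel_surj:
  assumes c: "is_cokernel (ModCat C) p i" and i: "i \<in> Hom (ModCat C) F G" and p: "p \<in> Hom (ModCat C) G (H :: ('o, 'm, 'g) cfunctor)"
    and X: "X \<in> Obj C" and z: "z \<in> carrier (FObj H X)"
  shows "\<exists>y \<in> carrier (FObj G X). NComp p X y = z"
proof -
  let ?M = "ModCat C :: (('o, 'm, 'g) cfunctor, ('o, 'm, 'g) nattrans) excat"
  interpret M: category ?M by (rule ModCat_category[OF category_axioms])
  define S where "S = (\<lambda>X. NComp p X ` carrier (FObj G X))"
  define p0 where "p0 = mk_nattrans C G (subfunctor H S) (NComp p)"
  define j where "j = mk_nattrans C (subfunctor H S) H (\<lambda>X x. x)"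
  note F = nattrans_cfunctor[OF i] nattrans_cfunctor[OF p]
  have I: "additive_cfunctor C (subfunctor H S)" "p0 \<in> Hom ?M G (subfunctor H S)" "j \<in> Hom ?M (subfunctor H S) H"
    using image_functor[OF p] unfolding S_def p0_def j_def by simp_all
  have pi: "p \<cdot>\<^bsub>?M\<^esub> i = ZeroArr ?M F H"
    using c nattrans_Dom_Cod[OF i] nattrans_Dom_Cod[OF p] by (simp add: is_cokernel_def del: ModCat_simps(5-))
  have ex1: "\<exists>!h. h \<in> Hom ?M H K \<and> h \<cdot>\<^bsub>?M\<^esub> p = g"
    if "g \<in> Hom ?M G K" "g \<cdot>\<^bsub>?M\<^esub> i = ZeroArr ?M F K" "additive_cfunctor C K" for g K
    using c that nattrans_Dom_Cod[OF i] nattrans_Dom_Cod[OF p] unfolding is_cokernel_def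
    by (simp del: ModCat_simps(5-))
  have "p0 \<cdot>\<^bsub>?M\<^esub> i = ZeroArr ?M F (subfunctor H S)"
  proof (rule nattrans_eqI[OF M.Comp_Hom[OF i I(2)] ModCat_zero_Hom[OF category_axioms F(1) I(1)]])
    fix V x assume V: "V \<in> Obj C" "x \<in> carrier (FObj F V)"
    have "NComp (p \<cdot>\<^bsub>?M\<^esub> i) V x = NComp (ZeroArr ?M F H) V x" by (simp only: pi)
    then show "NComp (p0 \<cdot>\<^bsub>?M\<^esub> i) V x = NComp (ZeroArr ?M F (subfunctor H S)) V x"
      using V nattrans_closed[OF i V] nattrans_Dom_Cod[OF i] by (simp add: p0_def)
  qed
  then obtain h where h: "h \<in> Hom ?M H (subfunctor H S)" "h \<cdot>\<^bsub>?M\<^esub> p = p0"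
    using ex1[OF I(2) _ I(1)] by blast
  have jp: "j \<cdot>\<^bsub>?M\<^esub> p0 = p"
    by (rule nattrans_eqI[OF M.Comp_Hom[OF I(2,3)] p])
      (use nattrans_closed[OF p] in \<open>simp add: ModCat_Comp_NComp[OF I(2)] p0_def j_def S_def\<close>)
  have "(j \<cdot>\<^bsub>?M\<^esub> h) \<cdot>\<^bsub>?M\<^esub> p = p"
    using M.Comp_assoc[OF p h(1) I(3)] by (simp only: h(2) jp)
  moreover have "Ide ?M H \<cdot>\<^bsub>?M\<^esub> p = p" using M.Ide_Comp[OF p] .
  moreover have "j \<cdot>\<^bsub>?M\<^esub> h \<in> Hom ?M H H" "Ide ?M H \<in> Hom ?M H H"
    using M.Comp_Hom[OF h(1) I(3)] M.Ide_Hom F(4) by simp_all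
  ultimately have "j \<cdot>\<^bsub>?M\<^esub> h = Ide ?M H" using ex1[OF p pi F(4)] by blast
  then have "NComp (j \<cdot>\<^bsub>?M\<^esub> h) X z = z" using X z by simp
  then have "NComp h X z = z"
    using ModCat_Comp_NComp[OF h(1) X z] nattrans_closed[OF h(1) X z] X z
    by (simp add: j_def nattrans_Dom_Cod[OF h(1)])
  then show ?thesis using nattrans_closed[OF h(1) X z] by (auto simp: S_def)
qed

text \<open>Pointwise injectivity of \<open>i\<close> makes the preimages chosen by \<open>k\<close>
  unique, and uniqueness yields additivity and naturality.\<close>

lemma pointwise_exact_kernel:
  assumes i: "i \<in> Hom (ModCat C) F G" and p: "p \<in> Hom (ModCat C) G (H :: ('o, 'm, 'g) cfunctor)"
    and mono: "\<And>X x. \<lbrakk>X \<in> Obj C; x \<in> carrier (FObj F X); NComp i X x = \<one>\<^bsub>FObj G X\<^esub>\<rbrakk>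
      \<Longrightarrow> x = \<one>\<^bsub>FObj F X\<^esub>"
    and exact: "\<And>X y. \<lbrakk>X \<in> Obj C; y \<in> carrier (FObj G X)\<rbrakk> \<Longrightarrow> NComp p X y = \<one>\<^bsub>FObj H X\<^esub> \<longleftrightarrow>
      (\<exists>x \<in> carrier (FObj F X). NComp i X x = y)"
  shows "is_kernel (ModCat C) i p"
proof -
  let ?M = "ModCat C :: (('o, 'm, 'g) cfunctor, ('o, 'm, 'g) nattrans) excat"
  interpret M: category ?M by (rule ModCat_category[OF category_axioms])
  note A = nattrans_cfunctor[OF i] nattrans_cfunctor[OF p] and D = nattrans_Dom_Cod[OF i] nattrans_Dom_Cod[OF p]
  have inj: "x = y" if "X \<in> Obj C" "x \<in> carrier (FObj F X)" "y \<in> carrier (FObj F X)"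
      "NComp i X x = NComp i X y" for X x y
    using nattrans_inj[OF i that(1) mono[OF that(1)] that(2-4)] .
  have pi: "p \<cdot>\<^bsub>?M\<^esub> i = ZeroArr ?M F H"
  proof (rule nattrans_eqI[OF M.Comp_Hom[OF i p] ModCat_zero_Hom[OF category_axioms A(1,4)]])
    fix X x assume x: "X \<in> Obj C" "x \<in> carrier (FObj F X)"
    show "NComp (p \<cdot>\<^bsub>?M\<^esub> i) X x = NComp (ZeroArr ?M F H) X x"
      using exact[OF x(1) nattrans_closed[OF i x]] x ModCat_Comp_NComp[OF i x] by auto
  qed
  have ex: "\<exists>!h. h \<in> Hom ?M W F \<and> i \<cdot>\<^bsub>?M\<^esub> h = g"
    if g: "g \<in> Hom ?M W G" and pg: "p \<cdot>\<^bsub>?M\<^esub> g = ZeroArr ?M W H" for W g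
  proof -
    note W = nattrans_cfunctor(1)[OF g]
    define k where "k = (\<lambda>X w. SOME x. x \<in> carrier (FObj F X) \<and> NComp i X x = NComp g X w)"
    have k: "k X w \<in> carrier (FObj F X)" "NComp i X (k X w) = NComp g X w"
      if X: "X \<in> Obj C" and w: "w \<in> carrier (FObj W X)" for X w
    proof -
      have "NComp (p \<cdot>\<^bsub>?M\<^esub> g) X w = NComp (ZeroArr ?M W H) X w" by (simp only: pg)
      then have "NComp p X (NComp g X w) = \<one>\<^bsub>FObj H X\<^esub>"
        using ModCat_Comp_NComp[OF g X w] X w by simp
      then have "\<exists>x. x \<in> carrier (FObj F X) \<and> NComp i X x = NComp g X w"
        using exact[OF X nattrans_closed[OF g X w]] by blast
      from someI_ex[OF this] show "k X w \<in> carrier (FObj F X)" "NComp i X (k X w) = NComp g X w"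
        unfolding k_def by simp_all
    qed
    have kH: "mk_nattrans C W F k \<in> Hom ?M W F"
    proof (rule ModCat_HomI[OF W A(1)])
      fix X x y assume X: "X \<in> Obj C" and xy: "x \<in> carrier (FObj W X)" "y \<in> carrier (FObj W X)"
      interpret W: comm_group "FObj W X" using cfunctor_group[OF W X] .
      interpret F: comm_group "FObj F X" using cfunctor_group[OF A(1) X] .
      show "k X (x \<otimes>\<^bsub>FObj W X\<^esub> y) = k X x \<otimes>\<^bsub>FObj F X\<^esub> k X y"
        by (rule inj[OF X]) (use k[OF X] X xy nattrans_mult[OF i X] nattrans_mult[OF g X] in simp_all)
    next
      fix f x assume f: "f \<in> Arr C" "x \<in> carrier (FObj W (Cod C f))" "Dom C f \<in> Obj C" "Cod C f \<in> Obj C"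
      have fx: "FArr W f x \<in> carrier (FObj W (Dom C f))" using cfunctor_closed[OF W f(1,2)] .
      show "k (Dom C f) (FArr W f x) = FArr F f (k (Cod C f) x)"
        by (rule inj[OF f(3)])
          (use k[OF f(3) fx] k[OF f(4,2)] cfunctor_closed[OF A(1) f(1)] nattrans_natural[OF i f(1)]
            nattrans_natural[OF g f(1)] f in simp_all)
    qed (use k category_axioms in simp_all)
    show ?thesis
    proof (rule ex1I[of _ "mk_nattrans C W F k"])
      have "i \<cdot>\<^bsub>?M\<^esub> mk_nattrans C W F k = g"
        by (rule nattrans_eqI[OF M.Comp_Hom[OF kH i] g])
          (use k in \<open>simp add: ModCat_Comp_NComp[OF kH]\<close>)
      then show "mk_nattrans C W F k \<in> Hom ?M W F \<and> i \<cdot>\<^bsub>?M\<^esub> mk_nattrans C W F k = g" using kH by blast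
      fix h assume h: "h \<in> Hom ?M W F \<and> i \<cdot>\<^bsub>?M\<^esub> h = g"
      show "h = mk_nattrans C W F k"
      proof (rule nattrans_eqI[OF conjunct1[OF h] kH])
        fix X x assume X: "X \<in> Obj C" "x \<in> carrier (FObj W X)"
        have "NComp i X (NComp h X x) = NComp g X x"
          using ModCat_Comp_NComp[OF conjunct1[OF h] X, of i] h by simp
        then have "NComp h X x = k X x"
          by (intro inj[OF X(1) nattrans_closed[OF conjunct1[OF h] X] k(1)[OF X]]) (simp only: k(2)[OF X])
        then show "NComp h X x = NComp (mk_nattrans C W F k) X x" using X by simp
      qed
    qed
  qed
  show ?thesis
    unfolding is_kernel_def
  proof (intro conjI ballI impI)
    fix W g assume "g \<in> Hom ?M W (Dom ?M p)" "p \<cdot>\<^bsub>?M\<^esub> g = ZeroArr ?M W (Cod ?M p)"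
    then show "\<exists>!h. h \<in> Hom ?M W (Dom ?M i) \<and> i \<cdot>\<^bsub>?M\<^esub> h = g"
      using ex by (simp only: ModCat_simps(1-4) D)
  qed (use i p pi D in \<open>simp_all add: ModCat_Hom del: ModCat_simps(5-)\<close>)
qed

text \<open>By \<open>wd\<close>, \<open>g\<close> is constant on the fibres of \<open>p\<close>, so
  evaluating it at arbitrarily chosen preimages is additive and natural.\<close>

lemma pointwise_exact_cokernel:
  assumes i: "i \<in> Hom (ModCat C) F G" and p: "p \<in> Hom (ModCat C) G (H :: ('o, 'm, 'g) cfunctor)"
    and exact: "\<And>X y. \<lbrakk>X \<in> Obj C; y \<in> carrier (FObj G X)\<rbrakk> \<Longrightarrow> NComp p X y = \<one>\<^bsub>FObj H X\<^esub> \<longleftrightarrow>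
      (\<exists>x \<in> carrier (FObj F X). NComp i X x = y)"
    and surj: "\<And>X z. \<lbrakk>X \<in> Obj C; z \<in> carrier (FObj H X)\<rbrakk> \<Longrightarrow> \<exists>y \<in> carrier (FObj G X). NComp p X y = z"
  shows "is_cokernel (ModCat C) p i"
proof -
  let ?M = "ModCat C :: (('o, 'm, 'g) cfunctor, ('o, 'm, 'g) nattrans) excat"
  interpret M: category ?M by (rule ModCat_category[OF category_axioms])
  note A = nattrans_cfunctor[OF i] nattrans_cfunctor[OF p] and D = nattrans_Dom_Cod[OF i] nattrans_Dom_Cod[OF p]
  have pi: "p \<cdot>\<^bsub>?M\<^esub> i = ZeroArr ?M F H"
  proof (rule nattrans_eqI[OF M.Comp_Hom[OF i p] ModCat_zero_Hom[OF category_axioms A(1,4)]])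
    fix X x assume x: "X \<in> Obj C" "x \<in> carrier (FObj F X)"
    show "NComp (p \<cdot>\<^bsub>?M\<^esub> i) X x = NComp (ZeroArr ?M F H) X x"
      using exact[OF x(1) nattrans_closed[OF i x]] x ModCat_Comp_NComp[OF i x] by auto
  qed
  have ex: "\<exists>!h. h \<in> Hom ?M H W \<and> h \<cdot>\<^bsub>?M\<^esub> p = g"
    if g: "g \<in> Hom ?M G W" and gi: "g \<cdot>\<^bsub>?M\<^esub> i = ZeroArr ?M F W" for W g
  proof -
    note W = nattrans_cfunctor(2)[OF g]
    have wd: "NComp g X y = NComp g X y'"
      if X: "X \<in> Obj C" and y: "y \<in> carrier (FObj G X)" "y' \<in> carrier (FObj G X)"
        and eq: "NComp p X y = NComp p X y'" for X y y'
    proof -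
      interpret p: group_hom "FObj G X" "FObj H X" "NComp p X" using nattrans_group_hom[OF p X] .
      interpret g: group_hom "FObj G X" "FObj W X" "NComp g X" using nattrans_group_hom[OF g X] .
      have "NComp p X (y \<otimes>\<^bsub>FObj G X\<^esub> inv\<^bsub>FObj G X\<^esub> y') = \<one>\<^bsub>FObj H X\<^esub>" using y eq by simp
      then obtain x where x: "x \<in> carrier (FObj F X)" "NComp i X x = y \<otimes>\<^bsub>FObj G X\<^esub> inv\<^bsub>FObj G X\<^esub> y'"
        using exact[OF X, of "y \<otimes>\<^bsub>FObj G X\<^esub> inv\<^bsub>FObj G X\<^esub> y'"] y by auto
      have "NComp (g \<cdot>\<^bsub>?M\<^esub> i) X x = NComp (ZeroArr ?M F W) X x" by (simp only: gi)
      then have "NComp g X (y \<otimes>\<^bsub>FObj G X\<^esub> inv\<^bsub>FObj G X\<^esub> y') = \<one>\<^bsub>FObj W X\<^esub>"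
        using ModCat_Comp_NComp[OF i X x(1)] X x by simp
      then have "NComp g X y \<otimes>\<^bsub>FObj W X\<^esub> inv\<^bsub>FObj W X\<^esub> NComp g X y' = \<one>\<^bsub>FObj W X\<^esub>" using y by simp
      then show ?thesis using y g.H.inv_solve_right'[of "\<one>\<^bsub>FObj W X\<^esub>" "NComp g X y" "NComp g X y'"] by simp
    qed
    define s where "s = (\<lambda>X z. SOME y. y \<in> carrier (FObj G X) \<and> NComp p X y = z)"
    have s: "s X z \<in> carrier (FObj G X)" "NComp p X (s X z) = z"
      if X: "X \<in> Obj C" and z: "z \<in> carrier (FObj H X)" for X z
    proof -
      have "\<exists>y. y \<in> carrier (FObj G X) \<and> NComp p X y = z" using surj[OF X z] by blast
      from someI_ex[OF this] show "s X z \<in> carrier (FObj G X)" "NComp p X (s X z) = z"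
        unfolding s_def by simp_all
    qed
    define k where "k = (\<lambda>X z. NComp g X (s X z))"
    have kH: "mk_nattrans C H W k \<in> Hom ?M H W"
    proof (rule ModCat_HomI[OF A(4) W])
      fix X x y assume X: "X \<in> Obj C" and xy: "x \<in> carrier (FObj H X)" "y \<in> carrier (FObj H X)"
      interpret H: comm_group "FObj H X" using cfunctor_group[OF A(4) X] .
      interpret G: comm_group "FObj G X" using cfunctor_group[OF A(2) X] .
      have "k X (x \<otimes>\<^bsub>FObj H X\<^esub> y) = NComp g X (s X x \<otimes>\<^bsub>FObj G X\<^esub> s X y)"
        unfolding k_def by (rule wd[OF X]) (use s[OF X] xy nattrans_mult[OF p X] in simp_all)
      then show "k X (x \<otimes>\<^bsub>FObj H X\<^esub> y) = k X x \<otimes>\<^bsub>FObj W X\<^esub> k X y"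
        using nattrans_mult[OF g X] s[OF X] xy by (simp add: k_def)
    next
      fix f x assume f: "f \<in> Arr C" "x \<in> carrier (FObj H (Cod C f))" "Dom C f \<in> Obj C" "Cod C f \<in> Obj C"
      note fx = cfunctor_closed[OF A(4) f(1,2)] and fs = cfunctor_closed[OF A(2) f(1) s(1)[OF f(4,2)]]
      have "k (Dom C f) (FArr H f x) = NComp g (Dom C f) (FArr G f (s (Cod C f) x))"
        unfolding k_def
        by (rule wd[OF f(3)]) (use s[OF f(3) fx] s[OF f(4,2)] fs nattrans_natural[OF p f(1)] in simp_all)
      then show "k (Dom C f) (FArr H f x) = FArr W f (k (Cod C f) x)"
        using nattrans_natural[OF g f(1) s(1)[OF f(4,2)]] by (simp add: k_def)
    qed (use s nattrans_closed[OF g] category_axioms in \<open>simp_all add: k_def\<close>)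
    show ?thesis
    proof (rule ex1I[of _ "mk_nattrans C H W k"])
      have "mk_nattrans C H W k \<cdot>\<^bsub>?M\<^esub> p = g"
      proof (rule nattrans_eqI[OF M.Comp_Hom[OF p kH] g])
        fix X y assume X: "X \<in> Obj C" "y \<in> carrier (FObj G X)"
        note pc = nattrans_closed[OF p X]
        show "NComp (mk_nattrans C H W k \<cdot>\<^bsub>?M\<^esub> p) X y = NComp g X y"
          using ModCat_Comp_NComp[OF p X, of "mk_nattrans C H W k"] wd[OF X(1) s(1)[OF X(1) pc] X(2)]
            s(2)[OF X(1) pc] pc X by (simp add: k_def)
      qed
      then show "mk_nattrans C H W k \<in> Hom ?M H W \<and> mk_nattrans C H W k \<cdot>\<^bsub>?M\<^esub> p = g" using kH by blast
      fix h assume h: "h \<in> Hom ?M H W \<and> h \<cdot>\<^bsub>?M\<^esub> p = g"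
      show "h = mk_nattrans C H W k"
      proof (rule nattrans_eqI[OF conjunct1[OF h] kH])
        fix X z assume X: "X \<in> Obj C" "z \<in> carrier (FObj H X)"
        have "NComp h X (NComp p X (s X z)) = NComp g X (s X z)"
          using ModCat_Comp_NComp[OF p X(1) s(1)[OF X], of h] h by simp
        then show "NComp h X z = NComp (mk_nattrans C H W k) X z" using s[OF X] X by (simp add: k_def)
      qed
    qed
  qed
  show ?thesis
    unfolding is_cokernel_def
  proof (intro conjI ballI impI)
    fix W g assume "g \<in> Hom ?M (Cod ?M i) W" "g \<cdot>\<^bsub>?M\<^esub> i = ZeroArr ?M (Dom ?M i) W"
    then show "\<exists>!h. h \<in> Hom ?M (Cod ?M p) W \<and> h \<cdot>\<^bsub>?M\<^esub> p = g"
      using ex by (simp only: ModCat_simps(1-4) D)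
  qed (use i p pi D in \<open>simp_all add: ModCat_Hom del: ModCat_simps(5-)\<close>)
qed

end

lemma (in preadditive_category) ModCat_Confl_iff:
  assumes i: "i \<in> Hom (ModCat C) F G" and p: "p \<in> Hom (ModCat C) G (H :: ('a, 'b, 'b) cfunctor)"
  shows "(i, p) \<in> Confl (ModCat C) \<longleftrightarrow> pointwise_exact C i p"
proof
  note D = nattrans_Dom_Cod[OF i] nattrans_Dom_Cod[OF p]
  {
    assume "(i, p) \<in> Confl (ModCat C)"
    then have k: "is_kernel (ModCat C) i p" and c: "is_cokernel (ModCat C) p i"
      by (simp_all add: ModCat_Confl kernel_cokernel_pair_def)
    show "pointwise_exact C i p"
      unfolding pointwise_exact_def D
      using ModCat_kernel_pointwise[OF k i p] ModCat_cokernel_surj[OF c i p] by simp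
  }
  assume "pointwise_exact C i p"
  then show "(i, p) \<in> Confl (ModCat C)"
    unfolding pointwise_exact_def D ModCat_Confl kernel_cokernel_pair_def
    using pointwise_exact_kernel[OF i p] pointwise_exact_cokernel[OF i p] by blast
qed

section \<open>Admissibly presented functors\<close>

text \<open>Exactness of \<open>Hom(-, X) --> Hom(-, Y) --> F --> 0\<close>, spelled out on
  elements. \<open>mod_adm_Obj\<close> reconciles this with the abstract exact sequences in the
  definition of \<open>mod_adm\<close>.\<close>

definition presents ::
    "('o, 'm) excat \<Rightarrow> 'o \<Rightarrow> 'm \<Rightarrow> 'o \<Rightarrow> ('o, 'm, 'm) nattrans \<Rightarrow> ('o, 'm, 'm) cfunctor \<Rightarrow> bool" where
  "presents C X f Y \<pi> F \<longleftrightarrow> f \<in> Hom C X Y \<and> \<pi> \<in> Hom (ModCat C) (Yoneda_obj C Y) F \<and>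
     (\<forall>W \<in> Obj C.
        (\<forall>h \<in> Hom C W Y. NComp \<pi> W h = \<one>\<^bsub>FObj F W\<^esub> \<longleftrightarrow> (\<exists>x \<in> Hom C W X. f \<cdot>\<^bsub>C\<^esub> x = h)) \<and>
        (\<forall>z \<in> carrier (FObj F W). \<exists>h \<in> Hom C W Y. NComp \<pi> W h = z))"

definition zero_functor :: "('o, 'm, 'g) cfunctor" where
  "zero_functor = \<lparr>FObj = (\<lambda>X. \<lparr>carrier = {undefined}, monoid.mult = (\<lambda>a b. undefined), one = undefined\<rparr>),
     FArr = (\<lambda>f x. undefined)\<rparr>"

context category
begin

lemma zero_functor_cfunctor: "additive_cfunctor C zero_functor"
  unfolding additive_cfunctor_def zero_functor_def
  by (auto intro!: comm_groupI simp: hom_def)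

lemma zero_functor_object: "zero_object (ModCat C) (zero_functor :: ('o, 'm, 'g) cfunctor)"
proof -
  let ?Z = "zero_functor :: ('o, 'm, 'g) cfunctor"
  let ?M = "ModCat C :: (('o, 'm, 'g) cfunctor, ('o, 'm, 'g) nattrans) excat"
  have Z: "z = \<one>\<^bsub>FObj ?Z X\<^esub>" if "z \<in> carrier (FObj ?Z X)" for X z
    using that by (simp add: zero_functor_def)
  show ?thesis
    unfolding zero_object_def
  proof (intro conjI ballI ex1I)
    show "?Z \<in> Obj ?M" using zero_functor_cfunctor by simp
    fix F assume "F \<in> Obj ?M"
    then have F: "additive_cfunctor C F" by simp
    show "ZeroArr ?M ?Z F \<in> Hom ?M ?Z F" "ZeroArr ?M F ?Z \<in> Hom ?M F ?Z"
      using ModCat_zero_Hom[OF category_axioms] zero_functor_cfunctor F by blast+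
    note ZH = this
    show "f = ZeroArr ?M ?Z F" if f: "f \<in> Hom ?M ?Z F" for f
    proof (rule nattrans_eqI[OF f ZH(1)])
      fix X x assume x: "X \<in> Obj C" "x \<in> carrier (FObj ?Z X)"
      then show "NComp f X x = NComp (ZeroArr ?M ?Z F) X x" using Z[OF x(2)] nattrans_one[OF f x(1)] by simp
    qed
    show "f = ZeroArr ?M F ?Z" if f: "f \<in> Hom ?M F ?Z" for f
      by (rule nattrans_eqI[OF f ZH(2)]) (use nattrans_closed[OF f] Z in simp)
  qed
qed

end

context preadditive_category
begin

lemma ModCat_Ide_zero_Confl:
  fixes F :: "('a, 'b, 'b) cfunctor"
  assumes "additive_cfunctor C F"
  shows "(Ide (ModCat C) F, ZeroArr (ModCat C) F zero_functor) \<in> Confl (ModCat C)"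
proof -
  let ?M = "ModCat C :: (('a, 'b, 'b) cfunctor, ('a, 'b, 'b) nattrans) excat"
  interpret M: category ?M by (rule ModCat_category[OF category_axioms])
  have "Ide ?M F \<in> Hom ?M F F" using M.Ide_Hom assms by simp
  moreover have "ZeroArr ?M F zero_functor \<in> Hom ?M F zero_functor"
    using ModCat_zero_Hom[OF category_axioms assms zero_functor_cfunctor] .
  moreover have "pointwise_exact C (Ide ?M F) (ZeroArr ?M F zero_functor)"
    unfolding pointwise_exact_def
  proof (intro ballI conjI impI)
    fix X z assume X: "X \<in> Obj C"
      and "z \<in> carrier (FObj (NCod (ZeroArr ?M F (zero_functor :: ('a, 'b, 'b) cfunctor))) X)"
    then have z: "z = undefined" by (simp add: zero_functor_def)
    have 1: "\<one>\<^bsub>FObj F X\<^esub> \<in> carrier (FObj (NCod (Ide ?M F)) X)"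
      using cfunctor_one_closed[OF assms X] by simp
    have "NComp (ZeroArr ?M F zero_functor) X \<one>\<^bsub>FObj F X\<^esub> = \<one>\<^bsub>FObj (zero_functor :: ('a, 'b, 'b) cfunctor) X\<^esub>"
      using 1 X by simp
    moreover have "\<one>\<^bsub>FObj (zero_functor :: ('a, 'b, 'b) cfunctor) X\<^esub> = z"
      unfolding z by (simp add: zero_functor_def)
    ultimately have "NComp (ZeroArr ?M F zero_functor) X \<one>\<^bsub>FObj F X\<^esub> = z" by (rule trans)
    then show "\<exists>y \<in> carrier (FObj (NCod (Ide ?M F)) X). NComp (ZeroArr ?M F zero_functor) X y = z"
      using 1 by (rule bexI)
  qed simp_all
  ultimately show ?thesis using ModCat_Confl_iff by blast
qed

lemma ModCat_deflation_surj:
  assumes "deflation (ModCat C) p" "p \<in> Hom (ModCat C) G (H :: ('a, 'b, 'b) cfunctor)" "X \<in> Obj C"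
    "z \<in> carrier (FObj H X)"
  shows "\<exists>y \<in> carrier (FObj G X). NComp p X y = z"
proof -
  obtain i where c: "is_cokernel (ModCat C) p i"
    using assms(1) by (auto simp: deflation_def ModCat_Confl kernel_cokernel_pair_def)
  then have "i \<in> Arr (ModCat C) \<and> Dom (ModCat C) p = Cod (ModCat C) i"
    unfolding is_cokernel_def by (elim conjE) (intro conjI)
  then have "i \<in> Hom (ModCat C) (NDom i) G"
    using assms(2) by (simp add: ModCat_Hom)
  then show ?thesis by (rule ModCat_cokernel_surj[OF c _ assms(2-4)])
qed

lemma presents_D:
  assumes "presents C X f Y \<pi> F"
  shows presents_Hom: "f \<in> Hom C X Y" "\<pi> \<in> Hom (ModCat C) (Yoneda_obj C Y) F"
    and presents_kernel: "\<And>W h. h \<in> Hom C W Y \<Longrightarrow>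
      NComp \<pi> W h = \<one>\<^bsub>FObj F W\<^esub> \<longleftrightarrow> (\<exists>x \<in> Hom C W X. f \<cdot> x = h)"
    and presents_surj: "\<And>W z. \<lbrakk>W \<in> Obj C; z \<in> carrier (FObj F W)\<rbrakk> \<Longrightarrow> \<exists>h \<in> Hom C W Y. NComp \<pi> W h = z"
    and presents_cfunctor: "additive_cfunctor C F"
  using assms Hom_Obj nattrans_cfunctor(2) unfolding presents_def by blast+

text \<open>The carriers of the cokernel of \<open>Hom(-, f)\<close> consist of representatives of cosets, so that
  they stay inside the type of arrows.\<close>

definition coker_rel :: "'b \<Rightarrow> 'a \<Rightarrow> 'b \<Rightarrow> 'b \<Rightarrow> bool" where
  "coker_rel f W h h' \<longleftrightarrow> h \<in> Hom C W (Cod C f) \<and> h' \<in> Hom C W (Cod C f) \<and>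
     (\<exists>x \<in> Hom C W (Dom C f). h = h' \<oplus> f \<cdot> x)"

definition coker_rep :: "'b \<Rightarrow> 'a \<Rightarrow> 'b \<Rightarrow> 'b" where
  "coker_rep f W h = (SOME h'. coker_rel f W h h')"

definition coker_functor :: "'b \<Rightarrow> ('a, 'b, 'b) cfunctor" where
  "coker_functor f = \<lparr>FObj = (\<lambda>W. \<lparr>carrier = coker_rep f W ` Hom C W (Cod C f),
       monoid.mult = (\<lambda>a b. coker_rep f W (a \<oplus> b)), one = coker_rep f W (\<zero> W (Cod C f))\<rparr>),
     FArr = (\<lambda>u a. coker_rep f (Dom C u) (a \<cdot> u))\<rparr>"

lemma coker_rel_refl: "\<lbrakk>f \<in> Arr C; h \<in> Hom C W (Cod C f)\<rbrakk> \<Longrightarrow> coker_rel f W h h"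
  using Hom_Obj[of h W "Cod C f"] unfolding coker_rel_def
  by (intro conjI bexI[of _ "\<zero> W (Dom C f)"]) (simp_all add: Hom_def)

lemma coker_rel_sym: "\<lbrakk>f \<in> Arr C; coker_rel f W h h'\<rbrakk> \<Longrightarrow> coker_rel f W h' h"
  unfolding coker_rel_def
proof (elim conjE bexE, intro conjI)
  fix x assume *: "f \<in> Arr C" "h \<in> Hom C W (Cod C f)" "h' \<in> Hom C W (Cod C f)"
    "x \<in> Hom C W (Dom C f)" "h = h' \<oplus> f \<cdot> x"
  have "h' = h \<oplus> f \<cdot> neg C x" unfolding *(5) using *(1,3,4) by (simp add: Hom_def)
  then show "\<exists>x \<in> Hom C W (Dom C f). h' = h \<oplus> f \<cdot> x"
    using *(4) by (intro bexI[of _ "neg C x"]) (simp_all add: Hom_def)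
qed

lemma coker_rel_trans:
  assumes "f \<in> Arr C" "coker_rel f W h h'" "coker_rel f W h' h''"
  shows "coker_rel f W h h''"
proof -
  obtain x y where *: "x \<in> Hom C W (Dom C f)" "h = h' \<oplus> f \<cdot> x" "y \<in> Hom C W (Dom C f)"
    "h' = h'' \<oplus> f \<cdot> y" "h'' \<in> Hom C W (Cod C f)" "h \<in> Hom C W (Cod C f)"
    using assms(2,3) by (auto simp: coker_rel_def)
  have "h = h'' \<oplus> f \<cdot> (y \<oplus> x)" using *(1,3,5) assms(1) unfolding *(2,4) by (simp add: Hom_def)
  then show ?thesis
    using * unfolding coker_rel_def by (intro conjI bexI[of _ "y \<oplus> x"]) (simp_all add: Hom_def)
qed

lemma coker_rep_rel:
  assumes "f \<in> Arr C" "h \<in> Hom C W (Cod C f)"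
  shows "coker_rel f W h (coker_rep f W h)"
  unfolding coker_rep_def by (rule someI[of _ h]) (rule coker_rel_refl[OF assms])

lemma coker_rep_closed: "\<lbrakk>f \<in> Arr C; h \<in> Hom C W (Cod C f)\<rbrakk> \<Longrightarrow> coker_rep f W h \<in> Hom C W (Cod C f)"
  using coker_rep_rel by (simp add: coker_rel_def)

text \<open>Related arrows have equal classes, and choice applied to equal predicates gives equal
  representatives.\<close>

lemma coker_rep_eq:
  assumes "f \<in> Arr C" "h \<in> Hom C W (Cod C f)" "h' \<in> Hom C W (Cod C f)"
  shows "coker_rep f W h = coker_rep f W h' \<longleftrightarrow> coker_rel f W h h'"
proof
  assume "coker_rep f W h = coker_rep f W h'"
  then show "coker_rel f W h h'"
    using coker_rep_rel[OF assms(1,2)] coker_rep_rel[OF assms(1,3)] coker_rel_sym coker_rel_trans assms(1)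
    by metis
next
  assume "coker_rel f W h h'"
  then have "coker_rel f W h = coker_rel f W h'"
    using coker_rel_sym coker_rel_trans assms(1) by blast
  then show "coker_rep f W h = coker_rep f W h'" by (simp add: coker_rep_def)
qed

text \<open>Replacing a summand by its representative changes the sum only by a value of
  \<open>Hom(-, f)\<close>. So the operations on representatives inherit the group laws from the
  arrows.\<close>

lemma coker_rep_add:
  assumes "f \<in> Arr C" "a \<in> Hom C W (Cod C f)" "b \<in> Hom C W (Cod C f)"
  shows "coker_rep f W (coker_rep f W a \<oplus> b) = coker_rep f W (a \<oplus> b)"
    and "coker_rep f W (b \<oplus> coker_rep f W a) = coker_rep f W (b \<oplus> a)"
proof -
  note c = coker_rep_closed[OF assms(1,2)]
  obtain x where x: "x \<in> Hom C W (Dom C f)" "coker_rep f W a = a \<oplus> f \<cdot> x"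
    using coker_rel_sym[OF assms(1) coker_rep_rel[OF assms(1,2)]] by (auto simp: coker_rel_def)
  have "(a \<oplus> f \<cdot> x) \<oplus> b = (a \<oplus> b) \<oplus> f \<cdot> x" "b \<oplus> (a \<oplus> f \<cdot> x) = (b \<oplus> a) \<oplus> f \<cdot> x"
    using x(1) assms add_commute[of b "f \<cdot> x"] by (simp_all add: Hom_def)
  then have "coker_rel f W (coker_rep f W a \<oplus> b) (a \<oplus> b)" "coker_rel f W (b \<oplus> coker_rep f W a) (b \<oplus> a)"
    using assms c x(1) unfolding coker_rel_def by (simp_all add: x(2)) (auto simp: Hom_def)
  then show "coker_rep f W (coker_rep f W a \<oplus> b) = coker_rep f W (a \<oplus> b)"
    "coker_rep f W (b \<oplus> coker_rep f W a) = coker_rep f W (b \<oplus> a)"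
    using coker_rep_eq[OF assms(1)] by (simp_all add: coker_rel_def)
qed

lemma coker_rep_comp:
  assumes "f \<in> Arr C" "a \<in> Hom C W (Cod C f)" "u \<in> Hom C V W"
  shows "coker_rep f V (coker_rep f W a \<cdot> u) = coker_rep f V (a \<cdot> u)"
proof -
  note c = coker_rep_closed[OF assms(1,2)]
  obtain x where x: "x \<in> Hom C W (Dom C f)" "coker_rep f W a = a \<oplus> f \<cdot> x"
    using coker_rel_sym[OF assms(1) coker_rep_rel[OF assms(1,2)]] by (auto simp: coker_rel_def)
  have "coker_rep f W a \<cdot> u = a \<cdot> u \<oplus> f \<cdot> (x \<cdot> u)"
    unfolding x(2) using x(1) assms by (simp add: Hom_def)
  then have "coker_rel f V (coker_rep f W a \<cdot> u) (a \<cdot> u)"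
    using assms c x(1) unfolding coker_rel_def
    by (intro conjI bexI[of _ "x \<cdot> u"]) (simp_all add: Hom_def)
  then show ?thesis using coker_rep_eq[OF assms(1)] by (simp add: coker_rel_def)
qed

lemma coker_functor_simps [simp]:
  "carrier (FObj (coker_functor f) W) = coker_rep f W ` Hom C W (Cod C f)"
  "monoid.mult (FObj (coker_functor f) W) = (\<lambda>a b. coker_rep f W (a \<oplus> b))"
  "\<one>\<^bsub>FObj (coker_functor f) W\<^esub> = coker_rep f W (\<zero> W (Cod C f))"
  "FArr (coker_functor f) u a = coker_rep f (Dom C u) (a \<cdot> u)"
  by (simp_all add: coker_functor_def)

lemma coker_functor_cfunctor:
  assumes f: "f \<in> Arr C"
  shows "additive_cfunctor C (coker_functor f)"
proof -
  note rep = coker_rep_add[OF f] coker_rep_closed[OF f]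
  have H: "a \<oplus> b \<in> Hom C W (Cod C f)" if "a \<in> Hom C W (Cod C f)" "b \<in> Hom C W (Cod C f)" for a b W
    using that by (simp add: Hom_def)
  have H': "a \<cdot> u \<in> Hom C (Dom C u) (Cod C f)" if "a \<in> Hom C (Cod C u) (Cod C f)" "u \<in> Arr C" for a u
    using that by (simp add: Hom_def)
  have repu: "coker_rep f (Dom C u) (coker_rep f (Cod C u) a \<cdot> u) = coker_rep f (Dom C u) (a \<cdot> u)"
    if "a \<in> Hom C (Cod C u) (Cod C f)" "u \<in> Arr C" for a u
    using coker_rep_comp[OF f that(1), of u "Dom C u"] that(2) by (simp add: Hom_def)
  have grp: "comm_group (FObj (coker_functor f) W)" if W: "W \<in> Obj C" for W
  proof (rule comm_groupI)
    have z: "\<zero> W (Cod C f) \<in> Hom C W (Cod C f)" using zero_Hom W f by simp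
    show "\<one>\<^bsub>FObj (coker_functor f) W\<^esub> \<in> carrier (FObj (coker_functor f) W)" using z by simp
    fix x assume "x \<in> carrier (FObj (coker_functor f) W)"
    then obtain a where a: "x = coker_rep f W a" "a \<in> Hom C W (Cod C f)" by auto
    have "\<zero> W (Cod C f) \<oplus> a = a" using a(2) by (simp add: Hom_def)
    then show "\<one>\<^bsub>FObj (coker_functor f) W\<^esub> \<otimes>\<^bsub>FObj (coker_functor f) W\<^esub> x = x"
      using a z rep H by simp
    have "neg C a \<in> Hom C W (Cod C f)" "neg C a \<oplus> a = \<zero> W (Cod C f)" using a(2) by (simp_all add: Hom_def)
    then show "\<exists>y \<in> carrier (FObj (coker_functor f) W). y \<otimes>\<^bsub>FObj (coker_functor f) W\<^esub> x
        = \<one>\<^bsub>FObj (coker_functor f) W\<^esub>"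
      using a rep H by (intro bexI[of _ "coker_rep f W (neg C a)"]) simp_all
    fix y assume "y \<in> carrier (FObj (coker_functor f) W)"
    then obtain b where b: "y = coker_rep f W b" "b \<in> Hom C W (Cod C f)" by auto
    have ab: "a \<oplus> b = b \<oplus> a" using a(2) b(2) add_commute[of a b] by (simp add: Hom_def)
    show "x \<otimes>\<^bsub>FObj (coker_functor f) W\<^esub> y \<in> carrier (FObj (coker_functor f) W)"
      using a b rep H by simp
    show "x \<otimes>\<^bsub>FObj (coker_functor f) W\<^esub> y = y \<otimes>\<^bsub>FObj (coker_functor f) W\<^esub> x"
      using a b rep H ab by simp
    fix z assume "z \<in> carrier (FObj (coker_functor f) W)"
    then obtain c where c: "z = coker_rep f W c" "c \<in> Hom C W (Cod C f)" by auto
    have "(a \<oplus> b) \<oplus> c = a \<oplus> (b \<oplus> c)" using a(2) b(2) c(2) by (simp add: Hom_def)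
    then show "x \<otimes>\<^bsub>FObj (coker_functor f) W\<^esub> y \<otimes>\<^bsub>FObj (coker_functor f) W\<^esub> z
        = x \<otimes>\<^bsub>FObj (coker_functor f) W\<^esub> (y \<otimes>\<^bsub>FObj (coker_functor f) W\<^esub> z)"
      using a b c rep H by simp
  qed
  show ?thesis
    unfolding additive_cfunctor_def
  proof (intro conjI ballI impI)
    show "comm_group (FObj (coker_functor f) W)" if "W \<in> Obj C" for W using grp[OF that] .
  next
    fix u assume u: "u \<in> Arr C"
    have "(a \<oplus> b) \<cdot> u = a \<cdot> u \<oplus> b \<cdot> u"
      if "a \<in> Hom C (Cod C u) (Cod C f)" "b \<in> Hom C (Cod C u) (Cod C f)" for a b
      using that u by (simp add: Hom_def)
    then show "FArr (coker_functor f) u \<in> hom (FObj (coker_functor f) (Cod C u)) (FObj (coker_functor f) (Dom C u))"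
      using u rep H H' repu by (auto simp: hom_def)
  next
    fix X x assume "X \<in> Obj C" "x \<in> carrier (FObj (coker_functor f) X)"
    then obtain a where a: "x = coker_rep f X a" "a \<in> Hom C X (Cod C f)" by auto
    have "a \<cdot> Ide C X = a" using a(2) by (simp add: Hom_def)
    then show "FArr (coker_functor f) (Ide C X) x = x"
      using a repu[of a "Ide C X"] \<open>X \<in> Obj C\<close> by simp
  next
    fix u v x assume u: "u \<in> Arr C" "v \<in> Arr C" "Cod C u = Dom C v"
      and "x \<in> carrier (FObj (coker_functor f) (Cod C v))"
    then obtain a where a: "x = coker_rep f (Cod C v) a" "a \<in> Hom C (Cod C v) (Cod C f)" by auto
    have "a \<cdot> (v \<cdot> u) = (a \<cdot> v) \<cdot> u" "a \<cdot> v \<in> Hom C (Cod C u) (Cod C f)"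
      using a(2) u by (simp_all add: Hom_def)
    then show "FArr (coker_functor f) (v \<cdot> u) x = FArr (coker_functor f) u (FArr (coker_functor f) v x)"
      using a u repu[of a v] repu[of a "v \<cdot> u"] repu[of "a \<cdot> v" u] by simp
  next
    fix u v x assume u: "u \<in> Arr C" "v \<in> Arr C" "Dom C u = Dom C v" "Cod C u = Cod C v"
      and "x \<in> carrier (FObj (coker_functor f) (Cod C u))"
    then obtain a where a: "x = coker_rep f (Cod C u) a" "a \<in> Hom C (Cod C u) (Cod C f)" by auto
    have "a \<cdot> (u \<oplus> v) = a \<cdot> u \<oplus> a \<cdot> v" "a \<cdot> u \<in> Hom C (Dom C u) (Cod C f)" "a \<cdot> v \<in> Hom C (Dom C u) (Cod C f)"
      using a(2) u by (simp_all add: Hom_def)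
    then show "FArr (coker_functor f) (u \<oplus> v) x
        = FArr (coker_functor f) u x \<otimes>\<^bsub>FObj (coker_functor f) (Dom C u)\<^esub> FArr (coker_functor f) v x"
      using a u repu[of a v] repu[of a "u \<oplus> v"] repu[of a u] rep by simp
  qed
qed

lemma coker_functor_presents:
  assumes f: "f \<in> Hom C X Y"
  shows "\<exists>\<pi>. presents C X f Y \<pi> (coker_functor f)"
proof -
  have fA: "f \<in> Arr C" and D: "Dom C f = X" "Cod C f = Y" and O: "X \<in> Obj C" "Y \<in> Obj C"
    using f Hom_Obj by (auto simp: Hom_def)
  define \<pi> where "\<pi> = mk_nattrans C (Yoneda_obj C Y) (coker_functor f) (coker_rep f)"
  have "\<pi> \<in> Hom (ModCat C) (Yoneda_obj C Y) (coker_functor f)"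
    unfolding \<pi>_def
  proof (rule ModCat_HomI[OF Yoneda_cfunctor[OF O(2)] coker_functor_cfunctor[OF fA]])
    fix W a b assume "a \<in> carrier (FObj (Yoneda_obj C Y) W)" "b \<in> carrier (FObj (Yoneda_obj C Y) W)"
    then have "a \<in> Hom C W (Cod C f)" "b \<in> Hom C W (Cod C f)" by (simp_all add: D)
    then show "coker_rep f W (a \<otimes>\<^bsub>FObj (Yoneda_obj C Y) W\<^esub> b)
        = coker_rep f W a \<otimes>\<^bsub>FObj (coker_functor f) W\<^esub> coker_rep f W b"
      using coker_rep_add[OF fA] coker_rep_closed[OF fA] by simp
  next
    fix u a assume "u \<in> Arr C" "a \<in> carrier (FObj (Yoneda_obj C Y) (Cod C u))"
    then have "a \<in> Hom C (Cod C u) (Cod C f)" "u \<in> Hom C (Dom C u) (Cod C u)" by (simp_all add: D Hom_def)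
    then show "coker_rep f (Dom C u) (FArr (Yoneda_obj C Y) u a)
        = FArr (coker_functor f) u (coker_rep f (Cod C u) a)"
      using coker_rep_comp[OF fA] by simp
  qed (use D category_axioms in simp_all)
  moreover have "coker_rep f W h = coker_rep f W (\<zero> W Y) \<longleftrightarrow> (\<exists>x \<in> Hom C W X. f \<cdot> x = h)"
    if h: "h \<in> Hom C W Y" for W h
  proof -
    have W: "W \<in> Obj C" using Hom_Obj[OF h] by simp
    have "coker_rel f W h (\<zero> W Y) \<longleftrightarrow> (\<exists>x \<in> Hom C W X. f \<cdot> x = h)"
      using h zero_Hom[OF W O(2)] f by (auto simp: coker_rel_def D Hom_def)
    then show ?thesis using coker_rep_eq[OF fA, of h W "\<zero> W Y"] h zero_Hom[OF W O(2)] by (simp add: D)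
  qed
  ultimately have "presents C X f Y \<pi> (coker_functor f)"
    using f unfolding presents_def by (auto simp: \<pi>_def D)
  then show ?thesis by blast
qed

end

section \<open>Objects and conflations of the category of admissibly presented functors\<close>

context exact_category
begin

text \<open>\<open>J\<close> is the image of \<open>Hom(-, m \<cdot> p)\<close>, realized as a
  subfunctor so that \<open>j\<close> is an inclusion. As \<open>m\<close> is monic, the kernel of
  \<open>q\<close> is \<open>Hom(-, k)\<close>; hence \<open>J\<close> is itself presented, by the
  inflation \<open>k\<close>, which keeps the factorization inside \<open>mod_adm\<close>.\<close>

lemma presentation_conflations:
  assumes p: "ses C K k X p I" and m: "ses C I m Y c D" and \<pi>: "presents C X (m \<cdot> p) Y \<pi> F"
  shows "\<exists>J q j. q \<in> Hom (ModCat C) (Yoneda_obj C X) J \<and> j \<in> Hom (ModCat C) J (Yoneda_obj C Y) \<and>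
    (Yoneda_arr C k, q) \<in> Confl (ModCat C) \<and> (j, \<pi>) \<in> Confl (ModCat C) \<and>
    Yoneda_arr C (m \<cdot> p) = j \<cdot>\<^bsub>ModCat C\<^esub> q \<and> presents C K k X q J"
proof -
  let ?M = "ModCat C :: (('a, 'b, 'b) cfunctor, ('a, 'b, 'b) nattrans) excat"
  interpret M: category ?M by (rule ModCat_category[OF category_axioms])
  note Hp = ses_Hom[OF p] and Hm = ses_Hom[OF m] and O = ses_Obj[OF p] ses_Obj[OF m]
    and \<pi>H = presents_Hom(2)[OF \<pi>]
  have mp: "m \<cdot> p \<in> Hom C X Y" using Hp Hm by (simp add: Hom_def)
  note Ymp = Yoneda_arr_Hom[OF mp] and Yk = Yoneda_arr_Hom[OF Hp(1)]
  define S where "S = (\<lambda>W. NComp (Yoneda_arr C (m \<cdot> p)) W ` carrier (FObj (Yoneda_obj C X) W))"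
  define J where "J = subfunctor (Yoneda_obj C Y) S"
  define q where "q = mk_nattrans C (Yoneda_obj C X) J (NComp (Yoneda_arr C (m \<cdot> p)))"
  define j where "j = mk_nattrans C J (Yoneda_obj C Y) (\<lambda>W x. x)"
  have J: "additive_cfunctor C J" and q: "q \<in> Hom ?M (Yoneda_obj C X) J"
    and j: "j \<in> Hom ?M J (Yoneda_obj C Y)"
    using image_functor[OF Ymp] unfolding J_def S_def q_def j_def by simp_all
  have S: "S W = {h. \<exists>x \<in> Hom C W X. (m \<cdot> p) \<cdot> x = h}" for W
    using Yoneda_arr_NComp[OF mp] by (auto simp: S_def image_iff)
  have qN: "NComp q W h = (m \<cdot> p) \<cdot> h" if "h \<in> Hom C W X" for W h
    using that Hom_Obj[OF that] Yoneda_arr_NComp[OF mp that] by (simp add: q_def)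
  have J1: "\<one>\<^bsub>FObj J W\<^esub> = \<zero> W Y" "carrier (FObj J W) = S W" for W by (simp_all add: J_def)
  have pk: "presents C K k X q J"
    unfolding presents_def
  proof (intro conjI ballI)
    fix W h assume h: "h \<in> Hom C W X"
    have mph: "(m \<cdot> p) \<cdot> h = m \<cdot> (p \<cdot> h)" "p \<cdot> h \<in> Hom C W I" using h Hp Hm by (simp_all add: Hom_def)
    have OW: "W \<in> Obj C" using Hom_Obj[OF h] by simp
    show "NComp q W h = \<one>\<^bsub>FObj J W\<^esub> \<longleftrightarrow> (\<exists>x \<in> Hom C W K. k \<cdot> x = h)"
    proof
      assume "NComp q W h = \<one>\<^bsub>FObj J W\<^esub>"
      then have "m \<cdot> (p \<cdot> h) = \<zero> W Y" using qN[OF h] mph by (simp add: J1)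
      then have "p \<cdot> h = \<zero> W I" by (rule ses_mono0[OF m mph(2)])
      then show "\<exists>x \<in> Hom C W K. k \<cdot> x = h" by (rule ses_lift[OF p h])
    next
      assume "\<exists>x \<in> Hom C W K. k \<cdot> x = h"
      then obtain x where x: "x \<in> Hom C W K" "k \<cdot> x = h" by blast
      have "p \<cdot> h = \<zero> W I" using x Hp O by (auto simp: Hom_def cx[OF ses_comp[OF p]])
      then show "NComp q W h = \<one>\<^bsub>FObj J W\<^esub>" using qN[OF h] mph Hm OW by (simp add: J1 Hom_def)
    qed
  next
    fix W z assume "z \<in> carrier (FObj J W)"
    then show "\<exists>h \<in> Hom C W X. NComp q W h = z" using qN by (auto simp: J1 S)
  qed (use Hp q in auto)
  have "pointwise_exact C (Yoneda_arr C k) q"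
    unfolding pointwise_exact_def nattrans_Dom_Cod[OF Yk] nattrans_Dom_Cod[OF q] Yoneda_obj_simps
  proof (intro ballI conjI impI)
    fix W x assume "x \<in> Hom C W K" "NComp (Yoneda_arr C k) W x = \<zero> W X"
    then show "x = \<zero> W K" using ses_mono0[OF p] Yoneda_arr_NComp[OF Hp(1)] by simp
  next
    fix W y assume W: "W \<in> Obj C" and y: "y \<in> Hom C W X"
    have "(\<exists>x \<in> Hom C W K. NComp (Yoneda_arr C k) W x = y) \<longleftrightarrow> (\<exists>x \<in> Hom C W K. k \<cdot> x = y)"
      using Yoneda_arr_NComp[OF Hp(1)] by auto
    then show "(NComp q W y = \<one>\<^bsub>FObj J W\<^esub>) = (\<exists>x \<in> Hom C W K. NComp (Yoneda_arr C k) W x = y)"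
      using presents_kernel[OF pk y] by simp
  qed (use presents_surj[OF pk] in blast)
  then have 1: "(Yoneda_arr C k, q) \<in> Confl ?M" using ModCat_Confl_iff[OF Yk q] by simp
  have "pointwise_exact C j \<pi>"
    unfolding pointwise_exact_def nattrans_Dom_Cod[OF j] nattrans_Dom_Cod[OF \<pi>H] Yoneda_obj_simps J1
  proof (intro ballI conjI impI)
    fix W x assume "W \<in> Obj C" "x \<in> S W" "NComp j W x = \<zero> W Y"
    then show "x = \<zero> W Y" by (simp add: j_def J1)
  next
    fix W y assume W: "W \<in> Obj C" and y: "y \<in> Hom C W Y"
    have "(\<exists>x \<in> S W. NComp j W x = y) \<longleftrightarrow> y \<in> S W" using W by (simp add: j_def J1)
    then show "(NComp \<pi> W y = \<one>\<^bsub>FObj F W\<^esub>) = (\<exists>x \<in> S W. NComp j W x = y)"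
      using presents_kernel[OF \<pi> y] by (simp add: S)
  qed (use presents_surj[OF \<pi>] in blast)
  then have 2: "(j, \<pi>) \<in> Confl ?M" using ModCat_Confl_iff[OF j \<pi>H] by simp
  have "Yoneda_arr C (m \<cdot> p) = j \<cdot>\<^bsub>?M\<^esub> q"
  proof (rule nattrans_eqI[OF Ymp M.Comp_Hom[OF q j]])
    fix W x assume W: "W \<in> Obj C" "x \<in> carrier (FObj (Yoneda_obj C X) W)"
    have "NComp (Yoneda_arr C (m \<cdot> p)) W x \<in> S W" using W by (simp add: S_def)
    then show "NComp (Yoneda_arr C (m \<cdot> p)) W x = NComp (j \<cdot>\<^bsub>?M\<^esub> q) W x"
      using W ModCat_Comp_NComp[OF q W] by (simp add: j_def q_def J1)
  qed
  then show ?thesis using q j 1 2 pk by blast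
qed

text \<open>From left to right, kernels and deflations of the abstract exact sequence are evaluated
  pointwise. Conversely, an admissible factorization of \<open>f\<close> yields through
  \<open>presentation_conflations\<close> the conflations that make each morphism of the sequence
  admissible.\<close>

lemma mod_adm_Obj:
  "F \<in> Obj (mod_adm C) \<longleftrightarrow> (\<exists>X f Y \<pi>. admissible_arr C f \<and> presents C X f Y \<pi> F)"
proof
  let ?M = "ModCat C :: (('a, 'b, 'b) cfunctor, ('a, 'b, 'b) nattrans) excat"
  interpret M: category ?M by (rule ModCat_category[OF category_axioms])
  assume "F \<in> Obj (mod_adm C)"
  then obtain f \<pi> Z where f: "f \<in> Arr C" "admissible_arr C f"
    and \<pi>: "\<pi> \<in> Hom ?M (Yoneda_obj C (Cod C f)) F" and Z: "zero_object ?M Z"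
    and ex: "exact_sequence ?M [Yoneda_arr C f, \<pi>, ZeroArr ?M F Z]"
    unfolding mod_adm_def full_subcategory_def by auto
  define X Y where XY: "X = Dom C f" "Y = Cod C f"
  have fH: "f \<in> Hom C X Y" using f by (simp add: XY Hom_def)
  note Yf = Yoneda_arr_Hom[OF fH]
  have \<pi>H: "\<pi> \<in> Hom ?M (Yoneda_obj C Y) F" using \<pi> by (simp add: XY)
  have ZH: "ZeroArr ?M F Z \<in> Hom ?M F Z"
    using ModCat_zero_Hom[OF category_axioms nattrans_cfunctor(2)[OF \<pi>]] Z
    by (simp add: zero_object_def del: ModCat_simps(5-))
  obtain m m' where m: "is_image ?M m (Yoneda_arr C f)" "is_kernel ?M m \<pi>"
    and m': "is_image ?M m' \<pi>" "is_kernel ?M m' (ZeroArr ?M F Z)"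
    using ex unfolding exact_sequence_Cons by blast
  have img: "\<exists>J p. deflation ?M p \<and> p \<in> Hom ?M G J \<and> m \<in> Hom ?M J H \<and> g = m \<cdot>\<^bsub>?M\<^esub> p"
    if i: "is_image ?M m g" and k: "is_kernel ?M m h" and g: "g \<in> Hom ?M G H" for m g G H h
  proof -
    obtain p where p: "deflation ?M p" "Cod ?M p = Dom ?M m" "g = m \<cdot>\<^bsub>?M\<^esub> p"
      using i unfolding is_image_def by blast
    obtain i where "is_cokernel ?M p i"
      using p(1) by (auto simp: deflation_def ModCat_Confl kernel_cokernel_pair_def)
    then have pA: "p \<in> Arr ?M" unfolding is_cokernel_def by blast
    have mA: "m \<in> Arr ?M" using k unfolding is_kernel_def by blast
    have "Dom ?M p = G" "Cod ?M m = H"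
      using g M.Dom_Comp[OF pA mA p(2)] M.Cod_Comp[OF pA mA p(2)] unfolding p(3) by (auto dest: Hom_D)
    then show ?thesis using p pA mA by (auto simp: ModCat_Hom)
  qed
  obtain J p where p: "deflation ?M p" "p \<in> Hom ?M (Yoneda_obj C X) J" "m \<in> Hom ?M J (Yoneda_obj C Y)"
    "Yoneda_arr C f = m \<cdot>\<^bsub>?M\<^esub> p"
    using img[OF m Yf] by blast
  obtain J' p' where p': "deflation ?M p'" "p' \<in> Hom ?M (Yoneda_obj C Y) J'" "m' \<in> Hom ?M J' F"
    "\<pi> = m' \<cdot>\<^bsub>?M\<^esub> p'"
    using img[OF m' \<pi>H] by blast
  have "presents C X f Y \<pi> F"
    unfolding presents_def
  proof (intro conjI ballI)
    fix W h assume W: "W \<in> Obj C" and h: "h \<in> Hom C W Y"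
    have fx: "f \<cdot> x = NComp m W (NComp p W x)" if "x \<in> Hom C W X" for x
      using Yoneda_arr_NComp[OF fH that] ModCat_Comp_NComp[OF p(2) W, of x m] that unfolding p(4) by simp
    have "NComp \<pi> W h = \<one>\<^bsub>FObj F W\<^esub> \<longleftrightarrow> (\<exists>y \<in> carrier (FObj J W). NComp m W y = h)"
      using ModCat_kernel_pointwise(2)[OF m(2) p(3) \<pi>H W] h by simp
    also have "\<dots> \<longleftrightarrow> (\<exists>x \<in> Hom C W X. f \<cdot> x = h)"
    proof
      assume "\<exists>y \<in> carrier (FObj J W). NComp m W y = h"
      then obtain y where y: "y \<in> carrier (FObj J W)" "NComp m W y = h" by blast
      obtain x where "x \<in> Hom C W X" "NComp p W x = y"
        using ModCat_deflation_surj[OF p(1,2) W y(1)] by auto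
      then show "\<exists>x \<in> Hom C W X. f \<cdot> x = h" using fx y by auto
    next
      assume "\<exists>x \<in> Hom C W X. f \<cdot> x = h"
      then show "\<exists>y \<in> carrier (FObj J W). NComp m W y = h"
        using fx nattrans_closed[OF p(2) W] by auto
    qed
    finally show "NComp \<pi> W h = \<one>\<^bsub>FObj F W\<^esub> \<longleftrightarrow> (\<exists>x \<in> Hom C W X. f \<cdot> x = h)" .
  next
    fix W z assume W: "W \<in> Obj C" and z: "z \<in> carrier (FObj F W)"
    \<comment> \<open>The image of \<pi> is the kernel of the zero morphism to \<open>Z\<close>, so
      it contains every element: this is surjectivity of \<pi>.\<close>
    have "NComp (ZeroArr ?M F Z) W z = \<one>\<^bsub>FObj Z W\<^esub>" using W z by simp
    then obtain y where y: "y \<in> carrier (FObj J' W)" "NComp m' W y = z"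
      using ModCat_kernel_pointwise(2)[OF m'(2) p'(3) ZH W z] by blast
    obtain h where h: "h \<in> Hom C W Y" "NComp p' W h = y"
      using ModCat_deflation_surj[OF p'(1,2) W y(1)] by auto
    then show "\<exists>h \<in> Hom C W Y. NComp \<pi> W h = z"
      using ModCat_Comp_NComp[OF p'(2) W, of h m'] y(2) unfolding p'(4) by auto
  qed (fact fH \<pi>H)+
  then show "\<exists>X f Y \<pi>. admissible_arr C f \<and> presents C X f Y \<pi> F" using f by blast
next
  let ?M = "ModCat C :: (('a, 'b, 'b) cfunctor, ('a, 'b, 'b) nattrans) excat"
  interpret M: category ?M by (rule ModCat_category[OF category_axioms])
  assume "\<exists>X f Y \<pi>. admissible_arr C f \<and> presents C X f Y \<pi> F"
  then obtain X f Y \<pi> where f: "admissible_arr C f" and \<pi>: "presents C X f Y \<pi> F" by blast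
  note fH = presents_Hom(1)[OF \<pi>] and \<pi>H = presents_Hom(2)[OF \<pi>] and F = presents_cfunctor[OF \<pi>]
  let ?Z = "zero_functor :: ('a, 'b, 'b) cfunctor"
  let ?z = "ZeroArr ?M F ?Z"
  obtain K k I p m c D where p: "ses C K k X p I" and m: "ses C I m Y c D" and fmp: "f = m \<cdot> p"
    using admissible_ses[OF f fH] by blast
  obtain J q j where q: "q \<in> Hom ?M (Yoneda_obj C X) J" "j \<in> Hom ?M J (Yoneda_obj C Y)"
    and kq: "(Yoneda_arr C k, q) \<in> Confl ?M" and j\<pi>: "(j, \<pi>) \<in> Confl ?M"
    and Yf: "Yoneda_arr C f = j \<cdot>\<^bsub>?M\<^esub> q"
    using presentation_conflations[OF p m] \<pi> unfolding fmp by blast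
  note IF = ModCat_Ide_zero_Confl[OF F] and IZ = ModCat_Ide_zero_Confl[OF zero_functor_cfunctor]
  have ZH: "?z \<in> Hom ?M F ?Z" using ModCat_zero_Hom[OF category_axioms F zero_functor_cfunctor] .
  have D: "Dom ?M j = J" "Cod ?M q = J" "Cod ?M \<pi> = F" "Dom ?M (Ide ?M F) = F" "Dom ?M ?z = F"
    "Cod ?M ?z = ?Z" "Dom ?M (Ide ?M ?Z) = ?Z"
    using q \<pi>H ZH M.Ide_Hom[of F] M.Ide_Hom[of ?Z] F zero_functor_cfunctor by (auto simp: ModCat_Hom)
  have e1: "\<pi> = Ide ?M F \<cdot>\<^bsub>?M\<^esub> \<pi>" "?z = Ide ?M ?Z \<cdot>\<^bsub>?M\<^esub> ?z"
    using M.Ide_Comp[OF \<pi>H] M.Ide_Comp[OF ZH] by (simp_all del: ModCat_simps(5-))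
  have i1: "is_image ?M j (Yoneda_arr C f)"
    using kq j\<pi> Yf D unfolding is_image_def inflation_def deflation_def by metis
  have i2: "is_image ?M (Ide ?M F) \<pi>"
    using j\<pi> IF e1(1) D unfolding is_image_def inflation_def deflation_def by metis
  have i3: "is_image ?M (Ide ?M ?Z) ?z"
    using IF IZ e1(2) D unfolding is_image_def inflation_def deflation_def by metis
  have k1: "is_kernel ?M j \<pi>" "is_kernel ?M (Ide ?M F) ?z"
    using j\<pi> IF unfolding ModCat_Confl kernel_cokernel_pair_def by blast+
  have "Cod ?M (Yoneda_arr C f) = Dom ?M \<pi>" using Yoneda_arr_Hom[OF fH] \<pi>H by (simp add: ModCat_Hom)
  then have "exact_sequence ?M [Yoneda_arr C f, \<pi>, ?z]"
    unfolding exact_sequence_Cons exact_sequence_single admissible_arr_def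
    using i1 i2 i3 k1 D by metis
  moreover have "f \<in> Arr C" "Cod C f = Y" using fH by (simp_all add: Hom_def)
  ultimately show "F \<in> Obj (mod_adm C)"
    using f \<pi>H F zero_functor_object unfolding mod_adm_def full_subcategory_def by auto
qed

lemma mod_adm_simps [simp]:
  "Dom (mod_adm C) = NDom" "Cod (mod_adm C) = NCod" "Ide (mod_adm C) = Ide (ModCat C)"
  "Comp (mod_adm C) = Comp (ModCat C)" "ZeroArr (mod_adm C) = ZeroArr (ModCat C)"
  by (simp_all add: mod_adm_def full_subcategory_def)

lemma mod_adm_Obj_cfunctor: "F \<in> Obj (mod_adm C) \<Longrightarrow> additive_cfunctor C F"
  by (simp add: mod_adm_def full_subcategory_def)

lemma mod_adm_Hom:
  "\<eta> \<in> Hom (mod_adm C) F G \<longleftrightarrow> F \<in> Obj (mod_adm C) \<and> G \<in> Obj (mod_adm C) \<and> \<eta> \<in> Hom (ModCat C) F G"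
  by (auto simp: mod_adm_def full_subcategory_def Hom_def natural_transformation_def)

lemma mod_adm_category: "category (mod_adm C)"
proof -
  let ?M = "ModCat C :: (('a, 'b, 'b) cfunctor, ('a, 'b, 'b) nattrans) excat"
  interpret M: category ?M by (rule ModCat_category[OF category_axioms])
  show ?thesis
  proof (rule category.intro)
    fix f assume "f \<in> Arr (mod_adm C)"
    then show "Dom (mod_adm C) f \<in> Obj (mod_adm C)" "Cod (mod_adm C) f \<in> Obj (mod_adm C)"
      by (auto simp: mod_adm_def full_subcategory_def natural_transformation_def)
  next
    fix F assume "F \<in> Obj (mod_adm C)"
    then show "Ide (mod_adm C) F \<in> Hom (mod_adm C) F F"
      unfolding mod_adm_Hom mod_adm_simps using M.Ide_Hom[of F] mod_adm_Obj_cfunctor by simp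
  next
    fix f X Y g Z assume "f \<in> Hom (mod_adm C) X Y" "g \<in> Hom (mod_adm C) Y Z"
    then show "Comp (mod_adm C) g f \<in> Hom (mod_adm C) X Z"
      unfolding mod_adm_Hom mod_adm_simps using M.Comp_Hom by blast
  next
    fix f W X g Y h Z
    assume "f \<in> Hom (mod_adm C) W X" "g \<in> Hom (mod_adm C) X Y" "h \<in> Hom (mod_adm C) Y Z"
    then show "Comp (mod_adm C) (Comp (mod_adm C) h g) f = Comp (mod_adm C) h (Comp (mod_adm C) g f)"
      unfolding mod_adm_Hom mod_adm_simps by (elim conjE) (rule M.Comp_assoc)
  next
    fix f X Y assume "f \<in> Hom (mod_adm C) X Y"
    then have f: "f \<in> Hom (ModCat C) X Y" by (simp only: mod_adm_Hom)
    show "Comp (mod_adm C) f (Ide (mod_adm C) X) = f" "Comp (mod_adm C) (Ide (mod_adm C) Y) f = f"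
      unfolding mod_adm_simps by (rule M.Comp_Ide[OF f], rule M.Ide_Comp[OF f])
  qed
qed

lemma mod_adm_Confl:
  assumes "i \<in> Hom (mod_adm C) F G" "p \<in> Hom (mod_adm C) G H"
  shows "(i, p) \<in> Confl (mod_adm C) \<longleftrightarrow> pointwise_exact C i p"
proof -
  have "(i, p) \<in> Confl (mod_adm C) \<longleftrightarrow> (i, p) \<in> Confl (ModCat C)"
    using assms by (auto simp: mod_adm_def full_subcategory_def Hom_def)
  then show ?thesis using ModCat_Confl_iff assms unfolding mod_adm_Hom by blast
qed

lemma mod_adm_Confl_Hom:
  assumes "(i, p) \<in> Confl (mod_adm C)"
  shows "i \<in> Hom (mod_adm C) (NDom i) (NCod i)" "p \<in> Hom (mod_adm C) (NCod i) (NCod p)"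
proof -
  have c: "(i, p) \<in> Confl (ModCat C)"
    and O: "\<And>F. \<lbrakk>additive_cfunctor C F; F = NDom i \<or> F = NCod i \<or> F = NCod p\<rbrakk> \<Longrightarrow> F \<in> Obj (mod_adm C)"
    using assms by (auto simp: mod_adm_def full_subcategory_def)
  have "natural_transformation C i" "natural_transformation C p" "NCod i = NDom p"
    using c unfolding ModCat_Confl kernel_cokernel_pair_def is_kernel_def by simp_all
  then have "i \<in> Hom (ModCat C) (NDom i) (NCod i)" "p \<in> Hom (ModCat C) (NCod i) (NCod p)"
    by (simp_all add: ModCat_Hom)
  then show "i \<in> Hom (mod_adm C) (NDom i) (NCod i)" "p \<in> Hom (mod_adm C) (NCod i) (NCod p)"
    unfolding mod_adm_Hom using O nattrans_cfunctor by blast+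
qed

lemma ModCat_Confl_mod_adm:
  assumes "(i, p) \<in> Confl (ModCat C)" "i \<in> Hom (mod_adm C) F G" "p \<in> Hom (mod_adm C) G H"
  shows "(i, p) \<in> Confl (mod_adm C)"
  using assms by (auto simp: mod_adm_def full_subcategory_def Hom_def)

text \<open>The representable functor of \<open>Y\<close> is presented by the admissible morphism
  from a zero object to \<open>Y\<close>.\<close>

lemma Yoneda_obj_mod_adm:
  assumes "Y \<in> Obj C"
  shows "Yoneda_obj C Y \<in> Obj (mod_adm C)"
proof -
  obtain Z where Z: "zero_object C Z" "Z \<in> Obj C" by (rule zero_object_exists)
  let ?M = "ModCat C :: (('a, 'b, 'b) cfunctor, ('a, 'b, 'b) nattrans) excat"
  interpret M: category ?M by (rule ModCat_category[OF category_axioms])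
  have IH: "Ide ?M (Yoneda_obj C Y) \<in> Hom ?M (Yoneda_obj C Y) (Yoneda_obj C Y)"
    using M.Ide_Hom Yoneda_cfunctor[OF assms] by simp
  have adm: "admissible_arr C (\<zero> Z Y)"
    using ses_admissible[OF ses_zero_Ide[OF Z] ses_zero_Ide[OF Z(1) assms]] Z assms by simp
  have "h = \<zero> W Y \<longleftrightarrow> (\<exists>x \<in> Hom C W Z. \<zero> Z Y \<cdot> x = h)" if "W \<in> Obj C" for W h
  proof
    assume "h = \<zero> W Y"
    then have "\<zero> Z Y \<cdot> \<zero> W Z = h" using that Z assms by simp
    then show "\<exists>x \<in> Hom C W Z. \<zero> Z Y \<cdot> x = h" using zero_Hom[OF that Z(2)] by blast
  qed (use that Z assms in \<open>auto simp: Hom_def\<close>)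
  then have "presents C Z (\<zero> Z Y) Y (Ide ?M (Yoneda_obj C Y)) (Yoneda_obj C Y)"
    unfolding presents_def using zero_Hom[OF Z(2) assms] IH by simp
  then show ?thesis using adm mod_adm_Obj by blast
qed

end

section \<open>Exact equivalences\<close>

lemma is_functor_D:
  assumes "is_functor C D Fo Fa"
  shows functor_Obj: "X \<in> Obj C \<Longrightarrow> Fo X \<in> Obj D"
    and functor_Hom: "f \<in> Hom C X Y \<Longrightarrow> Fa f \<in> Hom D (Fo X) (Fo Y)"
    and functor_Ide: "X \<in> Obj C \<Longrightarrow> Fa (Ide C X) = Ide D (Fo X)"
    and functor_Comp: "\<lbrakk>f \<in> Hom C X Y; g \<in> Hom C Y Z\<rbrakk> \<Longrightarrow> Fa (g \<cdot>\<^bsub>C\<^esub> f) = Fa g \<cdot>\<^bsub>D\<^esub> Fa f"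
  using assms unfolding is_functor_def by (auto simp: Hom_def)

text \<open>\<open>Go\<close> and the isomorphisms \<open>e\<close> are chosen objectwise, and
  \<open>Ga g\<close> is the unique arrow that \<open>Fa\<close> sends to the conjugate of
  \<open>g\<close> by \<open>e\<close>. So \<open>Ga\<close> recovers a conflation only through
  isomorphic squares, which is the form in which \<open>refl\<close> asks that conflations be
  reflected.\<close>

lemma exactly_equivalentI:
  assumes C: "category C" and D: "category D" and F: "is_functor C D Fo Fa"
    and ff: "\<And>X Y g. \<lbrakk>X \<in> Obj C; Y \<in> Obj C; g \<in> Hom D (Fo X) (Fo Y)\<rbrakk>
      \<Longrightarrow> \<exists>f \<in> Hom C X Y. Fa f = g"
    and faith: "\<And>X Y f f'. \<lbrakk>f \<in> Hom C X Y; f' \<in> Hom C X Y; Fa f = Fa f'\<rbrakk> \<Longrightarrow> f = f'"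
    and ess: "\<And>Z. Z \<in> Obj D \<Longrightarrow> \<exists>X \<in> Obj C. \<exists>e \<in> Hom D (Fo X) Z. is_iso D e"
    and pres: "preserves_conflations C D Fa"
    and refl: "\<And>i p A B K X Y Z f g a b c. \<lbrakk>(i, p) \<in> Confl D; i \<in> Hom D A B; p \<in> Hom D B K;
      f \<in> Hom C X Y; g \<in> Hom C Y Z; a \<in> Hom D (Fo X) A; b \<in> Hom D (Fo Y) B; c \<in> Hom D (Fo Z) K;
      is_iso D a; is_iso D b; is_iso D c; b \<cdot>\<^bsub>D\<^esub> Fa f = i \<cdot>\<^bsub>D\<^esub> a; c \<cdot>\<^bsub>D\<^esub> Fa g = p \<cdot>\<^bsub>D\<^esub> b\<rbrakk>
      \<Longrightarrow> (f, g) \<in> Confl C"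
    and Confl_Hom: "\<And>i p. (i, p) \<in> Confl D \<Longrightarrow> \<exists>A B K. i \<in> Hom D A B \<and> p \<in> Hom D B K"
  shows "exactly_equivalent C D"
proof -
  interpret C: category C by (rule C)
  interpret D: category D by (rule D)
  note FO = functor_Obj[OF F] and FH = functor_Hom[OF F] and FI = functor_Ide[OF F] and FC = functor_Comp[OF F]
  have "\<forall>Z. \<exists>X e e'. Z \<in> Obj D \<longrightarrow> X \<in> Obj C \<and> e \<in> Hom D (Fo X) Z \<and> e' \<in> Hom D Z (Fo X) \<and>
     e' \<cdot>\<^bsub>D\<^esub> e = Ide D (Fo X) \<and> e \<cdot>\<^bsub>D\<^esub> e' = Ide D Z"
    using ess D.is_isoE by metis
  then obtain Go e e' where "\<forall>Z. Z \<in> Obj D \<longrightarrow> Go Z \<in> Obj C \<and> e Z \<in> Hom D (Fo (Go Z)) Z \<and>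
     e' Z \<in> Hom D Z (Fo (Go Z)) \<and> e' Z \<cdot>\<^bsub>D\<^esub> e Z = Ide D (Fo (Go Z)) \<and> e Z \<cdot>\<^bsub>D\<^esub> e' Z = Ide D Z"
    by metis
  then have Go: "Go Z \<in> Obj C" and e: "e Z \<in> Hom D (Fo (Go Z)) Z" and e': "e' Z \<in> Hom D Z (Fo (Go Z))"
    and e'e: "e' Z \<cdot>\<^bsub>D\<^esub> e Z = Ide D (Fo (Go Z))" and ee': "e Z \<cdot>\<^bsub>D\<^esub> e' Z = Ide D Z"
    if "Z \<in> Obj D" for Z
    using that by simp_all
  have iso_e: "is_iso D (e Z)" if "Z \<in> Obj D" for Z
    using D.is_isoI[OF e e' e'e ee'] that by blast
  define Ga where "Ga = (\<lambda>g. SOME f. f \<in> Hom C (Go (Dom D g)) (Go (Cod D g)) \<and>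
     Fa f = e' (Cod D g) \<cdot>\<^bsub>D\<^esub> (g \<cdot>\<^bsub>D\<^esub> e (Dom D g)))"
  have Ga: "Ga g \<in> Hom C (Go Z) (Go W)" "Fa (Ga g) = e' W \<cdot>\<^bsub>D\<^esub> (g \<cdot>\<^bsub>D\<^esub> e Z)"
    if g: "g \<in> Hom D Z W" for g Z W
  proof -
    have O: "Z \<in> Obj D" "W \<in> Obj D" using D.Hom_Obj[OF g] by simp_all
    have "e' W \<cdot>\<^bsub>D\<^esub> (g \<cdot>\<^bsub>D\<^esub> e Z) \<in> Hom D (Fo (Go Z)) (Fo (Go W))"
      using D.Comp_Hom[OF D.Comp_Hom[OF e[OF O(1)] g] e'[OF O(2)]] .
    then have "\<exists>f. f \<in> Hom C (Go (Dom D g)) (Go (Cod D g)) \<and>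
        Fa f = e' (Cod D g) \<cdot>\<^bsub>D\<^esub> (g \<cdot>\<^bsub>D\<^esub> e (Dom D g))"
      using ff[OF Go[OF O(1)] Go[OF O(2)]] g by (auto simp: Hom_D)
    from someI_ex[OF this] show "Ga g \<in> Hom C (Go Z) (Go W)" "Fa (Ga g) = e' W \<cdot>\<^bsub>D\<^esub> (g \<cdot>\<^bsub>D\<^esub> e Z)"
      using g unfolding Ga_def by (simp_all add: Hom_D)
  qed
  have nat: "e W \<cdot>\<^bsub>D\<^esub> Fa (Ga g) = g \<cdot>\<^bsub>D\<^esub> e Z" if g: "g \<in> Hom D Z W" for g Z W
  proof -
    have O: "Z \<in> Obj D" "W \<in> Obj D" using D.Hom_Obj[OF g] by simp_all
    show ?thesis
      unfolding Ga(2)[OF g] using e[OF O(1)] e[OF O(2)] e'[OF O(2)] g ee'[OF O(2)]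
      by (simp add: Hom_def D.cx[OF ee'[OF O(2)]])
  qed
  have GaI: "Ga (Ide D Z) = Ide C (Go Z)" if Z: "Z \<in> Obj D" for Z
  proof (rule faith)
    show "Ga (Ide D Z) \<in> Hom C (Go Z) (Go Z)" using Ga(1)[OF D.Ide_Hom[OF Z]] .
    show "Ide C (Go Z) \<in> Hom C (Go Z) (Go Z)" using C.Ide_Hom[OF Go[OF Z]] .
    show "Fa (Ga (Ide D Z)) = Fa (Ide C (Go Z))"
      unfolding Ga(2)[OF D.Ide_Hom[OF Z]] FI[OF Go[OF Z]] using D.Ide_Comp[OF e[OF Z]] e'e[OF Z] by simp
  qed
  have GaC: "Ga (g \<cdot>\<^bsub>D\<^esub> f) = Ga g \<cdot>\<^bsub>C\<^esub> Ga f" if f: "f \<in> Hom D Z W" and g: "g \<in> Hom D W V" for f g Z W V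
  proof (rule faith)
    have gf: "g \<cdot>\<^bsub>D\<^esub> f \<in> Hom D Z V" using D.Comp_Hom[OF f g] .
    have O: "Z \<in> Obj D" "W \<in> Obj D" "V \<in> Obj D" using D.Hom_Obj[OF f] D.Hom_Obj[OF g] by simp_all
    show "Ga (g \<cdot>\<^bsub>D\<^esub> f) \<in> Hom C (Go Z) (Go V)" using Ga(1)[OF gf] .
    show "Ga g \<cdot>\<^bsub>C\<^esub> Ga f \<in> Hom C (Go Z) (Go V)" using C.Comp_Hom[OF Ga(1)[OF f] Ga(1)[OF g]] .
    show "Fa (Ga (g \<cdot>\<^bsub>D\<^esub> f)) = Fa (Ga g \<cdot>\<^bsub>C\<^esub> Ga f)"
      unfolding FC[OF Ga(1)[OF f] Ga(1)[OF g]] Ga(2)[OF f] Ga(2)[OF g] Ga(2)[OF gf]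
      using f g e[OF O(1)] e[OF O(2)] e'[OF O(2)] e'[OF O(3)]
      by (simp add: Hom_def D.cx[OF ee'[OF O(2)]])
  qed
  have GF: "is_functor D C Go Ga"
    unfolding is_functor_def
  proof (intro conjI ballI impI)
    fix f assume "f \<in> Arr D"
    then have "f \<in> Hom D (Dom D f) (Cod D f)" by (simp add: Hom_def)
    then show "Ga f \<in> Hom C (Go (Dom D f)) (Go (Cod D f))" by (rule Ga(1))
  next
    fix f g assume "f \<in> Arr D" "g \<in> Arr D" "Cod D f = Dom D g"
    then have "f \<in> Hom D (Dom D f) (Dom D g)" "g \<in> Hom D (Dom D g) (Cod D g)" by (simp_all add: Hom_def)
    then show "Ga (g \<cdot>\<^bsub>D\<^esub> f) = Ga g \<cdot>\<^bsub>C\<^esub> Ga f" by (rule GaC)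
  qed (use Go GaI in auto)
  have n1: "naturally_isomorphic D D (Fo \<circ> Go) (Fa \<circ> Ga) id id"
    unfolding naturally_isomorphic_def
  proof (intro exI conjI ballI)
    fix f assume "f \<in> Arr D"
    then have "f \<in> Hom D (Dom D f) (Cod D f)" by (simp add: Hom_def)
    then show "id f \<cdot>\<^bsub>D\<^esub> e (Dom D f) = e (Cod D f) \<cdot>\<^bsub>D\<^esub> (Fa \<circ> Ga) f" using nat by simp
  qed (use e iso_e in auto)
  have "\<forall>X. \<exists>h. X \<in> Obj C \<longrightarrow> h \<in> Hom C (Go (Fo X)) X \<and> Fa h = e (Fo X)"
    using ff Go e FO by metis
  then obtain \<eta> where "\<forall>X. X \<in> Obj C \<longrightarrow> \<eta> X \<in> Hom C (Go (Fo X)) X \<and> Fa (\<eta> X) = e (Fo X)" by metis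
  then have \<eta>: "\<eta> X \<in> Hom C (Go (Fo X)) X" "Fa (\<eta> X) = e (Fo X)" if "X \<in> Obj C" for X
    using that by simp_all
  have iso_\<eta>: "is_iso C (\<eta> X)" if X: "X \<in> Obj C" for X
  proof -
    note FX = FO[OF X]
    obtain h where h: "h \<in> Hom C X (Go (Fo X))" "Fa h = e' (Fo X)" using ff[OF X Go[OF FX] e'[OF FX]] by blast
    note \<eta>X = \<eta>[OF X]
    have "h \<cdot>\<^bsub>C\<^esub> \<eta> X = Ide C (Go (Fo X))"
      by (rule faith[OF C.Comp_Hom[OF \<eta>X(1) h(1)] C.Ide_Hom[OF Go[OF FX]]])
        (simp only: FC[OF \<eta>X(1) h(1)] h(2) \<eta>X(2) FI[OF Go[OF FX]] e'e[OF FX])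
    moreover have "\<eta> X \<cdot>\<^bsub>C\<^esub> h = Ide C X"
      by (rule faith[OF C.Comp_Hom[OF h(1) \<eta>X(1)] C.Ide_Hom[OF X]])
        (simp only: FC[OF h(1) \<eta>X(1)] h(2) \<eta>X(2) FI[OF X] ee'[OF FX])
    ultimately show ?thesis by (rule C.is_isoI[OF \<eta>X(1) h(1)])
  qed
  have n2: "naturally_isomorphic C C (Go \<circ> Fo) (Ga \<circ> Fa) id id"
    unfolding naturally_isomorphic_def
  proof (intro exI conjI ballI)
    fix f assume "f \<in> Arr C"
    then have f: "f \<in> Hom C (Dom C f) (Cod C f)" and O: "Dom C f \<in> Obj C" "Cod C f \<in> Obj C"
      by (simp_all add: Hom_def)
    note Gf = Ga(1)[OF FH[OF f]]
    have "f \<cdot>\<^bsub>C\<^esub> \<eta> (Dom C f) = \<eta> (Cod C f) \<cdot>\<^bsub>C\<^esub> Ga (Fa f)"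
      by (rule faith[OF C.Comp_Hom[OF \<eta>(1)[OF O(1)] f] C.Comp_Hom[OF Gf \<eta>(1)[OF O(2)]]])
        (simp only: FC[OF \<eta>(1)[OF O(1)] f] FC[OF Gf \<eta>(1)[OF O(2)]] \<eta>(2)[OF O(1)] \<eta>(2)[OF O(2)]
          nat[OF FH[OF f]])
    then show "id f \<cdot>\<^bsub>C\<^esub> \<eta> (Dom C f) = \<eta> (Cod C f) \<cdot>\<^bsub>C\<^esub> (Ga \<circ> Fa) f" by simp
  qed (use \<eta> iso_\<eta> in auto)
  have "preserves_conflations D C Ga"
    unfolding preserves_conflations_def
  proof clarify
    fix i p assume ip: "(i, p) \<in> Confl D"
    obtain A B K where i: "i \<in> Hom D A B" and p: "p \<in> Hom D B K" using Confl_Hom[OF ip] by blast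
    have O: "A \<in> Obj D" "B \<in> Obj D" "K \<in> Obj D" using D.Hom_Obj[OF i] D.Hom_Obj[OF p] by simp_all
    show "(Ga i, Ga p) \<in> Confl C"
      using refl[OF ip i p Ga(1)[OF i] Ga(1)[OF p] e[OF O(1)] e[OF O(2)] e[OF O(3)] iso_e[OF O(1)]
          iso_e[OF O(2)] iso_e[OF O(3)] nat[OF i] nat[OF p]] .
  qed
  then show ?thesis unfolding exactly_equivalent_def using F GF n1 n2 pres by blast
qed

lemma (in category) is_cokernel_unique:
  assumes "is_cokernel C p f" "is_cokernel C p' f"
  shows "\<exists>e \<in> Hom C (Cod C p) (Cod C p'). is_iso C e"
proof -
  define Q Q' where Q: "Q = Cod C p" "Q' = Cod C p'"
  have p: "p \<in> Hom C (Cod C f) Q" "p \<cdot> f = ZeroArr C (Dom C f) Q"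
    and p': "p' \<in> Hom C (Cod C f) Q'" "p' \<cdot> f = ZeroArr C (Dom C f) Q'"
    using assms by (simp_all add: is_cokernel_def Hom_def Q)
  have O: "Q \<in> Obj C" "Q' \<in> Obj C" using Hom_Obj[OF p(1)] Hom_Obj[OF p'(1)] by simp_all
  have u: "\<exists>!h. h \<in> Hom C Q W \<and> h \<cdot> p = g" if "g \<in> Hom C (Cod C f) W" "g \<cdot> f = ZeroArr C (Dom C f) W"
      "W \<in> Obj C" for g W
    using assms(1) that unfolding is_cokernel_def Q by blast
  have u': "\<exists>!h. h \<in> Hom C Q' W \<and> h \<cdot> p' = g" if "g \<in> Hom C (Cod C f) W" "g \<cdot> f = ZeroArr C (Dom C f) W"
      "W \<in> Obj C" for g W
    using assms(2) that unfolding is_cokernel_def Q by blast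
  obtain e where e: "e \<in> Hom C Q Q'" "e \<cdot> p = p'" using u[OF p' O(2)] by blast
  obtain e' where e': "e' \<in> Hom C Q' Q" "e' \<cdot> p' = p" using u'[OF p O(1)] by blast
  have 1: "e' \<cdot> e \<in> Hom C Q Q" "(e' \<cdot> e) \<cdot> p = p" "Ide C Q \<in> Hom C Q Q" "Ide C Q \<cdot> p = p"
    using e e' p(1) O by (simp_all add: Hom_def)
  have 2: "e \<cdot> e' \<in> Hom C Q' Q'" "(e \<cdot> e') \<cdot> p' = p'" "Ide C Q' \<in> Hom C Q' Q'" "Ide C Q' \<cdot> p' = p'"
    using e e' p'(1) O by (simp_all add: Hom_def)
  have "e' \<cdot> e = Ide C Q" using ex1_implies_ex[OF u[OF p O(1)]] u[OF p O(1)] 1 by blast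
  moreover have "e \<cdot> e' = Ide C Q'" using u'[OF p' O(2)] 2 by blast
  ultimately have "is_iso C e" by (rule is_isoI[OF e(1) e'(1)])
  then show ?thesis using e(1) Q by blast
qed

text \<open>Both functors are cokernels of \<open>Hom(-, f)\<close> in
  \<open>ModCat C\<close>.\<close>

lemma (in preadditive_category) presents_unique:
  assumes "presents C X f Y \<pi> F" "presents C X f Y \<pi>' F'"
  shows "\<exists>e \<in> Hom (ModCat C) F F'. is_iso (ModCat C) e"
proof -
  have c: "is_cokernel (ModCat C) \<pi> (Yoneda_arr C f) \<and> \<pi> \<in> Hom (ModCat C) (Yoneda_obj C Y) F"
    if p: "presents C X f Y \<pi> F" for \<pi> F
  proof
    note fH = presents_Hom[OF p]
    show "is_cokernel (ModCat C) \<pi> (Yoneda_arr C f)"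
    proof (rule pointwise_exact_cokernel[OF Yoneda_arr_Hom[OF fH(1)] fH(2)])
      fix W y assume W: "W \<in> Obj C" and "y \<in> carrier (FObj (Yoneda_obj C Y) W)"
      then show "(NComp \<pi> W y = \<one>\<^bsub>FObj F W\<^esub>)
          = (\<exists>x \<in> carrier (FObj (Yoneda_obj C X) W). NComp (Yoneda_arr C f) W x = y)"
        using presents_kernel[OF p] Yoneda_arr_NComp[OF fH(1)] by simp
    qed (use presents_surj[OF p] in simp)
    show "\<pi> \<in> Hom (ModCat C) (Yoneda_obj C Y) F" by (rule fH(2))
  qed
  interpret M: category "ModCat C :: (('a, 'b, 'b) cfunctor, ('a, 'b, 'b) nattrans) excat"
    by (rule ModCat_category[OF category_axioms])
  show ?thesis
    using M.is_cokernel_unique[of \<pi> "Yoneda_arr C f" \<pi>'] c[OF assms(1)] c[OF assms(2)]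
    by (simp add: ModCat_Hom)
qed

lemma (in preadditive_category) pointwise_exact_iso:
  fixes F G H F' G' H' :: "('a, 'b, 'b) cfunctor"
  assumes ex: "pointwise_exact C i p" and i: "i \<in> Hom (ModCat C) F G" and p: "p \<in> Hom (ModCat C) G H"
    and i': "i' \<in> Hom (ModCat C) F' G'" and p': "p' \<in> Hom (ModCat C) G' H'"
    and a: "a \<in> Hom (ModCat C) F' F" "is_iso (ModCat C) a"
    and b: "b \<in> Hom (ModCat C) G' G" "is_iso (ModCat C) b"
    and c: "c \<in> Hom (ModCat C) H' H" "is_iso (ModCat C) c"
    and bi: "b \<cdot>\<^bsub>ModCat C\<^esub> i' = i \<cdot>\<^bsub>ModCat C\<^esub> a" and cp: "c \<cdot>\<^bsub>ModCat C\<^esub> p' = p \<cdot>\<^bsub>ModCat C\<^esub> b"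
  shows "pointwise_exact C i' p'"
proof -
  let ?M = "ModCat C :: (('a, 'b, 'b) cfunctor, ('a, 'b, 'b) nattrans) excat"
  interpret M: category ?M by (rule ModCat_category[OF category_axioms])
  have inv: "\<exists>e'. e' \<in> Hom ?M Q P \<and> (\<forall>W \<in> Obj C. (\<forall>x \<in> carrier (FObj P W). NComp e' W (NComp e W x) = x) \<and>
      (\<forall>y \<in> carrier (FObj Q W). NComp e W (NComp e' W y) = y))"
    if e: "e \<in> Hom ?M P Q" "is_iso ?M e" for e P Q
  proof -
    obtain e' where e': "e' \<in> Hom ?M Q P" "e' \<cdot>\<^bsub>?M\<^esub> e = Ide ?M P" "e \<cdot>\<^bsub>?M\<^esub> e' = Ide ?M Q"
      using M.is_isoE[OF e(2,1)] by metis
    have "NComp e' W (NComp e W x) = x" if "W \<in> Obj C" "x \<in> carrier (FObj P W)" for W x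
      using ModCat_Comp_NComp[OF e(1) that, of e'] that unfolding e'(2) by simp
    moreover have "NComp e W (NComp e' W x) = x" if "W \<in> Obj C" "x \<in> carrier (FObj Q W)" for W x
      using ModCat_Comp_NComp[OF e'(1) that, of e] that unfolding e'(3) by simp
    ultimately show ?thesis using e'(1) by blast
  qed
  obtain a' where a': "a' \<in> Hom ?M F F'"
    "\<And>W x. \<lbrakk>W \<in> Obj C; x \<in> carrier (FObj F' W)\<rbrakk> \<Longrightarrow> NComp a' W (NComp a W x) = x"
    "\<And>W x. \<lbrakk>W \<in> Obj C; x \<in> carrier (FObj F W)\<rbrakk> \<Longrightarrow> NComp a W (NComp a' W x) = x"
    using inv[OF a] by blast
  obtain b' where b': "b' \<in> Hom ?M G G'"
    "\<And>W x. \<lbrakk>W \<in> Obj C; x \<in> carrier (FObj G' W)\<rbrakk> \<Longrightarrow> NComp b' W (NComp b W x) = x"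
    "\<And>W x. \<lbrakk>W \<in> Obj C; x \<in> carrier (FObj G W)\<rbrakk> \<Longrightarrow> NComp b W (NComp b' W x) = x"
    using inv[OF b] by blast
  obtain c' where c': "c' \<in> Hom ?M H H'"
    "\<And>W x. \<lbrakk>W \<in> Obj C; x \<in> carrier (FObj H' W)\<rbrakk> \<Longrightarrow> NComp c' W (NComp c W x) = x"
    "\<And>W x. \<lbrakk>W \<in> Obj C; x \<in> carrier (FObj H W)\<rbrakk> \<Longrightarrow> NComp c W (NComp c' W x) = x"
    using inv[OF c] by blast
  have bi: "NComp b W (NComp i' W x) = NComp i W (NComp a W x)"
    if "W \<in> Obj C" "x \<in> carrier (FObj F' W)" for W x
    using ModCat_Comp_NComp[OF i' that, of b] ModCat_Comp_NComp[OF a(1) that, of i] unfolding bi by simp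
  have cp: "NComp c W (NComp p' W x) = NComp p W (NComp b W x)"
    if "W \<in> Obj C" "x \<in> carrier (FObj G' W)" for W x
    using ModCat_Comp_NComp[OF p' that, of c] ModCat_Comp_NComp[OF b(1) that, of p] unfolding cp by simp
  note cl = nattrans_closed[OF a(1)] nattrans_closed[OF b(1)] nattrans_closed[OF c(1)]
    nattrans_closed[OF a'(1)] nattrans_closed[OF b'(1)] nattrans_closed[OF c'(1)]
    nattrans_closed[OF i] nattrans_closed[OF p] nattrans_closed[OF i'] nattrans_closed[OF p']
  have ex1: "\<And>W x. \<lbrakk>W \<in> Obj C; x \<in> carrier (FObj F W); NComp i W x = \<one>\<^bsub>FObj G W\<^esub>\<rbrakk> \<Longrightarrow> x = \<one>\<^bsub>FObj F W\<^esub>"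
    and ex2: "\<And>W y. \<lbrakk>W \<in> Obj C; y \<in> carrier (FObj G W)\<rbrakk> \<Longrightarrow> NComp p W y = \<one>\<^bsub>FObj H W\<^esub> \<longleftrightarrow>
      (\<exists>x \<in> carrier (FObj F W). NComp i W x = y)"
    and ex3: "\<And>W z. \<lbrakk>W \<in> Obj C; z \<in> carrier (FObj H W)\<rbrakk> \<Longrightarrow> \<exists>y \<in> carrier (FObj G W). NComp p W y = z"
    using ex unfolding pointwise_exact_def nattrans_Dom_Cod[OF i] nattrans_Dom_Cod[OF p] by simp_all
  show ?thesis
    unfolding pointwise_exact_def nattrans_Dom_Cod[OF i'] nattrans_Dom_Cod[OF p']
  proof (intro ballI conjI impI)
    fix W x assume W: "W \<in> Obj C" and x: "x \<in> carrier (FObj F' W)" "NComp i' W x = \<one>\<^bsub>FObj G' W\<^esub>"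
    have "NComp i W (NComp a W x) = \<one>\<^bsub>FObj G W\<^esub>" using bi[OF W x(1)] x(2) nattrans_one[OF b(1) W] by simp
    then have "NComp a W x = \<one>\<^bsub>FObj F W\<^esub>" by (rule ex1[OF W cl(1)[OF W x(1)]])
    then show "x = \<one>\<^bsub>FObj F' W\<^esub>" using a'(2)[OF W x(1)] nattrans_one[OF a'(1) W] by simp
  next
    fix W y assume W: "W \<in> Obj C" and y: "y \<in> carrier (FObj G' W)"
    have "NComp p' W y = \<one>\<^bsub>FObj H' W\<^esub> \<longleftrightarrow> NComp p W (NComp b W y) = \<one>\<^bsub>FObj H W\<^esub>"
    proof
      assume "NComp p' W y = \<one>\<^bsub>FObj H' W\<^esub>"
      then show "NComp p W (NComp b W y) = \<one>\<^bsub>FObj H W\<^esub>"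
        using cp[OF W y] nattrans_one[OF c(1) W] by simp
    next
      assume "NComp p W (NComp b W y) = \<one>\<^bsub>FObj H W\<^esub>"
      then have "NComp c W (NComp p' W y) = \<one>\<^bsub>FObj H W\<^esub>" using cp[OF W y] by simp
      then show "NComp p' W y = \<one>\<^bsub>FObj H' W\<^esub>"
        using c'(2)[OF W cl(10)[OF W y]] nattrans_one[OF c'(1) W] by simp
    qed
    also have "\<dots> \<longleftrightarrow> (\<exists>x \<in> carrier (FObj F W). NComp i W x = NComp b W y)" by (rule ex2[OF W cl(2)[OF W y]])
    also have "\<dots> \<longleftrightarrow> (\<exists>x \<in> carrier (FObj F' W). NComp i' W x = y)"
    proof
      assume "\<exists>x \<in> carrier (FObj F W). NComp i W x = NComp b W y"
      then obtain x where x: "x \<in> carrier (FObj F W)" "NComp i W x = NComp b W y" by blast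
      have "NComp b W (NComp i' W (NComp a' W x)) = NComp b W y"
        using bi[OF W cl(4)[OF W x(1)]] a'(3)[OF W x(1)] x(2) by simp
      then have "NComp b' W (NComp b W (NComp i' W (NComp a' W x))) = NComp b' W (NComp b W y)"
        by (rule arg_cong)
      then have "NComp i' W (NComp a' W x) = y"
        by (simp only: b'(2)[OF W cl(9)[OF W cl(4)[OF W x(1)]]] b'(2)[OF W y])
      then show "\<exists>x \<in> carrier (FObj F' W). NComp i' W x = y" using cl(4)[OF W x(1)] by blast
    next
      assume "\<exists>x \<in> carrier (FObj F' W). NComp i' W x = y"
      then obtain x where x: "x \<in> carrier (FObj F' W)" "NComp i' W x = y" by blast
      then have "NComp i W (NComp a W x) = NComp b W y" using bi[OF W x(1)] by simp
      then show "\<exists>x \<in> carrier (FObj F W). NComp i W x = NComp b W y" using cl(1)[OF W x(1)] by blast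
    qed
    finally show "NComp p' W y = \<one>\<^bsub>FObj H' W\<^esub> \<longleftrightarrow> (\<exists>x \<in> carrier (FObj F' W). NComp i' W x = y)" .
  next
    fix W z assume W: "W \<in> Obj C" and z: "z \<in> carrier (FObj H' W)"
    obtain y where y: "y \<in> carrier (FObj G W)" "NComp p W y = NComp c W z"
      using ex3[OF W cl(3)[OF W z]] by blast
    have y': "NComp b' W y \<in> carrier (FObj G' W)" using cl(5)[OF W y(1)] .
    have "NComp c W (NComp p' W (NComp b' W y)) = NComp c W z"
      using cp[OF W y'] b'(3)[OF W y(1)] y(2) by simp
    then have "NComp c' W (NComp c W (NComp p' W (NComp b' W y))) = NComp c' W (NComp c W z)" by (rule arg_cong)
    then have "NComp p' W (NComp b' W y) = z" by (simp only: c'(2)[OF W cl(10)[OF W y']] c'(2)[OF W z])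
    then show "\<exists>y \<in> carrier (FObj G' W). NComp p' W y = z" using y' by blast
  qed
qed

lemma (in exact_category) mod_adm_is_iso:
  assumes "e \<in> Hom (mod_adm C) F G"
  shows "is_iso (mod_adm C) e \<longleftrightarrow> is_iso (ModCat C) e"
proof -
  have O: "F \<in> Obj (mod_adm C)" "G \<in> Obj (mod_adm C)" and e: "e \<in> Hom (ModCat C) F G"
    using assms by (simp_all only: mod_adm_Hom)
  have "Hom (mod_adm C) G F = Hom (ModCat C) G F" using O mod_adm_Hom by blast
  moreover have "NDom e = F" "NCod e = G" using nattrans_Dom_Cod[OF e] by simp_all
  moreover have "e \<in> Arr (mod_adm C)" by (rule Hom_D(1)[OF assms])
  moreover have "e \<in> Arr (ModCat C)" by (rule Hom_D(1)[OF e])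
  ultimately show ?thesis unfolding is_iso_def mod_adm_simps ModCat_simps(3,4) by (simp only:)
qed

section \<open>The Yoneda embedding restricted to projective objects\<close>

context auslander_category
begin

text \<open>\<open>Yoneda_obj C X\<close> serves unchanged as a functor on \<open>E\<close>;
  \<open>mk_nattrans E\<close> keeps only the components at projective objects.\<close>

definition restricted_Yoneda :: "'b \<Rightarrow> ('a, 'b, 'b) nattrans" where
  "restricted_Yoneda f = mk_nattrans E (Yoneda_obj C (Dom C f)) (Yoneda_obj C (Cod C f)) (\<lambda>W h. f \<cdot> h)"

lemma restricted_Yoneda_cfunctor: "X \<in> Obj C \<Longrightarrow> additive_cfunctor E (Yoneda_obj C X)"
  using Yoneda_cfunctor[of X] unfolding additive_cfunctor_def by (auto simp: projective_def)

lemma restricted_Yoneda_Hom: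
  assumes "f \<in> Hom C X Y"
  shows "restricted_Yoneda f \<in> Hom (ModCat E) (Yoneda_obj C X) (Yoneda_obj C Y)"
proof -
  have D: "Dom C f = X" "Cod C f = Y" "X \<in> Obj C" "Y \<in> Obj C" using assms Hom_Obj by (auto simp: Hom_def)
  show ?thesis
    unfolding restricted_Yoneda_def D
    by (rule ModCat_HomI[OF restricted_Yoneda_cfunctor[OF D(3)] restricted_Yoneda_cfunctor[OF D(4)]])
      (use assms proj_excat_category in \<open>auto simp: Hom_def\<close>)
qed

lemma restricted_Yoneda_NComp:
  "\<lbrakk>f \<in> Hom C X Y; h \<in> Hom C W X; projective C W\<rbrakk> \<Longrightarrow> NComp (restricted_Yoneda f) W h = f \<cdot> h"
  by (simp add: restricted_Yoneda_def Hom_D)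

text \<open>\<open>Hom(W, -)\<close> is exact for projective \<open>W\<close>, so it preserves the
  exactness of \<open>P1 --> P0 --> X --> 0\<close>.\<close>

lemma restricted_Yoneda_presents:
  assumes r: "ses C K n P0 r X" and p: "ses C K2 k2 P1 p K" and P: "projective C P1" "projective C P0"
  shows "\<exists>\<pi>. presents E P1 (n \<cdot> p) P0 \<pi> (Yoneda_obj C X)"
proof -
  interpret E: exact_category E by (rule proj_excat_exact)
  note Hr = ses_Hom[OF r] and Hp = ses_Hom[OF p] and O = ses_Obj[OF r]
  define \<pi> where "\<pi> = mk_nattrans E (Yoneda_obj E P0) (Yoneda_obj C X) (\<lambda>W h. r \<cdot> h)"
  have \<pi>H: "\<pi> \<in> Hom (ModCat E) (Yoneda_obj E P0) (Yoneda_obj C X)"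
    unfolding \<pi>_def
    by (rule ModCat_HomI[OF E.Yoneda_cfunctor restricted_Yoneda_cfunctor[OF O(3)]])
      (use Hr P proj_excat_category in \<open>auto simp: Hom_def\<close>)
  have \<pi>N: "NComp \<pi> W h = r \<cdot> h" if "h \<in> Hom C W P0" "projective C W" for W h
    using that P by (simp add: \<pi>_def proj_excat_Hom)
  have "presents E P1 (n \<cdot> p) P0 \<pi> (Yoneda_obj C X)"
    unfolding presents_def
  proof (intro conjI ballI)
    show "n \<cdot> p \<in> Hom E P1 P0" using Hr Hp P by (simp add: proj_excat_Hom) (simp add: Hom_def)
  next
    fix W h assume W: "W \<in> Obj E" and "h \<in> Hom E W P0"
    then have PW: "projective C W" and h: "h \<in> Hom C W P0" by (simp_all add: proj_excat_Hom)
    have "r \<cdot> h = \<zero> W X \<longleftrightarrow> (\<exists>x \<in> Hom C W P1. (n \<cdot> p) \<cdot> x = h)"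
    proof
      assume "r \<cdot> h = \<zero> W X"
      then obtain y where y: "y \<in> Hom C W K" "n \<cdot> y = h" using ses_lift[OF r h] by blast
      obtain x where "x \<in> Hom C W P1" "p \<cdot> x = y" using projective_lift[OF PW p y(1)] by blast
      then show "\<exists>x \<in> Hom C W P1. (n \<cdot> p) \<cdot> x = h" using y Hr Hp by (auto simp: Hom_def)
    next
      assume "\<exists>x \<in> Hom C W P1. (n \<cdot> p) \<cdot> x = h"
      then obtain x where x: "x \<in> Hom C W P1" "(n \<cdot> p) \<cdot> x = h" by blast
      have "r \<cdot> ((n \<cdot> p) \<cdot> x) = \<zero> W X" using x(1) Hr Hp O by (simp add: Hom_def cx[OF ses_comp[OF r]])
      then show "r \<cdot> h = \<zero> W X" by (simp only: x(2))
    qed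
    then show "(NComp \<pi> W h = \<one>\<^bsub>FObj (Yoneda_obj C X) W\<^esub>) = (\<exists>x \<in> Hom E W P1. Comp E (n \<cdot> p) x = h)"
      using \<pi>N[OF h PW] PW P by (simp add: proj_excat_Hom_eq)
  next
    fix W z assume "W \<in> Obj E" "z \<in> carrier (FObj (Yoneda_obj C X) W)"
    then have PW: "projective C W" and z: "z \<in> Hom C W X" by simp_all
    obtain h where h: "h \<in> Hom C W P0" "r \<cdot> h = z" using projective_lift[OF PW r z] by blast
    then show "\<exists>h \<in> Hom E W P0. NComp \<pi> W h = z"
      using \<pi>N[OF h(1) PW] PW P by (auto simp: proj_excat_Hom)
  qed (rule \<pi>H)
  then show ?thesis by blast
qed

text \<open>A presentation \<open>P1 \<rightarrow> P0\<close> of \<open>X\<close> factors through the kernel \<open>L\<close> of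
  \<open>P0 \<rightarrow> X \<rightarrow> X'\<close>, where \<open>X'\<close> is the torsion-free quotient of \<open>X\<close>; this factorization is the
  admissible one in the category of projectives.\<close>

lemma restricted_Yoneda_mod_adm:
  assumes X: "X \<in> Obj C"
  shows "Yoneda_obj C X \<in> Obj (mod_adm E)"
proof -
  interpret E: exact_category E by (rule proj_excat_exact)
  obtain T t X' l Z m c T' where t: "ses C T t X l X'" and m: "ses C X' m Z c T'"
    and Z: "projective C Z" and T: "T \<in> left_perp C (Proj C)"
    using torsion_approximation[OF X] by metis
  obtain P0 K n r where P0: "projective C P0" and r: "ses C K n P0 r X"
    using G_cover[OF X] by (auto simp: Proj_def)
  note Ht = ses_Hom[OF t] and Hr = ses_Hom[OF r] and O = ses_Obj[OF t] ses_Obj[OF r]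
  have "deflation C (l \<cdot> r)" "l \<cdot> r \<in> Hom C P0 X'"
    using Comp_deflation[OF ses_deflation[OF r] ses_deflation[OF t]] Ht Hr by (simp_all add: Hom_def)
  then obtain L j where j: "ses C L j P0 (l \<cdot> r) X'" using deflation_ses by blast
  note Hj = ses_Hom[OF j] and OL = ses_Obj(1)[OF j]
  have L: "projective C L" using second_syzygy_projective[OF j m P0 Z] .
  have "(l \<cdot> r) \<cdot> n = \<zero> K X'" using Ht Hr O by (simp add: Hom_def ses_comp[OF r])
  then obtain n' where n': "n' \<in> Hom C K L" "j \<cdot> n' = n" using ses_lift[OF j Hr(1)] by blast
  have "r \<cdot> j \<in> Hom C L X" "l \<cdot> (r \<cdot> j) = \<zero> L X'"
    using ses_comp[OF j] Ht Hr Hj by (simp_all add: Hom_def)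
  then obtain t' where t': "t' \<in> Hom C L T" "t \<cdot> t' = r \<cdot> j" using ses_lift[OF t] by blast
  \<comment> \<open>\<open>K\<close> and \<open>L\<close> are the kernels of \<open>P0 --> X\<close>
    and \<open>P0 --> X'\<close>, so \<open>L/K\<close> is the kernel \<open>T\<close> of
    \<open>X --> X'\<close>. As \<open>T\<close> is torsion, \<open>P1 --> K --> L\<close> is a
    deflation of \<open>E\<close>.\<close>
  have nt: "ses C K n' L t' T"
  proof (rule G_ses[OF n'(1) t'(1)])
    show "t' \<cdot> n' = \<zero> K T"
      by (rule ses_mono0[OF t])
        (use t' n' Ht Hr Hj in \<open>simp_all add: Hom_def cx[OF t'(2)] ses_comp[OF r]\<close>)
  next
    fix P x assume x: "x \<in> Hom C P K" "n' \<cdot> x = \<zero> P L"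
    have "P \<in> Obj C" using Hom_Obj[OF x(1)] by simp
    then have "n \<cdot> x = \<zero> P P0" using cx[OF n'(2), of x] x n'(1) Hj by (simp add: Hom_def)
    then show "x = \<zero> P K" by (rule ses_mono0[OF r x(1)])
  next
    fix P y assume y: "y \<in> Hom C P L" "t' \<cdot> y = \<zero> P T"
    have OP: "P \<in> Obj C" using Hom_Obj[OF y(1)] by simp
    have "j \<cdot> y \<in> Hom C P P0" "r \<cdot> (j \<cdot> y) = \<zero> P X"
      using cx[OF t'(2), of y] y t'(1) Ht Hr Hj OP by (simp_all add: Hom_def)
    then obtain x where x: "x \<in> Hom C P K" "n \<cdot> x = j \<cdot> y" using ses_lift[OF r] by blast
    have "n' \<cdot> x = y"
      by (rule ses_mono[OF j, of _ P]) (use x y n' Hj in \<open>simp_all add: Hom_def cx[OF n'(2)]\<close>)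
    then show "\<exists>x \<in> Hom C P K. n' \<cdot> x = y" using x by blast
  next
    fix P z assume P: "P \<in> Proj C" and z: "z \<in> Hom C P T"
    have "t \<cdot> z \<in> Hom C P X" using z Ht by (simp add: Hom_def)
    then obtain u where u: "u \<in> Hom C P P0" "r \<cdot> u = t \<cdot> z" using G_lift[OF P r] by blast
    have "(l \<cdot> r) \<cdot> u = \<zero> P X'" using u z Ht Hr O by (simp add: Hom_def cx[OF ses_comp[OF t]])
    then obtain y where y: "y \<in> Hom C P L" "j \<cdot> y = u" using ses_lift[OF j u(1)] by blast
    have "t' \<cdot> y = z"
      by (rule ses_mono[OF t, of _ P]) (use y u z t' Ht Hr Hj in \<open>simp_all add: Hom_def cx[OF t'(2)]\<close>)
    then show "\<exists>y \<in> Hom C P L. t' \<cdot> y = z" using y by blast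
  qed
  obtain P1 K2 k2 p where P1: "projective C P1" and p: "ses C K2 k2 P1 p K"
    using G_cover[OF O(4)] by (auto simp: Proj_def)
  note Hp = ses_Hom[OF p]
  have d: "deflation E (n' \<cdot> p)" using proj_excat_deflationI[OF p nt P1 L T] .
  have i: "inflation E j" using ses_inflation[OF j] L P0 Hj by (simp add: proj_excat_inflation Hom_def)
  have "n \<cdot> p = j \<cdot> (n' \<cdot> p)" using n' Hp Hj cx[OF n'(2), of p] by (simp add: Hom_def)
  moreover have "Cod C (n' \<cdot> p) = Dom C j" using n'(1) Hp Hj by (simp add: Hom_def)
  ultimately have "admissible_arr E (n \<cdot> p)"
    using i d unfolding admissible_arr_def is_image_def by auto
  then show ?thesis using restricted_Yoneda_presents[OF r p P1 P0] E.mod_adm_Obj by blast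
qed

text \<open>\<eta> sends the element \<open>r\<close> of Hom(P0, X) to some \<open>e\<close> in
  Hom(P0, Y). Naturality shows that \<open>e\<close> vanishes on the relations
  \<open>n \<cdot> p\<close>, hence on \<open>n\<close>, and the morphism induced on
  \<open>X\<close> agrees with \<eta> because every element of Hom(W, X) lifts along
  \<open>r\<close>.\<close>

lemma restricted_Yoneda_full:
  assumes \<eta>: "\<eta> \<in> Hom (ModCat E) (Yoneda_obj C X) (Yoneda_obj C Y)" and O: "X \<in> Obj C" "Y \<in> Obj C"
  shows "\<exists>f \<in> Hom C X Y. restricted_Yoneda f = \<eta>"
proof -
  interpret E: exact_category E by (rule proj_excat_exact)
  obtain P0 K n r where P0: "projective C P0" and r: "ses C K n P0 r X"
    using G_cover[OF O(1)] by (auto simp: Proj_def)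
  obtain P1 K2 k2 p where P1: "projective C P1" and p: "ses C K2 k2 P1 p K"
    using G_cover[OF ses_Obj(1)[OF r]] by (auto simp: Proj_def)
  note Hr = ses_Hom[OF r] and Hp = ses_Hom[OF p] and Or = ses_Obj[OF r] ses_Obj[OF p]
  define e where "e = NComp \<eta> P0 r"
  have e: "e \<in> Hom C P0 Y" using nattrans_closed[OF \<eta>, of P0 r] P0 Hr by (simp add: e_def)
  have nat: "NComp \<eta> W (r \<cdot> h) = e \<cdot> h" if h: "h \<in> Hom C W P0" "projective C W" for h W
    using nattrans_natural[OF \<eta>, of h r] h P0 Hr by (simp add: Hom_def e_def)
  have "e \<cdot> (n \<cdot> p) = NComp \<eta> P1 (r \<cdot> (n \<cdot> p))"
    using nat[of "n \<cdot> p" P1] P1 Hr Hp by (simp add: Hom_def)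
  also have "r \<cdot> (n \<cdot> p) = \<zero> P1 X" using Hr Hp Or by (simp add: Hom_def cx[OF ses_comp[OF r]])
  also have "NComp \<eta> P1 (\<zero> P1 X) = \<zero> P1 Y" using nattrans_one[OF \<eta>, of P1] P1 by simp
  finally have "e \<cdot> n = \<zero> K Y"
    using e Hr Hp by (intro ses_epi0[OF p]) (simp_all add: Hom_def)
  then obtain f where f: "f \<in> Hom C X Y" "f \<cdot> r = e" using ses_colift[OF r e] by blast
  have "restricted_Yoneda f = \<eta>"
  proof (rule nattrans_eqI[OF restricted_Yoneda_Hom[OF f(1)] \<eta>])
    fix W x assume "W \<in> Obj E" "x \<in> carrier (FObj (Yoneda_obj C X) W)"
    then have W: "projective C W" and x: "x \<in> Hom C W X" by simp_all
    obtain h where h: "h \<in> Hom C W P0" "r \<cdot> h = x" using projective_lift[OF W r x] by blast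
    show "NComp (restricted_Yoneda f) W x = NComp \<eta> W x"
      using restricted_Yoneda_NComp[OF f(1) x W] nat[OF h(1) W] cx[OF f(2), of h] h f(1) Hr
      by (simp add: Hom_def)
  qed
  then show ?thesis using f(1) by blast
qed

lemma restricted_Yoneda_faithful:
  assumes f: "f \<in> Hom C X Y" "f' \<in> Hom C X Y" "restricted_Yoneda f = restricted_Yoneda f'"
  shows "f = f'"
proof -
  obtain P0 K n r where P0: "projective C P0" and r: "ses C K n P0 r X"
    using G_cover[of X] Hom_Obj[OF f(1)] by (auto simp: Proj_def)
  note Hr = ses_Hom[OF r]
  have "f \<cdot> r = f' \<cdot> r"
    using restricted_Yoneda_NComp[OF f(1) Hr(2) P0] restricted_Yoneda_NComp[OF f(2) Hr(2) P0] f(3) by simp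
  then show ?thesis by (rule ses_epi[OF r f(1,2)])
qed

text \<open>A deflation of \<open>E\<close> is \<open>j \<cdot> q\<close> in \<open>C\<close>, so
  the presenting morphism is the deflation \<open>q\<close> followed by the inflation
  \<open>m \<cdot> j\<close> of \<open>C\<close>. The cokernel of the latter has the same
  presentation as \<open>F\<close>.\<close>

lemma restricted_Yoneda_ess_surj:
  assumes "F \<in> Obj (mod_adm E)"
  shows "\<exists>X \<in> Obj C. \<exists>e \<in> Hom (ModCat E) (Yoneda_obj C X) F. is_iso (ModCat E) e"
proof -
  interpret E: exact_category E by (rule proj_excat_exact)
  obtain X f Y \<pi> where f: "admissible_arr E f" and \<pi>: "presents E X f Y \<pi> F"
    using assms E.mod_adm_Obj by blast
  note fH = E.presents_Hom(1)[OF \<pi>]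
  obtain K k I p m c D where p: "ses E K k X p I" and m: "ses E I m Y c D" and fmp: "f = m \<cdot> p"
    using E.admissible_ses[OF f fH] by auto
  have pH: "p \<in> Hom C X I" and mH: "m \<in> Hom C I Y" and PY: "projective C Y"
    using E.ses_Hom[OF p] E.ses_Hom[OF m] by (simp_all add: proj_excat_Hom)
  obtain N n q J j d T where q: "ses C N n X q J" and j: "ses C J j I d T" and pjq: "p = j \<cdot> q"
    and PX: "projective C X"
    using proj_excat_deflationE[OF E.ses_deflation[OF p] pH] by metis
  have "inflation C m" using E.ses_inflation[OF m] by (simp add: proj_excat_inflation)
  then have "inflation C (m \<cdot> j)" "m \<cdot> j \<in> Hom C J Y"
    using Comp_inflation[OF ses_inflation[OF j], of m] ses_Hom[OF j] mH by (simp_all add: Hom_def)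
  then obtain d' D' where d': "ses C J (m \<cdot> j) Y d' D'" using inflation_ses by blast
  have "f = (m \<cdot> j) \<cdot> q" using fmp pjq ses_Hom[OF q] ses_Hom[OF j] mH by (simp add: Hom_def)
  then obtain \<pi>' where "presents E X f Y \<pi>' (Yoneda_obj C D')"
    using restricted_Yoneda_presents[OF d' q PX PY] by auto
  from E.presents_unique[OF this \<pi>] show ?thesis using ses_Obj(3)[OF d'] by blast
qed

lemma restricted_Yoneda_pointwise_exact:
  assumes "ses C A i B p D"
  shows "pointwise_exact E (restricted_Yoneda i) (restricted_Yoneda p)"
proof -
  note H = ses_Hom[OF assms] and O = ses_Obj[OF assms]
  note N = restricted_Yoneda_NComp[OF H(1)] restricted_Yoneda_NComp[OF H(2)]
  show ?thesis
    unfolding pointwise_exact_def nattrans_Dom_Cod[OF restricted_Yoneda_Hom[OF H(1)]]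
      nattrans_Dom_Cod[OF restricted_Yoneda_Hom[OF H(2)]] Yoneda_obj_simps
  proof (intro ballI conjI impI)
    fix W x assume "W \<in> Obj E" "x \<in> Hom C W A" "NComp (restricted_Yoneda i) W x = \<zero> W B"
    then show "x = \<zero> W A" using ses_mono0[OF assms] N(1) by simp
  next
    fix W y assume "W \<in> Obj E" and y: "y \<in> Hom C W B"
    then have W: "projective C W" by simp
    have "p \<cdot> y = \<zero> W D \<longleftrightarrow> (\<exists>x \<in> Hom C W A. i \<cdot> x = y)"
      using ses_lift[OF assms y] H O by (auto simp: Hom_def cx[OF ses_comp[OF assms]])
    then show "(NComp (restricted_Yoneda p) W y = \<zero> W D)
        = (\<exists>x \<in> Hom C W A. NComp (restricted_Yoneda i) W x = y)"
      using N(2)[OF y W] N(1)[OF _ W] by simp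
  next
    fix W z assume "W \<in> Obj E" and z: "z \<in> Hom C W D"
    then have W: "projective C W" by simp
    show "\<exists>y \<in> Hom C W B. NComp (restricted_Yoneda p) W y = z"
      using projective_lift[OF W assms z] N(2)[OF _ W] by simp
  qed
qed

text \<open>For \<open>Proj C\<close>, the hypotheses of \<open>G_ses\<close> are exactness on
  morphisms from projectives, which is pointwise exactness over \<open>E\<close>. So the embedding
  also reflects conflations.\<close>

lemma pointwise_exact_restricted_Yoneda:
  assumes ex: "pointwise_exact E (restricted_Yoneda f) (restricted_Yoneda g)"
    and f: "f \<in> Hom C A B" and g: "g \<in> Hom C B D"
  shows "ses C A f B g D"
proof -
  note N = restricted_Yoneda_NComp[OF f] restricted_Yoneda_NComp[OF g]
  note O = Hom_Obj[OF f] Hom_Obj[OF g]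
  have ex1: "x = \<zero> W A" if "x \<in> Hom C W A" "f \<cdot> x = \<zero> W B" "projective C W" for W x
    using ex that N(1)[OF that(1,3)] unfolding pointwise_exact_def nattrans_Dom_Cod[OF restricted_Yoneda_Hom[OF f]]
      Yoneda_obj_simps by simp
  have ex2: "g \<cdot> y = \<zero> W D \<longleftrightarrow> (\<exists>x \<in> Hom C W A. f \<cdot> x = y)" if "y \<in> Hom C W B" "projective C W" for W y
  proof -
    have "(\<exists>x \<in> Hom C W A. NComp (restricted_Yoneda f) W x = y) \<longleftrightarrow> (\<exists>x \<in> Hom C W A. f \<cdot> x = y)"
      using N(1)[OF _ that(2)] by (intro bex_cong) simp_all
    moreover have "NComp (restricted_Yoneda g) W y = \<zero> W D \<longleftrightarrow>
        (\<exists>x \<in> Hom C W A. NComp (restricted_Yoneda f) W x = y)"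
      using ex that unfolding pointwise_exact_def
        nattrans_Dom_Cod[OF restricted_Yoneda_Hom[OF f]] nattrans_Dom_Cod[OF restricted_Yoneda_Hom[OF g]]
        Yoneda_obj_simps by simp
    ultimately show ?thesis by (simp only: N(2)[OF that])
  qed
  have ex3: "\<exists>y \<in> Hom C W B. g \<cdot> y = z" if "z \<in> Hom C W D" "projective C W" for W z
  proof -
    have "\<exists>y \<in> Hom C W B. NComp (restricted_Yoneda g) W y = z"
      using ex that unfolding pointwise_exact_def
        nattrans_Dom_Cod[OF restricted_Yoneda_Hom[OF f]] nattrans_Dom_Cod[OF restricted_Yoneda_Hom[OF g]]
        Yoneda_obj_simps by simp
    then show ?thesis using N(2)[OF _ that(2)] by auto
  qed
  show ?thesis
  proof (rule G_ses[OF f g])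
    show "g \<cdot> f = \<zero> A D"
    proof (rule G_zero)
      show "g \<cdot> f \<in> Hom C A D" using f g by (simp add: Hom_def)
      fix P x assume P: "P \<in> Proj C" and x: "x \<in> Hom C P A"
      have "f \<cdot> x \<in> Hom C P B" using x f by (simp add: Hom_def)
      then have "g \<cdot> (f \<cdot> x) = \<zero> P D" using ex2[of "f \<cdot> x" P] x P by (auto simp: Proj_def)
      then show "(g \<cdot> f) \<cdot> x = \<zero> P D" using f g x by (simp add: Hom_def)
    qed
  qed (use ex1 ex2 ex3 in \<open>auto simp: Proj_def\<close>)
qed

theorem exactly_equivalent_mod_adm: "exactly_equivalent C (mod_adm E)"
proof -
  interpret E: exact_category E by (rule proj_excat_exact)
  have H: "restricted_Yoneda f \<in> Hom (mod_adm E) (Yoneda_obj C X) (Yoneda_obj C Y)" if "f \<in> Hom C X Y" for f X Y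
    unfolding E.mod_adm_Hom using restricted_Yoneda_Hom[OF that] restricted_Yoneda_mod_adm Hom_Obj[OF that] by simp
  note iso = E.mod_adm_is_iso
  show ?thesis
  proof (rule exactly_equivalentI[of C "mod_adm E" "Yoneda_obj C" restricted_Yoneda])
    show "category C" by (rule category_axioms)
    show "category (mod_adm E)" by (rule E.mod_adm_category)
    show "is_functor C (mod_adm E) (Yoneda_obj C) restricted_Yoneda"
      unfolding is_functor_def
    proof (intro conjI ballI impI)
      fix X assume X: "X \<in> Obj C"
      show "Yoneda_obj C X \<in> Obj (mod_adm E)" by (rule restricted_Yoneda_mod_adm[OF X])
      show "restricted_Yoneda (Ide C X) = Ide (mod_adm E) (Yoneda_obj C X)"
        using X by (auto simp: restricted_Yoneda_def mk_nattrans_def restrict_def fun_eq_iff Hom_def)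
    next
      fix f assume "f \<in> Arr C"
      then have "f \<in> Hom C (Dom C f) (Cod C f)" by (simp add: Hom_def)
      then show "restricted_Yoneda f \<in> Hom (mod_adm E) (Yoneda_obj C (Dom C f)) (Yoneda_obj C (Cod C f))"
        by (rule H)
    next
      fix f g assume fg: "f \<in> Arr C" "g \<in> Arr C" "Cod C f = Dom C g"
      then show "restricted_Yoneda (g \<cdot> f) = Comp (mod_adm E) (restricted_Yoneda g) (restricted_Yoneda f)"
        by (auto simp: restricted_Yoneda_def mk_nattrans_def restrict_def fun_eq_iff Hom_def)
    qed
    show "\<exists>f \<in> Hom C X Y. restricted_Yoneda f = g"
      if "X \<in> Obj C" "Y \<in> Obj C" "g \<in> Hom (mod_adm E) (Yoneda_obj C X) (Yoneda_obj C Y)" for X Y g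
      using restricted_Yoneda_full[OF _ that(1,2)] that(3) unfolding E.mod_adm_Hom by blast
    show "f = f'" if "f \<in> Hom C X Y" "f' \<in> Hom C X Y" "restricted_Yoneda f = restricted_Yoneda f'" for X Y f f'
      using restricted_Yoneda_faithful[OF that] .
    show "\<exists>X \<in> Obj C. \<exists>e \<in> Hom (mod_adm E) (Yoneda_obj C X) F. is_iso (mod_adm E) e"
      if F: "F \<in> Obj (mod_adm E)" for F
    proof -
      obtain X e where e: "X \<in> Obj C" "e \<in> Hom (ModCat E) (Yoneda_obj C X) F" "is_iso (ModCat E) e"
        using restricted_Yoneda_ess_surj[OF F] by blast
      have eH: "e \<in> Hom (mod_adm E) (Yoneda_obj C X) F"
        unfolding E.mod_adm_Hom using e F restricted_Yoneda_mod_adm by simp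
      then show ?thesis using e iso[OF eH] by blast
    qed
    show "preserves_conflations C (mod_adm E) restricted_Yoneda"
      unfolding preserves_conflations_def
    proof clarify
      fix i p assume "(i, p) \<in> Confl C"
      then have s: "ses C (Dom C i) i (Cod C i) p (Cod C p)" by (rule Confl_ses)
      show "(restricted_Yoneda i, restricted_Yoneda p) \<in> Confl (mod_adm E)"
        using E.mod_adm_Confl[OF H H] restricted_Yoneda_pointwise_exact[OF s] ses_Hom[OF s] by blast
    qed
    show "\<exists>A B K. i \<in> Hom (mod_adm E) A B \<and> p \<in> Hom (mod_adm E) B K" if "(i, p) \<in> Confl (mod_adm E)" for i p
      using E.mod_adm_Confl_Hom[OF that] by blast
    fix i p F G K X Y Z f g a b c
    assume ip: "(i, p) \<in> Confl (mod_adm E)" and i: "i \<in> Hom (mod_adm E) F G" and p: "p \<in> Hom (mod_adm E) G K"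
      and f: "f \<in> Hom C X Y" and g: "g \<in> Hom C Y Z" and a: "a \<in> Hom (mod_adm E) (Yoneda_obj C X) F"
      and b: "b \<in> Hom (mod_adm E) (Yoneda_obj C Y) G" and c: "c \<in> Hom (mod_adm E) (Yoneda_obj C Z) K"
      and isos: "is_iso (mod_adm E) a" "is_iso (mod_adm E) b" "is_iso (mod_adm E) c"
      and sq: "Comp (mod_adm E) b (restricted_Yoneda f) = Comp (mod_adm E) i a"
        "Comp (mod_adm E) c (restricted_Yoneda g) = Comp (mod_adm E) p b"
    have pw: "pointwise_exact E i p" using E.mod_adm_Confl[OF i p] ip by simp
    have M: "i \<in> Hom (ModCat E) F G" "p \<in> Hom (ModCat E) G K" "a \<in> Hom (ModCat E) (Yoneda_obj C X) F"
      "b \<in> Hom (ModCat E) (Yoneda_obj C Y) G" "c \<in> Hom (ModCat E) (Yoneda_obj C Z) K"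
      using i p a b c unfolding E.mod_adm_Hom by blast+
    have Misos: "is_iso (ModCat E) a" "is_iso (ModCat E) b" "is_iso (ModCat E) c"
      using isos iso[OF a] iso[OF b] iso[OF c] by blast+
    have "pointwise_exact E (restricted_Yoneda f) (restricted_Yoneda g)"
      by (rule E.pointwise_exact_iso[OF pw M(1,2) restricted_Yoneda_Hom[OF f] restricted_Yoneda_Hom[OF g]
            M(3) Misos(1) M(4) Misos(2) M(5) Misos(3) sq[unfolded E.mod_adm_simps]])
    then show "(f, g) \<in> Confl C" using pointwise_exact_restricted_Yoneda[OF _ f g] by (simp add: ses_def)
  qed
qed

end

section \<open>Properties of categories of admissibly presented functors\<close>

text \<open>What is used of an exact equivalence of \<open>C\<close> with \<open>mod_adm E\<close>: here \<open>yo\<close> and \<open>ya\<close> are the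
  composite of the Yoneda embedding with the equivalence.\<close>

locale auslander_data = exact_category C
  for C :: "('o, 'm) excat" (structure) +
  fixes E :: "('p, 'q) excat" and yo :: "'p \<Rightarrow> 'o" and ya :: "'q \<Rightarrow> 'm"
  assumes E_exact: "exact_category E"
    and y_functor: "is_functor E C yo ya"
    and y_full: "\<lbrakk>X \<in> Obj E; Y \<in> Obj E; g \<in> Hom C (yo X) (yo Y)\<rbrakk> \<Longrightarrow> \<exists>f \<in> Hom E X Y. ya f = g"
    and y_faithful: "\<lbrakk>f \<in> Hom E X Y; f' \<in> Hom E X Y; ya f = ya f'\<rbrakk> \<Longrightarrow> f = f'"
    and y_projective: "X \<in> Obj E \<Longrightarrow> projective C (yo X)"
    and y_presents: "\<lbrakk>ses E K k X p I; ses E I m Y c D\<rbrakk> \<Longrightarrow> \<exists>J q j r A.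
      ses C (yo K) (ya k) (yo X) q J \<and> ses C J j (yo Y) r A \<and> ya (m \<cdot>\<^bsub>E\<^esub> p) = j \<cdot> q"
    and y_cover: "A \<in> Obj C \<Longrightarrow> \<exists>K k X p I m Y c D J q j r.
      ses E K k X p I \<and> ses E I m Y c D \<and>
      ses C (yo K) (ya k) (yo X) q J \<and> ses C J j (yo Y) r A \<and> ya (m \<cdot>\<^bsub>E\<^esub> p) = j \<cdot> q"

text \<open>Objects corresponding to representable functors are projective and cover, so conflations
  of \<open>C\<close> can be tested on them.\<close>

sublocale auslander_data \<subseteq> exact_category_gen C "yo ` Obj E"
proof
  fix P assume "P \<in> yo ` Obj E" then show "projective C P" using y_projective by auto
next
  fix A assume "A \<in> Obj C"
  then obtain I m Y c D J j r where "ses E I m Y c D" "ses C J j (yo Y) r A" using y_cover by metis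
  then show "\<exists>P \<in> yo ` Obj E. \<exists>N n r. ses C N n P r A"
    using exact_category.ses_Obj(2)[OF E_exact] by blast
qed

context auslander_data
begin

lemma y_Hom: "f \<in> Hom E X Y \<Longrightarrow> ya f \<in> Hom C (yo X) (yo Y)"
  by (rule functor_Hom[OF y_functor])

lemma y_Obj: "X \<in> Obj E \<Longrightarrow> yo X \<in> Obj C"
  by (rule functor_Obj[OF y_functor])

lemma y_Comp: "\<lbrakk>f \<in> Hom E X Y; g \<in> Hom E Y Z\<rbrakk> \<Longrightarrow> ya (g \<cdot>\<^bsub>E\<^esub> f) = ya g \<cdot> ya f"
  by (rule functor_Comp[OF y_functor])

lemma y_Ide: "X \<in> Obj E \<Longrightarrow> ya (Ide E X) = Ide C (yo X)"
  by (rule functor_Ide[OF y_functor])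

text \<open>By fullness the zero endomorphism of \<open>yo Z\<close> comes from the only
  endomorphism of \<open>Z\<close>, the identity. So \<open>yo Z\<close> is a zero object, and other
  zero morphisms factor through it.\<close>

lemma y_zero:
  assumes "X \<in> Obj E" "Y \<in> Obj E"
  shows "ya (ZeroArr E X Y) = \<zero> (yo X) (yo Y)"
proof -
  interpret E: exact_category E by (rule E_exact)
  obtain Z where Z: "zero_object E Z" "Z \<in> Obj E" by (rule E.zero_object_exists)
  have "Ide C (yo Z) = \<zero> (yo Z) (yo Z)"
  proof -
    obtain f where f: "f \<in> Hom E Z Z" "ya f = \<zero> (yo Z) (yo Z)"
      using y_full[OF Z(2) Z(2) zero_Hom[OF y_Obj[OF Z(2)] y_Obj[OF Z(2)]]] by blast
    then have "f = Ide E Z" using E.zero_object_Hom(1)[OF Z] E.Ide_Hom[OF Z(2)] by metis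
    then show ?thesis using f y_Ide[OF Z(2)] by simp
  qed
  then have yZ: "zero_object C (yo Z)" using y_Obj[OF Z(2)] by (intro zero_objectI)
  have h: "ZeroArr E X Z \<in> Hom E X Z" "ZeroArr E Z Y \<in> Hom E Z Y"
    using E.zero_Hom assms Z by simp_all
  have "ya (ZeroArr E X Z) = \<zero> (yo X) (yo Z)"
    using zero_object_Hom(2)[OF yZ y_Obj[OF assms(1)]] y_Hom[OF h(1)] by blast
  moreover have "ZeroArr E Z Y \<cdot>\<^bsub>E\<^esub> ZeroArr E X Z = ZeroArr E X Y" using assms Z by simp
  ultimately show ?thesis
    using y_Comp[OF h] y_Hom[OF h(2)] y_Obj[OF assms(1)] by (simp add: Hom_def)
qed

text \<open>A fully faithful functor preserves biproducts, as the idempotent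
  \<open>ya i1 \<cdot> ya p1 \<oplus> ya i2 \<cdot> ya p2\<close> comes from an endomorphism of the biproduct.\<close>

lemma y_add:
  assumes f: "f \<in> Hom E X Y" and g: "g \<in> Hom E X Y"
  shows "ya (Add E f g) = ya f \<oplus> ya g"
proof -
  interpret E: exact_category E by (rule E_exact)
  have OY: "Y \<in> Obj E" using E.Hom_Obj[OF f] by simp
  obtain S i1 i2 p1 p2 where S: "is_biproduct E Y Y S i1 i2 p1 p2"
    "i1 \<in> Hom E Y S" "i2 \<in> Hom E Y S" "p1 \<in> Hom E S Y" "p2 \<in> Hom E S Y"
    "p1 \<cdot>\<^bsub>E\<^esub> i1 = Ide E Y" "p2 \<cdot>\<^bsub>E\<^esub> i2 = Ide E Y" "p1 \<cdot>\<^bsub>E\<^esub> i2 = ZeroArr E Y Y"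
    "p2 \<cdot>\<^bsub>E\<^esub> i1 = ZeroArr E Y Y" "Add E (i1 \<cdot>\<^bsub>E\<^esub> p1) (i2 \<cdot>\<^bsub>E\<^esub> p2) = Ide E S"
    using E.biproductE[OF OY OY] by blast
  have OS: "S \<in> Obj E" using E.Hom_Obj[OF S(2)] by simp
  note yS = y_Hom[OF S(2)] y_Hom[OF S(3)] y_Hom[OF S(4)] y_Hom[OF S(5)]
  note yO = y_Obj[OF OY] y_Obj[OF OS]
  have yp: "ya p1 \<cdot> ya i1 = Ide C (yo Y)" "ya p2 \<cdot> ya i2 = Ide C (yo Y)"
    "ya p1 \<cdot> ya i2 = \<zero> (yo Y) (yo Y)" "ya p2 \<cdot> ya i1 = \<zero> (yo Y) (yo Y)"
    using y_Comp[OF S(2,4)] y_Comp[OF S(3,5)] y_Comp[OF S(3,4)] y_Comp[OF S(2,5)]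
      y_Ide[OF OY] y_zero[OF OY OY] S(6-9) by simp_all
  note cxp = cx[OF yp(1)] cx[OF yp(2)] cx[OF yp(3)] cx[OF yp(4)]
  have "ya i1 \<cdot> ya p1 \<oplus> ya i2 \<cdot> ya p2 \<in> Hom C (yo S) (yo S)" using yS by (simp add: Hom_def)
  then obtain e where e: "e \<in> Hom E S S" "ya e = ya i1 \<cdot> ya p1 \<oplus> ya i2 \<cdot> ya p2"
    using y_full[OF OS OS] by blast
  \<comment> \<open>By faithfulness \<open>e\<close> has the components of the identity of the
    biproduct.\<close>
  have pe: "p1 \<cdot>\<^bsub>E\<^esub> e = p1" "p2 \<cdot>\<^bsub>E\<^esub> e = p2"
    by (rule y_faithful[of _ S Y], use e S(4,5) in \<open>simp add: Hom_def\<close>, fact S,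
        use y_Comp[OF e(1) S(4)] y_Comp[OF e(1) S(5)] yS yO in \<open>simp add: Hom_def e(2) cxp\<close>)+
  have "e = Add E (i1 \<cdot>\<^bsub>E\<^esub> p1) (i2 \<cdot>\<^bsub>E\<^esub> p2) \<cdot>\<^bsub>E\<^esub> e" using e(1) by (simp add: S(10) Hom_def)
  also have "\<dots> = Add E (i1 \<cdot>\<^bsub>E\<^esub> p1) (i2 \<cdot>\<^bsub>E\<^esub> p2)" using e(1) S(2-5) by (simp add: Hom_def pe)
  finally have 1: "ya i1 \<cdot> ya p1 \<oplus> ya i2 \<cdot> ya p2 = Ide C (yo S)"
    using e(2) y_Ide[OF OS] by (simp add: S(10))
  \<comment> \<open>\<open>f + g\<close> is the composite of \<open>w = (f, g)\<close> with the
    codiagonal \<open>n\<close>, and \<open>ya\<close> respects the biproduct relations.\<close>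
  define w where "w = Add E (i1 \<cdot>\<^bsub>E\<^esub> f) (i2 \<cdot>\<^bsub>E\<^esub> g)"
  define n where "n = Add E p1 p2"
  have w: "w \<in> Hom E X S" and n: "n \<in> Hom E S Y" using S f g by (simp_all add: w_def n_def Hom_def)
  have ew: "p1 \<cdot>\<^bsub>E\<^esub> w = f" "p2 \<cdot>\<^bsub>E\<^esub> w = g" "n \<cdot>\<^bsub>E\<^esub> i1 = Ide E Y" "n \<cdot>\<^bsub>E\<^esub> i2 = Ide E Y"
    "n \<cdot>\<^bsub>E\<^esub> w = Add E f g"
    using S f g E.Hom_Obj[OF f]
    by (simp_all add: w_def n_def Hom_def E.cx[OF S(6)] E.cx[OF S(7)] E.cx[OF S(8)] E.cx[OF S(9)])
  have yw: "ya p1 \<cdot> ya w = ya f" "ya p2 \<cdot> ya w = ya g" "ya n \<cdot> ya i1 = Ide C (yo Y)"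
    "ya n \<cdot> ya i2 = Ide C (yo Y)" "ya n \<cdot> ya w = ya (Add E f g)"
    using y_Comp[OF w S(4)] y_Comp[OF w S(5)] y_Comp[OF S(2) n] y_Comp[OF S(3) n] y_Comp[OF w n]
      y_Ide[OF OY] ew by simp_all
  have "ya n \<cdot> ya w = ya n \<cdot> ((ya i1 \<cdot> ya p1 \<oplus> ya i2 \<cdot> ya p2) \<cdot> ya w)"
    unfolding 1 using y_Hom[OF w] by (simp add: Hom_def)
  also have "\<dots> = ya f \<oplus> ya g"
    using yS y_Hom[OF w] y_Hom[OF n] y_Hom[OF f] y_Hom[OF g] yO
    by (simp add: Hom_def yw(1,2) cx[OF yw(3)] cx[OF yw(4)])
  finally show ?thesis using yw(5) by simp
qed

text \<open>The exact sequence \<open>Hom(-, X) \<rightarrow> Hom(-, Y) \<rightarrow> A \<rightarrow> 0\<close>, transported to \<open>C\<close>.\<close>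

definition cpres :: "'p \<Rightarrow> 'q \<Rightarrow> 'p \<Rightarrow> 'm \<Rightarrow> 'o \<Rightarrow> bool" where
  "cpres X f Y r A \<longleftrightarrow> f \<in> Hom E X Y \<and> admissible_arr E f \<and> r \<in> Hom C (yo Y) A \<and>
     r \<cdot> ya f = \<zero> (yo X) A \<and>
     (\<forall>W y. y \<in> Hom E W Y \<longrightarrow> r \<cdot> ya y = \<zero> (yo W) A \<longrightarrow> (\<exists>x \<in> Hom E W X. f \<cdot>\<^bsub>E\<^esub> x = y)) \<and>
     (\<forall>W z. W \<in> Obj E \<longrightarrow> z \<in> Hom C (yo W) A \<longrightarrow> (\<exists>y \<in> Hom E W Y. r \<cdot> ya y = z)) \<and>
     (\<forall>B g. g \<in> Hom C (yo Y) B \<longrightarrow> g \<cdot> ya f = \<zero> (yo X) B \<longrightarrow> (\<exists>h \<in> Hom C A B. h \<cdot> r = g)) \<and>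
     (\<forall>B g h. g \<in> Hom C A B \<longrightarrow> h \<in> Hom C A B \<longrightarrow> g \<cdot> r = h \<cdot> r \<longrightarrow> g = h)"

lemma cpres_D:
  assumes "cpres X f Y r A"
  shows cpres_Hom: "f \<in> Hom E X Y" "r \<in> Hom C (yo Y) A" and cpres_admissible: "admissible_arr E f"
    and cpres_zero: "r \<cdot> ya f = \<zero> (yo X) A"
    and cpres_kernel: "\<And>W y. \<lbrakk>y \<in> Hom E W Y; r \<cdot> ya y = \<zero> (yo W) A\<rbrakk> \<Longrightarrow> \<exists>x \<in> Hom E W X. f \<cdot>\<^bsub>E\<^esub> x = y"
    and cpres_surj: "\<And>W z. \<lbrakk>W \<in> Obj E; z \<in> Hom C (yo W) A\<rbrakk> \<Longrightarrow> \<exists>y \<in> Hom E W Y. r \<cdot> ya y = z"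
    and cpres_colift: "\<And>B g. \<lbrakk>g \<in> Hom C (yo Y) B; g \<cdot> ya f = \<zero> (yo X) B\<rbrakk> \<Longrightarrow> \<exists>h \<in> Hom C A B. h \<cdot> r = g"
    and cpres_epi: "\<And>B g h. \<lbrakk>g \<in> Hom C A B; h \<in> Hom C A B; g \<cdot> r = h \<cdot> r\<rbrakk> \<Longrightarrow> g = h"
  using assms unfolding cpres_def by simp_all

text \<open>Elements killed by \<open>r\<close> are lifted along \<open>j\<close> and then, as
  \<open>yo W\<close> is projective, along \<open>q\<close>; fullness and faithfulness turn the lift
  into an arrow of \<open>E\<close>.\<close>

lemma ses_cpres:
  assumes p: "ses E K k X p I" and m: "ses E I m Y c D"
    and q: "ses C (yo K) (ya k) (yo X) q J" and j: "ses C J j (yo Y) r A" and f: "ya (m \<cdot>\<^bsub>E\<^esub> p) = j \<cdot> q"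
  shows "cpres X (m \<cdot>\<^bsub>E\<^esub> p) Y r A"
proof -
  interpret E: exact_category E by (rule E_exact)
  note Hp = E.ses_Hom[OF p] and Hm = E.ses_Hom[OF m] and Hq = ses_Hom[OF q] and Hj = ses_Hom[OF j]
    and O = E.ses_Obj[OF p] E.ses_Obj[OF m] and O' = ses_Obj[OF q] ses_Obj[OF j]
  have mp: "m \<cdot>\<^bsub>E\<^esub> p \<in> Hom E X Y" using Hp Hm by (simp add: Hom_def)
  show ?thesis
    unfolding cpres_def
  proof (intro conjI allI impI)
    show "r \<cdot> ya (m \<cdot>\<^bsub>E\<^esub> p) = \<zero> (yo X) A"
      unfolding f using Hq Hj O' by (simp add: Hom_def cx[OF ses_comp[OF j]])
  next
    fix W y assume y: "y \<in> Hom E W Y" "r \<cdot> ya y = \<zero> (yo W) A"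
    have OW: "W \<in> Obj E" using E.Hom_Obj[OF y(1)] by simp
    obtain z where z: "z \<in> Hom C (yo W) J" "j \<cdot> z = ya y" using ses_lift[OF j y_Hom[OF y(1)] y(2)] by blast
    obtain x' where x': "x' \<in> Hom C (yo W) (yo X)" "q \<cdot> x' = z"
      using projective_lift[OF y_projective[OF OW] q z(1)] by blast
    obtain x where x: "x \<in> Hom E W X" "ya x = x'" using y_full[OF OW O(2) x'(1)] by blast
    have "(m \<cdot>\<^bsub>E\<^esub> p) \<cdot>\<^bsub>E\<^esub> x = y"
    proof (rule y_faithful)
      show "(m \<cdot>\<^bsub>E\<^esub> p) \<cdot>\<^bsub>E\<^esub> x \<in> Hom E W Y" using E.Comp_Hom[OF x(1) mp] .
      show "ya ((m \<cdot>\<^bsub>E\<^esub> p) \<cdot>\<^bsub>E\<^esub> x) = ya y"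
        unfolding y_Comp[OF x(1) mp] f x(2) using x' z(2) Hq Hj by (simp add: Hom_def)
    qed (rule y(1))
    then show "\<exists>x \<in> Hom E W X. (m \<cdot>\<^bsub>E\<^esub> p) \<cdot>\<^bsub>E\<^esub> x = y" using x(1) by blast
  next
    fix W z assume W: "W \<in> Obj E" and z: "z \<in> Hom C (yo W) A"
    obtain y' where y': "y' \<in> Hom C (yo W) (yo Y)" "r \<cdot> y' = z"
      using projective_lift[OF y_projective[OF W] j z] by blast
    then show "\<exists>y \<in> Hom E W Y. r \<cdot> ya y = z" using y_full[OF W O(5) y'(1)] by blast
  next
    fix B g assume g: "g \<in> Hom C (yo Y) B" "g \<cdot> ya (m \<cdot>\<^bsub>E\<^esub> p) = \<zero> (yo X) B"
    have "g \<cdot> j = \<zero> J B"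
      by (rule ses_epi0[OF q]) (use g Hq Hj in \<open>simp_all add: f Hom_def\<close>)
    then show "\<exists>h \<in> Hom C A B. h \<cdot> r = g" by (rule ses_colift[OF j g(1)])
  next
    fix B g h assume "g \<in> Hom C A B" "h \<in> Hom C A B" "g \<cdot> r = h \<cdot> r"
    then show "g = h" by (rule ses_epi[OF j])
  qed (use mp E.ses_admissible[OF p m] Hj in auto)
qed

lemma cpres_exists: "A \<in> Obj C \<Longrightarrow> \<exists>X f Y r. cpres X f Y r A"
  using y_cover ses_cpres by metis

lemma cpres_of_admissible:
  assumes "admissible_arr E f" "f \<in> Hom E X Y"
  shows "\<exists>r A. cpres X f Y r A"
proof -
  obtain K k I p m c D where p: "ses E K k X p I" and m: "ses E I m Y c D" and f: "f = m \<cdot>\<^bsub>E\<^esub> p"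
    using exact_category.admissible_ses[OF E_exact assms] by blast
  then show ?thesis using y_presents[OF p m] ses_cpres[OF p m] by blast
qed

lemma cpres_y:
  assumes "Z \<in> Obj E" "zero_object E Z" "Y \<in> Obj E"
  shows "cpres Z (ZeroArr E Z Y) Y (Ide C (yo Y)) (yo Y)"
proof -
  interpret E: exact_category E by (rule E_exact)
  have "admissible_arr E (ZeroArr E Z Y)"
    using E.ses_admissible[OF E.ses_zero_Ide[OF assms(2,1)] E.ses_zero_Ide[OF assms(2,3)]] assms by simp
  moreover have "\<exists>x \<in> Hom E W Z. ZeroArr E Z Y \<cdot>\<^bsub>E\<^esub> x = y"
    if y: "y \<in> Hom E W Y" "Ide C (yo Y) \<cdot> ya y = \<zero> (yo W) (yo Y)" for W y
  proof -
    have OW: "W \<in> Obj E" using E.Hom_Obj[OF y(1)] by simp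
    have "ya y = ya (ZeroArr E W Y)"
      using y(2) Ide_Comp[OF y_Hom[OF y(1)]] y_zero[OF OW assms(3)] by simp
    then have "y = ZeroArr E W Y" by (rule y_faithful[OF y(1) E.zero_Hom[OF OW assms(3)]])
    then show ?thesis using E.zero_Hom[OF OW assms(1)] OW assms by (intro bexI[of _ "ZeroArr E W Z"]) simp_all
  qed
  moreover have "\<exists>y \<in> Hom E W Y. Ide C (yo Y) \<cdot> ya y = z" if "W \<in> Obj E" "z \<in> Hom C (yo W) (yo Y)" for W z
    using y_full[OF that(1) assms(3) that(2)] Ide_Comp[OF that(2)] by auto
  moreover have "\<exists>h \<in> Hom C (yo Y) B. h \<cdot> Ide C (yo Y) = g" if "g \<in> Hom C (yo Y) B" for B g
    using that Comp_Ide[OF that] by blast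
  moreover have "g = h" if "g \<in> Hom C (yo Y) B" "h \<in> Hom C (yo Y) B" "g \<cdot> Ide C (yo Y) = h \<cdot> Ide C (yo Y)" for B g h
    using that Comp_Ide by metis
  ultimately show ?thesis
    unfolding cpres_def
    using E.zero_Hom[OF assms(1,3)] Ide_Hom[OF y_Obj[OF assms(3)]] y_zero[OF assms(1,3)]
      y_Obj[OF assms(1)] y_Obj[OF assms(3)] by simp
qed

text \<open>The hypotheses \<open>mono\<close>, \<open>exact\<close> and \<open>surj\<close> spell out exactness of the sequence of functors
  \<open>0 \<rightarrow> coker Hom(-, f1) \<rightarrow> coker Hom(-, f2) \<rightarrow> coker Hom(-, f3) \<rightarrow> 0\<close>.\<close>

lemma cpres_ses:
  assumes p1: "cpres X1 f1 Y1 r1 A1" and p2: "cpres X2 f2 Y2 r2 A2" and p3: "cpres X3 f3 Y3 r3 A3"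
    and a: "a \<in> Hom E Y1 Y2" and b: "b \<in> Hom E Y2 Y3"
    and wa: "u \<in> Hom E X1 X2" "a \<cdot>\<^bsub>E\<^esub> f1 = f2 \<cdot>\<^bsub>E\<^esub> u"
    and wb: "v \<in> Hom E X2 X3" "b \<cdot>\<^bsub>E\<^esub> f2 = f3 \<cdot>\<^bsub>E\<^esub> v"
    and ba: "s \<in> Hom E Y1 X3" "b \<cdot>\<^bsub>E\<^esub> a = f3 \<cdot>\<^bsub>E\<^esub> s"
    and mono: "\<And>W y x. \<lbrakk>y \<in> Hom E W Y1; x \<in> Hom E W X2; a \<cdot>\<^bsub>E\<^esub> y = f2 \<cdot>\<^bsub>E\<^esub> x\<rbrakk>
      \<Longrightarrow> \<exists>x' \<in> Hom E W X1. f1 \<cdot>\<^bsub>E\<^esub> x' = y"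
    and exact: "\<And>W y x. \<lbrakk>y \<in> Hom E W Y2; x \<in> Hom E W X3; b \<cdot>\<^bsub>E\<^esub> y = f3 \<cdot>\<^bsub>E\<^esub> x\<rbrakk>
      \<Longrightarrow> \<exists>y' \<in> Hom E W Y1. \<exists>x' \<in> Hom E W X2. y = Add E (a \<cdot>\<^bsub>E\<^esub> y') (f2 \<cdot>\<^bsub>E\<^esub> x')"
    and surj: "\<And>W z. z \<in> Hom E W Y3
      \<Longrightarrow> \<exists>y \<in> Hom E W Y2. \<exists>x \<in> Hom E W X3. z = Add E (b \<cdot>\<^bsub>E\<^esub> y) (f3 \<cdot>\<^bsub>E\<^esub> x)"
  shows "\<exists>\<alpha> \<beta>. ses C A1 \<alpha> A2 \<beta> A3 \<and> \<alpha> \<cdot> r1 = r2 \<cdot> ya a \<and> \<beta> \<cdot> r2 = r3 \<cdot> ya b"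
proof -
  interpret E: exact_category E by (rule E_exact)
  note H1 = cpres_Hom[OF p1] and H2 = cpres_Hom[OF p2] and H3 = cpres_Hom[OF p3]
  note O = E.Hom_Obj[OF H1(1)] E.Hom_Obj[OF H2(1)] E.Hom_Obj[OF H3(1)]
  note OA = Hom_Obj[OF H1(2)] Hom_Obj[OF H2(2)] Hom_Obj[OF H3(2)]
  note yO = y_Obj[OF conjunct1[OF O(1)]] y_Obj[OF conjunct1[OF O(2)]] y_Obj[OF conjunct1[OF O(3)]]
    y_Obj[OF conjunct2[OF O(1)]]
  have rf: "r \<cdot> ya (f \<cdot>\<^bsub>E\<^esub> x) = \<zero> (yo W) A" if "cpres X f Y r A" "x \<in> Hom E W X" for X f Y r A x W
  proof -
    note H = cpres_Hom[OF that(1)]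
    have "r \<cdot> ya (f \<cdot>\<^bsub>E\<^esub> x) = (r \<cdot> ya f) \<cdot> ya x"
      using y_Comp[OF that(2) H(1)] H(2) y_Hom[OF H(1)] y_Hom[OF that(2)] by (simp add: Hom_def)
    then show ?thesis
      unfolding cpres_zero[OF that(1)] using y_Hom[OF that(2)] Hom_Obj[OF H(2)] by (simp add: Hom_def)
  qed
  have "r2 \<cdot> ya a \<in> Hom C (yo Y1) A2" "(r2 \<cdot> ya a) \<cdot> ya f1 = \<zero> (yo X1) A2"
    using rf[OF p2 wa(1)] y_Comp[OF H1(1) a] wa(2) H2 y_Hom[OF a] y_Hom[OF H1(1)] by (simp_all add: Hom_def)
  then obtain \<alpha> where \<alpha>: "\<alpha> \<in> Hom C A1 A2" "\<alpha> \<cdot> r1 = r2 \<cdot> ya a" using cpres_colift[OF p1] by blast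
  have "r3 \<cdot> ya b \<in> Hom C (yo Y2) A3" "(r3 \<cdot> ya b) \<cdot> ya f2 = \<zero> (yo X2) A3"
    using rf[OF p3 wb(1)] y_Comp[OF H2(1) b] wb(2) H3 y_Hom[OF b] y_Hom[OF H2(1)] by (simp_all add: Hom_def)
  then obtain \<beta> where \<beta>: "\<beta> \<in> Hom C A2 A3" "\<beta> \<cdot> r2 = r3 \<cdot> ya b" using cpres_colift[OF p2] by blast
  have \<alpha>y: "\<alpha> \<cdot> (r1 \<cdot> ya y) = r2 \<cdot> ya (a \<cdot>\<^bsub>E\<^esub> y)" if "y \<in> Hom E W Y1" for y W
    using y_Comp[OF that a] \<alpha> H1 H2 y_Hom[OF that] y_Hom[OF a] by (simp add: Hom_def cx[OF \<alpha>(2)])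
  have \<beta>y: "\<beta> \<cdot> (r2 \<cdot> ya y) = r3 \<cdot> ya (b \<cdot>\<^bsub>E\<^esub> y)" if "y \<in> Hom E W Y2" for y W
    using y_Comp[OF that b] \<beta> H2 H3 y_Hom[OF that] y_Hom[OF b] by (simp add: Hom_def cx[OF \<beta>(2)])
  have radd: "r \<cdot> ya (Add E y (f \<cdot>\<^bsub>E\<^esub> x)) = r \<cdot> ya y"
    if p: "cpres X f Y r A" and y: "y \<in> Hom E W Y" and x: "x \<in> Hom E W X" for X f Y r A y x W
  proof -
    note H = cpres_Hom[OF p]
    have fx: "f \<cdot>\<^bsub>E\<^esub> x \<in> Hom E W Y" using E.Comp_Hom[OF x H(1)] .
    show ?thesis
      using y_add[OF y fx] rf[OF p x] y_Hom[OF y] y_Hom[OF fx] H(2) by (simp add: Hom_def)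
  qed
  have "ses C A1 \<alpha> A2 \<beta> A3"
  proof (rule G_ses[OF \<alpha>(1) \<beta>(1)])
    have "(\<beta> \<cdot> \<alpha>) \<cdot> r1 = \<beta> \<cdot> (r2 \<cdot> ya a)" using \<alpha> \<beta>(1) H1(2) by (simp add: Hom_def)
    also have "\<dots> = \<zero> (yo Y1) A3" using \<beta>y[OF a] rf[OF p3 ba(1)] ba(2) by simp
    also have "\<dots> = \<zero> A1 A3 \<cdot> r1" using OA H1(2) by (simp add: Hom_def)
    finally have e: "(\<beta> \<cdot> \<alpha>) \<cdot> r1 = \<zero> A1 A3 \<cdot> r1" .
    show "\<beta> \<cdot> \<alpha> = \<zero> A1 A3"
      by (rule cpres_epi[OF p1 _ _ e]) (use \<alpha> \<beta> OA in \<open>simp_all add: Hom_def\<close>)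
  next
    fix P x assume "P \<in> yo ` Obj E" and x: "x \<in> Hom C P A1" "\<alpha> \<cdot> x = \<zero> P A2"
    then obtain W where W: "W \<in> Obj E" "P = yo W" by blast
    obtain y where y: "y \<in> Hom E W Y1" "r1 \<cdot> ya y = x" using cpres_surj[OF p1 W(1)] x W by blast
    have ay: "a \<cdot>\<^bsub>E\<^esub> y \<in> Hom E W Y2" using E.Comp_Hom[OF y(1) a] .
    have "r2 \<cdot> ya (a \<cdot>\<^bsub>E\<^esub> y) = \<zero> (yo W) A2" using \<alpha>y[OF y(1)] y(2) x(2) W(2) by simp
    then obtain x2 where x2: "x2 \<in> Hom E W X2" "f2 \<cdot>\<^bsub>E\<^esub> x2 = a \<cdot>\<^bsub>E\<^esub> y" using cpres_kernel[OF p2 ay] by blast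
    obtain x1 where "x1 \<in> Hom E W X1" "f1 \<cdot>\<^bsub>E\<^esub> x1 = y" using mono[OF y(1) x2(1)] x2(2) by auto
    then show "x = \<zero> P A1" using rf[OF p1] y(2) W(2) by auto
  next
    fix P z assume "P \<in> yo ` Obj E" and z: "z \<in> Hom C P A2" "\<beta> \<cdot> z = \<zero> P A3"
    then obtain W where W: "W \<in> Obj E" "P = yo W" by blast
    obtain y where y: "y \<in> Hom E W Y2" "r2 \<cdot> ya y = z" using cpres_surj[OF p2 W(1)] z W by blast
    have by': "b \<cdot>\<^bsub>E\<^esub> y \<in> Hom E W Y3" using E.Comp_Hom[OF y(1) b] .
    have "r3 \<cdot> ya (b \<cdot>\<^bsub>E\<^esub> y) = \<zero> (yo W) A3" using \<beta>y[OF y(1)] y(2) z(2) W(2) by simp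
    then obtain x3 where x3: "x3 \<in> Hom E W X3" "f3 \<cdot>\<^bsub>E\<^esub> x3 = b \<cdot>\<^bsub>E\<^esub> y" using cpres_kernel[OF p3 by'] by blast
    obtain y1 x2 where y1: "y1 \<in> Hom E W Y1" "x2 \<in> Hom E W X2" "y = Add E (a \<cdot>\<^bsub>E\<^esub> y1) (f2 \<cdot>\<^bsub>E\<^esub> x2)"
      using exact[OF y(1) x3(1)] x3(2) by auto
    have "\<alpha> \<cdot> (r1 \<cdot> ya y1) = z"
      using \<alpha>y[OF y1(1)] radd[OF p2 E.Comp_Hom[OF y1(1) a] y1(2)] y(2) y1(3) by simp
    moreover have "r1 \<cdot> ya y1 \<in> Hom C P A1" using H1 y_Hom[OF y1(1)] W(2) by (simp add: Hom_def)
    ultimately show "\<exists>x \<in> Hom C P A1. \<alpha> \<cdot> x = z" by blast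
  next
    fix P z assume "P \<in> yo ` Obj E" and z: "z \<in> Hom C P A3"
    then obtain W where W: "W \<in> Obj E" "P = yo W" by blast
    obtain y where y: "y \<in> Hom E W Y3" "r3 \<cdot> ya y = z" using cpres_surj[OF p3 W(1)] z W by blast
    obtain y2 x3 where y2: "y2 \<in> Hom E W Y2" "x3 \<in> Hom E W X3" "y = Add E (b \<cdot>\<^bsub>E\<^esub> y2) (f3 \<cdot>\<^bsub>E\<^esub> x3)"
      using surj[OF y(1)] by blast
    have "\<beta> \<cdot> (r2 \<cdot> ya y2) = z"
      using \<beta>y[OF y2(1)] radd[OF p3 E.Comp_Hom[OF y2(1) b] y2(2)] y(2) y2(3) by simp
    moreover have "r2 \<cdot> ya y2 \<in> Hom C P A2" using H2 y_Hom[OF y2(1)] W(2) by (simp add: Hom_def)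
    ultimately show "\<exists>y \<in> Hom C P A2. \<beta> \<cdot> y = z" by blast
  qed
  then show ?thesis using \<alpha>(2) \<beta>(2) by blast
qed

end

section \<open>Dimensions, torsion objects and approximations for admissibly presented
  functors\<close>

context auslander_data
begin

lemma data_gl_dim: "gl_dim C \<le> 2"
proof (rule gl_dim_le_2I)
  fix A assume "A \<in> Obj C"
  then obtain K k X p I m Y c D J q j r where p: "ses E K k X p I" and m: "ses E I m Y c D"
    and "ses C (yo K) (ya k) (yo X) q J" "ses C J j (yo Y) r A"
    using y_cover by metis
  moreover have "projective C (yo K)" "projective C (yo X)" "projective C (yo Y)"
    using y_projective exact_category.ses_Obj[OF E_exact p] exact_category.ses_Obj[OF E_exact m] by blast+
  ultimately show "\<exists>P2 d P1 p K l P0 r. ses C P2 d P1 p K \<and> ses C K l P0 r A \<and>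
      projective C P2 \<and> projective C P1 \<and> projective C P0" by blast
qed

text \<open>If the cokernel \<open>P\<close> of \<open>ya f\<close> is projective, then \<open>f\<close> has a pseudo-inverse \<open>g\<close>, so the
  inflation part of \<open>f\<close> splits and \<open>P\<close> is represented by the cokernel of \<open>f\<close>.\<close>

lemma projective_representable:
  assumes P: "projective C P"
  shows "\<exists>D \<in> Obj E. \<exists>\<theta> \<in> Hom C P (yo D). is_iso C \<theta>"
proof -
  interpret E: exact_category E by (rule E_exact)
  have OP: "P \<in> Obj C" using P by (simp add: projective_def)
  obtain K k X p I m Y c D J q j r where p: "ses E K k X p I" and m: "ses E I m Y c D"
    and q: "ses C (yo K) (ya k) (yo X) q J" and j: "ses C J j (yo Y) r P" and yf: "ya (m \<cdot>\<^bsub>E\<^esub> p) = j \<cdot> q"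
    using y_cover[OF OP] by metis
  define f where "f = m \<cdot>\<^bsub>E\<^esub> p"
  have pres: "cpres X f Y r P" using ses_cpres[OF p m q j yf] by (simp add: f_def)
  note Hp = E.ses_Hom[OF p] and Hm = E.ses_Hom[OF m] and O = E.ses_Obj[OF p] E.ses_Obj[OF m]
    and H = cpres_Hom[OF pres]
  obtain \<sigma> where \<sigma>: "\<sigma> \<in> Hom C P (yo Y)" "r \<cdot> \<sigma> = Ide C P" using projective_lift[OF P j Ide_Hom[OF OP]] by blast
  \<comment> \<open>\<open>e = 1 - \<sigma> r\<close> is killed by \<open>r\<close>, so
    \<open>e = f g\<close>. Moreover \<open>e f = f\<close>, and cancelling \<open>m\<close> on the
    left and \<open>p\<close> on the right gives the retraction \<open>p g\<close> of
    \<open>m\<close>.\<close>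
  have "Ide C (yo Y) \<ominus> \<sigma> \<cdot> r \<in> Hom C (yo Y) (yo Y)" using \<sigma>(1) H(2) y_Obj[OF O(5)] by (simp add: Hom_def)
  then obtain e where e: "e \<in> Hom E Y Y" "ya e = Ide C (yo Y) \<ominus> \<sigma> \<cdot> r" using y_full[OF O(5) O(5)] by blast
  have "r \<cdot> ya e = \<zero> (yo Y) P"
    using \<sigma> H(2) y_Obj[OF O(5)] OP by (simp add: e(2) Hom_def cx[OF \<sigma>(2)])
  then obtain g where g: "g \<in> Hom E Y X" "f \<cdot>\<^bsub>E\<^esub> g = e" using cpres_kernel[OF pres e(1)] by blast
  have "ya (e \<cdot>\<^bsub>E\<^esub> f) = ya f"
    using y_Comp[OF H(1) e(1)] \<sigma>(1) H(2) y_Hom[OF H(1)] y_Obj[OF O(5)] y_Obj[OF O(2)] OP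
    by (simp add: e(2) Hom_def cpres_zero[OF pres])
  then have ef: "e \<cdot>\<^bsub>E\<^esub> f = f"
    by (intro y_faithful[OF E.Comp_Hom[OF H(1) e(1)] H(1)])
  have pg: "p \<cdot>\<^bsub>E\<^esub> g \<in> Hom E Y I" using g(1) Hp by (simp add: Hom_def)
  have mpg: "m \<cdot>\<^bsub>E\<^esub> (p \<cdot>\<^bsub>E\<^esub> g) = e" using g Hp Hm by (simp add: f_def Hom_def)
  have e1: "(m \<cdot>\<^bsub>E\<^esub> ((p \<cdot>\<^bsub>E\<^esub> g) \<cdot>\<^bsub>E\<^esub> m)) \<cdot>\<^bsub>E\<^esub> p = m \<cdot>\<^bsub>E\<^esub> p"
    using ef g(1) Hp Hm e(1) unfolding f_def mpg[symmetric] by (simp add: Hom_def)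
  have e2: "m \<cdot>\<^bsub>E\<^esub> ((p \<cdot>\<^bsub>E\<^esub> g) \<cdot>\<^bsub>E\<^esub> m) = m \<cdot>\<^bsub>E\<^esub> Ide E I"
    by (rule E.ses_epi[OF p, of _ Y]) (use e1 pg Hp Hm O in \<open>simp_all add: Hom_def\<close>)
  have ret: "(p \<cdot>\<^bsub>E\<^esub> g) \<cdot>\<^bsub>E\<^esub> m = Ide E I"
    by (rule E.ses_mono[OF m _ _ e2]) (use pg Hm O in \<open>simp_all add: Hom_def\<close>)
  obtain d where d: "d \<in> Hom E D Y" "c \<cdot>\<^bsub>E\<^esub> d = Ide E D" "Add E (m \<cdot>\<^bsub>E\<^esub> (p \<cdot>\<^bsub>E\<^esub> g)) (d \<cdot>\<^bsub>E\<^esub> c) = Ide E Y"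
    using E.ses_retraction_section[OF m pg ret] by blast
  have "c \<cdot>\<^bsub>E\<^esub> f = ZeroArr E X D" using Hp Hm O by (simp add: f_def Hom_def E.cx[OF E.ses_comp[OF m]])
  then have "ya c \<cdot> ya f = \<zero> (yo X) (yo D)" using y_Comp[OF H(1) Hm(2)] y_zero[OF O(2) O(6)] by simp
  then obtain \<theta> where \<theta>: "\<theta> \<in> Hom C P (yo D)" "\<theta> \<cdot> r = ya c" using cpres_colift[OF pres y_Hom[OF Hm(2)]] by blast
  have yd: "ya d \<in> Hom C (yo D) (yo Y)" "ya c \<cdot> ya d = Ide C (yo D)"
    using y_Hom[OF d(1)] y_Comp[OF d(1) Hm(2)] d(2) y_Ide[OF O(6)] by simp_all
  have rd: "r \<cdot> ya d \<in> Hom C (yo D) P" using yd H(2) by (simp add: Hom_def)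
  have "\<theta> \<cdot> (r \<cdot> ya d) = Ide C (yo D)" using \<theta> yd H(2) by (simp add: Hom_def cx[OF \<theta>(2)])
  moreover have "(r \<cdot> ya d) \<cdot> \<theta> = Ide C P"
  proof (rule cpres_epi[OF pres])
    have dc: "d \<cdot>\<^bsub>E\<^esub> c \<in> Hom E Y Y" using d(1) Hm by (simp add: Hom_def)
    have "ya (Ide E Y) = ya e \<oplus> ya (d \<cdot>\<^bsub>E\<^esub> c)" using y_add[OF e(1) dc] d(3) by (simp add: mpg)
    then have "r \<cdot> Ide C (yo Y) = r \<cdot> ya e \<oplus> r \<cdot> ya (d \<cdot>\<^bsub>E\<^esub> c)"
      using y_Ide[OF O(5)] y_Hom[OF e(1)] y_Hom[OF dc] H(2) by (simp add: Hom_def)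
    then have "r = r \<cdot> ya (d \<cdot>\<^bsub>E\<^esub> c)"
      using \<open>r \<cdot> ya e = \<zero> (yo Y) P\<close> H(2) y_Hom[OF dc] by (simp add: Hom_def)
    also have "\<dots> = ((r \<cdot> ya d) \<cdot> \<theta>) \<cdot> r"
      using y_Comp[OF Hm(2) d(1)] \<theta> yd(1) H(2) by (simp add: Hom_def)
    finally show "((r \<cdot> ya d) \<cdot> \<theta>) \<cdot> r = Ide C P \<cdot> r" using H(2) by (simp add: Hom_def)
  qed (use \<theta>(1) rd OP in \<open>simp_all add: Hom_def\<close>)
  ultimately have "is_iso C \<theta>" by (intro is_isoI[OF \<theta>(1) rd])
  then show ?thesis using \<theta>(1) O(6) by blast
qed

text \<open>An extension of \<open>H\<close> by \<open>yo I\<close> is described on a resolution of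
  \<open>H\<close> by an arrow \<open>u\<close> from \<open>X\<close> to \<open>I\<close> that
  vanishes on \<open>K\<close>. It therefore factors through the image \<open>W\<close> of the
  presenting morphism and extends along the inflation \<open>m\<close> to \<open>Y\<close>;
  subtracting the extension from \<open>s\<close> yields a section.\<close>

lemma y_injective:
  assumes I: "injective E I"
  shows "injective C (yo I)"
proof (rule injective_if_retracts)
  interpret E: exact_category E by (rule E_exact)
  have OI: "I \<in> Obj E" using I by (simp add: injective_def)
  show yI: "yo I \<in> Obj C" by (rule y_Obj[OF OI])
  fix a B b H assume a: "ses C (yo I) a B b H"
  note Ha = ses_Hom[OF a] and OH = ses_Obj[OF a]
  obtain X f Y r where pres: "cpres X f Y r H" using cpres_exists[OF OH(3)] by blast
  note Hf = cpres_Hom[OF pres]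
  obtain K k W p m c D where p: "ses E K k X p W" and m: "ses E W m Y c D" and f: "f = m \<cdot>\<^bsub>E\<^esub> p"
    using E.admissible_ses[OF cpres_admissible[OF pres] Hf(1)] by blast
  note Hp = E.ses_Hom[OF p] and Hm = E.ses_Hom[OF m] and O = E.ses_Obj[OF p] E.ses_Obj[OF m]
  obtain s where s: "s \<in> Hom C (yo Y) B" "b \<cdot> s = r" using projective_lift[OF y_projective[OF O(5)] a Hf(2)] by blast
  have "s \<cdot> ya f \<in> Hom C (yo X) B" "b \<cdot> (s \<cdot> ya f) = \<zero> (yo X) H"
    using s y_Hom[OF Hf(1)] Ha cpres_zero[OF pres] by (simp_all add: Hom_def cx[OF s(2)])
  then obtain u' where u': "u' \<in> Hom C (yo X) (yo I)" "a \<cdot> u' = s \<cdot> ya f" using ses_lift[OF a] by blast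
  obtain u where u: "u \<in> Hom E X I" "ya u = u'" using y_full[OF O(2) OI u'(1)] by blast
  have uk: "u \<cdot>\<^bsub>E\<^esub> k \<in> Hom E K I" using u(1) Hp by (simp add: Hom_def)
  have "f \<cdot>\<^bsub>E\<^esub> k = ZeroArr E K Y" using Hp Hm O by (simp add: f Hom_def E.ses_comp[OF p])
  then have fk: "ya f \<cdot> ya k = \<zero> (yo K) (yo Y)" using y_Comp[OF Hp(1) Hf(1)] y_zero[OF O(1) O(5)] by simp
  have "a \<cdot> (u' \<cdot> ya k) = \<zero> (yo K) B"
    using u' s(1) y_Hom[OF Hp(1)] y_Hom[OF Hf(1)] Ha fk y_Obj[OF O(1)]
    by (simp add: Hom_def cx[OF u'(2)])
  then have "ya (u \<cdot>\<^bsub>E\<^esub> k) = \<zero> (yo K) (yo I)"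
    using ses_mono0[OF a y_Hom[OF uk]] y_Comp[OF Hp(1) u(1)] u(2) by simp
  then have "u \<cdot>\<^bsub>E\<^esub> k = ZeroArr E K I"
    using y_faithful[OF uk E.zero_Hom[OF O(1) OI]] y_zero[OF O(1) OI] by simp
  then obtain v where v: "v \<in> Hom E W I" "v \<cdot>\<^bsub>E\<^esub> p = u" using E.ses_colift[OF p u(1)] by blast
  obtain w where w: "w \<in> Hom E Y I" "w \<cdot>\<^bsub>E\<^esub> m = v" using E.injective_extend[OF I m v(1)] by blast
  have wf: "w \<cdot>\<^bsub>E\<^esub> f = u" using w v Hp Hm E.cx[OF w(2), of p] by (simp add: f Hom_def)
  have "ya w \<cdot> ya f = u'" using y_Comp[OF Hf(1) w(1)] wf u(2) by simp
  then have "s \<ominus> a \<cdot> ya w \<in> Hom C (yo Y) B" "(s \<ominus> a \<cdot> ya w) \<cdot> ya f = \<zero> (yo X) B"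
    using s(1) Ha y_Hom[OF w(1)] y_Hom[OF Hf(1)] u' by (simp_all add: Hom_def)
  then obtain \<sigma> where \<sigma>: "\<sigma> \<in> Hom C H B" "\<sigma> \<cdot> r = s \<ominus> a \<cdot> ya w" using cpres_colift[OF pres] by blast
  have e: "(b \<cdot> \<sigma>) \<cdot> r = Ide C H \<cdot> r"
    using \<sigma> Ha s y_Hom[OF w(1)] Hf(2) OH y_Obj[OF O(5)] by (simp add: Hom_def cx[OF ses_comp[OF a]])
  have "b \<cdot> \<sigma> = Ide C H"
    by (rule cpres_epi[OF pres _ _ e]) (use \<sigma> Ha OH in \<open>simp_all add: Hom_def\<close>)
  then show "\<exists>\<rho> \<in> Hom C B (yo I). \<rho> \<cdot> a = Ide C (yo I)" using ses_section_retraction[OF a \<sigma>(1)] by blast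
qed

text \<open>Two steps of an injective coresolution of \<open>D\<close> in \<open>E\<close> form an
  admissible morphism \<open>I1 --> I2\<close> with kernel \<open>D\<close>. The presentation
  belonging to it is a copresentation of \<open>yo D\<close> by projective-injectives.\<close>

lemma data_dom_dim:
  assumes "enough_injectives E"
  shows "dom_dim C \<ge> 2"
proof (rule dom_dim_ge_2I)
  interpret E: exact_category E by (rule E_exact)
  have emb: "\<exists>i I q D. ses E X i I q D \<and> injective E I" if X: "X \<in> Obj E" for X
  proof -
    obtain i where i: "inflation E i" "Dom E i = X" "injective E (Cod E i)"
      using assms X unfolding enough_injectives_def by blast
    have "i \<in> Hom E X (Cod E i)" using E.inflation_Arr[OF i(1)] i(2) by (simp add: Hom_def)
    then show ?thesis using E.inflation_ses[OF i(1)] i(3) by blast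
  qed
  fix P assume "projective C P"
  then obtain D \<theta> where D: "D \<in> Obj E" and \<theta>: "\<theta> \<in> Hom C P (yo D)" "is_iso C \<theta>"
    using projective_representable by blast
  obtain i1 I1 q1 Z1 where 1: "ses E D i1 I1 q1 Z1" "injective E I1" using emb[OF D] by blast
  obtain i2 I2 q2 Z2 where 2: "ses E Z1 i2 I2 q2 Z2" "injective E I2" using emb[OF E.ses_Obj(3)[OF 1(1)]] by blast
  obtain J q j r A where q: "ses C (yo D) (ya i1) (yo I1) q J" and j: "ses C J j (yo I2) r A"
    using y_presents[OF 1(1) 2(1)] by blast
  have "ses C P (ya i1 \<cdot> \<theta>) (yo I1) q J" by (rule ses_iso_precomp[OF q \<theta>(2,1)])
  then show "\<exists>a I1 q Q b I2 c E. ses C P a I1 q Q \<and> ses C Q b I2 c E \<and>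
    projective C I1 \<and> injective C I1 \<and> projective C I2 \<and> injective C I2"
    using j y_projective[OF E.ses_Obj(2)[OF 1(1)]] y_projective[OF E.ses_Obj(2)[OF 2(1)]]
      y_injective[OF 1(2)] y_injective[OF 2(2)] by blast
qed

text \<open>The cokernel \<open>c\<close> of the presenting morphism induces a morphism from
  \<open>T\<close> to the projective \<open>yo D\<close>, which vanishes. So \<open>c = 0\<close>,
  the inflation part is an isomorphism and \<open>f\<close> is a deflation.\<close>

lemma perp_presentation:
  assumes "T \<in> left_perp C (Proj C)"
  shows "\<exists>K k X f Y r. ses E K k X f Y \<and> cpres X f Y r T"
proof -
  interpret E: exact_category E by (rule E_exact)
  have OT: "T \<in> Obj C" using assms by (simp add: left_perp_def)
  obtain X f Y r where pres: "cpres X f Y r T" using cpres_exists[OF OT] by blast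
  note Hf = cpres_Hom[OF pres]
  obtain K k I p m c D where p: "ses E K k X p I" and m: "ses E I m Y c D" and f: "f = m \<cdot>\<^bsub>E\<^esub> p"
    using E.admissible_ses[OF cpres_admissible[OF pres] Hf(1)] by blast
  note Hp = E.ses_Hom[OF p] and Hm = E.ses_Hom[OF m] and O = E.ses_Obj[OF p] E.ses_Obj[OF m]
  have "c \<cdot>\<^bsub>E\<^esub> f = ZeroArr E X D" using Hp Hm O by (simp add: f Hom_def E.cx[OF E.ses_comp[OF m]])
  then have "ya c \<cdot> ya f = \<zero> (yo X) (yo D)" using y_Comp[OF Hf(1) Hm(2)] y_zero[OF O(2) O(6)] by simp
  then obtain h where h: "h \<in> Hom C T (yo D)" "h \<cdot> r = ya c" using cpres_colift[OF pres y_Hom[OF Hm(2)]] by blast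
  have "h = \<zero> T (yo D)" using assms h(1) y_projective[OF O(6)] by (auto simp: left_perp_def Proj_def)
  then have "ya c = ya (ZeroArr E Y D)"
    using h(2) Hf(2) y_Obj[OF O(6)] y_zero[OF O(5) O(6)] by (simp add: Hom_def)
  then have "c = ZeroArr E Y D" by (rule y_faithful[OF Hm(2) E.zero_Hom[OF O(5) O(6)]])
  then have iso: "is_iso E m" using E.ses_zero_right[OF m] by simp
  have "ses E K k X f Y"
    by (rule E.ses_iso[OF p Hp(1) Hf(1) E.is_iso_Ide[OF O(1)] E.is_iso_Ide[OF O(2)] iso])
      (use O Hp Hm Hf in \<open>simp_all add: Hom_def f\<close>)
  then show ?thesis using pres by blast
qed

text \<open>The kernel, image and cokernel of a morphism \<open>A \<rightarrow> T\<close> to a torsion object are cokernels of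
  \<open>ya v\<close>, \<open>ya f'\<close> and \<open>ya e\<close>, where \<open>f'\<close> is a pullback of the deflation presenting \<open>T\<close>.\<close>

lemma data_admissible_to_perp:
  assumes \<phi>: "\<phi> \<in> Hom C A T" and T: "T \<in> left_perp C (Proj C)"
  shows "admissible_arr C \<phi>"
proof -
  interpret E: exact_category E by (rule E_exact)
  obtain K k X f Y rT where f: "ses E K k X f Y" and presT: "cpres X f Y rT T"
    using perp_presentation[OF T] by blast
  obtain XA fA B rA where presA: "cpres XA fA B rA A" using cpres_exists Hom_Obj[OF \<phi>] by blast
  note HT = cpres_Hom[OF presT] and HA = cpres_Hom[OF presA]
  obtain KA kA WA pA mA cA CA where pA: "ses E KA kA XA pA WA" and mA: "ses E WA mA B cA CA"
    and fA: "fA = mA \<cdot>\<^bsub>E\<^esub> pA"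
    using E.admissible_ses[OF cpres_admissible[OF presA] HA(1)] by blast
  note Hk = E.ses_Hom[OF f] and HpA = E.ses_Hom[OF pA] and HmA = E.ses_Hom[OF mA]
    and O = E.ses_Obj[OF f] E.ses_Obj[OF pA] E.ses_Obj[OF mA]
  have "\<phi> \<cdot> rA \<in> Hom C (yo B) T" using \<phi> HA(2) by (simp add: Hom_def)
  then obtain t where t: "t \<in> Hom E B Y" "rT \<cdot> ya t = \<phi> \<cdot> rA" using cpres_surj[OF presT O(8)] by blast
  have tfA: "t \<cdot>\<^bsub>E\<^esub> fA \<in> Hom E XA Y" using t HA by (simp add: Hom_def)
  have "rT \<cdot> ya (t \<cdot>\<^bsub>E\<^esub> fA) = \<phi> \<cdot> (rA \<cdot> ya fA)"
    using y_Comp[OF HA(1) t(1)] y_Hom[OF HA(1)] y_Hom[OF t(1)] HT(2) HA(2) \<phi>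
    by (simp add: Hom_def cx[OF t(2)])
  also have "\<dots> = \<zero> (yo XA) T" unfolding cpres_zero[OF presA] using \<phi> y_Obj[OF O(5)] by (simp add: Hom_def)
  finally obtain s0 where s0: "s0 \<in> Hom E XA X" "f \<cdot>\<^bsub>E\<^esub> s0 = t \<cdot>\<^bsub>E\<^esub> fA"
    using cpres_kernel[OF presT tfA] by blast
  obtain X' k' f' t' where f': "ses E K k' X' f' B" and t': "t' \<in> Hom E X' X" "f \<cdot>\<^bsub>E\<^esub> t' = t \<cdot>\<^bsub>E\<^esub> f'"
    and pb: "is_pullback E f t f' t'"
    using E.ses_pullback[OF f t(1)] by blast
  note Hf' = E.ses_Hom[OF f'] and OX' = E.ses_Obj(2)[OF f']
  have "Dom E f' = X'" using Hf' by (simp add: Hom_def)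
  note pb_lift = E.is_pullback_lift[OF pb Hk(2) t(1), unfolded this]
    and pb_eq = E.is_pullback_eq[OF pb Hk(2) t(1), unfolded this]
  obtain s where s: "s \<in> Hom E XA X'" "t' \<cdot>\<^bsub>E\<^esub> s = s0" "f' \<cdot>\<^bsub>E\<^esub> s = fA"
    by (rule pb_lift[OF s0(1) HA(1) s0(2)])
  \<comment> \<open>\<open>V\<close> is the preimage under \<open>f'\<close> of the image
    \<open>WA\<close> of \<open>fA\<close>, and \<open>Q\<close> pairs elements of \<open>V\<close>
    with preimages in \<open>XA\<close>. So \<open>v\<close> is admissible, and its values are the
    elements that \<open>f'\<close> maps to values of \<open>fA\<close>: it presents the kernel of
    \<phi>.\<close>
  have "deflation E (cA \<cdot>\<^bsub>E\<^esub> f')" "cA \<cdot>\<^bsub>E\<^esub> f' \<in> Hom E X' CA"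
    using E.Comp_deflation[OF E.ses_deflation[OF f'] E.ses_deflation[OF mA]] Hf' HmA
    by (simp_all add: Hom_def)
  then obtain V i where i: "ses E V i X' (cA \<cdot>\<^bsub>E\<^esub> f') CA" using E.deflation_ses by blast
  note Hi = E.ses_Hom[OF i] and OV = E.ses_Obj(1)[OF i]
  have "f' \<cdot>\<^bsub>E\<^esub> i \<in> Hom E V B" "cA \<cdot>\<^bsub>E\<^esub> (f' \<cdot>\<^bsub>E\<^esub> i) = ZeroArr E V CA"
    using E.ses_comp[OF i] Hf' Hi HmA by (simp_all add: Hom_def)
  then obtain w where w: "w \<in> Hom E V WA" "mA \<cdot>\<^bsub>E\<^esub> w = f' \<cdot>\<^bsub>E\<^esub> i" using E.ses_lift[OF mA] by blast
  obtain Q a \<pi>2 \<pi>1 where Q: "ses E KA a Q \<pi>2 V" and \<pi>1: "\<pi>1 \<in> Hom E Q XA" "pA \<cdot>\<^bsub>E\<^esub> \<pi>1 = w \<cdot>\<^bsub>E\<^esub> \<pi>2"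
    and pbQ: "is_pullback E pA w \<pi>2 \<pi>1"
    using E.ses_pullback[OF pA w(1)] by blast
  note HQ = E.ses_Hom[OF Q]
  have "Dom E \<pi>2 = Q" using HQ by (simp add: Hom_def)
  note pbQ_lift = E.is_pullback_lift[OF pbQ HpA(2) w(1), unfolded this]
  define v where "v = i \<cdot>\<^bsub>E\<^esub> \<pi>2"
  have v: "v \<in> Hom E Q X'" "admissible_arr E v"
    using E.ses_admissible[OF Q i] HQ Hi by (simp_all add: v_def Hom_def)
  have f'v: "f' \<cdot>\<^bsub>E\<^esub> v = fA \<cdot>\<^bsub>E\<^esub> \<pi>1"
  proof -
    have "f' \<cdot>\<^bsub>E\<^esub> v = (mA \<cdot>\<^bsub>E\<^esub> w) \<cdot>\<^bsub>E\<^esub> \<pi>2" unfolding w(2) v_def using Hf' Hi HQ by (simp add: Hom_def)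
    also have "\<dots> = mA \<cdot>\<^bsub>E\<^esub> (pA \<cdot>\<^bsub>E\<^esub> \<pi>1)" unfolding \<pi>1(2) using HmA w(1) HQ by (simp add: Hom_def)
    also have "\<dots> = fA \<cdot>\<^bsub>E\<^esub> \<pi>1" unfolding fA using HmA HpA \<pi>1(1) by (simp add: Hom_def)
    finally show ?thesis .
  qed
  have im_v: "\<exists>x' \<in> Hom E W Q. v \<cdot>\<^bsub>E\<^esub> x' = y"
    if y: "y \<in> Hom E W X'" and x: "x \<in> Hom E W XA" and yx: "f' \<cdot>\<^bsub>E\<^esub> y = fA \<cdot>\<^bsub>E\<^esub> x" for W y x
  proof -
    have OW: "W \<in> Obj E" using E.Hom_Obj[OF y] by simp
    have "(cA \<cdot>\<^bsub>E\<^esub> f') \<cdot>\<^bsub>E\<^esub> y = cA \<cdot>\<^bsub>E\<^esub> (f' \<cdot>\<^bsub>E\<^esub> y)" using y Hf' HmA by (simp add: Hom_def)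
    also have "\<dots> = ZeroArr E W CA"
      unfolding yx fA using x HmA HpA O by (simp add: Hom_def E.cx[OF E.ses_comp[OF mA]])
    finally obtain y0 where y0: "y0 \<in> Hom E W V" "i \<cdot>\<^bsub>E\<^esub> y0 = y" using E.ses_lift[OF i y] by blast
    have "mA \<cdot>\<^bsub>E\<^esub> (w \<cdot>\<^bsub>E\<^esub> y0) = f' \<cdot>\<^bsub>E\<^esub> y"
      using y0 w(1) HmA Hf' Hi by (simp add: Hom_def E.cx[OF w(2)])
    also have "\<dots> = mA \<cdot>\<^bsub>E\<^esub> (pA \<cdot>\<^bsub>E\<^esub> x)" unfolding yx fA using HmA HpA x by (simp add: Hom_def)
    finally have e: "mA \<cdot>\<^bsub>E\<^esub> (pA \<cdot>\<^bsub>E\<^esub> x) = mA \<cdot>\<^bsub>E\<^esub> (w \<cdot>\<^bsub>E\<^esub> y0)" by simp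
    have e: "pA \<cdot>\<^bsub>E\<^esub> x = w \<cdot>\<^bsub>E\<^esub> y0"
      by (rule E.ses_mono[OF mA _ _ e]) (use x HpA w(1) y0(1) in \<open>simp_all add: Hom_def\<close>)
    obtain z where z: "z \<in> Hom E W Q" "\<pi>1 \<cdot>\<^bsub>E\<^esub> z = x" "\<pi>2 \<cdot>\<^bsub>E\<^esub> z = y0" by (rule pbQ_lift[OF x y0(1) e])
    then have "v \<cdot>\<^bsub>E\<^esub> z = y" using y0(2) Hi HQ by (simp add: v_def Hom_def)
    then show ?thesis using z(1) by blast
  qed
  obtain r' A' where presA': "cpres Q v X' r' A'" using cpres_of_admissible[OF v(2,1)] by blast
  obtain Z where Z: "zero_object E Z" "Z \<in> Obj E" by (rule E.zero_object_exists)
  have "admissible_arr E f'" using E.ses_admissible[OF f' E.ses_Ide_zero[OF Z(1) O(8)]] Hf' by (simp add: Hom_def)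
  then obtain r2 A2 where pres2: "cpres X' f' B r2 A2" using cpres_of_admissible Hf'(2) by blast
  \<comment> \<open>The cokernel of \<phi> is presented by \<open>e = (f, -t)\<close>. Its kernel is
    the pullback \<open>X'\<close>, and it is a deflation by the obscure axiom, since
    \<open>e \<cdot> i1 = f\<close> is one.\<close>
  obtain S i1 i2 p1 p2 where S: "is_biproduct E X B S i1 i2 p1 p2"
    "i1 \<in> Hom E X S" "i2 \<in> Hom E B S" "p1 \<in> Hom E S X" "p2 \<in> Hom E S B"
    "p1 \<cdot>\<^bsub>E\<^esub> i1 = Ide E X" "p2 \<cdot>\<^bsub>E\<^esub> i2 = Ide E B" "p1 \<cdot>\<^bsub>E\<^esub> i2 = ZeroArr E B X"
    "p2 \<cdot>\<^bsub>E\<^esub> i1 = ZeroArr E X B" "Add E (i1 \<cdot>\<^bsub>E\<^esub> p1) (i2 \<cdot>\<^bsub>E\<^esub> p2) = Ide E S"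
    using E.biproductE[OF O(2) O(8)] by blast
  note cxS = E.cx[OF S(6)] E.cx[OF S(7)] E.cx[OF S(8)] E.cx[OF S(9)]
  have OS: "S \<in> Obj E" using E.Hom_Obj[OF S(2)] by simp
  define d where "d = Add E (i1 \<cdot>\<^bsub>E\<^esub> t') (i2 \<cdot>\<^bsub>E\<^esub> f')"
  define e where "e = Add E (f \<cdot>\<^bsub>E\<^esub> p1) (neg E (t \<cdot>\<^bsub>E\<^esub> p2))"
  have d: "d \<in> Hom E X' S" "p1 \<cdot>\<^bsub>E\<^esub> d = t'" "p2 \<cdot>\<^bsub>E\<^esub> d = f'"
    using S t'(1) Hf' O OX' by (simp_all add: d_def Hom_def cxS)
  have e: "e \<in> Hom E S Y" using Hk t(1) S by (simp add: e_def Hom_def)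
  have ex: "e \<cdot>\<^bsub>E\<^esub> x = Add E (f \<cdot>\<^bsub>E\<^esub> (p1 \<cdot>\<^bsub>E\<^esub> x)) (neg E (t \<cdot>\<^bsub>E\<^esub> (p2 \<cdot>\<^bsub>E\<^esub> x)))" if "x \<in> Hom E W S" for x W
    using that Hk t(1) S by (simp add: e_def Hom_def)
  have ei1: "e \<cdot>\<^bsub>E\<^esub> i1 = f" and ei2: "e \<cdot>\<^bsub>E\<^esub> neg E i2 = t"
    using Hk t(1) S O by (simp_all add: e_def Hom_def)
  have ed: "e \<cdot>\<^bsub>E\<^esub> d = ZeroArr E X' Y"
    using ex[OF d(1)] d t' Hk t(1) Hf' by (simp add: Hom_def)
  have De: "Dom E e = S" "Cod E e = Y" "Dom E d = X'" "Cod E d = S" "e \<in> Arr E" "d \<in> Arr E"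
    using e d(1) by (simp_all add: Hom_def)
  have "is_kernel E d e"
    unfolding is_kernel_def De
  proof (intro conjI ballI impI)
    fix W g assume g: "g \<in> Hom E W S" "e \<cdot>\<^bsub>E\<^esub> g = ZeroArr E W Y"
    have pg: "p1 \<cdot>\<^bsub>E\<^esub> g \<in> Hom E W X" "p2 \<cdot>\<^bsub>E\<^esub> g \<in> Hom E W B" using g(1) S by (simp_all add: Hom_def)
    have "f \<cdot>\<^bsub>E\<^esub> (p1 \<cdot>\<^bsub>E\<^esub> g) = t \<cdot>\<^bsub>E\<^esub> (p2 \<cdot>\<^bsub>E\<^esub> g)"
      using g(2) ex[OF g(1)] E.sub_eq_zero_iff[of "f \<cdot>\<^bsub>E\<^esub> (p1 \<cdot>\<^bsub>E\<^esub> g)" "t \<cdot>\<^bsub>E\<^esub> (p2 \<cdot>\<^bsub>E\<^esub> g)" W Y] pg Hk t(1)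
      by (simp add: Hom_def)
    then obtain h where h: "h \<in> Hom E W X'" "t' \<cdot>\<^bsub>E\<^esub> h = p1 \<cdot>\<^bsub>E\<^esub> g" "f' \<cdot>\<^bsub>E\<^esub> h = p2 \<cdot>\<^bsub>E\<^esub> g"
      by (rule pb_lift[OF pg])
    have "d \<cdot>\<^bsub>E\<^esub> h = Add E (i1 \<cdot>\<^bsub>E\<^esub> (t' \<cdot>\<^bsub>E\<^esub> h)) (i2 \<cdot>\<^bsub>E\<^esub> (f' \<cdot>\<^bsub>E\<^esub> h))"
      using h(1) S t'(1) Hf' by (simp add: d_def Hom_def)
    also have "\<dots> = Add E (i1 \<cdot>\<^bsub>E\<^esub> p1) (i2 \<cdot>\<^bsub>E\<^esub> p2) \<cdot>\<^bsub>E\<^esub> g"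
      unfolding h(2,3) using g(1) S(2-5) by (simp add: Hom_def)
    also have "\<dots> = g" using g(1) by (simp add: S(10) Hom_def)
    finally have dh: "d \<cdot>\<^bsub>E\<^esub> h = g" .
    show "\<exists>!h. h \<in> Hom E W X' \<and> d \<cdot>\<^bsub>E\<^esub> h = g"
    proof (rule ex1I[of _ h])
      fix h' assume h': "h' \<in> Hom E W X' \<and> d \<cdot>\<^bsub>E\<^esub> h' = g"
      then have "t' \<cdot>\<^bsub>E\<^esub> h' = p1 \<cdot>\<^bsub>E\<^esub> g" "f' \<cdot>\<^bsub>E\<^esub> h' = p2 \<cdot>\<^bsub>E\<^esub> g"
        using E.cx[OF d(2), of h'] E.cx[OF d(3), of h'] d(1) S(4,5) by (auto simp: Hom_def)
      then show "h' = h" using pb_eq[of h' W h] h h' by simp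
    qed (use h(1) dh in blast)
  qed (use ed De in simp_all)
  moreover have "deflation E (e \<cdot>\<^bsub>E\<^esub> i1)" using E.ses_deflation[OF f] ei1 by simp
  ultimately have e_ses: "ses E X' d S e Y" by (rule E.ses_if_composite_deflation[OF _ d(1) e S(2)])
  have "admissible_arr E e" using E.ses_admissible[OF e_ses E.ses_Ide_zero[OF Z(1) O(3)]] e by (simp add: Hom_def)
  then obtain r3 A3 where pres3: "cpres S e Y r3 A3" using cpres_of_admissible e by blast
  have IB: "Ide E B \<in> Hom E B B" and IY: "Ide E Y \<in> Hom E Y Y" and IX': "Ide E X' \<in> Hom E X' X'"
    using E.Ide_Hom O OX' by simp_all
  have nI: "neg E i2 \<in> Hom E B S" using S(3) by (simp add: Hom_def)
  have eqs: "Ide E B \<cdot>\<^bsub>E\<^esub> fA = f' \<cdot>\<^bsub>E\<^esub> s" "Ide E B \<cdot>\<^bsub>E\<^esub> f' = f' \<cdot>\<^bsub>E\<^esub> Ide E X'"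
    "Ide E Y \<cdot>\<^bsub>E\<^esub> f = e \<cdot>\<^bsub>E\<^esub> i1" "Ide E Y \<cdot>\<^bsub>E\<^esub> t = e \<cdot>\<^bsub>E\<^esub> neg E i2"
    using s(3) HA(1) Hf' Hk t(1) ei1 ei2 OX' by (simp_all add: Hom_def)
  have zero_add: "z = Add E z (g \<cdot>\<^bsub>E\<^esub> ZeroArr E W M)"
    if "z \<in> Hom E W N" "g \<in> Hom E M N" for z g W M N
    using that E.Hom_Obj[OF that(1)] E.Hom_Obj[OF that(2)] by (simp add: Hom_def)
  \<comment> \<open>The image of \<phi> is presented by \<open>f'\<close>. This first conflation,
    given by \<open>v\<close>, \<open>fA\<close> and \<open>f'\<close>, makes \<open>A\<close> map
    onto the image; the second, given by \<open>f'\<close>, \<open>f\<close> and \<open>e\<close>,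
    embeds the image into \<open>T\<close>.\<close>
  have "\<exists>\<alpha> \<beta>. ses C A' \<alpha> A \<beta> A2 \<and> \<alpha> \<cdot> r' = rA \<cdot> ya f' \<and> \<beta> \<cdot> rA = r2 \<cdot> ya (Ide E B)"
  proof (rule cpres_ses[OF presA' presA pres2 Hf'(2) IB \<pi>1(1) f'v s(1) eqs(1) IX' eqs(2)])
    show "\<exists>x' \<in> Hom E W Q. v \<cdot>\<^bsub>E\<^esub> x' = y"
      if "y \<in> Hom E W X'" "x \<in> Hom E W XA" "f' \<cdot>\<^bsub>E\<^esub> y = fA \<cdot>\<^bsub>E\<^esub> x" for W y x
      by (rule im_v[OF that])
  next
    fix W y x assume y: "y \<in> Hom E W B" "x \<in> Hom E W X'" "Ide E B \<cdot>\<^bsub>E\<^esub> y = f' \<cdot>\<^bsub>E\<^esub> x"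
    have OW: "W \<in> Obj E" using E.Hom_Obj[OF y(1)] by simp
    have "y = f' \<cdot>\<^bsub>E\<^esub> x" using E.Ide_Comp[OF y(1)] y(3) by simp
    then have "y = Add E (f' \<cdot>\<^bsub>E\<^esub> x) (fA \<cdot>\<^bsub>E\<^esub> ZeroArr E W XA)" using zero_add[OF y(1) HA(1)] by simp
    then show "\<exists>y' \<in> Hom E W X'. \<exists>x' \<in> Hom E W XA. y = Add E (f' \<cdot>\<^bsub>E\<^esub> y') (fA \<cdot>\<^bsub>E\<^esub> x')"
      using y(2) E.zero_Hom[OF OW O(5)] by blast
  next
    fix W z assume z: "z \<in> Hom E W B"
    have OW: "W \<in> Obj E" using E.Hom_Obj[OF z] by simp
    have "z = Add E (Ide E B \<cdot>\<^bsub>E\<^esub> z) (f' \<cdot>\<^bsub>E\<^esub> ZeroArr E W X')"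
      using zero_add[OF z Hf'(2)] E.Ide_Comp[OF z] by simp
    then show "\<exists>y \<in> Hom E W B. \<exists>x \<in> Hom E W X'. z = Add E (Ide E B \<cdot>\<^bsub>E\<^esub> y) (f' \<cdot>\<^bsub>E\<^esub> x)"
      using z E.zero_Hom[OF OW OX'] by blast
  qed
  then obtain \<alpha> \<beta> where \<alpha>\<beta>: "ses C A' \<alpha> A \<beta> A2" "\<beta> \<cdot> rA = r2 \<cdot> ya (Ide E B)" by blast
  have "\<exists>\<gamma> \<delta>. ses C A2 \<gamma> T \<delta> A3 \<and> \<gamma> \<cdot> r2 = rT \<cdot> ya t \<and> \<delta> \<cdot> rT = r3 \<cdot> ya (Ide E Y)"
  proof (rule cpres_ses[OF pres2 presT pres3 t(1) IY t'(1) t'(2)[symmetric] S(2) eqs(3) nI eqs(4)])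
    fix W y x assume y: "y \<in> Hom E W B" "x \<in> Hom E W X" "t \<cdot>\<^bsub>E\<^esub> y = f \<cdot>\<^bsub>E\<^esub> x"
    obtain h where "h \<in> Hom E W X'" "t' \<cdot>\<^bsub>E\<^esub> h = x" "f' \<cdot>\<^bsub>E\<^esub> h = y" by (rule pb_lift[OF y(2,1) y(3)[symmetric]])
    then show "\<exists>x' \<in> Hom E W X'. f' \<cdot>\<^bsub>E\<^esub> x' = y" by blast
  next
    fix W y x assume y: "y \<in> Hom E W Y" "x \<in> Hom E W S" "Ide E Y \<cdot>\<^bsub>E\<^esub> y = e \<cdot>\<^bsub>E\<^esub> x"
    have px: "p1 \<cdot>\<^bsub>E\<^esub> x \<in> Hom E W X" "neg E (p2 \<cdot>\<^bsub>E\<^esub> x) \<in> Hom E W B" using y(2) S by (simp_all add: Hom_def)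
    have "y = e \<cdot>\<^bsub>E\<^esub> x" using E.Ide_Comp[OF y(1)] y(3) by simp
    also have "\<dots> = Add E (t \<cdot>\<^bsub>E\<^esub> neg E (p2 \<cdot>\<^bsub>E\<^esub> x)) (f \<cdot>\<^bsub>E\<^esub> (p1 \<cdot>\<^bsub>E\<^esub> x))"
      using ex[OF y(2)] y(2) S(4,5) t(1) Hk
        E.add_commute[of "f \<cdot>\<^bsub>E\<^esub> (p1 \<cdot>\<^bsub>E\<^esub> x)" "neg E (t \<cdot>\<^bsub>E\<^esub> (p2 \<cdot>\<^bsub>E\<^esub> x))"] by (simp add: Hom_def)
    finally show "\<exists>y' \<in> Hom E W B. \<exists>x' \<in> Hom E W X. y = Add E (t \<cdot>\<^bsub>E\<^esub> y') (f \<cdot>\<^bsub>E\<^esub> x')"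
      using px by blast
  next
    fix W z assume z: "z \<in> Hom E W Y"
    have OW: "W \<in> Obj E" using E.Hom_Obj[OF z] by simp
    have "z = Add E (Ide E Y \<cdot>\<^bsub>E\<^esub> z) (e \<cdot>\<^bsub>E\<^esub> ZeroArr E W S)"
      using zero_add[OF z e] E.Ide_Comp[OF z] by simp
    then show "\<exists>y \<in> Hom E W Y. \<exists>x \<in> Hom E W S. z = Add E (Ide E Y \<cdot>\<^bsub>E\<^esub> y) (e \<cdot>\<^bsub>E\<^esub> x)"
      using z E.zero_Hom[OF OW OS] by blast
  qed
  then obtain \<gamma> \<delta> where \<gamma>\<delta>: "ses C A2 \<gamma> T \<delta> A3" "\<gamma> \<cdot> r2 = rT \<cdot> ya t" by blast
  note H\<beta> = ses_Hom[OF \<alpha>\<beta>(1)] and H\<gamma> = ses_Hom[OF \<gamma>\<delta>(1)]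
  have "(\<gamma> \<cdot> \<beta>) \<cdot> rA = \<phi> \<cdot> rA"
    using H\<beta> H\<gamma> HA(2) cpres_Hom(2)[OF pres2] \<alpha>\<beta>(2) \<gamma>\<delta>(2) t(2) y_Ide[OF O(8)]
    by (simp add: Hom_def)
  then have "\<gamma> \<cdot> \<beta> = \<phi>"
    by (rule cpres_epi[OF presA, rotated 2]) (use H\<beta> H\<gamma> \<phi> in \<open>simp_all add: Hom_def\<close>)
  then show ?thesis using ses_admissible[OF \<alpha>\<beta>(1) \<gamma>\<delta>(1)] by simp
qed

text \<open>The morphism \<theta> is admissible because it passes through the functor presented by
  \<open>m\<close>: the kernel of \<open>A --> A2\<close> is presented by \<open>p\<close>, and the
  cokernel of \<open>A2 --> yo D\<close> by \<open>c\<close>. For the approximation property, a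
  projective is a retract of some \<open>yo Y'\<close>, so a morphism from \<open>A\<close> to it
  gives an arrow \<open>h\<close> from \<open>Y\<close> to \<open>Y'\<close> with
  \<open>h f = 0\<close>. Then \<open>h m = 0\<close>, and \<open>h\<close> factors through
  \<open>c\<close>.\<close>

lemma data_approximation:
  assumes A: "A \<in> Obj C"
  shows "\<exists>\<theta>. left_approximation C (Proj C) \<theta> A \<and> admissible_arr C \<theta>"
proof -
  interpret E: exact_category E by (rule E_exact)
  obtain X f Y r where pres: "cpres X f Y r A" using cpres_exists[OF A] by blast
  note Hf = cpres_Hom[OF pres]
  obtain K k I p m c D where p: "ses E K k X p I" and m: "ses E I m Y c D" and f: "f = m \<cdot>\<^bsub>E\<^esub> p"
    using E.admissible_ses[OF cpres_admissible[OF pres] Hf(1)] by blast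
  note Hp = E.ses_Hom[OF p] and Hm = E.ses_Hom[OF m] and O = E.ses_Obj[OF p] E.ses_Obj[OF m]
  obtain Z where Z: "zero_object E Z" "Z \<in> Obj E" by (rule E.zero_object_exists)
  have adm: "admissible_arr E p" "admissible_arr E m" "admissible_arr E c"
    using E.ses_admissible[OF p E.ses_Ide_zero[OF Z(1) O(3)]] E.ses_admissible[OF E.ses_zero_Ide[OF Z(1) O(3)] m]
      E.ses_admissible[OF m E.ses_Ide_zero[OF Z(1) O(6)]] Hp Hm by (simp_all add: Hom_def)
  obtain r1 A1 where pres1: "cpres X p I r1 A1" using cpres_of_admissible[OF adm(1) Hp(2)] by blast
  obtain r2 A2 where pres2: "cpres I m Y r2 A2" using cpres_of_admissible[OF adm(2) Hm(1)] by blast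
  obtain r3 A3 where pres3: "cpres Y c D r3 A3" using cpres_of_admissible[OF adm(3) Hm(2)] by blast
  note presD = cpres_y[OF Z(2,1) O(6)]
  have I: "Ide E X \<in> Hom E X X" "Ide E I \<in> Hom E I I" "Ide E Y \<in> Hom E Y Y" "Ide E D \<in> Hom E D D"
    using E.Ide_Hom O by simp_all
  have z0: "ZeroArr E I Z \<in> Hom E I Z" "ZeroArr E Z Y \<in> Hom E Z Y" "ZeroArr E Z D \<in> Hom E Z D"
    using E.zero_Hom O Z by simp_all
  have eqs: "m \<cdot>\<^bsub>E\<^esub> p = f \<cdot>\<^bsub>E\<^esub> Ide E X" "Ide E Y \<cdot>\<^bsub>E\<^esub> f = m \<cdot>\<^bsub>E\<^esub> p" "Ide E Y \<cdot>\<^bsub>E\<^esub> m = m \<cdot>\<^bsub>E\<^esub> Ide E I"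
    "c \<cdot>\<^bsub>E\<^esub> m = ZeroArr E Z D \<cdot>\<^bsub>E\<^esub> ZeroArr E I Z"
    "Ide E D \<cdot>\<^bsub>E\<^esub> ZeroArr E Z D = c \<cdot>\<^bsub>E\<^esub> ZeroArr E Z Y" "Ide E D \<cdot>\<^bsub>E\<^esub> c = c \<cdot>\<^bsub>E\<^esub> Ide E Y"
    using Hp Hm Hf O Z E.ses_comp[OF m] by (simp_all add: f Hom_def)
  have zero_add: "z = Add E z (g \<cdot>\<^bsub>E\<^esub> ZeroArr E W M)"
    if "z \<in> Hom E W N" "g \<in> Hom E M N" for z g W M N
    using that E.Hom_Obj[OF that(1)] E.Hom_Obj[OF that(2)] by (simp add: Hom_def)
  have "\<exists>\<alpha> \<beta>. ses C A1 \<alpha> A \<beta> A2 \<and> \<alpha> \<cdot> r1 = r \<cdot> ya m \<and> \<beta> \<cdot> r = r2 \<cdot> ya (Ide E Y)"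
  proof (rule cpres_ses[OF pres1 pres pres2 Hm(1) I(3) I(1) eqs(1) Hp(2) eqs(2) I(2) eqs(3)])
    fix W y x assume y: "y \<in> Hom E W I" "x \<in> Hom E W X" "m \<cdot>\<^bsub>E\<^esub> y = f \<cdot>\<^bsub>E\<^esub> x"
    have e: "m \<cdot>\<^bsub>E\<^esub> y = m \<cdot>\<^bsub>E\<^esub> (p \<cdot>\<^bsub>E\<^esub> x)" using y Hp Hm by (simp add: f Hom_def)
    have "y = p \<cdot>\<^bsub>E\<^esub> x" by (rule E.ses_mono[OF m _ _ e]) (use y Hp in \<open>simp_all add: Hom_def\<close>)
    then show "\<exists>x' \<in> Hom E W X. p \<cdot>\<^bsub>E\<^esub> x' = y" using y(2) by blast
  next
    fix W y x assume y: "y \<in> Hom E W Y" "x \<in> Hom E W I" "Ide E Y \<cdot>\<^bsub>E\<^esub> y = m \<cdot>\<^bsub>E\<^esub> x"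
    have OW: "W \<in> Obj E" using E.Hom_Obj[OF y(1)] by simp
    have "y = m \<cdot>\<^bsub>E\<^esub> x" using E.Ide_Comp[OF y(1)] y(3) by simp
    then have "y = Add E (m \<cdot>\<^bsub>E\<^esub> x) (f \<cdot>\<^bsub>E\<^esub> ZeroArr E W X)" using zero_add[OF y(1) Hf(1)] by simp
    then show "\<exists>y' \<in> Hom E W I. \<exists>x' \<in> Hom E W X. y = Add E (m \<cdot>\<^bsub>E\<^esub> y') (f \<cdot>\<^bsub>E\<^esub> x')"
      using y(2) E.zero_Hom[OF OW O(2)] by blast
  next
    fix W z assume z: "z \<in> Hom E W Y"
    have OW: "W \<in> Obj E" using E.Hom_Obj[OF z] by simp
    have "z = Add E (Ide E Y \<cdot>\<^bsub>E\<^esub> z) (m \<cdot>\<^bsub>E\<^esub> ZeroArr E W I)"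
      using zero_add[OF z Hm(1)] E.Ide_Comp[OF z] by simp
    then show "\<exists>y \<in> Hom E W Y. \<exists>x \<in> Hom E W I. z = Add E (Ide E Y \<cdot>\<^bsub>E\<^esub> y) (m \<cdot>\<^bsub>E\<^esub> x)"
      using z E.zero_Hom[OF OW O(3)] by blast
  qed
  then obtain \<alpha> \<beta> where \<alpha>\<beta>: "ses C A1 \<alpha> A \<beta> A2" "\<beta> \<cdot> r = r2 \<cdot> ya (Ide E Y)" by blast
  have "\<exists>\<gamma> \<delta>. ses C A2 \<gamma> (yo D) \<delta> A3 \<and> \<gamma> \<cdot> r2 = Ide C (yo D) \<cdot> ya c \<and>
      \<delta> \<cdot> Ide C (yo D) = r3 \<cdot> ya (Ide E D)"
  proof (rule cpres_ses[OF pres2 presD pres3 Hm(2) I(4) z0(1) eqs(4) z0(2) eqs(5) I(3) eqs(6)])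
    fix W y x assume y: "y \<in> Hom E W Y" "x \<in> Hom E W Z" "c \<cdot>\<^bsub>E\<^esub> y = ZeroArr E Z D \<cdot>\<^bsub>E\<^esub> x"
    have "c \<cdot>\<^bsub>E\<^esub> y = ZeroArr E W D" using y(2,3) O by (simp add: Hom_def)
    then show "\<exists>x' \<in> Hom E W I. m \<cdot>\<^bsub>E\<^esub> x' = y" by (rule E.ses_lift[OF m y(1)])
  next
    fix W y x assume y: "y \<in> Hom E W D" "x \<in> Hom E W Y" "Ide E D \<cdot>\<^bsub>E\<^esub> y = c \<cdot>\<^bsub>E\<^esub> x"
    have OW: "W \<in> Obj E" using E.Hom_Obj[OF y(1)] by simp
    have "y = c \<cdot>\<^bsub>E\<^esub> x" using E.Ide_Comp[OF y(1)] y(3) by simp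
    then have "y = Add E (c \<cdot>\<^bsub>E\<^esub> x) (ZeroArr E Z D \<cdot>\<^bsub>E\<^esub> ZeroArr E W Z)" using zero_add[OF y(1) z0(3)] by simp
    then show "\<exists>y' \<in> Hom E W Y. \<exists>x' \<in> Hom E W Z. y = Add E (c \<cdot>\<^bsub>E\<^esub> y') (ZeroArr E Z D \<cdot>\<^bsub>E\<^esub> x')"
      using y(2) E.zero_Hom[OF OW Z(2)] by blast
  next
    fix W z assume z: "z \<in> Hom E W D"
    have OW: "W \<in> Obj E" using E.Hom_Obj[OF z] by simp
    have "z = Add E (Ide E D \<cdot>\<^bsub>E\<^esub> z) (c \<cdot>\<^bsub>E\<^esub> ZeroArr E W Y)"
      using zero_add[OF z Hm(2)] E.Ide_Comp[OF z] by simp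
    then show "\<exists>y \<in> Hom E W D. \<exists>x \<in> Hom E W Y. z = Add E (Ide E D \<cdot>\<^bsub>E\<^esub> y) (c \<cdot>\<^bsub>E\<^esub> x)"
      using z E.zero_Hom[OF OW O(5)] by blast
  qed
  then obtain \<gamma> \<delta> where \<gamma>\<delta>: "ses C A2 \<gamma> (yo D) \<delta> A3" "\<gamma> \<cdot> r2 = Ide C (yo D) \<cdot> ya c" by blast
  note H\<beta> = ses_Hom[OF \<alpha>\<beta>(1)] and H\<gamma> = ses_Hom[OF \<gamma>\<delta>(1)] and H2 = cpres_Hom[OF pres2]
  define \<theta> where "\<theta> = \<gamma> \<cdot> \<beta>"
  have \<theta>: "\<theta> \<in> Hom C A (yo D)" using H\<beta> H\<gamma> by (simp add: \<theta>_def Hom_def)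
  have \<theta>r: "\<theta> \<cdot> r = ya c"
    using H\<beta> H\<gamma> Hf(2) H2(2) \<alpha>\<beta>(2) \<gamma>\<delta>(2) y_Ide[OF O(5)] y_Hom[OF Hm(2)]
    by (simp add: \<theta>_def Hom_def)
  have "\<exists>h \<in> Hom C (yo D) P. g = h \<cdot> \<theta>" if P: "projective C P" and g: "g \<in> Hom C A P" for P g
  proof -
    have OP: "P \<in> Obj C" using Hom_Obj[OF g] by simp
    obtain Y' N n \<rho> where Y': "Y' \<in> Obj E" "ses C N n (yo Y') \<rho> P" using G_cover[OF OP] by blast
    note H\<rho> = ses_Hom[OF Y'(2)]
    obtain \<sigma> where \<sigma>: "\<sigma> \<in> Hom C P (yo Y')" "\<rho> \<cdot> \<sigma> = Ide C P"
      using projective_lift[OF P Y'(2) Ide_Hom[OF OP]] by blast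
    have "\<sigma> \<cdot> (g \<cdot> r) \<in> Hom C (yo Y) (yo Y')" using \<sigma>(1) g Hf(2) by (simp add: Hom_def)
    then obtain h where h: "h \<in> Hom E Y Y'" "ya h = \<sigma> \<cdot> (g \<cdot> r)" using y_full[OF O(5) Y'(1)] by blast
    have hf: "h \<cdot>\<^bsub>E\<^esub> f \<in> Hom E X Y'" using h(1) Hf(1) by (simp add: Hom_def)
    have "ya (h \<cdot>\<^bsub>E\<^esub> f) = ya (ZeroArr E X Y')"
      using y_Comp[OF Hf(1) h(1)] h(2) \<sigma>(1) g Hf(2) y_Hom[OF Hf(1)] cpres_zero[OF pres] y_Obj[OF O(2)]
        y_zero[OF O(2) Y'(1)] by (simp add: Hom_def)
    then have "h \<cdot>\<^bsub>E\<^esub> f = ZeroArr E X Y'" by (rule y_faithful[OF hf E.zero_Hom[OF O(2) Y'(1)]])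
    then have "h \<cdot>\<^bsub>E\<^esub> m = ZeroArr E I Y'"
      using h(1) Hp Hm by (intro E.ses_epi0[OF p]) (simp_all add: f Hom_def)
    then obtain h' where h': "h' \<in> Hom E D Y'" "h' \<cdot>\<^bsub>E\<^esub> c = h" using E.ses_colift[OF m h(1)] by blast
    have yh: "ya h' \<in> Hom C (yo D) (yo Y')" using y_Hom[OF h'(1)] .
    have "(\<rho> \<cdot> ya h' \<cdot> \<theta>) \<cdot> r = \<rho> \<cdot> ya (h' \<cdot>\<^bsub>E\<^esub> c)"
      using y_Comp[OF Hm(2) h'(1)] yh \<theta> \<theta>r H\<rho> Hf(2) by (simp add: Hom_def)
    also have "\<dots> = g \<cdot> r"
      unfolding h'(2) h(2) using H\<rho> \<sigma> g Hf(2) by (simp add: Hom_def cx[OF \<sigma>(2)])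
    finally have e: "(\<rho> \<cdot> ya h' \<cdot> \<theta>) \<cdot> r = g \<cdot> r" .
    have "\<rho> \<cdot> ya h' \<cdot> \<theta> = g"
      by (rule cpres_epi[OF pres _ _ e]) (use H\<rho> yh \<theta> g in \<open>simp_all add: Hom_def\<close>)
    moreover have "\<rho> \<cdot> ya h' \<in> Hom C (yo D) P" using H\<rho> yh by (simp add: Hom_def)
    ultimately show ?thesis by blast
  qed
  then have "left_approximation C (Proj C) \<theta> A"
    using \<theta> y_projective[OF O(6)] unfolding left_approximation_def Proj_def by (simp add: Hom_D)
  moreover have "admissible_arr C \<theta>" using ses_admissible[OF \<alpha>\<beta>(1) \<gamma>\<delta>(1)] by (simp add: \<theta>_def)
  ultimately show ?thesis by blast
qed

end

section \<open>The functor of an exact equivalence\<close>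

lemma naturally_isomorphic_idE:
  assumes "naturally_isomorphic C C (Go \<circ> Fo) (Ga \<circ> Fa) id id"
  obtains \<eta> where "\<And>X. X \<in> Obj C \<Longrightarrow> \<eta> X \<in> Hom C (Go (Fo X)) X" "\<And>X. X \<in> Obj C \<Longrightarrow> is_iso C (\<eta> X)"
    "\<And>f X Y. f \<in> Hom C X Y \<Longrightarrow> f \<cdot>\<^bsub>C\<^esub> \<eta> X = \<eta> Y \<cdot>\<^bsub>C\<^esub> Ga (Fa f)"
  using assms unfolding naturally_isomorphic_def by (auto simp: Hom_def)

lemma (in category) equivalence_faithful:
  assumes n: "naturally_isomorphic C C (Go \<circ> Fo) (Ga \<circ> Fa) id id"
    and f: "f \<in> Hom C X Y" "f' \<in> Hom C X Y" "Fa f = Fa f'"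
  shows "f = f'"
proof -
  obtain \<eta> where \<eta>: "\<And>X. X \<in> Obj C \<Longrightarrow> \<eta> X \<in> Hom C (Go (Fo X)) X" "\<And>X. X \<in> Obj C \<Longrightarrow> is_iso C (\<eta> X)"
    "\<And>f X Y. f \<in> Hom C X Y \<Longrightarrow> f \<cdot> \<eta> X = \<eta> Y \<cdot> Ga (Fa f)"
    using naturally_isomorphic_idE[OF n] by metis
  have X: "X \<in> Obj C" using Hom_Obj[OF f(1)] by simp
  obtain g where g: "g \<in> Hom C X (Go (Fo X))" "\<eta> X \<cdot> g = Ide C X"
    using is_isoE[OF \<eta>(2)[OF X] \<eta>(1)[OF X]] by metis
  have "f \<cdot> (\<eta> X \<cdot> g) = f' \<cdot> (\<eta> X \<cdot> g)"
    using \<eta>(3)[OF f(1)] \<eta>(3)[OF f(2)] f(3) Comp_assoc[OF g(1) \<eta>(1)[OF X] f(1)]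
      Comp_assoc[OF g(1) \<eta>(1)[OF X] f(2)] by simp
  then show ?thesis using Comp_Ide[OF f(1)] Comp_Ide[OF f(2)] g(2) by simp
qed

text \<open>The candidate \<open>f\<close> is \<open>Ga g\<close> conjugated by \<eta>. Naturality
  gives \<open>Ga (Fa f) = Ga g\<close>, and \<open>Ga\<close> is faithful by the second natural
  isomorphism.\<close>

lemma (in category) equivalence_full:
  assumes D: "category D" and F: "is_functor C D Fo Fa" and G: "is_functor D C Go Ga"
    and n: "naturally_isomorphic C C (Go \<circ> Fo) (Ga \<circ> Fa) id id"
    and n': "naturally_isomorphic D D (Fo \<circ> Go) (Fa \<circ> Ga) id id"
    and O: "X \<in> Obj C" "Y \<in> Obj C" and g: "g \<in> Hom D (Fo X) (Fo Y)"
  shows "\<exists>f \<in> Hom C X Y. Fa f = g"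
proof -
  obtain \<eta> where \<eta>: "\<And>X. X \<in> Obj C \<Longrightarrow> \<eta> X \<in> Hom C (Go (Fo X)) X" "\<And>X. X \<in> Obj C \<Longrightarrow> is_iso C (\<eta> X)"
    "\<And>f X Y. f \<in> Hom C X Y \<Longrightarrow> f \<cdot> \<eta> X = \<eta> Y \<cdot> Ga (Fa f)"
    using naturally_isomorphic_idE[OF n] by metis
  obtain u where u: "u \<in> Hom C X (Go (Fo X))" "u \<cdot> \<eta> X = Ide C (Go (Fo X))"
    using is_isoE[OF \<eta>(2)[OF O(1)] \<eta>(1)[OF O(1)]] by metis
  obtain v where v: "v \<in> Hom C Y (Go (Fo Y))" "v \<cdot> \<eta> Y = Ide C (Go (Fo Y))"
    using is_isoE[OF \<eta>(2)[OF O(2)] \<eta>(1)[OF O(2)]] by metis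
  note Gg = functor_Hom[OF G g] and h = \<eta>(1)[OF O(1)] \<eta>(1)[OF O(2)]
  define f where "f = \<eta> Y \<cdot> (Ga g \<cdot> u)"
  have f: "f \<in> Hom C X Y" using Gg h u by (simp add: f_def Hom_def)
  note GF = functor_Hom[OF G functor_Hom[OF F f]]
  have 1: "f \<cdot> \<eta> X = \<eta> Y \<cdot> Ga g" using Gg h u by (simp add: f_def Hom_def)
  have 2: "f \<cdot> \<eta> X = \<eta> Y \<cdot> Ga (Fa f)" by (rule \<eta>(3)[OF f])
  have "v \<cdot> (\<eta> Y \<cdot> Ga (Fa f)) = v \<cdot> (\<eta> Y \<cdot> Ga g)" using 1 2 by simp
  then have "Ga (Fa f) = Ga g"
    using Comp_assoc[OF GF h(2) v(1)] Comp_assoc[OF Gg h(2) v(1)] Ide_Comp[OF GF] Ide_Comp[OF Gg] v(2)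
    by simp
  then have "Fa f = g"
    using category.equivalence_faithful[OF D n' functor_Hom[OF F f] g] by blast
  then show ?thesis using f by blast
qed

lemma (in preadditive_category) yoneda_eqI:
  assumes "\<eta> \<in> Hom (ModCat C) (Yoneda_obj C W) F" "\<theta> \<in> Hom (ModCat C) (Yoneda_obj C W) F"
    "NComp \<eta> W (Ide C W) = NComp \<theta> W (Ide C W)"
  shows "\<eta> = \<theta>"
  by (rule nattrans_eqI[OF assms(1,2)])
    (simp add: yoneda_eval[OF assms(1)] yoneda_eval[OF assms(2)] assms(3))

context exact_category
begin

lemma Yoneda_functor: "is_functor C (mod_adm C) (Yoneda_obj C) (Yoneda_arr C)"
  unfolding is_functor_def
proof (intro conjI ballI impI)
  fix f assume "f \<in> Arr C"
  then have "f \<in> Hom C (Dom C f) (Cod C f)" by (simp add: Hom_def)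
  then show "Yoneda_arr C f \<in> Hom (mod_adm C) (Yoneda_obj C (Dom C f)) (Yoneda_obj C (Cod C f))"
    unfolding mod_adm_Hom using Yoneda_arr_Hom Yoneda_obj_mod_adm Hom_Obj by blast
next
  fix X assume X: "X \<in> Obj C"
  show "Yoneda_obj C X \<in> Obj (mod_adm C)" using Yoneda_obj_mod_adm[OF X] .
  show "Yoneda_arr C (Ide C X) = Ide (mod_adm C) (Yoneda_obj C X)"
    using X by (auto simp: Yoneda_arr_def mk_nattrans_def restrict_def fun_eq_iff Hom_def)
next
  fix f g assume "f \<in> Arr C" "g \<in> Arr C" "Cod C f = Dom C g"
  then show "Yoneda_arr C (g \<cdot> f) = Comp (mod_adm C) (Yoneda_arr C g) (Yoneda_arr C f)"
    by (auto simp: Yoneda_arr_def mk_nattrans_def restrict_def fun_eq_iff Hom_def)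
qed

lemma Yoneda_full:
  assumes "X \<in> Obj C" "Y \<in> Obj C" "\<eta> \<in> Hom (mod_adm C) (Yoneda_obj C X) (Yoneda_obj C Y)"
  shows "\<exists>f \<in> Hom C X Y. Yoneda_arr C f = \<eta>"
proof -
  have \<eta>: "\<eta> \<in> Hom (ModCat C) (Yoneda_obj C X) (Yoneda_obj C Y)" using assms(3) unfolding mod_adm_Hom by simp
  have f: "NComp \<eta> X (Ide C X) \<in> Hom C X Y" using yoneda_eval_closed[OF \<eta> assms(1)] by simp
  have "Yoneda_arr C (NComp \<eta> X (Ide C X)) = \<eta>"
    by (rule yoneda_eqI[OF Yoneda_arr_Hom[OF f] \<eta>])
      (simp only: Yoneda_arr_NComp[OF f Ide_Hom[OF assms(1)]] Comp_Ide[OF f])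
  then show ?thesis using f by blast
qed

lemma Yoneda_faithful:
  assumes "f \<in> Hom C X Y" "f' \<in> Hom C X Y" "Yoneda_arr C f = Yoneda_arr C f'"
  shows "f = f'"
proof -
  have I: "Ide C X \<in> Hom C X X" using Ide_Hom Hom_Obj[OF assms(1)] by simp
  have "f = NComp (Yoneda_arr C f) X (Ide C X)"
    by (simp only: Yoneda_arr_NComp[OF assms(1) I] Comp_Ide[OF assms(1)])
  also have "\<dots> = f'"
    by (simp only: assms(3) Yoneda_arr_NComp[OF assms(2) I] Comp_Ide[OF assms(2)])
  finally show ?thesis .
qed

lemma mod_adm_presentation:
  assumes p: "ses C K k X p I" and m: "ses C I m Y c D" and \<pi>: "presents C X (m \<cdot> p) Y \<pi> F"
  shows "\<exists>J q j. ses (mod_adm C) (Yoneda_obj C K) (Yoneda_arr C k) (Yoneda_obj C X) q J \<and>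
    ses (mod_adm C) J j (Yoneda_obj C Y) \<pi> F \<and> Yoneda_arr C (m \<cdot> p) = Comp (mod_adm C) j q"
proof -
  note O = ses_Obj[OF p] ses_Obj[OF m]
  obtain J q j where J: "q \<in> Hom (ModCat C) (Yoneda_obj C X) J" "j \<in> Hom (ModCat C) J (Yoneda_obj C Y)"
    "(Yoneda_arr C k, q) \<in> Confl (ModCat C)" "(j, \<pi>) \<in> Confl (ModCat C)"
    "Yoneda_arr C (m \<cdot> p) = j \<cdot>\<^bsub>ModCat C\<^esub> q" "presents C K k X q J"
    using presentation_conflations[OF p m \<pi>] by blast
  obtain Z where Z: "zero_object C Z" by (rule zero_object_exists)
  have "admissible_arr C k"
    using ses_admissible[OF ses_zero_Ide[OF Z O(1)] p] Comp_Ide[OF ses_Hom(1)[OF p]] by simp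
  then have M: "J \<in> Obj (mod_adm C)" "F \<in> Obj (mod_adm C)"
    "Yoneda_obj C K \<in> Obj (mod_adm C)" "Yoneda_obj C X \<in> Obj (mod_adm C)" "Yoneda_obj C Y \<in> Obj (mod_adm C)"
    using mod_adm_Obj J(6) \<pi> ses_admissible[OF p m] Yoneda_obj_mod_adm O by blast+
  have H: "Yoneda_arr C k \<in> Hom (mod_adm C) (Yoneda_obj C K) (Yoneda_obj C X)"
    "q \<in> Hom (mod_adm C) (Yoneda_obj C X) J" "j \<in> Hom (mod_adm C) J (Yoneda_obj C Y)"
    "\<pi> \<in> Hom (mod_adm C) (Yoneda_obj C Y) F"
    unfolding mod_adm_Hom
    using M J(1,2) presents_Hom(2)[OF \<pi>] Yoneda_arr_Hom[OF ses_Hom(1)[OF p]] by blast+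
  have "Yoneda_arr C (m \<cdot> p) = Comp (mod_adm C) j q" unfolding mod_adm_simps by (rule J(5))
  then show ?thesis
    using H ModCat_Confl_mod_adm[OF J(3) H(1,2)] ModCat_Confl_mod_adm[OF J(4) H(3,4)] unfolding ses_def by blast
qed

text \<open>By the Yoneda lemma a lift is one element of \<open>G X\<close> over the element that
  \<open>w\<close> assigns to the identity, and conflations are pointwise surjective.\<close>

lemma Yoneda_projective:
  assumes X: "X \<in> Obj C" and s: "ses (mod_adm C) F i G p H" and w: "w \<in> Hom (mod_adm C) (Yoneda_obj C X) H"
  shows "\<exists>y \<in> Hom (mod_adm C) (Yoneda_obj C X) G. Comp (mod_adm C) p y = w"
proof -
  have sH: "i \<in> Hom (mod_adm C) F G" "p \<in> Hom (mod_adm C) G H" "(i, p) \<in> Confl (mod_adm C)"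
    using s by (simp_all only: ses_def)
  have ex: "pointwise_exact C i p" using mod_adm_Confl[OF sH(1,2)] sH(3) by simp
  have iH: "i \<in> Hom (ModCat C) F G" and pH: "p \<in> Hom (ModCat C) G H" and wH: "w \<in> Hom (ModCat C) (Yoneda_obj C X) H"
    and M: "G \<in> Obj (mod_adm C)" "Yoneda_obj C X \<in> Obj (mod_adm C)"
    using sH(1,2) w unfolding mod_adm_Hom by simp_all
  interpret M: category "ModCat C :: (('a, 'b, 'b) cfunctor, ('a, 'b, 'b) nattrans) excat"
    by (rule ModCat_category[OF category_axioms])
  have "\<forall>X \<in> Obj C. \<forall>z \<in> carrier (FObj H X). \<exists>y \<in> carrier (FObj G X). NComp p X y = z"
    using ex by (simp add: pointwise_exact_def nattrans_Dom_Cod[OF iH] nattrans_Dom_Cod[OF pH])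
  then obtain y where y: "y \<in> carrier (FObj G X)" "NComp p X y = NComp w X (Ide C X)"
    using X yoneda_eval_closed[OF wH X] by blast
  note G = nattrans_cfunctor(1)[OF pH]
  note yH = yoneda_map_Hom[OF G X y(1)]
  have "p \<cdot>\<^bsub>ModCat C\<^esub> yoneda_map G X y = w"
  proof (rule yoneda_eqI[OF M.Comp_Hom[OF yH pH] wH])
    have "Ide C X \<in> carrier (FObj (Yoneda_obj C X) X)" using Ide_Hom[OF X] by simp
    from ModCat_Comp_NComp[OF yH X this, of p]
    show "NComp (p \<cdot>\<^bsub>ModCat C\<^esub> yoneda_map G X y) X (Ide C X) = NComp w X (Ide C X)"
      by (simp only: yoneda_map_Ide[OF G X y(1)] y(2))
  qed
  moreover have "yoneda_map G X y \<in> Hom (mod_adm C) (Yoneda_obj C X) G"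
    unfolding mod_adm_Hom using M yH by simp
  ultimately show ?thesis unfolding mod_adm_simps by blast
qed

end

lemma preserves_ses:
  assumes "is_functor C D Fo Fa" "preserves_conflations C D Fa" "ses C A i B p K"
  shows "ses D (Fo A) (Fa i) (Fo B) (Fa p) (Fo K)"
  using assms(2,3) functor_Hom[OF assms(1)] by (auto simp: ses_def preserves_conflations_def)

text \<open>\<open>Fa\<close> carries the lifting problem to \<open>D\<close>, where
  \<open>lift\<close> solves it up to the isomorphism of \<open>Fo (Go Q)\<close> with
  \<open>Q\<close>; fullness and faithfulness bring the solution back.\<close>

lemma (in exact_category) equivalence_projective:
  assumes D: "category D" and F: "is_functor C D Fo Fa" and G: "is_functor D C Go Ga"
    and n: "naturally_isomorphic C C (Go \<circ> Fo) (Ga \<circ> Fa) id id"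
    and n': "naturally_isomorphic D D (Fo \<circ> Go) (Fa \<circ> Ga) id id"
    and F_confl: "preserves_conflations C D Fa" and Q: "Q \<in> Obj D"
    and lift: "\<And>A i B p K w. \<lbrakk>ses D A i B p K; w \<in> Hom D Q K\<rbrakk> \<Longrightarrow> \<exists>y \<in> Hom D Q B. p \<cdot>\<^bsub>D\<^esub> y = w"
  shows "projective C (Go Q)"
proof (rule projectiveI)
  interpret D: category D by (rule D)
  note GQ = functor_Obj[OF G Q]
  show "Go Q \<in> Obj C" by (rule GQ)
  obtain \<epsilon> where \<epsilon>: "\<And>X. X \<in> Obj D \<Longrightarrow> \<epsilon> X \<in> Hom D (Fo (Go X)) X" "\<And>X. X \<in> Obj D \<Longrightarrow> is_iso D (\<epsilon> X)"
    using naturally_isomorphic_idE[OF n'] by metis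
  obtain e where e: "e \<in> Hom D Q (Fo (Go Q))" "e \<cdot>\<^bsub>D\<^esub> \<epsilon> Q = Ide D (Fo (Go Q))"
    using D.is_isoE[OF \<epsilon>(2)[OF Q] \<epsilon>(1)[OF Q]] by metis
  note \<epsilon>Q = \<epsilon>(1)[OF Q]
  fix A i B p K z assume s: "ses C A i B p K" and z: "z \<in> Hom C (Go Q) K"
  note Hs = ses_Hom[OF s] and OB = ses_Obj(2)[OF s]
  note Fs = preserves_ses[OF F F_confl s] and Fz = functor_Hom[OF F z] and Fp = functor_Hom[OF F Hs(2)]
  obtain y where y: "y \<in> Hom D Q (Fo B)" "Fa p \<cdot>\<^bsub>D\<^esub> y = Fa z \<cdot>\<^bsub>D\<^esub> e"
    using lift[OF Fs D.Comp_Hom[OF e(1) Fz]] by blast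
  obtain h where h: "h \<in> Hom C (Go Q) B" "Fa h = y \<cdot>\<^bsub>D\<^esub> \<epsilon> Q"
    using equivalence_full[OF D F G n n' GQ OB D.Comp_Hom[OF \<epsilon>Q y(1)]] by blast
  have "Fa (p \<cdot> h) = (Fa p \<cdot>\<^bsub>D\<^esub> y) \<cdot>\<^bsub>D\<^esub> \<epsilon> Q"
    by (simp only: functor_Comp[OF F h(1) Hs(2)] h(2) D.Comp_assoc[OF \<epsilon>Q y(1) Fp])
  also have "\<dots> = Fa z" by (simp only: y(2) D.Comp_assoc[OF \<epsilon>Q e(1) Fz] e(2) D.Comp_Ide[OF Fz])
  finally have "p \<cdot> h = z" by (rule equivalence_faithful[OF n Comp_Hom[OF h(1) Hs(2)] z])
  then show "\<exists>y \<in> Hom C (Go Q) B. p \<cdot> y = z" using h(1) by blast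
qed

text \<open>The functor is the Yoneda embedding followed by \<open>Ga\<close>. The functor presented
  by a given admissible morphism is provided by \<open>coker_functor\<close>, and a presentation of
  \<open>Fo A\<close> is moved to \<open>A\<close> along the isomorphism
  \<open>\<eta> A\<close>.\<close>

theorem auslander_data_of_equivalence:
  fixes C :: "('o, 'm) excat" and E :: "('p, 'q) excat"
  assumes C: "exact_category C" and E: "exact_category E" and "exactly_equivalent C (mod_adm E)"
  shows "\<exists>yo ya. auslander_data C E yo ya"
proof -
  interpret C: exact_category C by (rule C)
  interpret E: exact_category E by (rule E)
  let ?M = "mod_adm E"
  note M = E.mod_adm_category
  obtain Fo Fa Go Ga where F: "is_functor C ?M Fo Fa" and G: "is_functor ?M C Go Ga"
    and n: "naturally_isomorphic C C (Go \<circ> Fo) (Ga \<circ> Fa) id id"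
    and n': "naturally_isomorphic ?M ?M (Fo \<circ> Go) (Fa \<circ> Ga) id id"
    and pF: "preserves_conflations C ?M Fa" and pG: "preserves_conflations ?M C Ga"
    using assms(3) unfolding exactly_equivalent_def by blast
  note Y = E.Yoneda_functor
  note G_ses = preserves_ses[OF G pG]
  have pres: "\<exists>J q j. ses C (Go (Yoneda_obj E K)) (Ga (Yoneda_arr E k)) (Go (Yoneda_obj E X)) q J \<and>
      ses C J j (Go (Yoneda_obj E Y)) (Ga \<pi>) (Go N) \<and> Ga (Yoneda_arr E (m \<cdot>\<^bsub>E\<^esub> p)) = j \<cdot>\<^bsub>C\<^esub> q"
    if s: "ses E K k X p I" "ses E I m Y c D" "presents E X (m \<cdot>\<^bsub>E\<^esub> p) Y \<pi> N" for K k X p I m Y c D \<pi> N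
  proof -
    obtain J q j where J: "ses ?M (Yoneda_obj E K) (Yoneda_arr E k) (Yoneda_obj E X) q J"
      "ses ?M J j (Yoneda_obj E Y) \<pi> N" "Yoneda_arr E (m \<cdot>\<^bsub>E\<^esub> p) = Comp ?M j q"
      using E.mod_adm_presentation[OF s] by blast
    have H: "q \<in> Hom ?M (Yoneda_obj E X) J" "j \<in> Hom ?M J (Yoneda_obj E Y)"
      using J(1,2) by (simp_all only: ses_def)
    have "Ga (Yoneda_arr E (m \<cdot>\<^bsub>E\<^esub> p)) = Ga j \<cdot>\<^bsub>C\<^esub> Ga q"
      by (simp only: J(3) functor_Comp[OF G H])
    then show ?thesis using G_ses[OF J(1)] G_ses[OF J(2)] by blast
  qed
  have "auslander_data C E (\<lambda>X. Go (Yoneda_obj E X)) (\<lambda>f. Ga (Yoneda_arr E f))"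
  proof (intro auslander_data.intro auslander_data_axioms.intro)
    show "exact_category C" by (rule C)
    show "exact_category E" by (rule E)
    show "is_functor E C (\<lambda>X. Go (Yoneda_obj E X)) (\<lambda>f. Ga (Yoneda_arr E f))"
      unfolding is_functor_def
    proof (intro conjI ballI impI)
      fix X assume X: "X \<in> Obj E"
      show "Go (Yoneda_obj E X) \<in> Obj C" using functor_Obj[OF G functor_Obj[OF Y X]] .
      show "Ga (Yoneda_arr E (Ide E X)) = Ide C (Go (Yoneda_obj E X))"
        by (simp only: functor_Ide[OF Y X] functor_Ide[OF G functor_Obj[OF Y X]])
    next
      fix f assume "f \<in> Arr E"
      then have "f \<in> Hom E (Dom E f) (Cod E f)" by (simp add: Hom_def)
      then show "Ga (Yoneda_arr E f) \<in> Hom C (Go (Yoneda_obj E (Dom E f))) (Go (Yoneda_obj E (Cod E f)))"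
        using functor_Hom[OF G functor_Hom[OF Y]] by blast
    next
      fix f g assume "f \<in> Arr E" "g \<in> Arr E" "Cod E f = Dom E g"
      then have f: "f \<in> Hom E (Dom E f) (Cod E f)" and g: "g \<in> Hom E (Cod E f) (Cod E g)" by (simp_all add: Hom_def)
      show "Ga (Yoneda_arr E (g \<cdot>\<^bsub>E\<^esub> f)) = Ga (Yoneda_arr E g) \<cdot>\<^bsub>C\<^esub> Ga (Yoneda_arr E f)"
        by (simp only: functor_Comp[OF Y f g] functor_Comp[OF G functor_Hom[OF Y f] functor_Hom[OF Y g]])
    qed
    show "\<exists>f \<in> Hom E X Y. Ga (Yoneda_arr E f) = g"
      if X: "X \<in> Obj E" and Y': "Y \<in> Obj E" and g: "g \<in> Hom C (Go (Yoneda_obj E X)) (Go (Yoneda_obj E Y))" for X Y g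
    proof -
      obtain \<eta> where \<eta>: "\<eta> \<in> Hom ?M (Yoneda_obj E X) (Yoneda_obj E Y)" "Ga \<eta> = g"
        using category.equivalence_full[OF M C.category_axioms G F n' n functor_Obj[OF Y X] functor_Obj[OF Y Y'] g]
        by blast
      then show ?thesis using E.Yoneda_full[OF X Y' \<eta>(1)] by auto
    qed
    show "f = f'" if f: "f \<in> Hom E X Y" "f' \<in> Hom E X Y" "Ga (Yoneda_arr E f) = Ga (Yoneda_arr E f')" for X Y f f'
      using E.Yoneda_faithful[OF f(1,2)]
        category.equivalence_faithful[OF M n' functor_Hom[OF Y f(1)] functor_Hom[OF Y f(2)] f(3)] by blast
    show "projective C (Go (Yoneda_obj E X))" if X: "X \<in> Obj E" for X
      by (rule C.equivalence_projective[OF M F G n n' pF functor_Obj[OF Y X] E.Yoneda_projective[OF X]])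
  next
    fix K k X p I m Y c D assume s: "ses E K k X p I" "ses E I m Y c D"
    have "m \<cdot>\<^bsub>E\<^esub> p \<in> Hom E X Y" using E.ses_Hom[OF s(1)] E.ses_Hom[OF s(2)] by (simp add: Hom_def)
    then obtain \<pi> where "presents E X (m \<cdot>\<^bsub>E\<^esub> p) Y \<pi> (E.coker_functor (m \<cdot>\<^bsub>E\<^esub> p))"
      using E.coker_functor_presents by blast
    from pres[OF s this]
    show "\<exists>J q j r A. ses C (Go (Yoneda_obj E K)) (Ga (Yoneda_arr E k)) (Go (Yoneda_obj E X)) q J \<and>
        ses C J j (Go (Yoneda_obj E Y)) r A \<and> Ga (Yoneda_arr E (m \<cdot>\<^bsub>E\<^esub> p)) = j \<cdot>\<^bsub>C\<^esub> q" by blast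
  next
    fix A assume A: "A \<in> Obj C"
    obtain X f Y \<pi> where f: "admissible_arr E f" and \<pi>: "presents E X f Y \<pi> (Fo A)"
      using functor_Obj[OF F A] E.mod_adm_Obj by blast
    obtain K k I p m c D where s: "ses E K k X p I" "ses E I m Y c D" and fmp: "f = m \<cdot>\<^bsub>E\<^esub> p"
      using E.admissible_ses[OF f E.presents_Hom(1)[OF \<pi>]] by blast
    obtain J q j where J: "ses C (Go (Yoneda_obj E K)) (Ga (Yoneda_arr E k)) (Go (Yoneda_obj E X)) q J"
      "ses C J j (Go (Yoneda_obj E Y)) (Ga \<pi>) (Go (Fo A))" "Ga (Yoneda_arr E (m \<cdot>\<^bsub>E\<^esub> p)) = j \<cdot>\<^bsub>C\<^esub> q"
      using pres[OF s \<pi>[unfolded fmp]] by blast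
    obtain \<eta> where \<eta>: "\<And>X. X \<in> Obj C \<Longrightarrow> \<eta> X \<in> Hom C (Go (Fo X)) X" "\<And>X. X \<in> Obj C \<Longrightarrow> is_iso C (\<eta> X)"
      using naturally_isomorphic_idE[OF n] by metis
    note HJ = C.ses_Hom[OF J(2)] and OJ = C.ses_Obj[OF J(2)] and \<eta>A = \<eta>(1)[OF A]
    have "ses C J j (Go (Yoneda_obj E Y)) (\<eta> A \<cdot>\<^bsub>C\<^esub> Ga \<pi>) A"
      by (rule C.ses_iso[OF J(2) HJ(1) C.Comp_Hom[OF HJ(2) \<eta>A] C.is_iso_Ide[OF OJ(1)]
            C.is_iso_Ide[OF OJ(2)] \<eta>(2)[OF A] C.Ide_Hom[OF OJ(1)] C.Ide_Hom[OF OJ(2)] \<eta>A])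
        (simp_all only: C.Comp_Ide[OF HJ(1)] C.Ide_Comp[OF HJ(1)] C.Comp_Ide[OF C.Comp_Hom[OF HJ(2) \<eta>A]])
    then show "\<exists>K k X p I m Y c D J q j r. ses E K k X p I \<and> ses E I m Y c D \<and>
        ses C (Go (Yoneda_obj E K)) (Ga (Yoneda_arr E k)) (Go (Yoneda_obj E X)) q J \<and>
        ses C J j (Go (Yoneda_obj E Y)) r A \<and> Ga (Yoneda_arr E (m \<cdot>\<^bsub>E\<^esub> p)) = j \<cdot>\<^bsub>C\<^esub> q"
      using s J(1,3) by blast
  qed
  then show ?thesis by blast
qed

section \<open>The two directions of the characterization\<close>

lemma auslander_category_if_conditions:
  fixes C :: "('o, 'm) excat"
  assumes "exact_category C" "enough_projectives C" and dom: "dom_dim C \<ge> 2" and gl: "gl_dim C \<le> 2"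
    and perp: "\<forall>f \<in> Arr C. Cod C f \<in> left_perp C (Proj C) \<longrightarrow> admissible_arr C f"
    and approx: "\<forall>X \<in> Obj C. \<exists>f. left_approximation C (Proj C) f X \<and> admissible_arr C f"
  shows "auslander_category C"
proof -
  interpret exact_category C by (rule assms(1))
  show ?thesis
  proof
    fix P assume "P \<in> Proj C" then show "projective C P" by (simp add: Proj_def)
  next
    fix X assume "X \<in> Obj C"
    then obtain p where p: "deflation C p" "projective C (Dom C p)" "Cod C p = X"
      using assms(2) unfolding enough_projectives_def by blast
    have "p \<in> Hom C (Dom C p) X" using deflation_Arr[OF p(1)] p(3) by (simp add: Hom_def)
    then obtain N n where "ses C N n (Dom C p) p X" using deflation_ses[OF p(1)] by blast
    then show "\<exists>P \<in> Proj C. \<exists>N n r. ses C N n P r X" using p(2) by (auto simp: Proj_def)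
  next
    fix P assume "projective C P"
    then show "\<exists>a I1 q Q b I2 c E. ses C P a I1 q Q \<and> ses C Q b I2 c E \<and>
        projective C I1 \<and> injective C I1 \<and> projective C I2 \<and> injective C I2"
      by (rule proj_inj_copresentation_2[OF dom])
  next
    fix X assume "X \<in> Obj C"
    then show "\<exists>P2 d P1 p K l P0 r. ses C P2 d P1 p K \<and> ses C K l P0 r X \<and>
        projective C P2 \<and> projective C P1 \<and> projective C P0"
      by (rule projective_resolution_2[OF gl])
  next
    fix f X T assume "f \<in> Hom C X T" "T \<in> left_perp C (Proj C)"
    then show "admissible_arr C f" using perp by (simp add: Hom_def)
  next
    fix X assume "X \<in> Obj C"
    then show "\<exists>f. left_approximation C (Proj C) f X \<and> admissible_arr C f" using approx by blast
  qed
qed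

lemma conditions_if_equivalence:
  fixes C :: "('o, 'm) excat" and E :: "('p, 'q) excat"
  assumes "exact_category C" "exact_category E" "enough_injectives E" "exactly_equivalent C (mod_adm E)"
  shows "dom_dim C \<ge> 2 \<and> 2 \<ge> gl_dim C \<and>
    (\<forall>f \<in> Arr C. Cod C f \<in> left_perp C (Proj C) \<longrightarrow> admissible_arr C f) \<and>
    (\<forall>X \<in> Obj C. \<exists>f. left_approximation C (Proj C) f X \<and> admissible_arr C f)"
proof -
  obtain yo ya where "auslander_data C E yo ya" using auslander_data_of_equivalence[OF assms(1,2,4)] by blast
  then interpret auslander_data C E yo ya .
  have "admissible_arr C f" if "f \<in> Arr C" "Cod C f \<in> left_perp C (Proj C)" for f
    using data_admissible_to_perp[OF _ that(2), of f "Dom C f"] that(1) by (simp add: Hom_def)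
  then show ?thesis using data_dom_dim[OF assms(3)] data_gl_dim data_approximation by blast
qed

text \<open>The two existence claims differ only in the types of \<open>E\<close>. The witness built
  from the conditions consists of objects and arrows of \<open>E'\<close>, so it has the same types,
  while necessity is asserted for \<open>E\<close> over arbitrary types.\<close>

theorem theorem1p5:
  fixes E' :: "('o, 'm) excat"
  assumes "exact_category E'" and "enough_projectives E'"
  shows "let conditions =
               dom_dim E' \<ge> 2 \<and> 2 \<ge> gl_dim E' \<and>
               (\<forall>f \<in> Arr E'. Cod E' f \<in> left_perp E' (Proj E') \<longrightarrow> admissible_arr E' f) \<and>
               (\<forall>X \<in> Obj E'. \<exists>f. left_approximation E' (Proj E') f X \<and> admissible_arr E' f)
         in ((\<exists>E :: ('o, 'm) excat.
                 exact_category E \<and> enough_injectives E \<and> exactly_equivalent E' (mod_adm E))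
              \<longleftrightarrow> conditions) \<and>
            ((\<exists>E :: ('p, 'q) excat.
                 exact_category E \<and> enough_injectives E \<and> exactly_equivalent E' (mod_adm E))
              \<longrightarrow> conditions) \<and>
            (conditions \<longrightarrow> enough_injectives E')"
proof -
  define conditions where "conditions \<longleftrightarrow> dom_dim E' \<ge> 2 \<and> 2 \<ge> gl_dim E' \<and>
    (\<forall>f \<in> Arr E'. Cod E' f \<in> left_perp E' (Proj E') \<longrightarrow> admissible_arr E' f) \<and>
    (\<forall>X \<in> Obj E'. \<exists>f. left_approximation E' (Proj E') f X \<and> admissible_arr E' f)"
  have 1: "conditions" if "\<exists>E :: ('o, 'm) excat. exact_category E \<and> enough_injectives E \<and> exactly_equivalent E' (mod_adm E)"
    using that conditions_if_equivalence[OF assms(1)] unfolding conditions_def by blast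
  have 2: "conditions" if "\<exists>E :: ('p, 'q) excat. exact_category E \<and> enough_injectives E \<and> exactly_equivalent E' (mod_adm E)"
    using that conditions_if_equivalence[OF assms(1)] unfolding conditions_def by blast
  have 3: "(\<exists>E :: ('o, 'm) excat. exact_category E \<and> enough_injectives E \<and> exactly_equivalent E' (mod_adm E)) \<and>
      enough_injectives E'" if conditions
  proof -
    have "auslander_category E'"
      by (rule auslander_category_if_conditions[OF assms]) (use that in \<open>simp_all add: conditions_def\<close>)
    then interpret auslander_category E' .
    show ?thesis
      using proj_excat_exact proj_excat_enough_injectives exactly_equivalent_mod_adm enough_injectives by blast
  qed
  show ?thesis unfolding Let_def conditions_def[symmetric] using 1 2 3 by blast
qed

end
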